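(* Under the standing assumptions below, there exists $\epsilon_0>0$ such that for every $\epsilon\in(0,\epsilon_0)$ the problem $$-\Delta u+V(x)u=A(\epsilon x)f(u)\ \text{ in }\mathbb{R}^N,\qquad u\in H^1(\mathbb{R}^N),$$ has a ground state solution $u_\epsilon$. Moreover, if $x_\epsilon\in\mathbb{R}^N$ denotes a global maximum point of $|u_\epsilon|$, then $$\lim_{\epsilon\to 0}A(\epsilon x_\epsilon)=\sup_{x\in\mathbb{R}^N}A(x).$$
   Context: Standing assumptions: $N\ge 1$. $V:\mathbb{R}^N\to\mathbb{R}$ is continuous, $\mathbb{Z}^N$-periodic, and $0\notin\sigma(-\Delta+V)$ (the spectrum of the Schrödinger operator $-\Delta+V$). $A:\mathbb{R}^N\to\mathbb{R}$ is continuous with $A(0)=\max_{x\in\mathbb{R}^N}A(x)$ and $0<A_0:=\inf_{\mathbb{R}^N}A\le \lim_{|x|\to\infty}A(x)<\sup_{\mathbb{R}^N}A$ (the limit exists). $f:\mathbb{R}\to\mathbb{R}$ is continuous and satisfies: (f1) $f(t)/t\to 0$ as $t\to0$; (f2) $\limsup_{|t|\to\infty}|f(t)|/|t|^q<\infty$ for some $q\in(1,2^*-1)$, where $2^*=2N/(N-2)$ if $N\ge3$ and $2^*=+\infty$ if $N=1,2$; (f3) $t\mapsto f(t)/t$ is increasing on $(0,\infty)$ and decreasing on $(-\infty,0)$; (f4) there is $\theta>2$ with $0<\theta F(t)\le f(t)t$ for all $t\neq0$, where $F(t)=\int_0^t f(s)\,ds$. Let $H^1(\mathbb{R}^N)=E^+\oplus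 E^-$ be the decomposition corresponding to the positive and negative parts of the spectrum of $-\Delta+V$, $u=u^++u^-$, and let $\|\cdot\|$ be the norm of an inner product on $H^1(\mathbb{R}^N)$ equivalent to the usual one, for which $E^+\perp E^-$ and $\int(|\nabla u|^2+V u^2)dx=\|u^+\|^2-\|u^-\|^2$. For $\epsilon\ge0$ let $I_\epsilon(u)=\frac12\|u^+\|^2-\frac12\|u^-\|^2-\int A(\epsilon x)F(u)\,dx$, $\mathcal{M}_\epsilon=\{u\in H^1(\mathbb{R}^N)\setminus E^-: I_\epsilon'(u)u=0,\ I_\epsilon'(u)v=0\ \forall v\in E^-\}$, and $c_\epsilon=\inf_{\mathcal{M}_\epsilon}I_\epsilon$. A ground state solution of the problem is $u$ with $I_\epsilon'(u)=0$ and $I_\epsilon(u)=c_\epsilon$. *)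

theory Defs
  imports "HOL-Analysis.Analysis"
begin

text \<open>Functions on R^N are modelled as maps real^'n => real (pointwise representatives).
  Integrals are Lebesgue (Bochner) integrals w.r.t. the Lebesgue measure on real^'n.\<close>

definition L2 :: "(real^'n \<Rightarrow> real) \<Rightarrow> bool" where
  "L2 u \<longleftrightarrow> u \<in> borel_measurable lebesgue \<and> integrable lebesgue (\<lambda>x. (u x)^2)"

definition L2_norm :: "(real^'n \<Rightarrow> real) \<Rightarrow> real" where
  "L2_norm u = sqrt (integral\<^sup>L lebesgue (\<lambda>x. (u x)^2))"

definition test_fun :: "(real^'n \<Rightarrow> real) \<Rightarrow> (real^'n \<Rightarrow> real^'n \<Rightarrow> real) \<Rightarrow> bool" where
  "test_fun \<phi> d\<phi> \<longleftrightarrow> (\<forall>x. (\<phi> has_derivative d\<phi> x) (at x))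
     \<and> (\<forall>i. continuous_on UNIV (\<lambda>x. d\<phi> x (axis i 1)))
     \<and> bounded {x. \<phi> x \<noteq> 0}"

definition is_weak_grad :: "(real^'n \<Rightarrow> real) \<Rightarrow> (real^'n \<Rightarrow> real^'n) \<Rightarrow> bool" where
  "is_weak_grad u g \<longleftrightarrow> (\<forall>i. L2 (\<lambda>x. g x $ i)) \<and>
     (\<forall>\<phi> d\<phi> i. test_fun \<phi> d\<phi> \<longrightarrow>
        integral\<^sup>L lebesgue (\<lambda>x. u x * d\<phi> x (axis i 1)) = - integral\<^sup>L lebesgue (\<lambda>x. g x $ i * \<phi> x))"

definition H1 :: "(real^'n \<Rightarrow> real) set" where
  "H1 = {u. L2 u \<and> (\<exists>g. is_weak_grad u g)}"

definition wgrad :: "(real^'n \<Rightarrow> real) \<Rightarrow> (real^'n \<Rightarrow> real^'n)" where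
  "wgrad u = (SOME g. is_weak_grad u g)"

definition Bform :: "(real^'n \<Rightarrow> real) \<Rightarrow> (real^'n \<Rightarrow> real) \<Rightarrow> (real^'n \<Rightarrow> real) \<Rightarrow> real" where
  "Bform V u v = integral\<^sup>L lebesgue (\<lambda>x. wgrad u x \<bullet> wgrad v x + V x * u x * v x)"

text \<open>Spectrum of the self-adjoint operator -Delta+V on L^2 (the operator associated with the
  form Bform on H^1: u in its domain with (-Delta+V)u = g iff u in H^1, g in L^2 and
  B(u,v) = (g,v) for all v in H^1).  lambda is in the resolvent set iff
  -Delta+V-lambda is a bijection from the domain onto L^2 with bounded inverse.\<close>
definition schroedinger_spectrum :: "(real^'n \<Rightarrow> real) \<Rightarrow> real set" where
  "schroedinger_spectrum V = {lam. \<not> (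
     (\<exists>C. \<forall>u g. u \<in> H1 \<longrightarrow> L2 g \<longrightarrow>
         (\<forall>v\<in>H1. Bform V u v - lam * integral\<^sup>L lebesgue (\<lambda>x. u x * v x)
                    = integral\<^sup>L lebesgue (\<lambda>x. g x * v x))
         \<longrightarrow> L2_norm u \<le> C * L2_norm g)
     \<and> (\<forall>g. L2 g \<longrightarrow> (\<exists>u\<in>H1. \<forall>v\<in>H1. Bform V u v - lam * integral\<^sup>L lebesgue (\<lambda>x. u x * v x)
                    = integral\<^sup>L lebesgue (\<lambda>x. g x * v x))))}"

text \<open>The decomposition H^1 = E^+ (+) E^- into the positive and negative spectral subspaces of
  -Delta+V, characterised (uniquely, given 0 not in the spectrum) as the pair of linear
  subspaces of H^1, closed under a.e. modification, spanning H^1, orthogonal both in L^2 and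
  for the form B, with B positive on E^+ and negative on E^- (away from 0).\<close>
definition spectral_decomp ::
  "(real^'n \<Rightarrow> real) \<Rightarrow> (real^'n \<Rightarrow> real) set \<Rightarrow> (real^'n \<Rightarrow> real) set \<Rightarrow> bool" where
  "spectral_decomp V Ep Em \<longleftrightarrow>
     (\<forall>E\<in>{Ep, Em}. E \<subseteq> H1 \<and> (\<lambda>x. 0) \<in> E
        \<and> (\<forall>a\<in>E. \<forall>b\<in>E. \<forall>s t::real. (\<lambda>x. s * a x + t * b x) \<in> E)
        \<and> (\<forall>a\<in>E. \<forall>b. b \<in> borel_measurable lebesgue \<longrightarrow> (AE x in lebesgue. a x = b x) \<longrightarrow> b \<in> E))
   \<and> (\<forall>u\<in>H1. \<exists>a\<in>Ep. \<exists>b\<in>Em. u = (\<lambda>x. a x + b x))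
   \<and> (\<forall>a\<in>Ep. \<forall>b\<in>Em. integral\<^sup>L lebesgue (\<lambda>x. a x * b x) = 0 \<and> Bform V a b = 0)
   \<and> (\<forall>a\<in>Ep. \<not> (AE x in lebesgue. a x = 0) \<longrightarrow> Bform V a a > 0)
   \<and> (\<forall>b\<in>Em. \<not> (AE x in lebesgue. b x = 0) \<longrightarrow> Bform V b b < 0)"

definition Eminus :: "(real^'n \<Rightarrow> real) \<Rightarrow> (real^'n \<Rightarrow> real) set" where
  "Eminus V = (SOME Em. \<exists>Ep. spectral_decomp V Ep Em)"

definition prim :: "(real \<Rightarrow> real) \<Rightarrow> real \<Rightarrow> real" where
  "prim f t = (if 0 \<le> t then integral {0..t} f else - integral {t..0} f)"

text \<open>The energy functional I_eps and its derivative I_eps'(u)v.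
  Note (||u+||^2 - ||u-||^2) = int (|grad u|^2 + V u^2) = Bform V u u.\<close>
definition Ifun :: "(real^'n \<Rightarrow> real) \<Rightarrow> (real^'n \<Rightarrow> real) \<Rightarrow> (real \<Rightarrow> real) \<Rightarrow> real
    \<Rightarrow> (real^'n \<Rightarrow> real) \<Rightarrow> real" where
  "Ifun V A f \<epsilon> u = Bform V u u / 2 - integral\<^sup>L lebesgue (\<lambda>x. A (\<epsilon> *\<^sub>R x) * prim f (u x))"

definition dIfun :: "(real^'n \<Rightarrow> real) \<Rightarrow> (real^'n \<Rightarrow> real) \<Rightarrow> (real \<Rightarrow> real) \<Rightarrow> real
    \<Rightarrow> (real^'n \<Rightarrow> real) \<Rightarrow> (real^'n \<Rightarrow> real) \<Rightarrow> real" where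
  "dIfun V A f \<epsilon> u v = Bform V u v - integral\<^sup>L lebesgue (\<lambda>x. A (\<epsilon> *\<^sub>R x) * f (u x) * v x)"

definition Nehari_Pankov :: "(real^'n \<Rightarrow> real) \<Rightarrow> (real^'n \<Rightarrow> real) \<Rightarrow> (real \<Rightarrow> real) \<Rightarrow> real
    \<Rightarrow> (real^'n \<Rightarrow> real) set" where
  "Nehari_Pankov V A f \<epsilon> = {u \<in> H1. u \<notin> Eminus V \<and> dIfun V A f \<epsilon> u u = 0
      \<and> (\<forall>v\<in>Eminus V. dIfun V A f \<epsilon> u v = 0)}"

definition ground_level :: "(real^'n \<Rightarrow> real) \<Rightarrow> (real^'n \<Rightarrow> real) \<Rightarrow> (real \<Rightarrow> real) \<Rightarrow> real \<Rightarrow> real" where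
  "ground_level V A f \<epsilon> = (INF u\<in>Nehari_Pankov V A f \<epsilon>. Ifun V A f \<epsilon> u)"

definition ground_state :: "(real^'n \<Rightarrow> real) \<Rightarrow> (real^'n \<Rightarrow> real) \<Rightarrow> (real \<Rightarrow> real) \<Rightarrow> real
    \<Rightarrow> (real^'n \<Rightarrow> real) \<Rightarrow> bool" where
  "ground_state V A f \<epsilon> u \<longleftrightarrow> u \<in> H1 \<and> (\<forall>v\<in>H1. dIfun V A f \<epsilon> u v = 0)
      \<and> Ifun V A f \<epsilon> u = ground_level V A f \<epsilon>"

end

theory Submission
  imports Defs "HOL-Complex_Analysis.Great_Picard" "HOL-Real_Asymp.Real_Asymp"
begin

text \<open>Since 0 is not in the spectrum, the form of the Schroedinger operator is represented on \<open>H\<^sup>1\<close> by a symmetric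
  operator that is bounded below; its sign, the limit of Newton's iteration, splits \<open>H\<^sup>1\<close> into \<open>E\<^sup>+\<close> and \<open>E\<^sup>-\<close>.
  By (f3) the energy restricted to a half space \<open>\<real>\<^sup>+w + E\<^sup>-\<close> has exactly one maximum, which lies on the
  Nehari-Pankov set, so levels can be compared by moving between such maxima, and Ekeland's principle on the unit
  sphere of \<open>E\<^sup>+\<close> gives Palais-Smale sequences on that set. Their integer translates converge weakly to nonzero
  critical points. Hence constant coefficients have ground states, their level is strictly decreasing in the
  constant, and the level for \<open>A(\<epsilon>x)\<close> is asymptotically at most the one for \<open>A(0)\<close>; as this is below the
  level for the limit of \<open>A\<close> at infinity, no mass escapes and ground states exist for small \<open>\<epsilon>\<close>.
  By a mean value estimate ground states carry a fixed mass around a maximum point of their modulus. So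
  their translates converge to a nonzero critical point for the constant \<open>a = lim A(\<epsilon>x\<^sub>\<epsilon>)\<close> whose energy is at
  most the level for \<open>A(0)\<close>, and strict monotonicity of the levels forces \<open>a = A(0)\<close>.\<close>

section \<open>Hilbert spaces\<close>

lemma quadratic_form_discriminant:
  fixes a c d :: real
  assumes nonneg: "\<And>s t. 0 \<le> s^2 * a + 2 * s * t * c + t^2 * d"
  shows "c^2 \<le> a * d"
proof (cases "d = 0")
  case True
  have "c = 0"
  proof (rule ccontr)
    assume "c \<noteq> 0"
    then have "2 * (-(a + 1) / (2 * c)) * c = -(a + 1)" by (simp add: field_simps)
    then show False using nonneg[of 1 "-(a + 1) / (2 * c)"] True by simp
  qed
  then show ?thesis using True by simp
next
  case False
  then have "0 < d" using nonneg[of 0 1] by simp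
  have "0 \<le> d * (a * d - c^2)" using nonneg[of d "- c"] by (simp add: power2_eq_square algebra_simps)
  then show ?thesis using \<open>0 < d\<close> by (simp add: zero_le_mult_iff)
qed

lemma semidefinite_form_Cauchy_Schwarz:
  fixes q :: "'a::real_vector \<Rightarrow> 'a \<Rightarrow> real"
  assumes lin: "\<And>x. linear (q x)" and sym: "\<And>x y. q x y = q y x"
    and W: "subspace W" and nonneg: "\<And>x. x \<in> W \<Longrightarrow> 0 \<le> q x x" and xy: "x \<in> W" "y \<in> W"
  shows "(q x y)^2 \<le> q x x * q y y"
proof (rule quadratic_form_discriminant)
  fix s t
  have left: "q (s *\<^sub>R x + t *\<^sub>R y) z = s * q x z + t * q y z" for z
    by (simp add: sym[of _ z] linear_add[OF lin] linear_scale[OF lin])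
  have "0 \<le> q (s *\<^sub>R x + t *\<^sub>R y) (s *\<^sub>R x + t *\<^sub>R y)"
    by (intro nonneg subspace_add subspace_scale W xy)
  then show "0 \<le> s^2 * q x x + 2 * s * t * q x y + t^2 * q y y"
    by (simp add: left linear_add[OF lin] linear_scale[OF lin] sym[of y x] power2_eq_square algebra_simps)
qed

lemma norm_sgn_diff_le:
  fixes x y :: "'a::real_normed_vector"
  assumes "x \<noteq> 0" "y \<noteq> 0"
  shows "norm (sgn x - sgn y) \<le> 2 * norm (x - y) / norm y"
proof -
  have "sgn x - sgn y = (1 / norm y) *\<^sub>R (x - y) + ((norm y - norm x) / norm y) *\<^sub>R sgn x"
    using assms by (simp add: sgn_div_norm algebra_simps diff_divide_distrib divide_inverse)
  then have "norm (sgn x - sgn y) \<le> norm (x - y) / norm y + abs (norm y - norm x) / norm y"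
    using norm_triangle_ineq[of "(1 / norm y) *\<^sub>R (x - y)" "((norm y - norm x) / norm y) *\<^sub>R sgn x"] assms
    by (simp add: norm_sgn)
  also have "\<dots> \<le> norm (x - y) / norm y + norm (x - y) / norm y"
    using norm_triangle_ineq3[of y x] by (intro add_mono divide_right_mono) (auto simp: norm_minus_commute)
  finally show ?thesis by simp
qed

definition weakly_converges :: "(nat \<Rightarrow> 'a::real_normed_vector) \<Rightarrow> 'a \<Rightarrow> bool" (infix "\<rightharpoonup>" 55) where
  "X \<rightharpoonup> x \<longleftrightarrow> (\<forall>l :: 'a \<Rightarrow> real. bounded_linear l \<longrightarrow> (\<lambda>n. l (X n)) \<longlonglongrightarrow> l x)"

lemma weakly_convergesD: "X \<rightharpoonup> x \<Longrightarrow> bounded_linear l \<Longrightarrow> (\<lambda>n. l (X n)) \<longlonglongrightarrow> l x"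
  for l :: "_ \<Rightarrow> real" by (simp add: weakly_converges_def)

lemma weakly_converges_inner: "X \<rightharpoonup> x \<Longrightarrow> (\<lambda>n. h \<bullet> X n) \<longlonglongrightarrow> h \<bullet> x"
  by (erule weakly_convergesD) (rule bounded_linear_inner_right)

lemma tendsto_imp_weakly_converges: "X \<longlonglongrightarrow> x \<Longrightarrow> X \<rightharpoonup> x"
  unfolding weakly_converges_def using bounded_linear.tendsto by blast

lemma weakly_converges_unique:
  fixes x y :: "'a::real_inner"
  assumes "X \<rightharpoonup> x" "X \<rightharpoonup> y" shows "x = y"
proof -
  have "(x - y) \<bullet> x = (x - y) \<bullet> y" using assms by (meson LIMSEQ_unique weakly_converges_inner)
  then have "(x - y) \<bullet> (x - y) = 0" by (simp add: inner_diff_right)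
  then show ?thesis by simp
qed

lemma weakly_converges_subseq: "X \<rightharpoonup> x \<Longrightarrow> strict_mono r \<Longrightarrow> (X \<circ> r) \<rightharpoonup> x"
  unfolding weakly_converges_def using LIMSEQ_subseq_LIMSEQ by (fastforce simp: o_def)

lemma weakly_converges_diff: "X \<rightharpoonup> x \<Longrightarrow> Y \<rightharpoonup> y \<Longrightarrow> (\<lambda>n. X n - Y n) \<rightharpoonup> x - y"
  by (simp add: weakly_converges_def linear_diff[OF bounded_linear.linear] tendsto_diff)

lemma weakly_converges_bounded_linear: "bounded_linear T \<Longrightarrow> X \<rightharpoonup> x \<Longrightarrow> (\<lambda>n. T (X n)) \<rightharpoonup> T x"
  unfolding weakly_converges_def using bounded_linear_compose by blast

lemma semidefinite_form_weakly_lsc: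
  fixes q :: "'a::real_normed_vector \<Rightarrow> 'a \<Rightarrow> real"
  assumes q: "bounded_bilinear q" "\<And>x y. q x y = q y x" "\<And>x. 0 \<le> q x x"
    and X: "X \<rightharpoonup> x" and bound: "\<And>n. q (X n) (X n) \<le> c n" and c: "c \<longlonglongrightarrow> c0"
  shows "q x x \<le> c0"
proof -
  interpret q: bounded_bilinear q by (rule q(1))
  have "2 * q x (X n) - q x x \<le> c n" for n
    using q(3)[of "X n - x"] bound[of n] by (simp add: q.diff_left q.diff_right q(2)[of "X n" x])
  moreover have "(\<lambda>n. 2 * q x (X n) - q x x) \<longlonglongrightarrow> 2 * q x x - q x x"
    by (intro tendsto_intros weakly_convergesD[OF X] q.bounded_linear_right)
  ultimately show ?thesis using LIMSEQ_le[OF _ c] by fastforce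
qed

locale coercive_form =
  fixes g :: "'a::banach \<Rightarrow> 'a \<Rightarrow> real" and c :: real
  assumes bilinear: "bounded_bilinear g" and sym: "g x y = g y x"
    and coercive: "0 < c" "c * (norm x)^2 \<le> g x x"
begin

sublocale form: bounded_bilinear g by (rule bilinear)

lemmas form_simps = form.add_left form.add_right form.diff_left form.diff_right form.scaleR_left form.scaleR_right

lemma pos: "x \<noteq> 0 \<Longrightarrow> 0 < g x x"
  using coercive(1) by (intro less_le_trans[OF _ coercive(2)]) simp

lemma nonneg [simp]: "0 \<le> g x x"
  using pos[of x] form.zero_left[of x] by (cases "x = 0") auto

lemma self_eq_0_iff [simp]: "g x x = 0 \<longleftrightarrow> x = 0"
  using pos[of x] form.zero_left[of x] by fastforce

lemma Cauchy_if_form_le: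
  assumes small: "\<And>m n. g (X m - X n) (X m - X n) \<le> 2 / real (Suc m) + 2 / real (Suc n)"
  shows "Cauchy X"
proof (rule CauchyI)
  fix e :: real assume "0 < e"
  then obtain N where N: "inverse (real (Suc N)) < c * e^2 / 4" using reals_Archimedean[of "c * e^2 / 4"] coercive(1) by auto
  have "norm (X m - X n) < e" if "N \<le> m" "N \<le> n" for m n
  proof -
    have "1 / real (Suc k) < c * e^2 / 4" if "N \<le> k" for k
    proof -
      have "1 / real (Suc k) \<le> 1 / real (Suc N)" using that by (intro divide_left_mono) auto
      then show ?thesis using N by (simp add: inverse_eq_divide)
    qed
    from this[OF \<open>N \<le> m\<close>] this[OF \<open>N \<le> n\<close>] have "c * (norm (X m - X n))^2 < c * e^2"
      using small[of m n] coercive(2)[of "X m - X n"] by simp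
    then show ?thesis using coercive(1) \<open>0 < e\<close> by (simp add: power_less_imp_less_base)
  qed
  then show "\<exists>N. \<forall>m\<ge>N. \<forall>n\<ge>N. norm (X m - X n) < e" by blast
qed

lemma quadratic_minimizer_exists:
  assumes W: "subspace W" "closed W" and l: "bounded_linear l"
  shows "\<exists>x\<in>W. \<forall>w\<in>W. g x x - 2 * l x \<le> g w w - 2 * l w"
proof -
  interpret l: bounded_linear l by (rule l)
  obtain M where M: "\<And>x. norm (l x) \<le> norm x * M" using l.bounded by blast
  define J where "J x = g x x - 2 * l x" for x
  have "- (M^2 / c) \<le> J x" for x
  proof -
    have "0 \<le> (c * norm x - M)^2 / c" using coercive(1) by simp
    also have "\<dots> = c * (norm x)^2 - 2 * (norm x * M) + M^2 / c"
      using coercive(1) by (simp add: power2_diff power2_eq_square field_simps)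
    finally show ?thesis using coercive(2)[of x] M[of x] unfolding J_def real_norm_def by linarith
  qed
  then have Inf_le: "Inf (J ` W) \<le> J x" if "x \<in> W" for x using that by (intro cINF_lower bdd_belowI2)
  have "\<exists>x\<in>W. J x < Inf (J ` W) + 1 / real (Suc n)" for n
    using cInf_lessD[of "J ` W" "Inf (J ` W) + 1 / real (Suc n)"] subspace_0[OF W(1)] by fastforce
  then obtain X where X: "\<And>n. X n \<in> W" "\<And>n. J (X n) < Inf (J ` W) + 1 / real (Suc n)" by metis
  have "g (X m - X n) (X m - X n) \<le> 2 / real (Suc m) + 2 / real (Suc n)" for m n
  proof -
    have mid: "(1/2) *\<^sub>R (X m + X n) \<in> W" by (intro subspace_add subspace_scale W X)
    have "g (X m - X n) (X m - X n) = 2 * J (X m) + 2 * J (X n) - 4 * J ((1/2) *\<^sub>R (X m + X n))"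
      by (simp add: J_def form_simps l.add l.scaleR sym[of "X n" "X m"] field_simps)
    then show ?thesis using Inf_le[OF mid] X(2)[of m] X(2)[of n] by simp
  qed
  then have "Cauchy X" by (rule Cauchy_if_form_le)
  then obtain x where x: "X \<longlonglongrightarrow> x" by (auto simp: Cauchy_convergent_iff convergent_def)
  have "J x \<le> Inf (J ` W)"
  proof (rule LIMSEQ_le)
    show "(\<lambda>n. J (X n)) \<longlonglongrightarrow> J x" unfolding J_def by (intro form.tendsto l.tendsto tendsto_intros x)
    show "(\<lambda>n. Inf (J ` W) + 1 / real (Suc n)) \<longlonglongrightarrow> Inf (J ` W)"
      using tendsto_add[OF tendsto_const LIMSEQ_inverse_real_of_nat, of "Inf (J ` W)"] by (simp add: inverse_eq_divide)
  qed (insert X(2) less_imp_le, blast)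
  then show ?thesis using Inf_le closed_sequentially[OF W(2) X(1) x] unfolding J_def by (meson order_trans)
qed

theorem riesz_representation:
  assumes W: "subspace W" "closed W" and l: "bounded_linear l"
  shows "\<exists>x\<in>W. \<forall>w\<in>W. g x w = l w"
proof -
  interpret l: bounded_linear l by (rule l)
  obtain x where x: "x \<in> W" "\<And>w. w \<in> W \<Longrightarrow> g x x - 2 * l x \<le> g w w - 2 * l w"
    using quadratic_minimizer_exists[OF W l] by blast
  have "g x w = l w" if "w \<in> W" for w
  proof (cases "w = 0")
    case False
    define d t where "d = l w - g x w" and "t = d / g w w"
    have w: "0 < g w w" using False by (rule pos)
    have "x + t *\<^sub>R w \<in> W" using W(1) x(1) that by (simp add: subspace_add subspace_scale)
    from x(2)[OF this] have "0 \<le> t * (t * g w w - 2 * d)"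
      by (simp add: d_def form_simps l.add l.scaleR sym[of w x] algebra_simps)
    also have "\<dots> = - (d^2 / g w w)" using w by (simp add: t_def power2_eq_square)
    finally have "d^2 \<le> 0" using w by (simp add: divide_le_0_iff)
    then show ?thesis by (simp add: d_def)
  qed (simp add: form.zero_right l.zero)
  then show ?thesis using x(1) by blast
qed

lemma projection_exists: "subspace W \<Longrightarrow> closed W \<Longrightarrow> \<exists>x\<in>W. \<forall>w\<in>W. g (y - x) w = 0"
  using riesz_representation[OF _ _ form.bounded_linear_right[of y], of W] unfolding form.diff_left right_minus_eq by metis

lemma form_operator_exists:
  fixes b :: "'a \<Rightarrow> 'a \<Rightarrow> real"
  assumes b: "bounded_bilinear b"
  shows "\<exists>L. bounded_linear L \<and> (\<forall>u v. b u v = g (L u) v)"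
proof -
  interpret b: bounded_bilinear b by (rule b)
  obtain L where L: "\<And>u v. b u v = g (L u) v" using riesz_representation[OF subspace_UNIV closed_UNIV b.bounded_linear_right] by (metis UNIV_I)
  have ext: "x = y" if "\<And>v. g x v = g y v" for x y
    using that[of "x - y"] self_eq_0_iff[of "x - y"] by (simp add: form.diff_left)
  obtain K where K: "0 < K" "\<And>u v. norm (b u v) \<le> norm u * norm v * K" using b.pos_bounded by blast
  have "bounded_linear L"
  proof (rule bounded_linear_intro)
    show "L (u + v) = L u + L v" for u v by (rule ext) (simp add: L[symmetric] b.add_left form.add_left)
    show "L (r *\<^sub>R u) = r *\<^sub>R L u" for r u by (rule ext) (simp add: L[symmetric] b.scaleR_left form.scaleR_left)
    show "norm (L u) \<le> norm u * (K / c)" for u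
    proof (cases "L u = 0")
      case False
      have "c * (norm (L u))^2 \<le> norm u * norm (L u) * K" using coercive(2)[of "L u"] K(2)[of u "L u"] by (simp add: L)
      then have "c * norm (L u) \<le> norm u * K" using False by (simp add: power2_eq_square mult_ac)
      then show ?thesis using coercive(1) by (simp add: field_simps)
    qed (insert coercive(1) K(1), simp)
  qed
  then show ?thesis using L by blast
qed

lemma symmetric_bounded_below_bij:
  assumes A: "bounded_linear A" "\<And>u v. g (A u) v = g u (A v)" and m: "0 < m" "\<And>u. m * norm u \<le> norm (A u)"
  shows "bij A" "bounded_linear (inv A)"
proof -
  interpret A: bounded_linear A by (rule A)
  have zero: "u = 0" if "A u = 0" for u using m(2)[of u] m(1) that by (simp add: mult_le_0_iff)
  have inj: "inj A" using zero by (simp add: linear_injective_0[OF A.linear])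
  have closed: "closed (range A)" by (intro complete_imp_closed complete_isometric_image[OF m(1) subspace_UNIV A(1)])
      (insert m(2) complete_UNIV, auto)
  have "\<exists>x. A x = y" for y
  proof -
    obtain x where x: "\<And>v. g (y - A x) (A v) = 0"
      using projection_exists[OF linear_subspace_image[OF A.linear subspace_UNIV] closed, of y] by blast
    have "g (A (y - A x)) (A (y - A x)) = 0" using x A(2) by simp
    then have "y - A x = 0" by (rule zero[OF iffD1[OF self_eq_0_iff]])
    then have "A x = y" by simp
    then show ?thesis by blast
  qed
  then have "surj A" by (metis surj_def)
  then show "bij A" using inj by (simp add: bij_def)
  then have right: "A (inv A u) = u" for u by (simp add: bij_is_surj surj_f_inv_f)
  show "bounded_linear (inv A)"
  proof (rule bounded_linear_intro[of _ "1 / m"])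
    show "inv A (x + y) = inv A x + inv A y" for x y by (rule injD[OF inj]) (simp add: right A.add)
    show "inv A (r *\<^sub>R x) = r *\<^sub>R inv A x" for r x by (rule injD[OF inj]) (simp add: right A.scaleR)
    show "norm (inv A x) \<le> norm x * (1 / m)" for x
      using m(2)[of "inv A x"] m(1) by (simp add: right field_simps)
  qed
qed

lemma form_le_imp_norm_le: "\<exists>m>0. \<forall>x y. g x x \<le> g y y \<longrightarrow> m * norm x \<le> norm y"
proof -
  obtain K where K: "0 < K" "\<And>x y. norm (g x y) \<le> norm x * norm y * K" using form.pos_bounded by blast
  have "sqrt (c / K) * norm x \<le> norm y" if "g x x \<le> g y y" for x y
  proof (rule power2_le_imp_le)
    have "c * (norm x)^2 \<le> (norm y)^2 * K" using coercive(2)[of x] K(2)[of y y] that by (simp add: power2_eq_square)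
    then show "(sqrt (c / K) * norm x)^2 \<le> (norm y)^2" using coercive(1) K(1) by (simp add: power_mult_distrib field_simps)
  qed simp
  then show ?thesis using coercive(1) K(1) by (intro exI[of _ "sqrt (c / K)"]) simp
qed

definition newton :: "('a \<Rightarrow> 'a) \<Rightarrow> 'a \<Rightarrow> 'a" where
  "newton X u = (1/2) *\<^sub>R (X u + inv X u)"

definition sign_iterate :: "('a \<Rightarrow> 'a) \<Rightarrow> ('a \<Rightarrow> 'a) \<Rightarrow> bool" where
  "sign_iterate L X \<longleftrightarrow> bounded_linear X \<and> bij X \<and> bounded_linear (inv X) \<and> (\<forall>u v. g (X u) v = g u (X v))
    \<and> (\<forall>u. X (L u) = L (X u)) \<and> (\<forall>u. 0 \<le> g (L (X u)) u)"

lemma sign_iterateD: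
  assumes "sign_iterate L X"
  shows "bounded_linear X" "bounded_linear (inv X)" "X (inv X u) = u" "inv X (X u) = u"
    "g (X u) v = g u (X v)" "X (L u) = L (X u)" "0 \<le> g (L (X u)) u"
  using assms by (auto simp: sign_iterate_def bij_is_surj surj_f_inv_f bij_is_inj)

lemma sign_iterate_invD:
  assumes "sign_iterate L X"
  shows "g (inv X u) v = g u (inv X v)" "inv X (L u) = L (inv X u)" "0 \<le> g (L (inv X u)) u"
    "g (X u) (inv X u) = g u u" "g (inv X u) (X u) = g u u"
proof -
  note X = sign_iterateD[OF assms]
  show "g (inv X u) v = g u (inv X v)" using X(5)[of "inv X u" "inv X v"] by (simp add: X(3))
  show "inv X (L u) = L (inv X u)" using X(4)[of "L (inv X u)"] by (simp add: X(3,6))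
  have "g (L (inv X u)) u = g (X (L (inv X u))) (inv X u)" using X(5)[of "L (inv X u)" "inv X u"] by (simp add: X(3))
  then show "0 \<le> g (L (inv X u)) u" using X(7)[of "inv X u"] by (simp add: X(6))
  show "g (X u) (inv X u) = g u u" using X(5)[of u "inv X u"] by (simp add: X(3))
  then show "g (inv X u) (X u) = g u u" by (simp add: sym)
qed

lemma sign_iterate_newton:
  assumes X: "sign_iterate L X" and L: "bounded_linear L"
  shows "sign_iterate L (newton X)"
proof -
  note X = sign_iterateD[OF X] sign_iterate_invD[OF X]
  have blin: "bounded_linear (newton X)" unfolding newton_def by (intro bounded_linear_const_scaleR bounded_linear_add X)
  have sym_newton: "g (newton X u) v = g u (newton X v)" for u v
    by (simp add: newton_def form_simps X(5,8))
  have below: "g u u \<le> g (newton X u) (newton X u)" for u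
  proof -
    have "4 * g (newton X u) (newton X u) = g (X u - inv X u) (X u - inv X u) + 4 * g u u"
      by (simp add: newton_def form_simps X(11,12) algebra_simps)
    then show ?thesis using nonneg[of "X u - inv X u"] by linarith
  qed
  obtain m where "0 < m" "\<And>u. m * norm u \<le> norm (newton X u)" using form_le_imp_norm_le below by metis
  note bij = symmetric_bounded_below_bij[OF blin sym_newton this]
  interpret L: bounded_linear L by (rule L)
  have "newton X (L u) = L (newton X u)" "0 \<le> g (L (newton X u)) u" for u
    using X(7)[of u] X(10)[of u] by (simp_all add: newton_def L.add L.scaleR form_simps X(6,9))
  then show ?thesis using blin bij sym_newton unfolding sign_iterate_def by blast
qed

text \<open>With \<open>Z = X - X\<inverse>\<close> and \<open>N = (X + X\<inverse>) / 2\<close> one has \<open>N - N\<inverse> = Z Z N\<inverse> / 4\<close>.\<close>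
lemma newton_contraction:
  assumes X: "sign_iterate L X" and L: "bounded_linear L"
  shows "4 * g (newton X u - inv (newton X) u) (newton X u - inv (newton X) u) \<le> g (X u - inv X u) (X u - inv X u)"
proof -
  interpret X: bounded_linear X by (rule sign_iterateD[OF X])
  interpret Y: bounded_linear "inv X" by (rule sign_iterateD[OF X])
  note inverse = sign_iterateD(3,4)[OF X]
  let ?Z = "\<lambda>w. X w - inv X w"
  define v where "v = inv (newton X) u"
  have v: "newton X v = u" unfolding v_def by (rule sign_iterateD(3)[OF sign_iterate_newton[OF X L]])
  have diff_le: "g (?Z w) (?Z w) \<le> g (X w + inv X w) (X w + inv X w)" for w
    by (simp add: form_simps sign_iterate_invD(4,5)[OF X])
  have diff: "newton X u - v = (1/4) *\<^sub>R ?Z (?Z v)" unfolding v[symmetric]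
    by (simp add: newton_def X.add X.diff X.scaleR Y.add Y.diff Y.scaleR inverse scaleR_add_right
        scaleR_diff_right scaleR_left_distrib[symmetric] algebra_simps)
  have twice: "2 *\<^sub>R ?Z u = X (?Z v) + inv X (?Z v)" unfolding v[symmetric]
    by (simp add: newton_def X.add X.diff X.scaleR Y.add Y.diff Y.scaleR inverse algebra_simps)
  have "16 * g (newton X u - v) (newton X u - v) = g (?Z (?Z v)) (?Z (?Z v))"
    unfolding diff by (simp add: form.scaleR_left form.scaleR_right)
  also have "\<dots> \<le> g (2 *\<^sub>R ?Z u) (2 *\<^sub>R ?Z u)" unfolding twice by (rule diff_le)
  also have "\<dots> = 4 * g (?Z u) (?Z u)" by (simp only: form.scaleR_left form.scaleR_right) simp
  finally show ?thesis by (simp add: v_def)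
qed

lemma newton_iterates_converge:
  assumes L: "bounded_linear L" "sign_iterate L L"
  shows "\<exists>S. \<forall>u. (\<lambda>k. (newton ^^ k) L u) \<longlonglongrightarrow> S u \<and> (\<lambda>k. inv ((newton ^^ k) L) u) \<longlonglongrightarrow> S u"
proof -
  define X where "X k = (newton ^^ k) L" for k
  have X: "sign_iterate L (X k)" for k
    by (induct k) (auto simp: X_def intro: sign_iterate_newton L)
  define Z where "Z k u = X k u - inv (X k) u" for k u
  define d where "d u = sqrt (g (Z 0 u) (Z 0 u) / c)" for u
  have Z: "norm (Z k u) \<le> d u * (1/2)^k" for k u
  proof (rule power2_le_imp_le)
    have "g (Z k u) (Z k u) \<le> g (Z 0 u) (Z 0 u) * (1/4)^k"
    proof (induct k)
      case (Suc k)
      then show ?case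
        using newton_contraction[OF X L(1), of k u] unfolding Z_def by (simp add: X_def)
    qed simp
    with coercive(2)[of "Z k u"] have "c * (norm (Z k u))^2 \<le> g (Z 0 u) (Z 0 u) * (1/4)^k" by (rule order_trans)
    then have "(norm (Z k u))^2 \<le> g (Z 0 u) (Z 0 u) / c * (1/4)^k" using coercive(1) by (simp add: field_simps)
    also have "\<dots> = (d u * (1/2)^k)^2"
      using coercive(1) by (simp add: d_def power_mult_distrib power_mult[symmetric] mult.commute[of k])
        (simp add: power_mult power2_eq_square)
    finally show "(norm (Z k u))^2 \<le> (d u * (1/2)^k)^2" .
  qed (insert coercive(1), simp add: d_def)
  have "X (Suc k) u - X k u = (-1/2) *\<^sub>R Z k u" for k u
    by (simp add: X_def Z_def newton_def scaleR_add_right scaleR_diff_right)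
      (simp flip: scaleR_left_distrib add: algebra_simps)
  then have "norm (X (Suc k) u - X k u) \<le> norm (Z k u)" for k u by (simp del: scaleR_minus_left)
  then have step: "norm (X (Suc k) u - X k u) \<le> d u * (1/2)^k" for k u using Z by (rule order_trans)
  have "convergent (\<lambda>k. X k u)" for u
  proof -
    have "summable (\<lambda>k. X (Suc k) u - X k u)"
      by (rule summable_comparison_test'[where N=0, OF _ step]) (intro summable_mult summable_geometric, simp)
    moreover have "(\<Sum>k<n. X (Suc k) u - X k u) = X n u - X 0 u" for n by (rule sum_lessThan_telescope)
    ultimately show ?thesis by (simp add: summable_iff_convergent convergent_diff_const_right_iff)
  qed
  then obtain S where S: "\<And>u. (\<lambda>k. X k u) \<longlonglongrightarrow> S u" unfolding convergent_def by metis
  have null: "(\<lambda>k. Z k u) \<longlonglongrightarrow> 0" for u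
  proof (rule Lim_null_comparison)
    show "\<forall>\<^sub>F k in sequentially. norm (Z k u) \<le> d u * (1/2)^k" using Z by simp
    show "(\<lambda>k. d u * (1/2)^k) \<longlonglongrightarrow> 0" by (intro tendsto_mult_right_zero LIMSEQ_power_zero) simp
  qed
  have "(\<lambda>k. inv (X k) u) \<longlonglongrightarrow> S u" for u
    using tendsto_diff[OF S[of u] null[of u]] by (simp add: Z_def)
  then show ?thesis using S unfolding X_def by blast
qed

theorem sign_operator_exists:
  assumes L: "bounded_linear L" "\<And>u v. g (L u) v = g u (L v)" and m: "0 < m" "\<And>u. m * norm u \<le> norm (L u)"
  shows "\<exists>S. linear S \<and> (\<forall>u v. g (S u) v = g u (S v)) \<and> (\<forall>u. S (S u) = u)
    \<and> (\<forall>u. S (L u) = L (S u)) \<and> (\<forall>u. 0 \<le> g (L (S u)) u)"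
proof -
  have "0 \<le> g (L (L u)) u" for u using L(2)[of "L u" u] by simp
  then have sign_L: "sign_iterate L L" unfolding sign_iterate_def using symmetric_bounded_below_bij[OF L m] L by blast
  define X where "X k = (newton ^^ k) L" for k
  have X: "sign_iterate L (X k)" for k
    by (induct k) (auto simp: X_def intro: sign_iterate_newton L sign_L)
  note X = sign_iterateD[OF X]
  obtain S where S: "\<And>u. (\<lambda>k. X k u) \<longlonglongrightarrow> S u" "\<And>u. (\<lambda>k. inv (X k) u) \<longlonglongrightarrow> S u"
    using newton_iterates_converge[OF L(1) sign_L] unfolding X_def by blast
  have "linear S"
  proof (rule linearI)
    show "S (x + y) = S x + S y" for x y
      using tendsto_add[OF S(1)[of x] S(1)[of y]]
      by (intro LIMSEQ_unique[OF S(1)]) (simp add: linear_add[OF bounded_linear.linear[OF X(1)]])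
    show "S (r *\<^sub>R x) = r *\<^sub>R S x" for r x
      using tendsto_scaleR[OF tendsto_const S(1)[of x], of r]
      by (intro LIMSEQ_unique[OF S(1)]) (simp add: linear_scale[OF bounded_linear.linear[OF X(1)]])
  qed
  moreover have sym_S: "g (S u) v = g u (S v)" for u v
    using LIMSEQ_unique[OF form.tendsto[OF S(1)[of u] tendsto_const] form.tendsto[OF tendsto_const S(1)[of v], of u, folded X(5)]] .
  moreover have "S (S u) = u" for u
  proof -
    have "g (inv (X k) u) (X k v) = g u v" for k v using X(5)[of k "inv (X k) u" v] by (simp add: X(3))
    then have "g (S u) (S v) = g u v" for v
      using form.tendsto[OF S(2)[of u] S(1)[of v]] by (simp add: LIMSEQ_const_iff)
    then have "g (S (S u) - u) v = 0" for v using sym_S[of "S u" v] by (simp add: form.diff_left)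
    from this[of "S (S u) - u"] show ?thesis by simp
  qed
  moreover have LS: "(\<lambda>k. L (X k u)) \<longlonglongrightarrow> L (S u)" for u by (rule bounded_linear.tendsto[OF L(1) S(1)])
  moreover have "S (L u) = L (S u)" for u
    using LIMSEQ_unique[OF S(1)[of "L u"]] LS[of u] by (simp add: X(6))
  moreover have "0 \<le> g (L (S u)) u" for u
    by (rule LIMSEQ_le_const[OF form.tendsto[OF LS tendsto_const]]) (insert X(7), blast)
  ultimately show ?thesis by blast
qed

end

interpretation inner_form: coercive_form "inner :: 'a::{real_inner,banach} \<Rightarrow> 'a \<Rightarrow> real" 1
  by (rule coercive_form.intro[OF bounded_bilinear_inner inner_commute]) (simp_all add: power2_norm_eq_inner)

lemma weakly_converges_iff_inner:
  fixes x :: "'a::{real_inner,banach}"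
  shows "X \<rightharpoonup> x \<longleftrightarrow> (\<forall>h. (\<lambda>n. h \<bullet> X n) \<longlonglongrightarrow> h \<bullet> x)"
proof
  assume inner: "\<forall>h. (\<lambda>n. h \<bullet> X n) \<longlonglongrightarrow> h \<bullet> x"
  show "X \<rightharpoonup> x" unfolding weakly_converges_def
  proof (intro allI impI)
    fix l :: "'a \<Rightarrow> real" assume "bounded_linear l"
    from inner_form.riesz_representation[OF subspace_UNIV closed_UNIV this] obtain h where "\<And>u. l u = h \<bullet> u" by (metis UNIV_I)
    then show "(\<lambda>n. l (X n)) \<longlonglongrightarrow> l x" using inner by simp
  qed
qed (insert weakly_converges_inner, blast)

lemma closed_inner_convergence:
  fixes Y :: "nat \<Rightarrow> 'a::real_inner"
  assumes bound: "\<And>n. norm (Y n) \<le> R"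
  shows "closed {h. convergent (\<lambda>n. Y n \<bullet> h)}"
  unfolding closed_sequential_limits
proof (intro allI impI)
  fix Z h assume Z: "(\<forall>k. Z k \<in> {h. convergent (\<lambda>n. Y n \<bullet> h)}) \<and> Z \<longlonglongrightarrow> h"
  have "Cauchy (\<lambda>n. Y n \<bullet> h)"
  proof (rule metric_CauchyI)
    fix e :: real assume e: "0 < e"
    have "(\<lambda>k. R * norm (Z k - h)) \<longlonglongrightarrow> R * norm (h - h)" using Z by (intro tendsto_intros) auto
    then obtain k where k: "R * norm (Z k - h) < e/3"
      using e order_tendstoD(2)[of _ "0::real" sequentially "e/3"] by (auto simp: eventually_sequentially)
    have near: "abs (Y n \<bullet> Z k - Y n \<bullet> h) < e/3" for n
      using Cauchy_Schwarz_ineq2[of "Y n" "Z k - h"] mult_right_mono[OF bound[of n] norm_ge_zero[of "Z k - h"]] k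
      by (simp add: inner_diff_right)
    obtain N where N: "\<forall>m\<ge>N. \<forall>n\<ge>N. dist (Y m \<bullet> Z k) (Y n \<bullet> Z k) < e/3"
      using Z e metric_CauchyD[of "\<lambda>n. Y n \<bullet> Z k" "e/3"] by (fastforce simp: convergent_Cauchy)
    have "dist (Y m \<bullet> h) (Y n \<bullet> h) < e" if "N \<le> m" "N \<le> n" for m n
      using N[rule_format, OF that] near[of m] near[of n] unfolding dist_real_def by linarith
    then show "\<exists>M. \<forall>m\<ge>M. \<forall>n\<ge>M. dist (Y m \<bullet> h) (Y n \<bullet> h) < e" by blast
  qed
  then show "h \<in> {h. convergent (\<lambda>n. Y n \<bullet> h)}" by (simp add: Cauchy_convergent_iff)
qed

theorem bounded_imp_weakly_convergent_subseq:
  fixes X :: "nat \<Rightarrow> 'a::{real_inner,banach}"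
  assumes bound: "\<And>n. norm (X n) \<le> R"
  shows "\<exists>r x. strict_mono r \<and> (X \<circ> r) \<rightharpoonup> x"
proof -
  have "abs (X n \<bullet> h) \<le> R * R" if "h \<in> range X" for n h
  proof -
    have "norm (X n) * norm h \<le> R * R" using that bound order_trans[OF norm_ge_zero bound] by (intro mult_mono) auto
    then show ?thesis using Cauchy_Schwarz_ineq2[of "X n" h] by linarith
  qed
  then obtain r where r: "strict_mono r" "\<And>h. h \<in> range X \<Longrightarrow> \<exists>l. (\<lambda>n. X (r n) \<bullet> h) \<longlonglongrightarrow> l"
    using function_convergent_subsequence[of "range X" "\<lambda>n h. X n \<bullet> h" "R * R"]
    by (metis countableI_type countable_image real_norm_def)
  define W where "W = {h. convergent (\<lambda>n. X (r n) \<bullet> h)}"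
  have W: "subspace W" "closed W"
    unfolding W_def by (auto simp: subspace_def inner_add_right intro!: convergent_add convergent_const
        convergent_mult closed_inner_convergence bound)
  have "h \<in> W" for h
  proof -
    obtain x where x: "x \<in> W" "\<And>w. w \<in> W \<Longrightarrow> (h - x) \<bullet> w = 0"
      using inner_form.projection_exists[OF W] by blast
    have "X (r n) \<bullet> (h - x) = 0" for n
      using x(2)[of "X (r n)"] r(2) by (auto simp: W_def convergent_def inner_commute)
    then have "h - x \<in> W" by (simp add: W_def convergent_const)
    from subspace_add[OF W(1) this x(1)] show ?thesis by simp
  qed
  then obtain l where l: "\<And>h. (\<lambda>n. X (r n) \<bullet> h) \<longlonglongrightarrow> l h" unfolding W_def convergent_def by simp metis
  have "bounded_linear l"
  proof (rule bounded_linear_intro[of _ R])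
    show "l (x + y) = l x + l y" for x y
      using LIMSEQ_unique[OF l[of "x + y"]] tendsto_add[OF l[of x] l[of y]] by (simp add: inner_add_right)
    show "l (a *\<^sub>R x) = a *\<^sub>R l x" for a x
      using LIMSEQ_unique[OF l[of "a *\<^sub>R x"]] tendsto_mult[OF tendsto_const[of a] l[of x]] by simp
    have "abs (X n \<bullet> x) \<le> norm x * R" for n x
      using Cauchy_Schwarz_ineq2[of "X n" x] mult_right_mono[OF bound[of n] norm_ge_zero[of x]] by (simp add: mult.commute)
    then show "norm (l x) \<le> norm x * R" for x
      using LIMSEQ_le_const2[OF tendsto_rabs[OF l[of x]]] by (simp add: real_norm_def)
  qed
  from inner_form.riesz_representation[OF subspace_UNIV closed_UNIV this] obtain x where "\<And>h. l h = x \<bullet> h" by (metis UNIV_I)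
  then have "(X \<circ> r) \<rightharpoonup> x" unfolding weakly_converges_iff_inner using l by (simp add: inner_commute)
  then show ?thesis using r(1) by blast
qed

text \<open>Each step at least halves the distance of the values to the greatest lower bound on the set of
  points below the current one in the Ekeland order.\<close>
lemma ekeland_sequence:
  fixes h :: "'a::metric_space \<Rightarrow> real"
  assumes bound: "\<And>x. x \<in> S \<Longrightarrow> m \<le> h x" and x0: "x0 \<in> S" and d: "0 < d"
  obtains X where "X 0 = x0" "\<And>n. X n \<in> S" "\<And>n k. h (X (n + k)) + d * dist (X (n + k)) (X n) \<le> h (X n)"
    "\<And>n y. y \<in> S \<Longrightarrow> h y + d * dist y (X n) \<le> h (X n) \<Longrightarrow> h (X (Suc n)) \<le> (h y + h (X n)) / 2"
proof -
  define T where "T x = {y \<in> S. h y + d * dist y x \<le> h x}" for x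
  have T_refl: "x \<in> T x" if "x \<in> S" for x using that by (simp add: T_def)
  have T_trans: "z \<in> T x" if "y \<in> T x" "z \<in> T y" for x y z
    using that mult_left_mono[OF dist_triangle[of z x y], of d] d by (auto simp: T_def algebra_simps)
  have "\<exists>z\<in>T x. \<forall>y\<in>T x. h z \<le> (h y + h x) / 2" if x: "x \<in> S" for x
  proof (cases "\<forall>y\<in>T x. h x \<le> h y")
    case True then show ?thesis using T_refl[OF x] by (intro bexI[of _ x]) auto
  next
    case False
    let ?i = "Inf (h ` T x)"
    have "bdd_below (h ` T x)" using bound by (auto simp: T_def intro!: bdd_belowI[of _ m])
    then have Inf_le: "?i \<le> h y" if "y \<in> T x" for y using that by (intro cInf_lower) auto
    then have "?i < (?i + h x) / 2" using False by fastforce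
    then obtain z where "z \<in> T x" "h z < (?i + h x) / 2" using cInf_lessD[of "h ` T x"] T_refl[OF x] by blast
    then show ?thesis using Inf_le by (intro bexI[of _ z]) fastforce+
  qed
  then obtain s where s: "\<And>x. x \<in> S \<Longrightarrow> s x \<in> T x" "\<And>x y. x \<in> S \<Longrightarrow> y \<in> T x \<Longrightarrow> h (s x) \<le> (h y + h x) / 2"
    by metis
  define X where "X n = (s ^^ n) x0" for n
  have XS: "X n \<in> S" for n using x0 s(1) by (induct n) (auto simp: X_def T_def)
  have "X (Suc n) \<in> T (X n)" for n using s(1)[OF XS[of n]] by (simp add: X_def)
  then have "X (n + k) \<in> T (X n)" for n k
    by (induct k) (insert T_refl XS T_trans, auto)
  then show ?thesis using s(2)[OF XS] XS by (intro that[of X]) (auto simp: X_def T_def)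
qed

lemma ekeland_sequence_convergent:
  fixes h :: "'a::complete_space \<Rightarrow> real"
  assumes d: "0 < d" and bound: "\<And>n. m \<le> h (X n)"
    and below: "\<And>n k. h (X (n + k)) + d * dist (X (n + k)) (X n) \<le> h (X n)"
  obtains x l where "X \<longlonglongrightarrow> x" "(\<lambda>n. h (X n)) \<longlonglongrightarrow> l"
proof -
  have "h (X (Suc n)) \<le> h (X n)" for n 
    using below[of n 1] mult_nonneg_nonneg[OF less_imp_le[OF d] zero_le_dist[of "X (Suc n)" "X n"]] by simp
  then have "decseq (\<lambda>n. h (X n))" by (simp add: decseq_Suc_iff)
  then obtain l where l: "(\<lambda>n. h (X n)) \<longlonglongrightarrow> l" "\<And>n. l \<le> h (X n)"
    using decseq_convergent[of "\<lambda>n. h (X n)" m] bound by blast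
  have "Cauchy X"
  proof (rule metric_CauchyI)
    fix e :: real assume "0 < e"
    then have "l < l + d * e / 2" using d by simp
    then obtain N where N: "h (X N) < l + d * e / 2" using order_tendstoD(2)[OF l(1)] by (fastforce simp: eventually_sequentially)
    have "dist (X n) (X N) < e/2" if "N \<le> n" for n
    proof -
      have "d * dist (X n) (X N) < d * (e/2)" using below[of N "n - N"] that l(2)[of n] N by simp
      then show ?thesis using d by simp
    qed
    then have "dist (X i) (X j) < e" if "N \<le> i" "N \<le> j" for i j
      using that by (metis dist_triangle_half_l dist_commute)
    then show "\<exists>N. \<forall>m\<ge>N. \<forall>n\<ge>N. dist (X m) (X n) < e" by blast
  qed
  then show ?thesis using l(1) that by (auto simp: Cauchy_convergent_iff convergent_def)
qed

theorem ekeland_variational_principle: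
  fixes h :: "'a::complete_space \<Rightarrow> real"
  assumes S: "closed S" and bound: "\<And>x. x \<in> S \<Longrightarrow> m \<le> h x"
    and lsc: "\<And>X x b. (\<And>n. X n \<in> S) \<Longrightarrow> X \<longlonglongrightarrow> x \<Longrightarrow> (\<And>n. h (X n) \<le> b) \<Longrightarrow> h x \<le> b"
    and x0: "x0 \<in> S" and d: "0 < d"
  shows "\<exists>x\<in>S. h x \<le> h x0 \<and> (\<forall>y\<in>S. h x - d * dist y x \<le> h y)"
proof -
  obtain X where X0: "X 0 = x0" and XS: "\<And>n. X n \<in> S"
    and below: "\<And>n k. h (X (n + k)) + d * dist (X (n + k)) (X n) \<le> h (X n)"
    and halve: "\<And>n y. y \<in> S \<Longrightarrow> h y + d * dist y (X n) \<le> h (X n) \<Longrightarrow> h (X (Suc n)) \<le> (h y + h (X n)) / 2"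
    using ekeland_sequence[of S m h x0 d] bound x0 d by blast
  have dist_nonneg: "0 \<le> d * dist x y" for x y :: 'a using d by simp
  obtain x l where x: "X \<longlonglongrightarrow> x" and l: "(\<lambda>n. h (X n)) \<longlonglongrightarrow> l"
    using ekeland_sequence_convergent[OF d bound[OF XS] below] by blast
  have limit_le: "h x \<le> h (X n)" for n
  proof (rule lsc[of "\<lambda>k. X (n + k)"])
    show "(\<lambda>k. X (n + k)) \<longlonglongrightarrow> x" using LIMSEQ_ignore_initial_segment[OF x, of n] by (simp add: add.commute)
    show "h (X (n + k)) \<le> h (X n)" for k using below[of n k] dist_nonneg[of "X (n + k)" "X n"] by linarith
  qed (rule XS)
  then have "h x \<le> l" by (intro LIMSEQ_le_const[OF l]) blast
  have limit_below: "l + d * dist x (X n) \<le> h (X n)" for n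
  proof (rule LIMSEQ_le_const2)
    show "(\<lambda>k. h (X (k + n)) + d * dist (X (k + n)) (X n)) \<longlonglongrightarrow> l + d * dist x (X n)"
      by (intro tendsto_intros LIMSEQ_ignore_initial_segment[OF l] LIMSEQ_ignore_initial_segment[OF x])
    show "\<exists>N. \<forall>k\<ge>N. h (X (k + n)) + d * dist (X (k + n)) (X n) \<le> h (X n)" using below[of n] by (simp add: add.commute)
  qed
  have "h x - d * dist y x \<le> h y" if y: "y \<in> S" for y
  proof (rule ccontr)
    assume "\<not> ?thesis"
    then have less: "h y + d * dist y x < l" using \<open>h x \<le> l\<close> by simp
    have "h y + d * dist y (X k) \<le> h (X k)" for k
      using less limit_below[of k] mult_left_mono[OF dist_triangle[of y "X k" x], of d] d by (simp add: distrib_left)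
    then have "h (X (Suc k)) \<le> (h y + h (X k)) / 2" for k by (rule halve[OF y])
    moreover have "(\<lambda>k. (h y + h (X k)) / 2) \<longlonglongrightarrow> (h y + l) / 2" by (intro tendsto_intros l) simp
    ultimately have "l \<le> (h y + l) / 2" using LIMSEQ_le[OF LIMSEQ_Suc[OF l]] by blast
    then show False using less dist_nonneg[of y x] by simp
  qed
  then show ?thesis using closed_sequentially[OF S XS x] limit_le[of 0] X0 by blast
qed

section \<open>The abstract Nehari-Pankov set\<close>

locale nehari_pankov =
  fixes B :: "'a::{real_inner,banach} \<Rightarrow> 'a \<Rightarrow> real" and P :: "'a \<Rightarrow> 'a" and \<K> :: "'k set"
    and \<Phi> :: "'k \<Rightarrow> 'a \<Rightarrow> real" and \<phi> :: "'k \<Rightarrow> 'a \<Rightarrow> 'a \<Rightarrow> real" and \<theta> :: real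
  assumes bilinear_B: "bounded_bilinear B" and B_sym: "B u v = B v u"
    and bounded_linear_P: "bounded_linear P" and P_idem: "P (P u) = P u" and P_orth: "B (P u) (v - P v) = 0"
    and B_coercive: "\<exists>c>0. \<forall>u. c * (norm (P u))^2 \<le> B (P u) (P u) \<and> c * (norm (u - P u))^2 \<le> - B (u - P u) (u - P u)"
    and P_nontrivial: "\<exists>w. P w = w \<and> w \<noteq> 0"
    and phi_linear: "K \<in> \<K> \<Longrightarrow> linear (\<phi> K u)"
    and phi_self_bounded: "\<exists>D. \<forall>K\<in>\<K>. \<forall>u. norm u \<le> R \<longrightarrow> \<phi> K u u \<le> D"
    and phi_coercive: "\<exists>C\<ge>0. \<forall>K\<in>\<K>. \<forall>u h. \<phi> K u u \<le> D \<longrightarrow> abs (\<phi> K u h) \<le> C * norm h"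
    and phi_weak_limit: "K \<in> \<K> \<Longrightarrow> Y \<rightharpoonup> y \<Longrightarrow> (\<And>n. norm (Y n) \<le> R) \<Longrightarrow> (\<lambda>n. \<phi> K (Y n) h) \<longlonglongrightarrow> \<phi> K y h"
    and Phi_lower_bound: "K \<in> \<K> \<Longrightarrow> 0 \<le> t \<Longrightarrow> \<Phi> K u + (t^2 - 1) / 2 * \<phi> K u u + t * \<phi> K u v \<le> \<Phi> K (t *\<^sub>R u + v)"
    and Phi_scaling_less: "K \<in> \<K> \<Longrightarrow> 0 \<le> t \<Longrightarrow> t \<noteq> 1 \<Longrightarrow> u \<noteq> 0 \<Longrightarrow> \<Phi> K u + (t^2 - 1) / 2 * \<phi> K u u < \<Phi> K (t *\<^sub>R u)"
    and theta: "2 < \<theta>" and ambrosetti_rabinowitz: "K \<in> \<K> \<Longrightarrow> \<theta> * \<Phi> K u \<le> \<phi> K u u"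
    and Phi_zero: "K \<in> \<K> \<Longrightarrow> \<Phi> K 0 = 0" and Phi_pos: "K \<in> \<K> \<Longrightarrow> u \<noteq> 0 \<Longrightarrow> 0 < \<Phi> K u"
    and Phi_growth: "K \<in> \<K> \<Longrightarrow> 1 \<le> r \<Longrightarrow> r powr \<theta> * \<Phi> K u \<le> \<Phi> K (r *\<^sub>R u)"
    and Phi_small: "0 < e \<Longrightarrow> \<exists>\<rho>>0. \<forall>K\<in>\<K>. \<forall>u. norm u \<le> \<rho> \<longrightarrow> \<Phi> K u \<le> e * (norm u)^2"
begin

sublocale form: bounded_bilinear B by (rule bilinear_B)
sublocale proj: bounded_linear P by (rule bounded_linear_P)

definition energy :: "'k \<Rightarrow> 'a \<Rightarrow> real" where "energy K u = B u u / 2 - \<Phi> K u"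

definition denergy :: "'k \<Rightarrow> 'a \<Rightarrow> 'a \<Rightarrow> real" where "denergy K u v = B u v - \<phi> K u v"

definition nehari :: "'k \<Rightarrow> 'a set" where
  "nehari K = {u. P u \<noteq> 0 \<and> denergy K u u = 0 \<and> (\<forall>v. P v = 0 \<longrightarrow> denergy K u v = 0)}"

definition level :: "'k \<Rightarrow> real" where "level K = Inf (energy K ` nehari K)"

definition half_space :: "'a \<Rightarrow> 'a set" where "half_space w = {z. \<exists>t\<ge>0. P z = t *\<^sub>R w}"

lemma half_spaceI: "P z = t *\<^sub>R w \<Longrightarrow> 0 \<le> t \<Longrightarrow> z \<in> half_space w"
  by (auto simp: half_space_def)

lemmas form_simps = form.add_left form.add_right form.diff_left form.diff_right form.scaleR_left form.scaleR_right
lemmas proj_simps = proj.add proj.diff proj.scaleR proj.zero P_idem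

lemma P_move: "B (P u) v = B u (P v)"
  using P_orth[of u v] P_orth[of v u] by (simp add: form.diff_right B_sym[of u "P v"] B_sym[of "P v" "P u"])

lemma B_split: "B u u = B (P u) (P u) + B (u - P u) (u - P u)"
  using P_orth[of u u] by (simp add: form_simps B_sym[of u "P u"])

lemma B_P_nonneg: "0 \<le> B (P u) (P u)" and B_complement_nonpos: "B (u - P u) (u - P u) \<le> 0"
proof -
  obtain c where c: "0 < c" "c * (norm (P u))^2 \<le> B (P u) (P u)" "c * (norm (u - P u))^2 \<le> - B (u - P u) (u - P u)"
    using B_coercive by blast
  have "0 \<le> c * (norm x)^2" for x :: 'a using c(1) by simp
  then show "0 \<le> B (P u) (P u)" "B (u - P u) (u - P u) \<le> 0" using c(2,3) by (meson order_trans, smt (verit))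
qed

lemma B_pos: "P w = w \<Longrightarrow> w \<noteq> 0 \<Longrightarrow> 0 < B w w"
  and B_neg: "P v = 0 \<Longrightarrow> v \<noteq> 0 \<Longrightarrow> B v v < 0"
proof -
  obtain c where c: "0 < c" "\<And>u. c * (norm (P u))^2 \<le> B (P u) (P u)" "\<And>u. c * (norm (u - P u))^2 \<le> - B (u - P u) (u - P u)"
    using B_coercive by blast
  have "0 < c * (norm x)^2" if "x \<noteq> 0" for x :: 'a using c(1) that by simp
  then show "P w = w \<Longrightarrow> w \<noteq> 0 \<Longrightarrow> 0 < B w w" "P v = 0 \<Longrightarrow> v \<noteq> 0 \<Longrightarrow> B v v < 0"
    using c(2)[of w] c(3)[of v] by (metis less_le_trans, force)
qed

lemma B_self_le: "\<exists>M>0. \<forall>u. abs (B u u) \<le> M * (norm u)^2"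
  using form.pos_bounded by (metis mult.commute power2_eq_square real_norm_def)

lemma norm_le_norm_P: "\<exists>m>0. \<forall>z. 0 \<le> B z z \<longrightarrow> m * norm z \<le> norm (P z)"
proof -
  obtain c where c: "0 < c" "\<And>u. c * (norm (u - P u))^2 \<le> - B (u - P u) (u - P u)" using B_coercive by blast
  obtain M where M: "0 < M" "\<And>u. abs (B u u) \<le> M * (norm u)^2" using B_self_le by blast
  define k where "k = sqrt (M / c)"
  have k: "0 \<le> k" using c M by (simp add: k_def)
  have "norm z \<le> (1 + k) * norm (P z)" if z: "0 \<le> B z z" for z
  proof -
    have "c * (norm (z - P z))^2 \<le> M * (norm (P z))^2" using c(2)[of z] M(2)[of "P z"] z B_split[of z] by linarith
    then have "(norm (z - P z))^2 \<le> (k * norm (P z))^2" using c(1) M(1) by (simp add: k_def power_mult_distrib field_simps)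
    then have "norm (z - P z) \<le> k * norm (P z)" by (rule power2_le_imp_le) (simp add: k)
    then show ?thesis using norm_triangle_ineq[of "P z" "z - P z"] by (simp add: distrib_right)
  qed
  then show ?thesis using k by (intro exI[of _ "1 / (1 + k)"]) (auto simp: field_simps add_pos_nonneg)
qed

lemma nehariD:
  assumes "u \<in> nehari K"
  shows "P u \<noteq> 0" "B u u = \<phi> K u u" "P v = 0 \<Longrightarrow> B u v = \<phi> K u v" "u \<noteq> 0"
  using assms proj.zero by (auto simp: nehari_def denergy_def)

context
  fixes K assumes K: "K \<in> \<K>"
begin

lemmas phi_simps = phi_linear[OF K, THEN linear_add] phi_linear[OF K, THEN linear_scale]
  phi_linear[OF K, THEN linear_0] phi_linear[OF K, THEN linear_neg]

lemma Phi_nonneg: "0 \<le> \<Phi> K u"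
  using Phi_pos[OF K, of u] Phi_zero[OF K] by (cases "u = 0") auto

lemma Phi_convex: "\<Phi> K u + \<phi> K u h \<le> \<Phi> K (u + h)"
  using Phi_lower_bound[OF K, of 1 u h] by simp

lemma bounded_linear_phi: "bounded_linear (\<phi> K u)"
proof -
  obtain C where "\<And>h. abs (\<phi> K u h) \<le> C * norm h" using phi_coercive[of "\<phi> K u u"] K by blast
  then show ?thesis by (intro bounded_linear_intro[of _ C]) (simp_all add: phi_simps mult.commute)
qed

lemma energy_le: "energy K u \<le> B (P u) (P u) / 2"
  using B_split[of u] B_complement_nonpos[of u] Phi_nonneg[of u] unfolding energy_def by argo

lemma denergy_add: "denergy K u (v + w) = denergy K u v + denergy K u w"
  and denergy_minus: "denergy K u (- v) = - denergy K u v"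
  by (simp_all add: denergy_def form_simps form.minus_right phi_simps)

lemma energy_fibre_le:
  assumes u: "u \<in> nehari K" and t: "0 \<le> t" and v: "P v = 0"
  shows "energy K (t *\<^sub>R u + v) \<le> energy K u + B v v / 2"
proof -
  note eq = nehariD(2)[OF u] nehariD(3)[OF u v]
  have "energy K (t *\<^sub>R u + v) = t^2 / 2 * B u u + t * B u v + B v v / 2 - \<Phi> K (t *\<^sub>R u + v)"
    by (simp add: energy_def form_simps B_sym[of v u] power2_eq_square field_simps)
  also have "\<dots> \<le> t^2 / 2 * \<phi> K u u + t * \<phi> K u v + B v v / 2 - (\<Phi> K u + (t^2 - 1) / 2 * \<phi> K u u + t * \<phi> K u v)"
    using Phi_lower_bound[OF K t, of u v] eq by simp
  also have "\<dots> = energy K u + B v v / 2" by (simp add: energy_def eq field_simps)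
  finally show ?thesis .
qed

lemma energy_fibre_maximum:
  assumes u: "u \<in> nehari K" and t: "0 \<le> t" and v: "P v = 0" and above: "energy K u \<le> energy K (t *\<^sub>R u + v)"
  shows "t = 1 \<and> v = 0"
proof -
  have v0: "v = 0" using energy_fibre_le[OF u t v] above B_neg[OF v] by fastforce
  have "t = 1"
  proof (rule ccontr)
    assume "t \<noteq> 1"
    from Phi_scaling_less[OF K t this nehariD(4)[OF u]] have "energy K (t *\<^sub>R u) < energy K u"
      by (simp add: energy_def form_simps nehariD(2)[OF u] power2_eq_square field_simps)
    then show False using above v0 by simp
  qed
  then show ?thesis using v0 by simp
qed

lemma nehari_maximal:
  assumes u: "u \<in> nehari K" and z: "z \<in> half_space (P u)"
  shows "energy K z \<le> energy K u" "energy K u \<le> energy K z \<Longrightarrow> z = u"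
proof -
  obtain t where t: "0 \<le> t" "P z = t *\<^sub>R P u" using z by (auto simp: half_space_def)
  define v where "v = z - t *\<^sub>R u"
  have v: "P v = 0" "z = t *\<^sub>R u + v" using t by (simp_all add: v_def proj_simps)
  have "B v v \<le> 0" using B_neg[OF v(1)] by (cases "v = 0") (auto simp: form.zero_left)
  then show "energy K z \<le> energy K u" using energy_fibre_le[OF u t(1) v(1)] v(2) by simp
  show "energy K u \<le> energy K z \<Longrightarrow> z = u" using energy_fibre_maximum[OF u t(1) v(1)] v(2) by simp
qed

lemma norm_powr_Phi_sgn_le:
  "\<exists>M. \<forall>z. 1 \<le> norm z \<longrightarrow> 0 \<le> energy K z \<longrightarrow> norm z powr (\<theta> - 2) * \<Phi> K (sgn z) \<le> M"
proof -
  obtain M where M: "0 < M" "\<And>u. abs (B u u) \<le> M * (norm u)^2" using B_self_le by blast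
  have "norm z powr (\<theta> - 2) * \<Phi> K (sgn z) \<le> M" if z: "1 \<le> norm z" "0 \<le> energy K z" for z
  proof -
    have "norm z *\<^sub>R sgn z = z" by (cases "z = 0") (simp_all add: sgn_div_norm)
    then have "norm z powr \<theta> * \<Phi> K (sgn z) \<le> \<Phi> K z" using Phi_growth[OF K z(1), of "sgn z"] by simp
    also have "\<dots> \<le> B z z" using z(2) Phi_nonneg[of z] by (simp add: energy_def)
    also have "\<dots> \<le> M * (norm z)^2" using M(2)[of z] by linarith
    finally have "norm z powr \<theta> * \<Phi> K (sgn z) \<le> M * (norm z)^2" .
    moreover have "norm z powr \<theta> = norm z powr (\<theta> - 2) * (norm z)^2"
      using z(1) powr_add[of "norm z" "\<theta> - 2" 2] by simp
    ultimately have "(norm z powr (\<theta> - 2) * \<Phi> K (sgn z)) * (norm z)^2 \<le> M * (norm z)^2" by (simp only: mult_ac)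
    moreover have "0 < (norm z)^2" using z(1) by (intro zero_less_power) linarith
    ultimately show ?thesis by (simp only: mult_le_cancel_right_pos)
  qed
  then show ?thesis by blast
qed

lemma Phi_weakly_lsc:
  assumes Y: "Y \<rightharpoonup> y" and d: "d < \<Phi> K y" shows "\<forall>\<^sub>F n in sequentially. d < \<Phi> K (Y n)"
proof -
  have "(\<lambda>n. \<Phi> K y + \<phi> K y (Y n - y)) \<longlonglongrightarrow> \<Phi> K y + \<phi> K y (y - y)"
    by (intro tendsto_intros weakly_convergesD[OF weakly_converges_diff[OF Y tendsto_imp_weakly_converges[OF tendsto_const]] bounded_linear_phi])
  then have "\<forall>\<^sub>F n in sequentially. d < \<Phi> K y + \<phi> K y (Y n - y)"
    using d by (intro order_tendstoD(1)) (simp_all add: phi_simps)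
  then show ?thesis by eventually_elim (insert Phi_convex[of y "Y _ - y"], auto intro: less_le_trans)
qed

text \<open>Otherwise the normalised sequence has a weak limit \<open>y \<noteq> 0\<close>, and superquadratic growth in the
  direction \<open>y\<close> makes the energy negative.\<close>
lemma bounded_over_cone:
  assumes b: "P b = b" and e: "0 < e"
  shows "\<exists>R. \<forall>z. e * norm (P z) \<le> B b z \<longrightarrow> 0 \<le> energy K z \<longrightarrow> norm z \<le> R"
proof (rule ccontr)
  assume "\<not> ?thesis"
  then have "\<forall>n::nat. \<exists>z. e * norm (P z) \<le> B b z \<and> 0 \<le> energy K z \<and> real n + 1 < norm z" by (meson not_le)
  then obtain Z where Z: "\<And>n::nat. e * norm (P (Z n)) \<le> B b (Z n)" "\<And>n. 0 \<le> energy K (Z n)" "\<And>n. real n + 1 < norm (Z n)"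
    by metis
  have Z_pos: "0 < norm (Z n)" for n using Z(3)[of n] by linarith
  define Y where "Y n = sgn (Z n)" for n
  have Y: "norm (Y n) \<le> 1" for n by (simp add: Y_def norm_sgn)
  obtain r y where r: "strict_mono r" and y: "(Y \<circ> r) \<rightharpoonup> y"
    using bounded_imp_weakly_convergent_subseq[of Y 1] Y by blast
  obtain m where m: "0 < m" "\<And>z. 0 \<le> B z z \<Longrightarrow> m * norm z \<le> norm (P z)" using norm_le_norm_P by blast
  have "e * m \<le> B b (Y n)" for n
  proof -
    have "0 \<le> B (Z n) (Z n)" using Z(2)[of n] Phi_nonneg[of "Z n"] by (simp add: energy_def)
    then have "e * (m * norm (Z n)) \<le> B b (Z n)"
      using mult_left_mono[OF m(2) less_imp_le[OF e]] Z(1)[of n] by (meson order_trans)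
    then show ?thesis using Z_pos[of n] by (simp add: Y_def sgn_div_norm form_simps field_simps)
  qed
  then have "e * m \<le> B b y" by (intro LIMSEQ_le_const[OF weakly_convergesD[OF y form.bounded_linear_right[of b]]]) auto
  then have "y \<noteq> 0" using mult_pos_pos[OF e m(1)] by (auto simp: form.zero_right)
  then have "\<Phi> K y / 2 < \<Phi> K y" using Phi_pos[OF K] by simp
  from Phi_weakly_lsc[OF y this] have large: "\<forall>\<^sub>F n in sequentially. \<Phi> K y / 2 < \<Phi> K (Y (r n))" by simp
  obtain M where M: "\<And>z. 1 \<le> norm z \<Longrightarrow> 0 \<le> energy K z \<Longrightarrow> norm z powr (\<theta> - 2) * \<Phi> K (sgn z) \<le> M"
    using norm_powr_Phi_sgn_le by blast
  have "\<forall>\<^sub>F n in sequentially. (real n + 1) powr (\<theta> - 2) * (\<Phi> K y / 2) \<le> M" using large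
  proof eventually_elim
    case (elim n)
    have n: "real n + 1 \<le> norm (Z (r n))" using Z(3)[of "r n"] seq_suble[OF r, of n] by simp
    then have "(real n + 1) powr (\<theta> - 2) * (\<Phi> K y / 2) \<le> norm (Z (r n)) powr (\<theta> - 2) * \<Phi> K (Y (r n))"
      using elim theta Phi_nonneg by (intro mult_mono powr_mono2) auto
    also have "\<dots> \<le> M" unfolding Y_def by (rule M) (insert n Z(2), auto)
    finally show ?case .
  qed
  moreover have "filterlim (\<lambda>n. (real n + 1) powr (\<theta> - 2) * (\<Phi> K y / 2)) at_top sequentially"
    using theta Phi_pos[OF K \<open>y \<noteq> 0\<close>] by real_asymp
  then have "\<forall>\<^sub>F n in sequentially. M < (real n + 1) powr (\<theta> - 2) * (\<Phi> K y / 2)"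
    unfolding filterlim_at_top_dense by blast
  ultimately have "\<forall>\<^sub>F n in sequentially. False" by eventually_elim simp
  then show False by simp
qed

lemma half_space_bounded:
  assumes w: "P w = w" "w \<noteq> 0"
  shows "\<exists>R. \<exists>d>0. \<forall>z b. z \<in> half_space b \<longrightarrow> norm (b - w) \<le> d \<longrightarrow> 0 \<le> energy K z \<longrightarrow> norm z \<le> R"
proof -
  obtain M where M: "0 < M" "\<And>x y. norm (B x y) \<le> norm x * norm y * M" using form.pos_bounded by blast
  have ww: "0 < B w w" by (rule B_pos[OF w])
  define e where "e = B w w / (4 * norm w)"
  have e: "0 < e" "2 * norm w * e = B w w / 2" using ww w by (simp_all add: e_def)
  define d where "d = min (norm w) (B w w / (2 * M * norm w))"
  have d: "0 < d" "d \<le> norm w" using ww w M(1) by (auto simp: d_def)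
  have "d \<le> B w w / (2 * M * norm w)" by (simp add: d_def)
  then have dM: "norm w * d * M \<le> B w w / 2" using w M(1) by (simp add: field_simps)
  obtain R where R: "\<And>z. e * norm (P z) \<le> B w z \<Longrightarrow> 0 \<le> energy K z \<Longrightarrow> norm z \<le> R"
    using bounded_over_cone[OF w(1) e(1)] by blast
  have "norm z \<le> R" if z: "z \<in> half_space b" "norm (b - w) \<le> d" "0 \<le> energy K z" for z b
  proof (rule R[OF _ z(3)])
    obtain t where t: "0 \<le> t" "P z = t *\<^sub>R b" using z(1) by (auto simp: half_space_def)
    have "norm b \<le> 2 * norm w" using norm_triangle_ineq[of "b - w" w] z(2) d(2) by simp
    then have "norm b * e \<le> B w w / 2" using mult_right_mono[of "norm b" "2 * norm w" e] e by simp
    moreover have "norm w * norm (b - w) * M \<le> norm w * d * M" using z(2) M(1) by (intro mult_right_mono mult_left_mono) auto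
    then have "abs (B w (b - w)) \<le> norm w * d * M" using M(2)[of w "b - w"] by simp
    then have "B w w / 2 \<le> B w b" using dM by (simp add: form_simps)
    ultimately have "t * (norm b * e) \<le> t * B w b" using t(1) by (intro mult_left_mono) auto
    also have "\<dots> = B w z" using P_move[of w z] t(2) w(1) by (simp add: form_simps)
    finally show "e * norm (P z) \<le> B w z" using t by (simp add: mult_ac)
  qed
  then show ?thesis using d(1) by blast
qed

end

lemma energy_sphere_lower_bound:
  "\<exists>\<rho>>0. \<exists>\<alpha>>0. \<forall>K\<in>\<K>. \<forall>z. P z = z \<longrightarrow> norm z = \<rho> \<longrightarrow> \<alpha> \<le> energy K z"
proof -
  obtain c where c: "0 < c" "\<And>u. c * (norm (P u))^2 \<le> B (P u) (P u)" using B_coercive by blast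
  obtain \<rho> where \<rho>: "0 < \<rho>" "\<And>K u. K \<in> \<K> \<Longrightarrow> norm u \<le> \<rho> \<Longrightarrow> \<Phi> K u \<le> c / 4 * (norm u)^2"
    using Phi_small[of "c / 4"] c(1) by auto
  have "c / 4 * \<rho>^2 \<le> energy K z" if "K \<in> \<K>" "P z = z" "norm z = \<rho>" for K z
    using c(2)[of z] \<rho>(2)[of K z] that by (simp add: energy_def)
  then show ?thesis using \<rho>(1) c(1) by (intro exI[of _ \<rho>] conjI exI[of _ "c / 4 * \<rho>^2"]) auto
qed

lemma nehari_energy_lower_bound: "\<exists>\<alpha>>0. \<forall>K\<in>\<K>. \<forall>u\<in>nehari K. \<alpha> \<le> energy K u"
proof -
  obtain \<rho> \<alpha> where \<rho>: "0 < \<rho>" "0 < \<alpha>" "\<And>K z. K \<in> \<K> \<Longrightarrow> P z = z \<Longrightarrow> norm z = \<rho> \<Longrightarrow> \<alpha> \<le> energy K z"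
    using energy_sphere_lower_bound by blast
  have "\<alpha> \<le> energy K u" if K: "K \<in> \<K>" and u: "u \<in> nehari K" for K u
  proof -
    define z where "z = (\<rho> / norm (P u)) *\<^sub>R P u"
    have z: "P z = (\<rho> / norm (P u)) *\<^sub>R P u" "P z = z" "norm z = \<rho>"
      using nehariD(1)[OF u] \<rho>(1) by (simp_all add: z_def proj_simps)
    have "z \<in> half_space (P u)" using \<rho>(1) by (intro half_spaceI[OF z(1)]) simp
    from nehari_maximal(1)[OF K u this] show ?thesis using \<rho>(3)[OF K z(2,3)] by linarith
  qed
  then show ?thesis using \<rho>(2) by blast
qed

lemma weak_limit_in_half_space:
  assumes Z: "Z \<rightharpoonup> z" and t: "\<And>n. 0 \<le> t n" "\<And>n. P (Z n) = t n *\<^sub>R b n" and b: "b \<longlonglongrightarrow> w" and w: "P w = w" "w \<noteq> 0"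
  obtains s where "t \<longlonglongrightarrow> s" "0 \<le> s" "P z = s *\<^sub>R w" "(\<lambda>n. P (Z n)) \<longlonglongrightarrow> P z"
proof -
  define s where "s = B w z / B w w"
  have ww: "0 < B w w" by (rule B_pos[OF w])
  have Bb: "(\<lambda>n. B w (b n)) \<longlonglongrightarrow> B w w" by (intro form.tendsto tendsto_const b)
  have "(\<lambda>n. B w (Z n) / B w (b n)) \<longlonglongrightarrow> s"
    unfolding s_def using ww by (intro tendsto_divide weakly_convergesD[OF Z form.bounded_linear_right] Bb) simp
  moreover have "\<forall>\<^sub>F n in sequentially. B w (Z n) / B w (b n) = t n" using order_tendstoD(1)[OF Bb ww]
  proof eventually_elim
    case (elim n)
    then show ?case using P_move[of w "Z n"] t(2)[of n] w(1) by (simp add: form_simps)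
  qed
  ultimately have s: "t \<longlonglongrightarrow> s" by (rule Lim_transform_eventually)
  then have PZ: "(\<lambda>n. P (Z n)) \<longlonglongrightarrow> s *\<^sub>R w" unfolding t(2) by (intro tendsto_intros b)
  then have Pz: "P z = s *\<^sub>R w"
    using weakly_converges_bounded_linear[OF bounded_linear_P Z] tendsto_imp_weakly_converges weakly_converges_unique by blast
  show ?thesis by (rule that[OF s _ Pz]) (insert PZ Pz LIMSEQ_le_const[OF s] t(1), auto)
qed

lemma energy_weakly_usc:
  assumes Z: "Z \<rightharpoonup> z" "(\<lambda>n. P (Z n)) \<longlonglongrightarrow> P z"
    and bound: "\<And>n. b n \<le> energy (Ks n) (Z n)" "b \<longlonglongrightarrow> b0"
    and Phi: "\<And>n. p n \<le> \<Phi> (Ks n) (Z n)" "p \<longlonglongrightarrow> p0" "\<Phi> K z \<le> p0"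
  shows "b0 \<le> energy K z"
proof -
  define q where "q x y = B (- (x - P x)) (y - P y)" for x y
  have "bounded_bilinear q" unfolding q_def by (rule bounded_bilinear.comp[OF bilinear_B])
      (intro bounded_linear_minus bounded_linear_sub bounded_linear_ident bounded_linear_P)+
  moreover have "q x y = q y x" "0 \<le> q x x" for x y
    using B_complement_nonpos[of x] B_sym[of "x - P x" "y - P y"] by (simp_all only: q_def form.minus_left)
  ultimately have "q z z \<le> B (P z) (P z) - 2 * b0 - 2 * p0"
  proof (rule semidefinite_form_weakly_lsc[OF _ _ _ Z(1)])
    show "q (Z n) (Z n) \<le> B (P (Z n)) (P (Z n)) - 2 * b n - 2 * p n" for n
      using bound(1)[of n] Phi(1)[of n] B_split[of "Z n"] unfolding energy_def q_def form.minus_left by argo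
    show "(\<lambda>n. B (P (Z n)) (P (Z n)) - 2 * b n - 2 * p n) \<longlonglongrightarrow> B (P z) (P z) - 2 * b0 - 2 * p0"
      by (intro tendsto_intros form.tendsto Z(2) bound(2) Phi(2))
  qed
  then show ?thesis using B_split[of z] Phi(3) unfolding energy_def q_def form.minus_left by argo
qed

context
  fixes K assumes K: "K \<in> \<K>"
begin

lemma energy_weakly_usc_const:
  assumes Z: "Z \<rightharpoonup> z" "(\<lambda>n. P (Z n)) \<longlonglongrightarrow> P z" and bound: "\<And>n. b n \<le> energy K (Z n)" "b \<longlonglongrightarrow> b0"
  shows "b0 \<le> energy K z"
proof (rule energy_weakly_usc[OF Z bound])
  show "\<Phi> K z + \<phi> K z (Z n - z) \<le> \<Phi> K (Z n)" for n using Phi_convex[OF K, of z "Z n - z"] by simp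
  show "(\<lambda>n. \<Phi> K z + \<phi> K z (Z n - z)) \<longlonglongrightarrow> \<Phi> K z + \<phi> K z (z - z)"
    by (intro tendsto_intros weakly_convergesD[OF weakly_converges_diff[OF Z(1) tendsto_imp_weakly_converges[OF tendsto_const]] bounded_linear_phi[OF K]])
qed (simp add: phi_simps[OF K])

lemma energy_lsc:
  assumes Z: "Z \<longlonglongrightarrow> z" and bound: "\<And>n. energy K (Z n) \<le> b"
  shows "energy K z \<le> b"
proof -
  obtain R where R: "\<And>n. norm (Z n) \<le> R" using convergent_imp_Bseq[OF convergentI[OF Z]] by (auto simp: Bseq_def)
  obtain D where D: "\<And>u. norm u \<le> R \<Longrightarrow> \<phi> K u u \<le> D" using phi_self_bounded K by blast
  obtain C where C: "\<And>u h. \<phi> K u u \<le> D \<Longrightarrow> abs (\<phi> K u h) \<le> C * norm h" using phi_coercive K by blast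
  have "B (Z n) (Z n) / 2 - \<Phi> K z - C * norm (z - Z n) \<le> b" for n
    using Phi_convex[OF K, of "Z n" "z - Z n"] C[OF D[OF R], of n "z - Z n"] bound[of n]
    by (simp add: energy_def abs_le_iff)
  moreover have "(\<lambda>n. B (Z n) (Z n) / 2 - \<Phi> K z - C * norm (z - Z n)) \<longlonglongrightarrow> B z z / 2 - \<Phi> K z - C * norm (z - z)"
    by (intro tendsto_intros form.tendsto Z) simp
  ultimately show ?thesis using LIMSEQ_le_const2 unfolding energy_def by fastforce
qed

lemma denergy_nonpos_if_decreasing:
  assumes decreasing: "\<And>s. 0 < s \<Longrightarrow> s < 1 \<Longrightarrow> energy K (z + s *\<^sub>R d) \<le> energy K z"
  shows "denergy K z d \<le> 0"
proof -
  define s where "s n = 1 / (real n + 2)" for n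
  have s: "0 < s n" "s n < 1" for n by (auto simp: s_def field_simps)
  have s_lim: "s \<longlonglongrightarrow> 0" unfolding s_def by real_asymp
  have "B z d - \<phi> K (z + s n *\<^sub>R d) d + s n / 2 * B d d \<le> 0" for n
  proof -
    have "\<Phi> K (z + s n *\<^sub>R d) - s n * \<phi> K (z + s n *\<^sub>R d) d \<le> \<Phi> K z"
      using Phi_convex[OF K, of "z + s n *\<^sub>R d" "- (s n *\<^sub>R d)"] by (simp add: phi_simps[OF K])
    moreover have "energy K (z + s n *\<^sub>R d) = B z z / 2 + s n * B z d + (s n)^2 / 2 * B d d - \<Phi> K (z + s n *\<^sub>R d)"
      by (simp add: energy_def form_simps B_sym[of d z] power2_eq_square field_simps)
    ultimately have "s n * (B z d - \<phi> K (z + s n *\<^sub>R d) d + s n / 2 * B d d) \<le> 0"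
      using decreasing[OF s[of n]] by (simp add: energy_def power2_eq_square field_simps)
    then show ?thesis using s(1)[of n] by (simp add: mult_le_0_iff)
  qed
  moreover have "(\<lambda>n. \<phi> K (z + s n *\<^sub>R d) d) \<longlonglongrightarrow> \<phi> K z d"
  proof (rule phi_weak_limit[OF K tendsto_imp_weakly_converges])
    show "(\<lambda>n. z + s n *\<^sub>R d) \<longlonglongrightarrow> z"
      using tendsto_add[OF tendsto_const tendsto_scaleR[OF s_lim tendsto_const], of z d] by simp
    show "norm (z + s n *\<^sub>R d) \<le> norm z + norm d" for n
      using norm_triangle_ineq[of z "s n *\<^sub>R d"] mult_left_le_one_le[of "norm d" "s n"] s[of n] by simp
  qed
  then have "(\<lambda>n. B z d - \<phi> K (z + s n *\<^sub>R d) d + s n / 2 * B d d) \<longlonglongrightarrow> B z d - \<phi> K z d + 0 / 2 * B d d"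
    by (intro tendsto_intros s_lim) auto
  ultimately show ?thesis using LIMSEQ_le_const2 by (fastforce simp: denergy_def)
qed

lemma half_space_energy_bdd_above:
  assumes w: "P w = w" "w \<noteq> 0"
  shows "bdd_above (energy K ` half_space w)"
proof -
  obtain R where R: "\<And>z. z \<in> half_space w \<Longrightarrow> 0 \<le> energy K z \<Longrightarrow> norm z \<le> R"
    using half_space_bounded[OF K w] by (metis diff_self less_imp_le norm_zero)
  obtain M where M: "0 < M" "\<And>u. abs (B u u) \<le> M * (norm u)^2" using B_self_le by blast
  have "energy K z \<le> M * R^2" if "z \<in> half_space w" for z
  proof (cases "0 \<le> energy K z")
    case True
    have "2 * energy K z \<le> M * (norm z)^2" using Phi_nonneg[OF K, of z] M(2)[of z] by (simp add: energy_def)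
    also have "\<dots> \<le> M * R^2" using R[OF that True] M(1) by (intro mult_left_mono power_mono) auto
    finally show ?thesis using True by linarith
  qed (insert M(1), auto intro: order_trans[of _ 0])
  then show ?thesis by (auto intro!: bdd_aboveI[of _ "M * R^2"])
qed

lemma half_space_maximizer:
  assumes w: "P w = w" "w \<noteq> 0"
  shows "\<exists>z\<in>half_space w. 0 < energy K z \<and> (\<forall>y\<in>half_space w. energy K y \<le> energy K z)"
proof -
  obtain R where R: "\<And>z. z \<in> half_space w \<Longrightarrow> 0 \<le> energy K z \<Longrightarrow> norm z \<le> R"
    using half_space_bounded[OF K w] by (metis diff_self less_imp_le norm_zero)
  define a where "a = Sup (energy K ` half_space w)"
  have le_a: "energy K z \<le> a" if "z \<in> half_space w" for z
    unfolding a_def using that by (intro cSup_upper half_space_energy_bdd_above[OF w]) auto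
  obtain \<rho> \<alpha> where \<rho>: "0 < \<rho>" "0 < \<alpha>" "\<And>z. P z = z \<Longrightarrow> norm z = \<rho> \<Longrightarrow> \<alpha> \<le> energy K z"
    using energy_sphere_lower_bound K by blast
  define z0 where "z0 = (\<rho> / norm w) *\<^sub>R w"
  have "P z0 = z0" "norm z0 = \<rho>" using w \<rho>(1) by (auto simp: z0_def proj_simps)
  moreover have z0: "z0 \<in> half_space w"
    using w(1) \<rho>(1) by (intro half_spaceI[of _ "\<rho> / norm w"]) (simp_all add: z0_def proj_simps)
  ultimately have a: "0 < a" using \<rho>(2,3) le_a[OF z0] by fastforce
  have "\<exists>z\<in>half_space w. max 0 (a - 1 / real (Suc n)) < energy K z" for n
    using less_cSupD[of "energy K ` half_space w" "max 0 (a - 1 / real (Suc n))"] z0 a unfolding a_def by fastforce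
  then obtain Z where Z: "\<And>n. Z n \<in> half_space w" "\<And>n. max 0 (a - 1 / real (Suc n)) < energy K (Z n)" by metis
  have "norm (Z n) \<le> R" for n using R[OF Z(1)] Z(2)[of n] by simp
  then obtain r z where r: "strict_mono r" and z: "(Z \<circ> r) \<rightharpoonup> z"
    using bounded_imp_weakly_convergent_subseq by blast
  obtain t where "\<And>n. 0 \<le> t n" "\<And>n. P (Z n) = t n *\<^sub>R w" using Z(1) unfolding half_space_def by simp metis
  then have "0 \<le> t (r n)" "P ((Z \<circ> r) n) = t (r n) *\<^sub>R w" for n by simp_all
  then obtain s where s: "0 \<le> s" "P z = s *\<^sub>R w" "(\<lambda>n. P ((Z \<circ> r) n)) \<longlonglongrightarrow> P z"
    using weak_limit_in_half_space[OF z _ _ tendsto_const w] by metis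
  have "a \<le> energy K z"
  proof (rule energy_weakly_usc_const[OF z s(3)])
    show "a - 1 / real (Suc (r n)) \<le> energy K ((Z \<circ> r) n)" for n using Z(2)[of "r n"] by simp
    have "(\<lambda>n. a - 1 / real (Suc n)) \<longlonglongrightarrow> a - 0"
      using LIMSEQ_inverse_real_of_nat by (intro tendsto_intros) (simp add: inverse_eq_divide)
    from LIMSEQ_subseq_LIMSEQ[OF this r] show "(\<lambda>n. a - 1 / real (Suc (r n))) \<longlonglongrightarrow> a" by (simp add: o_def)
  qed
  then show ?thesis using le_a a s(1,2) by (intro bexI[of _ z]) (force simp: half_space_def)+
qed

lemma half_space_maximizer_nehari:
  assumes z: "z \<in> half_space w" "P w = w" "w \<noteq> 0" "0 < energy K z"
    and max: "\<And>y. y \<in> half_space w \<Longrightarrow> energy K y \<le> energy K z"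
  shows "z \<in> nehari K" "\<exists>t>0. P z = t *\<^sub>R w"
proof -
  obtain t where t: "0 \<le> t" "P z = t *\<^sub>R w" using z(1) by (auto simp: half_space_def)
  have "t \<noteq> 0" using energy_le[OF K, of z] z(4) t(2) by (auto simp: form.zero_left)
  then have t_pos: "0 < t" using t(1) by simp
  then show "\<exists>t>0. P z = t *\<^sub>R w" using t(2) by blast
  have nonpos: "denergy K z d \<le> 0" if "\<And>s. 0 < s \<Longrightarrow> s < 1 \<Longrightarrow> z + s *\<^sub>R d \<in> half_space w" for d
    by (intro denergy_nonpos_if_decreasing max that)
  have "denergy K z v \<le> 0" if "P v = 0" for v
    by (rule nonpos) (insert that t, auto simp: half_space_def proj_simps)
  then have "denergy K z v = 0" if "P v = 0" for v
    using denergy_minus[OF K, of z v] that proj.neg[of v] by (metis antisym neg_0_le_iff_le neg_equal_0_iff_equal)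
  moreover have "denergy K z (c *\<^sub>R z) \<le> 0" if "abs c \<le> 1" for c
  proof (rule nonpos)
    fix s :: real assume s: "0 < s" "s < 1"
    have "abs (s * c) \<le> 1" using s that by (simp add: abs_mult mult_le_one)
    then have "0 \<le> (1 + s * c) * t" using t(1) by (intro mult_nonneg_nonneg) auto
    moreover have "P (z + s *\<^sub>R c *\<^sub>R z) = ((1 + s * c) * t) *\<^sub>R w" by (simp add: proj_simps t(2) algebra_simps)
    ultimately show "z + s *\<^sub>R c *\<^sub>R z \<in> half_space w" unfolding half_space_def by blast
  qed
  from this[of 1] this[of "-1"] have "denergy K z z = 0" using denergy_minus[OF K, of z z] by simp
  ultimately show "z \<in> nehari K" using t_pos t(2) z(3) by (simp add: nehari_def)
qed

definition peak :: "'a \<Rightarrow> 'a" where "peak w = (SOME z. z \<in> nehari K \<and> (\<exists>t>0. P z = t *\<^sub>R w))"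

theorem peak:
  assumes w: "P w = w" "w \<noteq> 0" shows "peak w \<in> nehari K" "\<exists>t>0. P (peak w) = t *\<^sub>R w"
proof -
  have "\<exists>z. z \<in> nehari K \<and> (\<exists>t>0. P z = t *\<^sub>R w)"
    using half_space_maximizer[OF w] half_space_maximizer_nehari[OF _ w] by blast
  from someI_ex[OF this] show "peak w \<in> nehari K" "\<exists>t>0. P (peak w) = t *\<^sub>R w" unfolding peak_def by auto
qed

lemma energy_le_peak:
  assumes w: "P w = w" "w \<noteq> 0" and z: "z \<in> half_space w"
  shows "energy K z \<le> energy K (peak w)"
proof (rule nehari_maximal(1)[OF K peak(1)[OF w]])
  obtain s t where "0 < s" "P (peak w) = s *\<^sub>R w" "0 \<le> t" "P z = t *\<^sub>R w" using peak(2)[OF w] z by (auto simp: half_space_def)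
  then show "z \<in> half_space (P (peak w))" by (auto simp: half_space_def intro!: exI[of _ "t / s"])
qed

lemma energy_peak_lsc:
  assumes X: "X \<longlonglongrightarrow> x" "\<And>n. P (X n) = X n" "\<And>n. X n \<noteq> 0" and x: "x \<noteq> 0" and bound: "\<And>n. energy K (peak (X n)) \<le> b"
  shows "energy K (peak x) \<le> b"
proof -
  have Px: "P x = x" using LIMSEQ_unique[OF proj.tendsto[OF X(1)]] X(1,2) by simp
  obtain t where t: "0 < t" "P (peak x) = t *\<^sub>R x" using peak(2)[OF Px x] by blast
  define Z where "Z n = peak x - t *\<^sub>R x + t *\<^sub>R X n" for n
  have "energy K (Z n) \<le> b" for n
  proof (rule order_trans[OF energy_le_peak[OF X(2,3)] bound])
    have "P (Z n) = t *\<^sub>R X n" by (simp add: Z_def proj_simps t(2) Px X(2))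
    then show "Z n \<in> half_space (X n)" using t(1) by (intro half_spaceI[of _ t]) simp_all
  qed
  moreover have "Z \<longlonglongrightarrow> peak x - t *\<^sub>R x + t *\<^sub>R x" unfolding Z_def by (intro tendsto_intros X)
  ultimately show ?thesis using energy_lsc by fastforce
qed

end

lemma denergy_difference_quotient_bound:
  assumes K: "K \<in> \<K>" and u: "u \<in> nehari K" and h: "P h = h" and pos: "0 < s" "0 < t"
    and z: "P z = t *\<^sub>R (P u + s *\<^sub>R h)" "energy K u - c * s \<le> energy K z"
  shows "- c \<le> t * (t * B (P u) h + t * s / 2 * B h h - \<phi> K (z - (t * s) *\<^sub>R h) h)"
proof -
  define d y where "d = t * s" and "y = z - d *\<^sub>R h"
  have z_eq: "z = y + d *\<^sub>R h" by (simp add: y_def)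
  have Py: "P y = t *\<^sub>R P u" by (simp add: y_def d_def proj_simps z(1) h scaleR_add_right)
  have "\<Phi> K y + d * \<phi> K y h \<le> \<Phi> K z"
    using Phi_convex[OF K, of y "d *\<^sub>R h"] by (simp add: z_eq phi_simps[OF K])
  moreover have "energy K z = B y y / 2 + d * B y h + d^2 / 2 * B h h - \<Phi> K z"
    by (simp add: energy_def z_eq form_simps B_sym[of h y] power2_eq_square field_simps)
  moreover have "energy K y \<le> energy K u" by (rule nehari_maximal(1)[OF K u half_spaceI[OF Py less_imp_le[OF pos(2)]]])
  moreover have "B y h = t * B (P u) h" using P_move[of y h] h Py by (simp add: form_simps)
  ultimately have "- c * s \<le> d * (t * B (P u) h) + d^2 / 2 * B h h - d * \<phi> K y h"
    using z(2) unfolding energy_def[of K y] by simp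
  also have "\<dots> = (t * (t * B (P u) h + t * s / 2 * B h h - \<phi> K y h)) * s"
    by (simp add: d_def power2_eq_square field_simps)
  finally show ?thesis using pos(1) unfolding y_def d_def by (subst (asm) mult_le_cancel_right) auto
qed

text \<open>The points \<open>Z n\<close> nearly maximise the energy over half spaces that converge to the one through \<open>u\<close>,
  so they converge weakly to \<open>u\<close>; comparing with \<open>Z n - t n s n h\<close>, which lies in the half space of \<open>u\<close>,
  yields the one-sided derivative at \<open>u\<close> in the limit.\<close>
lemma denergy_lower_bound:
  assumes K: "K \<in> \<K>" and u: "u \<in> nehari K" and h: "P h = h" and s: "\<And>n. 0 < s n" "s \<longlonglongrightarrow> 0"
    and Z: "\<And>n. 0 < t n" "\<And>n. P (Z n) = t n *\<^sub>R (P u + s n *\<^sub>R h)" "\<And>n. norm (Z n) \<le> R"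
    and low: "\<And>n. energy K u - c * s n \<le> energy K (Z n)"
  shows "- c \<le> denergy K u h"
proof -
  have Pu: "P (P u) = P u" "P u \<noteq> 0" using nehariD(1)[OF u] by (simp_all add: P_idem)
  obtain r z where r: "strict_mono r" and z: "(Z \<circ> r) \<rightharpoonup> z"
    using bounded_imp_weakly_convergent_subseq[of Z R] Z(3) by blast
  have sr: "(\<lambda>n. s (r n)) \<longlonglongrightarrow> 0" using LIMSEQ_subseq_LIMSEQ[OF s(2) r] by (simp add: o_def)
  have b: "(\<lambda>n. P u + s (r n) *\<^sub>R h) \<longlonglongrightarrow> P u"
    using tendsto_add[OF tendsto_const tendsto_scaleR[OF sr tendsto_const], of "P u" h] by simp
  have "0 \<le> t (r n)" "P ((Z \<circ> r) n) = t (r n) *\<^sub>R (P u + s (r n) *\<^sub>R h)" for n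
    using Z(1)[of "r n"] Z(2) by simp_all
  then obtain t0 where t0: "(\<lambda>n. t (r n)) \<longlonglongrightarrow> t0" "0 \<le> t0" "P z = t0 *\<^sub>R P u" "(\<lambda>n. P ((Z \<circ> r) n)) \<longlonglongrightarrow> P z"
    using weak_limit_in_half_space[OF z _ _ b Pu] by metis
  have "energy K u \<le> energy K z"
  proof (rule energy_weakly_usc_const[OF K z t0(4)])
    show "energy K u - c * s (r n) \<le> energy K ((Z \<circ> r) n)" for n using low by simp
    show "(\<lambda>n. energy K u - c * s (r n)) \<longlonglongrightarrow> energy K u"
      using tendsto_diff[OF tendsto_const tendsto_mult_right_zero[OF sr]] by fastforce
  qed
  then have zu: "z = u" using nehari_maximal(2)[OF K u] t0(2,3) by (auto simp: half_space_def)
  then have tr: "(\<lambda>n. t (r n)) \<longlonglongrightarrow> 1" using t0(1,3) Pu(2) scaleR_right_imp_eq[of "P u" t0 1] by simp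
  define Y where "Y n = Z n - (t n * s n) *\<^sub>R h" for n
  have tsh: "(\<lambda>n. (t (r n) * s (r n)) *\<^sub>R h) \<longlonglongrightarrow> (1 * 0) *\<^sub>R h" by (intro tendsto_intros tr sr)
  have Y: "(\<lambda>n. Y (r n)) \<rightharpoonup> u"
    using weakly_converges_diff[OF z tendsto_imp_weakly_converges[OF tsh]] by (simp add: Y_def zu)
  obtain R' where "\<And>n. norm ((t (r n) * s (r n)) *\<^sub>R h) \<le> R'"
    using convergent_imp_Bseq[OF convergentI[OF tsh]] by (auto simp: Bseq_def)
  then have Y_bound: "norm (Y (r n)) \<le> R + R'" for n
    using norm_triangle_le_diff[of "Z (r n)" "(t (r n) * s (r n)) *\<^sub>R h"] Z(3)[of "r n"] unfolding Y_def by (meson add_mono)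
  have "- c \<le> t n * (t n * B (P u) h + t n * s n / 2 * B h h - \<phi> K (Y n) h)" for n
    unfolding Y_def by (rule denergy_difference_quotient_bound[OF K u h s(1) Z(1,2) low])
  moreover have "(\<lambda>n. t (r n) * (t (r n) * B (P u) h + t (r n) * s (r n) / 2 * B h h - \<phi> K (Y (r n)) h))
    \<longlonglongrightarrow> 1 * (1 * B (P u) h + 1 * 0 / 2 * B h h - \<phi> K u h)"
    using tr by (intro tendsto_intros sr phi_weak_limit[OF K Y Y_bound]) auto
  ultimately have "- c \<le> 1 * (1 * B (P u) h + 1 * 0 / 2 * B h h - \<phi> K u h)" using LIMSEQ_le_const by blast
  also have "\<dots> = denergy K u h" using P_move[of u h] h by (simp add: denergy_def)
  finally show ?thesis .
qed

lemma peak_sgn: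
  assumes K: "K \<in> \<K>" and b: "P b = b" "b \<noteq> 0"
  shows "peak K (sgn b) \<in> nehari K" "\<exists>t>0. P (peak K (sgn b)) = t *\<^sub>R b"
proof -
  have w: "P (sgn b) = sgn b" "sgn b \<noteq> 0" using b by (simp_all add: sgn_div_norm proj_simps)
  show "peak K (sgn b) \<in> nehari K" by (rule peak(1)[OF K w])
  obtain t where "0 < t" "P (peak K (sgn b)) = t *\<^sub>R sgn b" using peak(2)[OF K w] by blast
  then show "\<exists>t>0. P (peak K (sgn b)) = t *\<^sub>R b"
    using b(2) by (intro exI[of _ "t / norm b"]) (simp add: sgn_div_norm divide_inverse)
qed

lemma denergy_lower_bound_peak:
  assumes K: "K \<in> \<K>" and u: "u \<in> nehari K" and h: "P h = h" and d: "0 \<le> d"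
    and min: "\<And>w. P w = w \<Longrightarrow> norm w = 1 \<Longrightarrow> energy K u - d * norm (w - sgn (P u)) \<le> energy K (peak K w)"
  shows "- (2 * d / norm (P u)) * norm h \<le> denergy K u h"
proof -
  have Pu: "P (P u) = P u" "P u \<noteq> 0" using nehariD(1)[OF u] by (simp_all add: P_idem)
  obtain \<alpha> where \<alpha>: "0 < \<alpha>" "\<And>z. z \<in> nehari K \<Longrightarrow> \<alpha> \<le> energy K z" using nehari_energy_lower_bound K by blast
  obtain R e where R: "0 < e" "\<And>z b. z \<in> half_space b \<Longrightarrow> norm (b - P u) \<le> e \<Longrightarrow> 0 \<le> energy K z \<Longrightarrow> norm z \<le> R"
    using half_space_bounded[OF K Pu] by metis
  define m where "m = min e (norm (P u) / 2) / (norm h + 1)"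
  define s where "s n = m / (real n + 1)" for n
  define b where "b n = P u + s n *\<^sub>R h" for n
  have h1: "0 < norm h + 1" by (simp add: add_nonneg_pos)
  have m: "0 < m" using R(1) Pu(2) h1 by (simp add: m_def)
  have s_pos: "0 < s n" for n using m by (simp add: s_def)
  have "s \<longlonglongrightarrow> 0" unfolding s_def by real_asymp
  have sh: "norm (b n - P u) \<le> min e (norm (P u) / 2)" for n
  proof -
    have "s n * norm h \<le> m * (norm h + 1)" using m by (intro mult_mono) (auto simp: s_def divide_le_eq)
    also have "\<dots> = min e (norm (P u) / 2)" using h1 by (simp add: m_def)
    finally show ?thesis using s_pos[of n] by (simp add: b_def)
  qed
  have b: "P (b n) = b n" "b n \<noteq> 0" for n
  proof -
    show "P (b n) = b n" by (simp add: b_def proj_simps h)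
    show "b n \<noteq> 0" using sh[of n] Pu(2) by (auto simp: norm_minus_commute)
  qed
  have w: "P (sgn (b n)) = sgn (b n)" "norm (sgn (b n)) = 1" for n
    using b[of n] by (simp_all add: sgn_div_norm proj_simps)
  note Z = peak_sgn[OF K b]
  obtain t where t: "\<And>n. 0 < t n" "\<And>n. P (peak K (sgn (b n))) = t n *\<^sub>R b n" using Z(2) by metis
  have "- (2 * d / norm (P u) * norm h) \<le> denergy K u h"
  proof (rule denergy_lower_bound[OF K u h s_pos \<open>s \<longlonglongrightarrow> 0\<close> t(1) t(2)[unfolded b_def]])
    fix n
    have "d * norm (sgn (b n) - sgn (P u)) \<le> d * (2 * norm (b n - P u) / norm (P u))"
      by (intro mult_left_mono norm_sgn_diff_le b Pu d)
    then show "energy K u - 2 * d / norm (P u) * norm h * s n \<le> energy K (peak K (sgn (P u + s n *\<^sub>R h)))"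
      using min[OF w, of n] s_pos[of n] by (simp add: b_def mult_ac)
    have "peak K (sgn (b n)) \<in> half_space (b n)" by (rule half_spaceI[OF t(2) less_imp_le[OF t(1)]])
    moreover have "0 \<le> energy K (peak K (sgn (b n)))" using \<alpha>(2)[OF Z(1)[of n]] \<alpha>(1) by simp
    ultimately show "norm (peak K (sgn (P u + s n *\<^sub>R h))) \<le> R" using R(2) sh[of n] by (simp add: b_def)
  qed
  then show ?thesis by simp
qed

lemma nehari_nonempty: "K \<in> \<K> \<Longrightarrow> nehari K \<noteq> {}"
  using P_nontrivial peak(1) by blast

lemma level_le: "K \<in> \<K> \<Longrightarrow> u \<in> nehari K \<Longrightarrow> level K \<le> energy K u"
  unfolding level_def using nehari_energy_lower_bound by (meson bdd_belowI2 cINF_lower)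

lemma level_pos: assumes K: "K \<in> \<K>" shows "0 < level K"
proof -
  obtain \<alpha> where \<alpha>: "0 < \<alpha>" "\<And>u. u \<in> nehari K \<Longrightarrow> \<alpha> \<le> energy K u" using nehari_energy_lower_bound K by blast
  have "\<alpha> \<le> level K" unfolding level_def by (rule cInf_greatest) (insert nehari_nonempty[OF K] \<alpha>(2), auto)
  then show ?thesis using \<alpha>(1) by simp
qed

definition critical :: "'k \<Rightarrow> 'a \<Rightarrow> bool" where "critical K u \<longleftrightarrow> (\<forall>h. denergy K u h = 0)"

lemma critical_imp_nehari: assumes K: "K \<in> \<K>" and u: "critical K u" "u \<noteq> 0" shows "u \<in> nehari K"
proof -
  have "0 < \<theta> * \<Phi> K u" using theta Phi_pos[OF K u(2)] by simp
  then have "0 < B u u" using u(1) ambrosetti_rabinowitz[OF K, of u] by (simp add: critical_def denergy_def)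
  then have "P u \<noteq> 0" using B_neg[OF _ u(2)] by fastforce
  then show ?thesis using u(1) by (simp add: nehari_def critical_def)
qed

lemma level_le_critical: "K \<in> \<K> \<Longrightarrow> critical K u \<Longrightarrow> u \<noteq> 0 \<Longrightarrow> level K \<le> energy K u"
  by (intro level_le critical_imp_nehari)

lemma nehari_bounded: "\<exists>R. \<forall>K\<in>\<K>. \<forall>u\<in>nehari K. energy K u \<le> d \<longrightarrow> norm u \<le> R"
proof -
  obtain c where c: "0 < c" "\<And>u. c * (norm (P u))^2 \<le> B (P u) (P u)" "\<And>u. c * (norm (u - P u))^2 \<le> - B (u - P u) (u - P u)"
    using B_coercive by blast
  have th: "0 < 1/2 - 1/\<theta>" using theta by (simp add: field_simps)
  define D where "D = d / (1/2 - 1/\<theta>)"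
  obtain C where C: "0 \<le> C" "\<And>K u h. K \<in> \<K> \<Longrightarrow> \<phi> K u u \<le> D \<Longrightarrow> abs (\<phi> K u h) \<le> C * norm h"
    using phi_coercive by metis
  have "norm u \<le> sqrt ((D + C * (C / c)) / c) + C / c" if K: "K \<in> \<K>" and u: "u \<in> nehari K" and bound: "energy K u \<le> d" for K u
  proof -
    define v where "v = u - P u"
    have v: "P v = 0" by (simp add: v_def proj_simps)
    note eq = nehariD(2)[OF u] nehariD(3)[OF u v]
    have "\<Phi> K u \<le> \<phi> K u u / \<theta>" using ambrosetti_rabinowitz[OF K, of u] theta by (simp add: field_simps)
    then have "(1/2 - 1/\<theta>) * \<phi> K u u \<le> d" using bound eq(1) by (simp add: energy_def algebra_simps)
    then have D: "\<phi> K u u \<le> D" using th by (simp add: D_def field_simps)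
    have Bv: "B v v = \<phi> K u v" using eq(2) P_orth[of u u] by (simp add: v_def form.diff_left)
    have \<phi>v: "- \<phi> K u v \<le> C * norm v" using C(2)[OF K D, of v] by linarith
    then have "c * norm v * norm v \<le> C * norm v" using c(3)[of u] Bv by (simp add: v_def power2_eq_square)
    then have nv: "norm v \<le> C / c" using c(1) C(1) by (cases "v = 0") (simp_all add: field_simps)
    have "c * (norm (P u))^2 \<le> \<phi> K u u - \<phi> K u v" using c(2)[of u] B_split[of u] eq(1) Bv by (simp add: v_def)
    also have "\<dots> \<le> D + C * (C / c)" using D \<phi>v mult_left_mono[OF nv C(1)] by linarith
    finally have "(norm (P u))^2 \<le> (D + C * (C / c)) / c" using c(1) by (simp add: field_simps)
    then have "norm (P u) \<le> sqrt ((D + C * (C / c)) / c)" by (rule real_le_rsqrt)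
    then show ?thesis using nv norm_triangle_ineq[of "P u" v] by (simp add: v_def)
  qed
  then show ?thesis by blast
qed

lemma peak_comparison:
  assumes K: "K \<in> \<K>" and K': "K' \<in> \<K>" and u: "u \<in> nehari K"
  shows "\<exists>z. z \<noteq> 0 \<and> level K' \<le> energy K' z \<and> energy K z \<le> energy K u"
proof -
  note peak = peak[OF K' P_idem nehariD(1)[OF u]]
  have "peak K' (P u) \<in> half_space (P u)" using peak(2) by (auto simp: half_space_def intro: less_imp_le)
  then show ?thesis using level_le[OF K' peak(1)] nehari_maximal(1)[OF K u] nehariD(4)[OF peak(1)] by blast
qed

lemma level_antimono:
  assumes K: "K \<in> \<K>" "K' \<in> \<K>" and pointwise: "\<And>u. \<Phi> K u \<le> \<Phi> K' u"
  shows "level K' \<le> level K"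
  unfolding level_def[of K]
proof (rule cInf_greatest)
  fix y assume "y \<in> energy K ` nehari K"
  then obtain u where u: "u \<in> nehari K" "y = energy K u" by blast
  obtain z where "level K' \<le> energy K' z" "energy K z \<le> energy K u" using peak_comparison[OF K u(1)] by blast
  then show "level K' \<le> y" using pointwise[of z] u(2) by (simp add: energy_def)
qed (insert nehari_nonempty[OF K(1)], simp)

lemma level_less_energy:
  assumes K: "K \<in> \<K>" "K' \<in> \<K>" and u: "u \<in> nehari K" and less: "\<And>z. z \<noteq> 0 \<Longrightarrow> \<Phi> K z < \<Phi> K' z"
  shows "level K' < energy K u"
proof -
  obtain z where "z \<noteq> 0" "level K' \<le> energy K' z" "energy K z \<le> energy K u" using peak_comparison[OF K u] by blast
  then show ?thesis using less[of z] by (simp add: energy_def)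
qed

lemma le_energy_of_le_levels:
  fixes Ks :: "nat \<Rightarrow> 'k"
  assumes Ks: "\<And>n. Ks n \<in> \<K>" and K: "K \<in> \<K>" and u: "u \<in> nehari K" and m: "\<And>n. m \<le> level (Ks n)"
    and K0: "K0 \<in> \<K>" "\<And>n z. \<Phi> K0 z \<le> \<Phi> (Ks n) z"
    and fatou: "\<And>r Z z R p p0. strict_mono r \<Longrightarrow> Z \<rightharpoonup> z \<Longrightarrow> (\<And>n. norm (Z n) \<le> R)
      \<Longrightarrow> (\<And>n. \<Phi> (Ks (r n)) (Z n) \<le> p n) \<Longrightarrow> p \<longlonglongrightarrow> p0 \<Longrightarrow> \<Phi> K z \<le> p0"
  shows "m \<le> energy K u"
proof -
  have Pu: "P (P u) = P u" "P u \<noteq> 0" using nehariD(1)[OF u] by (simp_all add: P_idem)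
  define Z where "Z n = peak (Ks n) (P u)" for n
  have ZN: "Z n \<in> nehari (Ks n)" for n unfolding Z_def by (rule peak(1)[OF Ks Pu])
  obtain t where t: "\<And>n. 0 < t n" "\<And>n. P (Z n) = t n *\<^sub>R P u" using peak(2)[OF Ks Pu] unfolding Z_def by metis
  have low: "m \<le> energy (Ks n) (Z n)" for n using m level_le[OF Ks ZN] by (rule order_trans)
  have "0 \<le> energy K0 (Z n)" for n
    using level_pos[OF Ks, of n] level_le[OF Ks ZN, of n] K0(2)[of "Z n" n] by (simp add: energy_def)
  moreover have "Z n \<in> half_space (P u)" for n by (rule half_spaceI[OF t(2) less_imp_le[OF t(1)]])
  ultimately obtain R where R: "\<And>n. norm (Z n) \<le> R"
    using half_space_bounded[OF K0(1) Pu] by (metis diff_self less_imp_le norm_zero)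
  obtain M where M: "0 < M" "\<And>u. abs (B u u) \<le> M * (norm u)^2" using B_self_le by blast
  have "abs (\<Phi> (Ks n) (Z n)) \<le> M * R^2 + abs m" for n
  proof -
    have "M * (norm (Z n))^2 \<le> M * R^2" using R[of n] M(1) by (intro mult_left_mono power_mono) auto
    then have "abs (B (Z n) (Z n)) \<le> M * R^2" using M(2)[of "Z n"] by linarith
    then show ?thesis using low[of n] Phi_nonneg[OF Ks, of n "Z n"] by (simp add: energy_def)
  qed
  then have bounded: "bounded (range (\<lambda>n. \<Phi> (Ks n) (Z n)))" by (auto intro!: boundedI)
  obtain r1 z where r1: "strict_mono r1" "(Z \<circ> r1) \<rightharpoonup> z" using bounded_imp_weakly_convergent_subseq[of Z R] R by blast
  have "bounded (range (\<lambda>n. \<Phi> (Ks (r1 n)) (Z (r1 n))))" by (rule bounded_subset[OF bounded]) blast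
  then obtain p0 r2 where r2: "strict_mono r2" "((\<lambda>n. \<Phi> (Ks (r1 n)) (Z (r1 n))) \<circ> r2) \<longlonglongrightarrow> p0"
    using bounded_imp_convergent_subsequence by blast
  define r where "r = r1 \<circ> r2"
  have r: "strict_mono r" unfolding r_def by (rule strict_mono_o[OF r1(1) r2(1)])
  have z: "(Z \<circ> r) \<rightharpoonup> z" using weakly_converges_subseq[OF r1(2) r2(1)] by (simp add: r_def o_assoc)
  have p: "(\<lambda>n. \<Phi> (Ks (r n)) (Z (r n))) \<longlonglongrightarrow> p0" using r2(2) by (simp add: r_def o_def)
  have "0 \<le> t (r n)" "P ((Z \<circ> r) n) = t (r n) *\<^sub>R P u" for n using t(1)[of "r n"] t(2) by simp_all
  then obtain s where s: "0 \<le> s" "P z = s *\<^sub>R P u" "(\<lambda>n. P ((Z \<circ> r) n)) \<longlonglongrightarrow> P z"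
    using weak_limit_in_half_space[OF z _ _ tendsto_const Pu] by metis
  have "m \<le> energy K z"
  proof (rule energy_weakly_usc[where Ks="Ks \<circ> r", OF z s(3) _ tendsto_const _ p])
    show "\<Phi> K z \<le> p0" by (rule fatou[OF r z _ _ p, of R]) (simp_all add: R)
  qed (insert low, simp_all)
  also have "\<dots> \<le> energy K u" by (rule nehari_maximal(1)[OF K u]) (insert s, auto simp: half_space_def)
  finally show ?thesis .
qed

lemma nehari_norm_P_lower_bound: "\<exists>\<nu>>0. \<forall>K\<in>\<K>. \<forall>u\<in>nehari K. \<nu> \<le> norm (P u)"
proof -
  obtain \<alpha> where \<alpha>: "0 < \<alpha>" "\<And>K u. K \<in> \<K> \<Longrightarrow> u \<in> nehari K \<Longrightarrow> \<alpha> \<le> energy K u" using nehari_energy_lower_bound by blast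
  obtain M where M: "0 < M" "\<And>u. abs (B u u) \<le> M * (norm u)^2" using B_self_le by blast
  have "sqrt (\<alpha> / M) \<le> norm (P u)" if "K \<in> \<K>" "u \<in> nehari K" for K u
  proof (rule real_le_lsqrt)
    have "\<alpha> \<le> M * (norm (P u))^2"
      using \<alpha>(2)[OF that] energy_le[OF that(1), of u] M(2)[of "P u"] B_P_nonneg[of u] by linarith
    then show "\<alpha> / M \<le> (norm (P u))^2" using M(1) by (simp add: field_simps)
  qed simp
  then show ?thesis using \<alpha>(1) M(1) by (intro exI[of _ "sqrt (\<alpha> / M)"]) simp
qed

lemma ekeland_on_unit_sphere:
  assumes K: "K \<in> \<K>" and d: "0 < d"
  shows "\<exists>x. P x = x \<and> norm x = 1 \<and> energy K (peak K x) \<le> level K + d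
    \<and> (\<forall>w. P w = w \<longrightarrow> norm w = 1 \<longrightarrow> energy K (peak K x) - d * norm (w - x) \<le> energy K (peak K w))"
proof -
  define S where "S = {w. P w = w \<and> norm w = 1}"
  have S: "P w = w" "w \<noteq> 0" if "w \<in> S" for w using that by (auto simp: S_def)
  have closed: "closed S" unfolding S_def by (intro closed_Collect_conj closed_Collect_eq continuous_intros proj.continuous_on)
  obtain u0 where u0: "u0 \<in> nehari K" "energy K u0 < level K + d"
    using cInf_lessD[of "energy K ` nehari K" "level K + d"] nehari_nonempty[OF K] d unfolding level_def by auto
  define x0 where "x0 = sgn (P u0)"
  have x0: "x0 \<in> S" using nehariD(1)[OF u0(1)] by (simp add: S_def x0_def norm_sgn) (simp add: sgn_div_norm proj_simps)
  obtain t where "0 < t" "P (peak K x0) = t *\<^sub>R x0" using peak(2)[OF K S[OF x0]] by blast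
  then have "peak K x0 \<in> half_space (P u0)"
    by (intro half_spaceI[of _ "t / norm (P u0)"]) (simp_all add: x0_def sgn_div_norm divide_inverse)
  then have "energy K (peak K x0) \<le> level K + d" using nehari_maximal(1)[OF K u0(1)] u0(2) by fastforce
  moreover have "\<exists>x\<in>S. energy K (peak K x) \<le> energy K (peak K x0)
    \<and> (\<forall>w\<in>S. energy K (peak K x) - d * dist w x \<le> energy K (peak K w))"
  proof (rule ekeland_variational_principle[OF closed _ _ x0 d])
    show "level K \<le> energy K (peak K x)" if "x \<in> S" for x by (intro level_le K peak(1) S that)
    show "energy K (peak K x) \<le> b" if "\<And>n. X n \<in> S" "X \<longlonglongrightarrow> x" "\<And>n. energy K (peak K (X n)) \<le> b" for X x b
      using energy_peak_lsc[OF K that(2) S[OF that(1)] S(2)[OF closed_sequentially[OF closed that(1,2)]] that(3)] .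
  qed
  ultimately show ?thesis unfolding S_def dist_norm by force
qed

theorem palais_smale_sequence:
  assumes K: "K \<in> \<K>" and e: "0 < e"
  shows "\<exists>u\<in>nehari K. energy K u \<le> level K + e \<and> (\<forall>h. abs (denergy K u h) \<le> e * norm h)"
proof -
  obtain \<nu> where \<nu>: "0 < \<nu>" "\<And>u. u \<in> nehari K \<Longrightarrow> \<nu> \<le> norm (P u)" using nehari_norm_P_lower_bound K by blast
  obtain k where k: "0 < k" "\<And>h. norm (P h) \<le> norm h * k" using proj.pos_bounded by blast
  define d where "d = min e (e * \<nu> / (2 * k))"
  have d: "0 < d" "d \<le> e" "2 * d * k \<le> e * \<nu>" using e \<nu>(1) k(1) by (auto simp: d_def min_def field_simps)
  obtain x where x: "P x = x" "norm x = 1" "energy K (peak K x) \<le> level K + d"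
    "\<And>w. P w = w \<Longrightarrow> norm w = 1 \<Longrightarrow> energy K (peak K x) - d * norm (w - x) \<le> energy K (peak K w)"
    using ekeland_on_unit_sphere[OF K d(1)] by blast
  have "x \<noteq> 0" using x(2) by auto
  define u where "u = peak K x"
  have u: "u \<in> nehari K" unfolding u_def by (rule peak(1)[OF K x(1) \<open>x \<noteq> 0\<close>])
  have sgn_u: "sgn (P u) = x" using peak(2)[OF K x(1) \<open>x \<noteq> 0\<close>] x(2) by (auto simp: u_def sgn_div_norm)
  have lower: "- (e * norm h) \<le> denergy K u h" for h
  proof -
    have "denergy K u (h - P h) = 0" using u by (simp add: nehari_def proj_simps)
    then have "denergy K u h = denergy K u (P h)" using denergy_add[OF K, of u "h - P h" "P h"] by simp
    moreover have "- (2 * d / norm (P u)) * norm (P h) \<le> denergy K u (P h)"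
      by (rule denergy_lower_bound_peak[OF K u P_idem]) (insert d(1) x(4), simp_all add: sgn_u u_def[symmetric])
    moreover have "2 * d / norm (P u) * norm (P h) \<le> e * norm h"
    proof -
      have "2 * d * norm (P h) \<le> 2 * d * k * norm h" using k(2)[of h] d(1) by (simp add: mult_ac)
      also have "\<dots> \<le> e * \<nu> * norm h" using d(3) by (rule mult_right_mono) simp
      also have "\<dots> \<le> e * norm (P u) * norm h" using \<nu>(2)[OF u] e by (intro mult_right_mono mult_left_mono) auto
      finally show ?thesis using nehariD(1)[OF u] by (simp add: field_simps)
    qed
    ultimately show ?thesis by simp
  qed
  have "abs (denergy K u h) \<le> e * norm h" for h
    using lower[of h] lower[of "- h"] denergy_minus[OF K, of u h] by (simp add: abs_le_iff)
  moreover have "energy K u \<le> level K + e" using x(3) d(2) by (simp add: u_def)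
  ultimately show ?thesis using u by blast
qed

end

section \<open>Square integrable functions and weak gradients\<close>

abbreviation nn_integral_lborel :: "('a::euclidean_space \<Rightarrow> ennreal) \<Rightarrow> ennreal" (binder "NNBINT " 10) where
  "nn_integral_lborel f \<equiv> nn_integral lborel f"

definition sq_int :: "'a measure \<Rightarrow> ('a \<Rightarrow> real) \<Rightarrow> bool" where
  "sq_int M u \<longleftrightarrow> u \<in> borel_measurable M \<and> integrable M (\<lambda>x. (u x)^2)"

lemma sq_int_measurable [measurable_dest]: "sq_int M u \<Longrightarrow> u \<in> borel_measurable M"
  by (simp add: sq_int_def)

lemma sq_int_square_integrable: "sq_int M u \<Longrightarrow> integrable M (\<lambda>x. (u x)^2)"
  by (simp add: sq_int_def)

lemma abs_mult_le_squares: "abs (a * b) \<le> a^2 + b^2" for a b :: real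
proof -
  have "0 \<le> (abs a - abs b)^2" by simp
  then have "2 * abs (a * b) \<le> a^2 + b^2" by (simp add: power2_diff abs_mult)
  then show ?thesis using abs_ge_zero[of "a * b"] by linarith
qed

lemma sq_int_mult:
  assumes [measurable]: "sq_int M u" "sq_int M v"
  shows "integrable M (\<lambda>x. u x * v x)"
proof (rule Bochner_Integration.integrable_bound)
  show "integrable M (\<lambda>x. (u x)^2 + (v x)^2)" using assms by (simp add: sq_int_def)
  show "AE x in M. norm (u x * v x) \<le> norm ((u x)^2 + (v x)^2)" using abs_mult_le_squares by simp
qed measurable

lemma sq_int_lincomb:
  assumes [measurable]: "sq_int M u" "sq_int M v"
  shows "sq_int M (\<lambda>x. a * u x + b * v x)"
proof -
  have "(\<lambda>x. (a * u x + b * v x)^2) = (\<lambda>x. a^2 * (u x)^2 + (2 * a * b) * (u x * v x) + b^2 * (v x)^2)"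
    by (auto simp: power2_eq_square algebra_simps)
  then show ?thesis using assms sq_int_mult[OF assms] by (simp add: sq_int_def)
qed

lemma sq_int_scale: "sq_int M u \<Longrightarrow> sq_int M (\<lambda>x. a * u x)"
  using sq_int_lincomb[of M u u a 0] by simp

lemma sq_int_add: "sq_int M u \<Longrightarrow> sq_int M v \<Longrightarrow> sq_int M (\<lambda>x. u x + v x)"
  using sq_int_lincomb[of M u v 1 1] by simp

lemma sq_int_diff: "sq_int M u \<Longrightarrow> sq_int M v \<Longrightarrow> sq_int M (\<lambda>x. u x - v x)"
  using sq_int_lincomb[of M u v 1 "-1"] by simp

lemma sq_int_zero: "sq_int M (\<lambda>x. 0)"
  by (simp add: sq_int_def)

lemma sq_int_sum: "(\<And>i. i \<in> S \<Longrightarrow> sq_int M (f i)) \<Longrightarrow> sq_int M (\<lambda>x. \<Sum>i\<in>S. f i x)"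
  by (induction S rule: infinite_finite_induct) (auto intro: sq_int_add sq_int_zero)

lemma sq_int_bounded_mult:
  assumes [measurable]: "sq_int M u" "w \<in> borel_measurable M" and w: "\<And>x. abs (w x) \<le> C"
  shows "sq_int M (\<lambda>x. w x * u x)" "(\<integral>x. (w x * u x)^2 \<partial>M) \<le> C^2 * (\<integral>x. (u x)^2 \<partial>M)"
proof -
  have pointwise: "(w x * u x)^2 \<le> C^2 * (u x)^2" for x
    unfolding power_mult_distrib using power_mono[OF w abs_ge_zero, of x 2] by (intro mult_right_mono) simp_all
  have int: "integrable M (\<lambda>x. C^2 * (u x)^2)" using assms(1) by (simp add: sq_int_def)
  have "integrable M (\<lambda>x. (w x * u x)^2)" by (rule Bochner_Integration.integrable_bound[OF int]) (insert pointwise, auto)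
  then show "sq_int M (\<lambda>x. w x * u x)" "(\<integral>x. (w x * u x)^2 \<partial>M) \<le> C^2 * (\<integral>x. (u x)^2 \<partial>M)"
    using integral_mono[OF _ int pointwise] by (simp_all add: sq_int_def)
qed

lemma sq_int_Cauchy_Schwarz:
  assumes u: "sq_int M u" and v: "sq_int M v"
  shows "(\<integral>x. u x * v x \<partial>M)^2 \<le> (\<integral>x. (u x)^2 \<partial>M) * (\<integral>x. (v x)^2 \<partial>M)"
proof (rule quadratic_form_discriminant)
  fix s t
  have "0 \<le> (\<integral>x. (s * u x + t * v x)^2 \<partial>M)" by simp
  also have "\<dots> = (\<integral>x. s^2 * (u x)^2 + (2 * s * t) * (u x * v x) + t^2 * (v x)^2 \<partial>M)"
    by (intro Bochner_Integration.integral_cong) (auto simp: power2_eq_square algebra_simps)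
  also have "\<dots> = s^2 * (\<integral>x. (u x)^2 \<partial>M) + 2 * s * t * (\<integral>x. u x * v x \<partial>M) + t^2 * (\<integral>x. (v x)^2 \<partial>M)"
    using assms sq_int_mult[OF u v] by (simp add: sq_int_def)
  finally show "0 \<le> s^2 * (\<integral>x. (u x)^2 \<partial>M) + 2 * s * t * (\<integral>x. u x * v x \<partial>M) + t^2 * (\<integral>x. (v x)^2 \<partial>M)" .
qed

lemma sq_int_nn_integral: "sq_int M u \<Longrightarrow> (\<integral>\<^sup>+x. ennreal ((u x)^2) \<partial>M) = ennreal (\<integral>x. (u x)^2 \<partial>M)"
  by (intro nn_integral_eq_integral) (auto simp: sq_int_def)

lemma sq_int_if_nn_integral_le:
  assumes [measurable]: "u \<in> borel_measurable M" and bound: "(\<integral>\<^sup>+x. ennreal ((u x)^2) \<partial>M) \<le> ennreal c" and c: "0 \<le> c"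
  shows "sq_int M u" "(\<integral>x. (u x)^2 \<partial>M) \<le> c"
proof -
  have "(\<integral>\<^sup>+x. ennreal ((u x)^2) \<partial>M) < \<infinity>" using bound by (simp add: le_less_trans less_top)
  then show u: "sq_int M u" unfolding sq_int_def by (auto intro!: integrableI_bounded)
  show "(\<integral>x. (u x)^2 \<partial>M) \<le> c" using bound c unfolding sq_int_nn_integral[OF u] by simp
qed

lemma Jensen_square:
  assumes "finite_measure M" and one: "measure M (space M) = 1" and [measurable]: "u \<in> borel_measurable M"
  shows "ennreal ((\<integral>x. u x \<partial>M)^2) \<le> (\<integral>\<^sup>+x. ennreal ((u x)^2) \<partial>M)"
proof (cases "(\<integral>\<^sup>+x. ennreal ((u x)^2) \<partial>M) = \<infinity>")
  case False
  interpret finite_measure M by fact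
  have "integrable M (\<lambda>x. (u x)^2)" using False by (intro integrableI_bounded) (auto simp: less_top)
  then have u: "sq_int M u" by (simp add: sq_int_def)
  have "sq_int M (\<lambda>x. 1)" by (simp add: sq_int_def)
  from sq_int_Cauchy_Schwarz[OF u this] show ?thesis unfolding sq_int_nn_integral[OF u] using one by (simp add: ennreal_leI)
qed simp

lemma nn_integral_Fatou:
  assumes [measurable]: "\<And>n. F n \<in> borel_measurable M" and lim: "AE x in M. (\<lambda>n. F n x) \<longlonglongrightarrow> f x"
    and bound: "\<forall>\<^sub>F n in sequentially. (\<integral>\<^sup>+x. ennreal (F n x) \<partial>M) \<le> ennreal (c n)" and c: "c \<longlonglongrightarrow> l"
  shows "(\<integral>\<^sup>+x. ennreal (f x) \<partial>M) \<le> ennreal l"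
proof -
  have "AE x in M. ennreal (f x) = liminf (\<lambda>n. ennreal (F n x))"
    using lim by eventually_elim (intro lim_imp_Liminf[OF trivial_limit_sequentially, symmetric] tendsto_ennrealI)
  then have "(\<integral>\<^sup>+x. ennreal (f x) \<partial>M) = (\<integral>\<^sup>+x. liminf (\<lambda>n. ennreal (F n x)) \<partial>M)" by (rule nn_integral_cong_AE)
  also have "\<dots> \<le> liminf (\<lambda>n. \<integral>\<^sup>+x. ennreal (F n x) \<partial>M)" by (rule nn_integral_liminf) measurable
  also have "\<dots> \<le> liminf (\<lambda>n. ennreal (c n))" by (rule Liminf_mono[OF bound])
  also have "\<dots> = ennreal l" by (intro lim_imp_Liminf[OF trivial_limit_sequentially] tendsto_ennrealI c)
  finally show ?thesis .
qed

lemma sq_int_Fatou: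
  assumes F: "\<And>n. sq_int M (F n)" and [measurable]: "f \<in> borel_measurable M" and c: "0 \<le> c"
    and bound: "\<forall>\<^sub>F n in sequentially. (\<integral>x. (F n x)^2 \<partial>M) \<le> c" and lim: "AE x in M. (\<lambda>n. F n x) \<longlonglongrightarrow> f x"
  shows "sq_int M f" "(\<integral>x. (f x)^2 \<partial>M) \<le> c"
proof -
  note [measurable] = sq_int_measurable[OF F]
  have "(\<integral>\<^sup>+x. ennreal ((f x)^2) \<partial>M) \<le> ennreal c"
  proof (rule nn_integral_Fatou[where F="\<lambda>n x. (F n x)^2" and c="\<lambda>_. c"])
    show "AE x in M. (\<lambda>n. (F n x)^2) \<longlonglongrightarrow> (f x)^2" using lim by eventually_elim (rule tendsto_power)
    show "\<forall>\<^sub>F n in sequentially. (\<integral>\<^sup>+x. ennreal ((F n x)^2) \<partial>M) \<le> ennreal c"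
      using bound by eventually_elim (simp add: sq_int_nn_integral[OF F] ennreal_leI)
  qed simp_all
  then show "sq_int M f" "(\<integral>x. (f x)^2 \<partial>M) \<le> c" using c by (auto intro: sq_int_if_nn_integral_le)
qed

lemma sq_int_AE_summable:
  fixes F :: "nat \<Rightarrow> 'a \<Rightarrow> real"
  assumes F: "\<And>k. sq_int M (F k)" and b: "0 < b" "b < 1" and bound: "\<And>k. (\<integral>x. (F k x)^2 \<partial>M) \<le> c * b ^ k"
  shows "AE x in M. summable (\<lambda>k. F k x)"
proof -
  note [measurable] = sq_int_measurable[OF F]
  define q where "q = sqrt b"
  have q: "0 < q" "q < 1" "b = q * q" using b by (simp_all add: q_def)
  have "0 \<le> (\<integral>x. (F 0 x)^2 \<partial>M)" by simp
  from order_trans[OF this bound[of 0]] have c: "0 \<le> c" by simp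
  have "(\<integral>\<^sup>+x. ennreal ((F k x)^2 / q ^ k) \<partial>M) \<le> ennreal (c * q ^ k)" for k
  proof -
    have "integrable M (\<lambda>x. (F k x)^2 / q ^ k)" using sq_int_square_integrable[OF F] by simp
    then have "(\<integral>\<^sup>+x. ennreal ((F k x)^2 / q ^ k) \<partial>M) = ennreal (\<integral>x. (F k x)^2 / q ^ k \<partial>M)"
      using q by (intro nn_integral_eq_integral) auto
    also have "\<dots> \<le> ennreal (c * q ^ k)"
      using bound[of k] q by (intro ennreal_leI) (simp add: divide_le_eq power_mult_distrib mult.assoc)
    finally show ?thesis .
  qed
  then have "(\<Sum>k. \<integral>\<^sup>+x. ennreal ((F k x)^2 / q ^ k) \<partial>M) \<le> (\<Sum>k. ennreal (c * q ^ k))" by (intro suminf_le) auto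
  also have "\<dots> < \<infinity>" using c q
    by (subst suminf_ennreal2) (auto intro!: summable_mult summable_geometric simp: less_top[symmetric])
  finally have "(\<integral>\<^sup>+x. (\<Sum>k. ennreal ((F k x)^2 / q ^ k)) \<partial>M) \<noteq> \<infinity>" by (subst nn_integral_suminf) auto
  then have "AE x in M. (\<Sum>k. ennreal ((F k x)^2 / q ^ k)) \<noteq> \<infinity>" by (intro nn_integral_PInf_AE) measurable
  then show ?thesis
  proof eventually_elim
    case (elim x)
    then have "summable (\<lambda>k. (F k x)^2 / q ^ k)" using q by (intro summable_suminf_not_top) auto
    from order_tendstoD(2)[OF summable_LIMSEQ_zero[OF this], of 1]
    have "\<forall>\<^sub>F k in sequentially. (F k x)^2 / q ^ k < 1" by simp
    then have "\<forall>\<^sub>F k in sequentially. norm (F k x) \<le> sqrt q ^ k"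
    proof eventually_elim
      case (elim k)
      then have "sqrt ((F k x)^2) \<le> sqrt (q ^ k)" using q by (intro real_sqrt_le_mono) (simp add: divide_less_eq)
      then show ?case unfolding real_sqrt_abs by (simp add: real_sqrt_power)
    qed
    then show ?case using q by (intro summable_comparison_test_ev[OF _ summable_geometric]) auto
  qed
qed

lemma sq_int_AE_convergent_subseq:
  fixes F :: "nat \<Rightarrow> 'a \<Rightarrow> real"
  assumes F: "\<And>n. sq_int M (F n)"
    and Cauchy: "\<And>e. 0 < e \<Longrightarrow> \<exists>N. \<forall>m\<ge>N. \<forall>n\<ge>N. (\<integral>x. (F m x - F n x)^2 \<partial>M) < e"
  obtains r where "strict_mono r" "AE x in M. convergent (\<lambda>k. F (r k) x)"
proof -
  define close where "close k N \<longleftrightarrow> (\<forall>m\<ge>N. \<forall>n\<ge>N. (\<integral>x. (F m x - F n x)^2 \<partial>M) < (1/2) ^ k)" for k N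
  have close: "\<exists>N'>N. close k N'" for k N
    using Cauchy[of "(1/2) ^ k"] unfolding close_def by (metis less_eq_Suc_le max.bounded_iff max.cobounded1 zero_less_divide_1_iff zero_less_numeral zero_less_power)
  obtain r where r: "\<And>k. close k (r k) \<and> r k < r (Suc k)"
    using dependent_nat_choice[of close "\<lambda>_. (<)"] close by metis
  have "(\<integral>x. (F (r (Suc k)) x - F (r k) x)^2 \<partial>M) \<le> 1 * (1/2) ^ k" for k
    using r[of k] by (simp add: close_def less_imp_le)
  then have "AE x in M. summable (\<lambda>k. F (r (Suc k)) x - F (r k) x)"
    by (intro sq_int_AE_summable[OF sq_int_diff[OF F F], where c=1 and b="1/2"]) auto
  then have "AE x in M. convergent (\<lambda>k. F (r k) x)"
  proof eventually_elim
    case (elim x)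
    then have "convergent (\<lambda>k. F (r k) x - F (r 0) x)" by (simp add: summable_iff_convergent sum_lessThan_telescope[of "\<lambda>k. F (r k) x"])
    from convergent_add[OF this convergent_const[of "F (r 0) x"]] show ?case by simp
  qed
  moreover have "strict_mono r" using r by (simp add: strict_mono_Suc_iff)
  ultimately show ?thesis by (rule that[rotated])
qed

theorem sq_int_complete:
  fixes F :: "nat \<Rightarrow> 'a \<Rightarrow> real"
  assumes F: "\<And>n. sq_int M (F n)"
    and Cauchy: "\<And>e. 0 < e \<Longrightarrow> \<exists>N. \<forall>m\<ge>N. \<forall>n\<ge>N. (\<integral>x. (F m x - F n x)^2 \<partial>M) < e"
  shows "\<exists>f. sq_int M f \<and> (\<lambda>n. \<integral>x. (F n x - f x)^2 \<partial>M) \<longlonglongrightarrow> 0"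
proof -
  obtain r where r: "strict_mono r" "AE x in M. convergent (\<lambda>k. F (r k) x)"
    using sq_int_AE_convergent_subseq[OF assms] by blast
  note [measurable] = sq_int_measurable[OF F]
  define f where "f x = lim (\<lambda>k. F (r k) x)" for x
  have [measurable]: "f \<in> borel_measurable M" unfolding f_def by measurable
  have lim: "AE x in M. (\<lambda>k. F n x - F (r k) x) \<longlonglongrightarrow> F n x - f x" for n
    using r(2) by eventually_elim (auto simp: f_def convergent_LIMSEQ_iff intro!: tendsto_diff)
  have close: "\<exists>N. \<forall>n\<ge>N. sq_int M (\<lambda>x. F n x - f x) \<and> (\<integral>x. (F n x - f x)^2 \<partial>M) \<le> e" if e: "0 < e" for e
  proof -
    obtain N where N: "\<forall>m\<ge>N. \<forall>n\<ge>N. (\<integral>x. (F m x - F n x)^2 \<partial>M) < e" using Cauchy[OF e] by blast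
    have "sq_int M (\<lambda>x. F n x - f x) \<and> (\<integral>x. (F n x - f x)^2 \<partial>M) \<le> e" if n: "N \<le> n" for n
    proof (intro conjI sq_int_Fatou[OF sq_int_diff[OF F F] _ less_imp_le[OF e] _ lim])
      show "\<forall>\<^sub>F k in sequentially. (\<integral>x. (F n x - F (r k) x)^2 \<partial>M) \<le> e"
        using eventually_ge_at_top[of N]
        by eventually_elim (insert N n seq_suble[OF r(1)], meson less_imp_le order_trans)
      then show "\<forall>\<^sub>F k in sequentially. (\<integral>x. (F n x - F (r k) x)^2 \<partial>M) \<le> e" .
    qed measurable
    then show ?thesis by blast
  qed
  obtain n where "sq_int M (\<lambda>x. F n x - f x)" using close[of 1] by auto
  then have "sq_int M f" using sq_int_diff[OF F[of n]] by fastforce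
  moreover have "(\<lambda>n. \<integral>x. (F n x - f x)^2 \<partial>M) \<longlonglongrightarrow> 0"
  proof (rule LIMSEQ_I)
    fix e :: real assume "0 < e"
    then show "\<exists>N. \<forall>n\<ge>N. norm ((\<integral>x. (F n x - f x)^2 \<partial>M) - 0) < e" using close[of "e / 2"] by fastforce
  qed
  ultimately show ?thesis by blast
qed

lemma sq_int_tendsto_mult:
  assumes F: "\<And>n. sq_int M (F n)" and f: "sq_int M f" and v: "sq_int M v"
    and lim: "(\<lambda>n. \<integral>x. (F n x - f x)^2 \<partial>M) \<longlonglongrightarrow> 0"
  shows "(\<lambda>n. \<integral>x. F n x * v x \<partial>M) \<longlonglongrightarrow> (\<integral>x. f x * v x \<partial>M)"
proof -
  let ?d = "\<lambda>n. (\<integral>x. F n x * v x \<partial>M) - (\<integral>x. f x * v x \<partial>M)"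
  have "(?d n)^2 \<le> (\<integral>x. (F n x - f x)^2 \<partial>M) * (\<integral>x. (v x)^2 \<partial>M)" for n
    using sq_int_Cauchy_Schwarz[OF sq_int_diff[OF F f] v, of n] sq_int_mult[OF F v] sq_int_mult[OF f v]
    by (simp add: left_diff_distrib)
  moreover have "(\<lambda>n. (\<integral>x. (F n x - f x)^2 \<partial>M) * (\<integral>x. (v x)^2 \<partial>M)) \<longlonglongrightarrow> 0"
    using lim by (rule tendsto_mult_left_zero)
  ultimately have "(\<lambda>n. (?d n)^2) \<longlonglongrightarrow> 0"
    by (intro Lim_null_comparison[of "\<lambda>n. (?d n)^2", OF always_eventually]) simp_all
  then have "(\<lambda>n. sqrt ((?d n)^2)) \<longlonglongrightarrow> sqrt 0" by (rule tendsto_real_sqrt)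
  then have "?d \<longlonglongrightarrow> 0" by (simp add: tendsto_rabs_zero_iff)
  then show ?thesis by (simp add: Lim_null[symmetric])
qed

lemma sq_int_bounded_support:
  fixes h :: "'a::euclidean_space \<Rightarrow> real"
  assumes [measurable]: "h \<in> borel_measurable borel"
    and bound: "\<And>x. abs (h x) \<le> C" and S: "bounded S" "\<And>x. x \<notin> S \<Longrightarrow> h x = 0"
  shows "sq_int lborel h"
  unfolding sq_int_def
proof
  obtain a b where ab: "S \<subseteq> cbox a b" using bounded_subset_cbox_symmetric[OF S(1)] by blast
  show "integrable lborel (\<lambda>x. (h x)^2)"
  proof (rule Bochner_Integration.integrable_bound)
    show "integrable lborel (\<lambda>x. C^2 * indicator (cbox a b) x)"
      by (intro integrable_mult_right integrable_real_indicator) (auto simp: emeasure_lborel_cbox_eq)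
    have "norm ((h x)^2) \<le> norm (C^2 * indicator (cbox a b) x)" for x
    proof (cases "x \<in> cbox a b")
      case True
      then show ?thesis using bound[of x] by (simp add: abs_le_square_iff[symmetric])
    qed (insert S(2)[of x] ab, auto)
    then show "AE x in lborel. norm ((h x)^2) \<le> norm (C^2 * indicator (cbox a b) x)" by simp
  qed measurable
qed measurable

lemma sq_int_continuous_bounded_support:
  fixes h :: "'a::euclidean_space \<Rightarrow> real"
  assumes h: "continuous_on UNIV h" and S: "bounded {x. h x \<noteq> 0}"
  shows "sq_int lborel h"
proof -
  have "compact (h ` closure {x. h x \<noteq> 0})" using S by (intro compact_continuous_image continuous_on_subset[OF h]) auto
  then obtain C where C: "\<And>x. h x \<noteq> 0 \<Longrightarrow> abs (h x) \<le> C"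
    using closure_subset[of "{x. h x \<noteq> 0}"] by (force dest!: compact_imp_bounded simp: bounded_iff)
  have "abs (h x) \<le> max C 0" for x using C[of x] by (cases "h x = 0") auto
  then show ?thesis using S by (intro sq_int_bounded_support[of _ "max C 0"] borel_measurable_continuous_onI h) auto
qed

lemma AE_eq_0_if_box_integrals_eq_0:
  fixes g :: "'a::euclidean_space \<Rightarrow> real"
  assumes [measurable]: "g \<in> borel_measurable borel"
    and int: "\<And>a b. integrable lborel (\<lambda>x. indicator (box a b) x * g x)"
    and eq_0: "\<And>a b. (LBINT x. indicator (box a b) x * g x) = 0"
  shows "AE x in lborel. g x = 0"
proof -
  let ?E = "range (\<lambda>(a, b). box a b :: 'a set)"
  define \<mu> where "\<mu> s = density lborel (\<lambda>x. ennreal (s * g x))" for s :: real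
  have \<mu>_box: "emeasure (\<mu> s) (box a b) = ennreal (LBINT x. max 0 (s * (indicator (box a b) x * g x)))" for s a b
  proof -
    have "emeasure (\<mu> s) (box a b) = (NNBINT x. ennreal (max 0 (s * (indicator (box a b) x * g x))))"
      unfolding \<mu>_def by (subst emeasure_density) (auto intro!: nn_integral_cong simp: indicator_def ennreal_neg max_def)
    also have "\<dots> = ennreal (LBINT x. max 0 (s * (indicator (box a b) x * g x)))"
      using int[of a b] by (intro nn_integral_eq_integral) auto
    finally show ?thesis .
  qed
  have "\<mu> 1 = \<mu> (-1)"
  proof (rule measure_eqI_generator_eq)
    show "Int_stable ?E" by (auto simp: Int_stable_def box_Int_box)
    show "sets (\<mu> 1) = sigma_sets UNIV ?E" "sets (\<mu> (-1)) = sigma_sets UNIV ?E" by (simp_all add: \<mu>_def borel_eq_box)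
    show "range (\<lambda>n. box (- (real n *\<^sub>R One)) (real n *\<^sub>R One)) \<subseteq> ?E" by auto
    show "(\<Union>n. box (- (real n *\<^sub>R One)) (real n *\<^sub>R One)) = (UNIV :: 'a set)" by (rule UN_box_eq_UNIV)
    fix X assume "X \<in> ?E"
    then obtain a b where X: "X = box a b" by auto
    have parts: "max 0 z - max 0 (- z) = z" for z :: real by (simp add: max_def)
    have "(LBINT x. max 0 (indicator X x * g x)) - (LBINT x. max 0 (- (indicator X x * g x))) = (LBINT x. indicator X x * g x)"
      unfolding X using int[of a b] by (subst Bochner_Integration.integral_diff[symmetric]) (simp_all add: parts)
    then show "emeasure (\<mu> 1) X = emeasure (\<mu> (-1)) X" using \<mu>_box[of 1 a b] \<mu>_box[of "-1" a b] eq_0 X by simp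
  qed (simp_all add: \<mu>_box)
  then have "AE x in lborel. ennreal (1 * g x) = ennreal (- 1 * g x)"
    unfolding \<mu>_def by (intro sigma_finite_measure.density_unique[OF sigma_finite_lborel]) measurable
  then show ?thesis
    by eventually_elim (smt (verit) ennreal_eq_0_iff ennreal_neg mult_1 mult_minus1)
qed

lemma test_fun_continuous: "test_fun \<psi> d \<Longrightarrow> continuous_on UNIV \<psi>"
  unfolding test_fun_def by (meson has_derivative_continuous continuous_at_imp_continuous_on)

lemma test_fun_linear: "test_fun \<psi> d \<Longrightarrow> linear (d x)"
  unfolding test_fun_def using has_derivative_linear by blast

lemma linear_eq_sum_axis: "linear l \<Longrightarrow> l k = (\<Sum>i\<in>UNIV. k $ i * l (axis i 1))" for l :: "real^'n \<Rightarrow> real"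
proof -
  assume l: "linear l"
  have "l k = l (\<Sum>i\<in>UNIV. k $ i *\<^sub>R axis i 1)" by (simp add: basis_expansion flip: scalar_mult_eq_scaleR)
  then show ?thesis by (simp add: linear_sum[OF l] linear_scale[OF l])
qed

lemma test_fun_deriv_eq_sum: "test_fun \<psi> d \<Longrightarrow> d x k = (\<Sum>i\<in>UNIV. k $ i * d x (axis i 1))"
  by (rule linear_eq_sum_axis[OF test_fun_linear])

lemma test_fun_deriv_continuous: "test_fun \<psi> d \<Longrightarrow> continuous_on UNIV (\<lambda>x. d x k)"
  unfolding test_fun_deriv_eq_sum[of \<psi> d _ k] by (intro continuous_intros) (simp add: test_fun_def)

lemma test_fun_measurable:
  assumes "test_fun \<psi> d"
  shows "\<psi> \<in> borel_measurable borel" "(\<lambda>x. d x k) \<in> borel_measurable borel"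
  by (intro borel_measurable_continuous_onI test_fun_continuous[OF assms] test_fun_deriv_continuous[OF assms])+

lemma test_fun_deriv_bounded_support:
  assumes t: "test_fun \<psi> d"
  shows "bounded {x. d x k \<noteq> 0}"
proof (rule bounded_subset[OF bounded_closure])
  show "bounded {x. \<psi> x \<noteq> 0}" using t by (simp add: test_fun_def)
  show "{x. d x k \<noteq> 0} \<subseteq> closure {x. \<psi> x \<noteq> 0}"
  proof (rule subsetI, rule ccontr)
    fix x assume x: "x \<in> {x. d x k \<noteq> 0}" "x \<notin> closure {x. \<psi> x \<noteq> 0}"
    have "(\<psi> has_derivative (\<lambda>h. 0)) (at x)"
      by (rule has_derivative_transform_within_open[where s="- closure {x. \<psi> x \<noteq> 0}", OF has_derivative_const[of 0]])
        (insert x closure_subset[of "{x. \<psi> x \<noteq> 0}"], auto)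
    then have "d x = (\<lambda>h. 0)" using t has_derivative_unique unfolding test_fun_def by blast
    then show False using x(1) by simp
  qed
qed

lemma test_fun_sq_int:
  assumes t: "test_fun \<psi> d"
  shows "sq_int lborel \<psi>" "sq_int lborel (\<lambda>x. d x k)"
  using t test_fun_deriv_bounded_support[OF t]
  by (auto intro!: sq_int_continuous_bounded_support test_fun_continuous[OF t] test_fun_deriv_continuous[OF t] simp: test_fun_def)

lemma test_fun_shift:
  assumes "test_fun \<psi> d"
  shows "test_fun (\<lambda>x. \<psi> (x + k)) (\<lambda>x. d (x + k))"
  unfolding test_fun_def
proof (intro conjI allI)
  fix x
  have "((\<lambda>x. x + k) has_derivative (\<lambda>h. h)) (at x)" by (auto intro!: derivative_eq_intros)
  from has_derivative_compose[OF this] assms show "((\<lambda>x. \<psi> (x + k)) has_derivative d (x + k)) (at x)"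
    by (auto simp: test_fun_def)
next
  fix i
  show "continuous_on UNIV (\<lambda>x. d (x + k) (axis i 1))"
    by (intro continuous_on_compose2[OF test_fun_deriv_continuous[OF assms]] continuous_intros) auto
next
  have "{x. \<psi> (x + k) \<noteq> 0} \<subseteq> (\<lambda>x. - k + x) ` {x. \<psi> x \<noteq> 0}" by (auto intro!: image_eqI[of _ _ "_ + k"])
  moreover have "bounded ((\<lambda>x. - k + x) ` {x. \<psi> x \<noteq> 0})" using assms by (intro bounded_translation) (simp add: test_fun_def)
  ultimately show "bounded {x. \<psi> (x + k) \<noteq> 0}" using bounded_subset by blast
qed

lemma test_fun_quotient:
  assumes t: "test_fun \<psi> d" and \<psi>: "\<And>x. 0 \<le> \<psi> x" and c: "0 < c"
  shows "test_fun (\<lambda>x. \<psi> x / (\<psi> x + c)) (\<lambda>x h. c / (\<psi> x + c)^2 * d x h)"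
  unfolding test_fun_def
proof (intro conjI allI)
  have pos: "\<psi> x + c \<noteq> 0" for x using \<psi>[of x] c by linarith
  show "continuous_on UNIV (\<lambda>x. c / (\<psi> x + c)^2 * d x (axis i 1))" for i
    using pos by (intro continuous_intros test_fun_continuous[OF t] test_fun_deriv_continuous[OF t]) auto
  have d: "(\<psi> has_derivative d x) (at x)" for x using t by (simp add: test_fun_def)
  show "((\<lambda>x. \<psi> x / (\<psi> x + c)) has_derivative (\<lambda>h. c / (\<psi> x + c)^2 * d x h)) (at x)" for x
  proof -
    have "((\<lambda>x. \<psi> x / (\<psi> x + c)) has_derivative (\<lambda>h. (d x h * (\<psi> x + c) - \<psi> x * d x h) / ((\<psi> x + c) * (\<psi> x + c)))) (at x)"
      using pos[of x] by (auto intro!: derivative_eq_intros d simp: fun_eq_iff)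
    then show ?thesis by (rule has_derivative_eq_rhs) (auto simp: power2_eq_square algebra_simps)
  qed
  show "bounded {x. \<psi> x / (\<psi> x + c) \<noteq> 0}" using t by (auto simp: test_fun_def elim!: bounded_subset)
qed

lemma pos_part_square_deriv: "((\<lambda>s::real. (max 0 s)^2) has_real_derivative 2 * max 0 s) (at s)"
proof -
  consider "0 < s" | "s < 0" | "s = 0" by linarith
  then show ?thesis
  proof cases
    assume s: "0 < s"
    have "((\<lambda>s. s^2) has_real_derivative 2 * s) (at s)" by (auto intro!: derivative_eq_intros)
    then show ?thesis
      by (rule has_field_derivative_transform_within_open[where S="{0<..}", THEN DERIV_cong]) (insert s, auto)
  next
    assume s: "s < 0"
    have "((\<lambda>s. 0) has_real_derivative 0) (at s)" by simp
    then show ?thesis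
      by (rule has_field_derivative_transform_within_open[where S="{..<0}", THEN DERIV_cong]) (insert s, auto)
  next
    assume s: "s = 0"
    have "((\<lambda>h. (max 0 h)^2 / h) \<longlongrightarrow> 0) (at (0::real))"
      by (rule Lim_null_comparison[OF always_eventually tendsto_rabs_zero[OF tendsto_ident_at]])
        (auto simp: max_def power2_eq_square)
    then show ?thesis using s by (simp add: has_field_derivative_iff)
  qed
qed

definition box_bump :: "real^'n \<Rightarrow> real^'n \<Rightarrow> real^'n \<Rightarrow> real" where
  "box_bump a b x = (\<Prod>i\<in>UNIV. (max 0 (x $ i - a $ i))^2 * (max 0 (b $ i - x $ i))^2)"

lemma box_bump_nonneg: "0 \<le> box_bump a b x"
  unfolding box_bump_def by (intro prod_nonneg) auto

lemma box_bump_eq_0_iff: "box_bump a b x = 0 \<longleftrightarrow> x \<notin> box a b"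
proof -
  have "(max 0 (x $ i - a $ i))^2 * (max 0 (b $ i - x $ i))^2 = 0 \<longleftrightarrow> \<not> (a $ i < x $ i \<and> x $ i < b $ i)" for i
    by (auto simp: max_def)
  then show ?thesis unfolding box_bump_def mem_box_cart by (simp add: prod_zero_iff del: mult_eq_0_iff)
qed

lemma box_bump_test_fun: "\<exists>d. test_fun (box_bump a b) d"
proof -
  define p where "p i x = (max 0 (x $ i - a $ i))^2 * (max 0 (b $ i - x $ i))^2" for i x
  define dp where "dp i x h = (2 * max 0 (x $ i - a $ i) * h $ i) * (max 0 (b $ i - x $ i))^2
    + (max 0 (x $ i - a $ i))^2 * (- (2 * max 0 (b $ i - x $ i) * h $ i))" for i x h
  have square: "((\<lambda>x. (max 0 (l x))^2) has_derivative (\<lambda>h. 2 * max 0 (l x) * l' h)) (at x)"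
    if "(l has_derivative l') (at x)" for l :: "real^'n \<Rightarrow> real" and l' x
    using has_derivative_compose[OF that pos_part_square_deriv[of "l x", unfolded has_field_derivative_def]] by simp
  have "((\<lambda>x. x $ i - a $ i) has_derivative (\<lambda>h. h $ i)) (at x)" "((\<lambda>x. b $ i - x $ i) has_derivative (\<lambda>h. - (h $ i))) (at x)" for i x
    by (auto intro!: derivative_eq_intros bounded_linear_imp_has_derivative bounded_linear_vec_nth)
  from has_derivative_mult[OF this(1)[THEN square] this(2)[THEN square]]
  have d: "(p i has_derivative dp i x) (at x)" for i x unfolding p_def[abs_def] dp_def by (simp add: algebra_simps)
  have bump: "box_bump a b = (\<lambda>x. \<Prod>i\<in>UNIV. p i x)" by (simp add: box_bump_def p_def fun_eq_iff)
  have "test_fun (box_bump a b) (\<lambda>x y. \<Sum>i\<in>UNIV. dp i x y * (\<Prod>j\<in>UNIV - {i}. p j x))"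
    unfolding test_fun_def
  proof (intro conjI allI)
    show "(box_bump a b has_derivative (\<lambda>y. \<Sum>i\<in>UNIV. dp i x y * (\<Prod>j\<in>UNIV - {i}. p j x))) (at x)" for x
      unfolding bump by (rule has_derivative_prod) (rule d)
    show "continuous_on UNIV (\<lambda>x. \<Sum>i\<in>UNIV. dp i x (axis k 1) * (\<Prod>j\<in>UNIV - {i}. p j x))" for k
      unfolding dp_def p_def by (intro continuous_intros)
    show "bounded {x. box_bump a b x \<noteq> 0}" by (rule bounded_subset[OF bounded_box[of a b]]) (auto simp: box_bump_eq_0_iff)
  qed
  then show ?thesis by blast
qed

theorem fundamental_lemma:
  fixes g :: "real^'n \<Rightarrow> real"
  assumes g: "sq_int lborel g" and orth: "\<And>\<psi> d. test_fun \<psi> d \<Longrightarrow> (LBINT x. g x * \<psi> x) = 0"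
  shows "AE x in lborel. g x = 0"
proof (rule AE_eq_0_if_box_integrals_eq_0)
  show [measurable]: "g \<in> borel_measurable borel" using g by (simp add: sq_int_def)
  fix a b :: "real^'n"
  have "sq_int lborel (indicator (box a b))" by (rule sq_int_bounded_support[of _ 1 "box a b"]) (auto simp: indicator_def)
  then show int: "integrable lborel (\<lambda>x. indicator (box a b) x * g x)" by (rule sq_int_mult[OF _ g])
  let ?p = "box_bump a b" and ?c = "\<lambda>n. inverse (real (Suc n))"
  obtain d where d: "test_fun ?p d" using box_bump_test_fun by blast
  note [measurable] = test_fun_measurable(1)[OF d]
  have "(\<lambda>n. (LBINT x. g x * (?p x / (?p x + ?c n)))) \<longlonglongrightarrow> (LBINT x. indicator (box a b) x * g x)"
  proof (rule integral_dominated_convergence[where w="\<lambda>x. abs (indicator (box a b) x * g x)"])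
    show "integrable lborel (\<lambda>x. abs (indicator (box a b) x * g x))" using int by simp
    have "(\<lambda>n. ?p x / (?p x + ?c n)) \<longlonglongrightarrow> indicator (box a b) x" for x
    proof (cases "x \<in> box a b")
      case True
      then have "?p x \<noteq> 0" by (simp add: box_bump_eq_0_iff)
      then have "(\<lambda>n. ?p x / (?p x + ?c n)) \<longlonglongrightarrow> ?p x / (?p x + 0)"
        by (intro tendsto_intros LIMSEQ_inverse_real_of_nat) simp
      then show ?thesis using True \<open>?p x \<noteq> 0\<close> by simp
    qed (insert box_bump_eq_0_iff[of a b x], simp)
    from tendsto_mult[OF tendsto_const this]
    show "AE x in lborel. (\<lambda>n. g x * (?p x / (?p x + ?c n))) \<longlonglongrightarrow> indicator (box a b) x * g x" by (simp add: mult.commute)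
    have "abs (?p x / (?p x + ?c n)) \<le> indicator (box a b) x" for x n
      using box_bump_nonneg[of a b x] box_bump_eq_0_iff[of a b x] by (auto simp: indicator_def divide_le_eq_1 add_nonneg_pos)
    from mult_left_mono[OF this abs_ge_zero]
    show "AE x in lborel. norm (g x * (?p x / (?p x + ?c n))) \<le> abs (indicator (box a b) x * g x)" for n
      by (simp add: abs_mult mult.commute)
  qed measurable
  moreover have "(LBINT x. g x * (?p x / (?p x + ?c n))) = 0" for n
    by (rule orth[OF test_fun_quotient[OF d box_bump_nonneg]]) simp
  ultimately show "(LBINT x. indicator (box a b) x * g x) = 0" by (simp add: LIMSEQ_const_iff)
qed

lemma nn_integral_shift:
  fixes k :: "'a::euclidean_space"
  assumes [measurable]: "f \<in> borel_measurable borel"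
  shows "(NNBINT x. f (x + k)) = (NNBINT x. f x)"
proof -
  have "(NNBINT x. f x) = (\<integral>\<^sup>+x. f x \<partial>distr lborel borel ((+) k))" by (simp add: lborel_distr_plus)
  also have "\<dots> = (NNBINT x. f (x + k))" by (subst nn_integral_distr) (auto simp: add.commute)
  finally show ?thesis by simp
qed

lemma integral_shift:
  fixes k :: "'a::euclidean_space" and f :: "'a \<Rightarrow> real"
  assumes [measurable]: "f \<in> borel_measurable borel"
  shows "(LBINT x. f (x + k)) = (LBINT x. f x)" "integrable lborel (\<lambda>x. f (x + k)) \<longleftrightarrow> integrable lborel f"
proof -
  have distr: "distr lborel borel ((+) k) = lborel" by (rule lborel_distr_plus)
  show "(LBINT x. f (x + k)) = (LBINT x. f x)" by (subst (2) distr[symmetric], subst integral_distr) (auto simp: add.commute)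
  show "integrable lborel (\<lambda>x. f (x + k)) \<longleftrightarrow> integrable lborel f"
    by (subst (2) distr[symmetric], subst integrable_distr_eq) (auto simp: add.commute)
qed

lemma sq_int_shift:
  fixes k :: "'a::euclidean_space"
  assumes f: "sq_int lborel f"
  shows "sq_int lborel (\<lambda>x. f (x + k))"
proof -
  note [measurable] = sq_int_measurable[OF f, simplified]
  show ?thesis using f integral_shift(2)[of "\<lambda>x. (f x)^2" k] by (simp add: sq_int_def)
qed

lemma AE_shift:
  fixes k :: "'a::euclidean_space"
  assumes "AE x in lborel. P x"
  shows "AE x in lborel. P (x + k)"
proof -
  obtain N where N: "\<And>x. x \<in> space lborel - N \<Longrightarrow> P x" "N \<in> null_sets lborel" using AE_E3[OF assms] by blast
  have [measurable]: "N \<in> sets borel" using null_setsD2[OF N(2)] by simp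
  have "AE x in lborel. x \<notin> N" by (rule AE_not_in[OF N(2)])
  then have "AE x in distr lborel borel ((+) k). x \<notin> N" unfolding lborel_distr_plus .
  then have "AE x in lborel. k + x \<notin> N" by (subst (asm) AE_distr_iff) auto
  then show ?thesis
  proof eventually_elim
    case (elim x)
    then show ?case using N(1) by (auto simp: add.commute)
  qed
qed

text \<open>\<open>is_weak_grad\<close> for \<open>lborel\<close> and Borel functions, to which Fubini applies directly.\<close>
definition weak_grad :: "(real^'n \<Rightarrow> real) \<Rightarrow> (real^'n \<Rightarrow> real^'n) \<Rightarrow> bool" where
  "weak_grad u g \<longleftrightarrow> (\<forall>i. sq_int lborel (\<lambda>x. g x $ i)) \<and>
    (\<forall>\<psi> d i. test_fun \<psi> d \<longrightarrow> (LBINT x. u x * d x (axis i 1)) = - (LBINT x. g x $ i * \<psi> x))"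

lemma weak_gradD:
  assumes "weak_grad u g"
  shows "sq_int lborel (\<lambda>x. g x $ i)"
    "test_fun \<psi> d \<Longrightarrow> (LBINT x. u x * d x (axis i 1)) = - (LBINT x. g x $ i * \<psi> x)"
  using assms unfolding weak_grad_def by blast+

lemma weak_grad_unique:
  fixes u v :: "real^'n \<Rightarrow> real"
  assumes g: "weak_grad u g" and g': "weak_grad v g'" and uv: "AE x in lborel. u x = v x"
    and [measurable]: "u \<in> borel_measurable borel" "v \<in> borel_measurable borel"
  shows "AE x in lborel. g x = g' x"
proof -
  have "AE x in lborel. g x $ i - g' x $ i = 0" for i
  proof (rule fundamental_lemma)
    show "sq_int lborel (\<lambda>x. g x $ i - g' x $ i)" by (intro sq_int_diff weak_gradD[OF g] weak_gradD[OF g'])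
    fix \<psi> :: "real^'n \<Rightarrow> real" and d assume t: "test_fun \<psi> d"
    note [measurable] = test_fun_measurable[OF t]
    have "(LBINT x. u x * d x (axis i 1)) = (LBINT x. v x * d x (axis i 1))" by (rule integral_cong_AE) (insert uv, auto)
    then have "(LBINT x. g x $ i * \<psi> x) = (LBINT x. g' x $ i * \<psi> x)" using weak_gradD(2)[OF g t] weak_gradD(2)[OF g' t] by simp
    then show "(LBINT x. (g x $ i - g' x $ i) * \<psi> x) = 0"
      using sq_int_mult[OF weak_gradD(1)[OF g] test_fun_sq_int(1)[OF t]] sq_int_mult[OF weak_gradD(1)[OF g'] test_fun_sq_int(1)[OF t]]
      by (simp add: left_diff_distrib)
  qed
  then have "AE x in lborel. \<forall>i. g x $ i - g' x $ i = 0" by (simp add: AE_all_countable)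
  then show ?thesis by eventually_elim (simp add: vec_eq_iff)
qed

lemma weak_grad_lincomb:
  fixes u v :: "real^'n \<Rightarrow> real"
  assumes g: "weak_grad u g" and u: "sq_int lborel u" and g': "weak_grad v g'" and v: "sq_int lborel v"
  shows "weak_grad (\<lambda>x. a * u x + b * v x) (\<lambda>x. a *\<^sub>R g x + b *\<^sub>R g' x)"
  unfolding weak_grad_def
proof (intro conjI allI impI)
  fix i
  note gi = weak_gradD(1)[OF g, of i] weak_gradD(1)[OF g', of i]
  then show "sq_int lborel (\<lambda>x. (a *\<^sub>R g x + b *\<^sub>R g' x) $ i)" using sq_int_lincomb[OF gi, of a b] by simp
  fix \<psi> :: "real^'n \<Rightarrow> real" and d assume t: "test_fun \<psi> d"
  note \<psi> = test_fun_sq_int(1)[OF t] and d = test_fun_sq_int(2)[OF t, of "axis i 1"]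
  have "(LBINT x. (a * u x + b * v x) * d x (axis i 1)) = a * (LBINT x. u x * d x (axis i 1)) + b * (LBINT x. v x * d x (axis i 1))"
    using sq_int_mult[OF u d] sq_int_mult[OF v d] by (simp add: distrib_right mult.assoc)
  also have "\<dots> = - (a * (LBINT x. g x $ i * \<psi> x) + b * (LBINT x. g' x $ i * \<psi> x))"
    using weak_gradD(2)[OF g t] weak_gradD(2)[OF g' t] by simp
  also have "\<dots> = - (LBINT x. (a *\<^sub>R g x + b *\<^sub>R g' x) $ i * \<psi> x)"
    using sq_int_mult[OF gi(1) \<psi>] sq_int_mult[OF gi(2) \<psi>] by (simp add: distrib_right mult.assoc)
  finally show "(LBINT x. (a * u x + b * v x) * d x (axis i 1)) = - (LBINT x. (a *\<^sub>R g x + b *\<^sub>R g' x) $ i * \<psi> x)" .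
qed

lemma Fubini_unit_interval:
  fixes F :: "real \<Rightarrow> 'a::euclidean_space \<Rightarrow> real"
  assumes [measurable]: "case_prod F \<in> borel_measurable (borel \<Otimes>\<^sub>M borel)"
    and bound: "\<And>t. (NNBINT x. ennreal (abs (F t x))) \<le> ennreal C * indicator {0..1} t"
  shows "(LBINT x. (LBINT t. F t x)) = (LBINT t. (LBINT x. F t x))"
proof (rule lborel_pair.Fubini_integral)
  have "sets (lborel \<Otimes>\<^sub>M lborel :: (real \<times> 'a) measure) = sets (borel \<Otimes>\<^sub>M borel)" by (rule sets_pair_measure_cong) simp_all
  then have [measurable]: "case_prod F \<in> borel_measurable (lborel \<Otimes>\<^sub>M lborel)" using assms(1) measurable_cong_sets by blast
  show "integrable (lborel \<Otimes>\<^sub>M lborel) (case_prod F)"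
  proof (rule integrableI_bounded)
    have "(\<integral>\<^sup>+z. ennreal (norm (case_prod F z)) \<partial>(lborel \<Otimes>\<^sub>M lborel)) = (NNBINT t. NNBINT x. ennreal (norm (F t x)))"
      by (subst lborel.nn_integral_fst[symmetric]) auto
    also have "\<dots> \<le> (NNBINT t. ennreal C * indicator {0..1} (t::real))" using bound by (intro nn_integral_mono) simp
    also have "\<dots> = ennreal C" by (simp add: nn_integral_cmult)
    finally show "(\<integral>\<^sup>+z. ennreal (norm (case_prod F z)) \<partial>(lborel \<Otimes>\<^sub>M lborel)) < \<infinity>" by (simp add: le_less_trans)
  qed measurable
qed

definition segment_average :: "'a::euclidean_space \<Rightarrow> ('a \<Rightarrow> real) \<Rightarrow> 'a \<Rightarrow> real" where
  "segment_average k G x = (LBINT t. indicator {0..1} t * G (x + t *\<^sub>R k))"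

lemma square_unit_interval_average_le:
  fixes h :: "real \<Rightarrow> real"
  assumes [measurable]: "h \<in> borel_measurable borel"
  shows "ennreal ((LBINT t. indicator {0..1} t * h t)^2) \<le> (NNBINT t. indicator {0..1} t * ennreal ((h t)^2))"
proof -
  let ?M = "restrict_space lborel {0..1 :: real}"
  have "finite_measure ?M" by (rule finite_measureI) (simp add: emeasure_restrict_space space_restrict_space)
  moreover have "measure ?M (space ?M) = 1" by (simp add: measure_restrict_space space_restrict_space)
  moreover have "h \<in> borel_measurable ?M" by (rule measurable_restrict_space1) simp
  ultimately show ?thesis
    using Jensen_square[of ?M h] by (simp add: integral_restrict_space nn_integral_restrict_space mult.commute)
qed

lemma sq_int_segment_average:
  assumes G: "sq_int lborel G"
  shows "sq_int lborel (segment_average k G)" "(LBINT x. (segment_average k G x)^2) \<le> (LBINT x. (G x)^2)"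
proof -
  note [measurable] = sq_int_measurable[OF G, simplified]
  have [measurable]: "segment_average k G \<in> borel_measurable borel" unfolding segment_average_def[abs_def] by measurable
  have "(NNBINT x. ennreal ((segment_average k G x)^2))
    \<le> (NNBINT x. NNBINT t. indicator {0..1} t * ennreal ((G (x + t *\<^sub>R k))^2))"
    unfolding segment_average_def by (intro nn_integral_mono square_unit_interval_average_le) measurable
  also have "\<dots> = (NNBINT t. NNBINT x. indicator {0..1} t * ennreal ((G (x + t *\<^sub>R k))^2))"
    by (rule lborel_pair.Fubini') measurable
  also have "\<dots> = (NNBINT t. indicator {0..1} (t::real) * (NNBINT x. ennreal ((G x)^2)))"
    using nn_integral_shift[of "\<lambda>x. ennreal ((G x)^2)"] by (simp add: nn_integral_cmult)
  also have "\<dots> = ennreal (LBINT x. (G x)^2)" by (simp add: nn_integral_multc sq_int_nn_integral[OF G])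
  finally have bound: "(NNBINT x. ennreal ((segment_average k G x)^2)) \<le> ennreal (LBINT x. (G x)^2)" .
  show "sq_int lborel (segment_average k G)" "(LBINT x. (segment_average k G x)^2) \<le> (LBINT x. (G x)^2)"
    by (rule sq_int_if_nn_integral_le[OF _ bound]; simp)+
qed

lemma integral_mult_segment_average:
  assumes a: "sq_int lborel a" and G: "sq_int lborel G"
  shows "(LBINT x. a x * segment_average k G x) = (LBINT t. indicator {0..1} t * (LBINT x. a x * G (x + t *\<^sub>R k)))"
proof -
  note [measurable] = sq_int_measurable[OF a, simplified] sq_int_measurable[OF G, simplified]
  let ?F = "\<lambda>t x. indicator {0..1} t * (a x * G (x + t *\<^sub>R k))"
  let ?C = "(LBINT x. (a x)^2) + (LBINT x. (G x)^2)"
  have "(LBINT x. a x * segment_average k G x) = (LBINT x. (LBINT t. ?F t x))"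
    by (simp add: segment_average_def mult.left_commute flip: integral_mult_right_zero)
  also have "\<dots> = (LBINT t. (LBINT x. ?F t x))"
  proof (rule Fubini_unit_interval[where C="?C"])
    fix t :: real
    have "(NNBINT x. ennreal (abs (?F t x))) \<le> (NNBINT x. indicator {0..1} t * (ennreal ((a x)^2) + ennreal ((G (x + t *\<^sub>R k))^2)))"
      using abs_mult_le_squares[of "a _" "G (_ + t *\<^sub>R k)"]
      by (intro nn_integral_mono) (auto simp: indicator_def simp flip: ennreal_plus)
    also have "\<dots> = indicator {0..1} t * ((NNBINT x. ennreal ((a x)^2)) + (NNBINT x. ennreal ((G (x + t *\<^sub>R k))^2)))"
      by (simp add: nn_integral_cmult nn_integral_add)
    also have "\<dots> = ennreal ?C * indicator {0..1} t"
      using nn_integral_shift[of "\<lambda>x. ennreal ((G x)^2)" "t *\<^sub>R k"]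
      by (simp add: sq_int_nn_integral[OF a] sq_int_nn_integral[OF G] mult.commute flip: ennreal_plus)
    finally show "(NNBINT x. ennreal (abs (?F t x))) \<le> ennreal ?C * indicator {0..1} t" .
  qed measurable
  finally show ?thesis by simp
qed

lemma test_fun_diff_eq_segment_average:
  assumes t: "test_fun \<psi> d"
  shows "\<psi> (x + k) - \<psi> x = segment_average k (\<lambda>y. d y k) x"
proof -
  have "(LBINT t. d (x + t *\<^sub>R k) k * indicator {0..1} t) = \<psi> (x + 1 *\<^sub>R k) - \<psi> (x + 0 *\<^sub>R k)"
  proof (rule integral_FTC_Icc_real)
    fix s :: real
    have "((\<lambda>s. x + s *\<^sub>R k) has_derivative (\<lambda>h. h *\<^sub>R k)) (at s)" by (auto intro!: derivative_eq_intros)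
    from has_derivative_compose[OF this, of \<psi> "d (x + s *\<^sub>R k)"] t
    show "((\<lambda>s. \<psi> (x + s *\<^sub>R k)) has_real_derivative d (x + s *\<^sub>R k) k) (at s)"
      by (simp add: test_fun_def has_field_derivative_def linear_scale[OF test_fun_linear[OF t]] mult_commute_abs)
    have "continuous_on UNIV (\<lambda>s. d (x + s *\<^sub>R k) k)"
      by (intro continuous_on_compose2[OF test_fun_deriv_continuous[OF t]] continuous_intros) auto
    then show "isCont (\<lambda>s. d (x + s *\<^sub>R k) k) s" by (simp add: continuous_on_eq_continuous_at)
  qed simp
  then show ?thesis by (simp add: segment_average_def mult.commute)
qed

lemma weak_grad_directional:
  assumes u: "sq_int lborel u" and g: "weak_grad u g" and t: "test_fun \<psi> d"
  shows "sq_int lborel (\<lambda>x. k \<bullet> g x)" "(LBINT x. u x * d x k) = - (LBINT x. (k \<bullet> g x) * \<psi> x)"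
proof -
  have inner: "k \<bullet> g x = (\<Sum>i\<in>UNIV. k $ i * g x $ i)" for x by (simp add: inner_vec_def)
  show "sq_int lborel (\<lambda>x. k \<bullet> g x)" unfolding inner by (intro sq_int_sum sq_int_scale weak_gradD[OF g])
  have "(LBINT x. u x * d x k) = (LBINT x. (\<Sum>i\<in>UNIV. k $ i * (u x * d x (axis i 1))))"
    by (subst test_fun_deriv_eq_sum[OF t]) (simp add: sum_distrib_left mult_ac)
  also have "\<dots> = (\<Sum>i\<in>UNIV. k $ i * (LBINT x. u x * d x (axis i 1)))"
    by (subst Bochner_Integration.integral_sum) (auto intro!: sq_int_mult u test_fun_sq_int[OF t])
  also have "\<dots> = - (\<Sum>i\<in>UNIV. k $ i * (LBINT x. g x $ i * \<psi> x))" by (simp add: weak_gradD(2)[OF g t] sum_negf)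
  also have "(\<Sum>i\<in>UNIV. k $ i * (LBINT x. g x $ i * \<psi> x)) = (LBINT x. (\<Sum>i\<in>UNIV. k $ i * (g x $ i * \<psi> x)))"
    by (subst Bochner_Integration.integral_sum) (auto intro!: sq_int_mult weak_gradD[OF g] test_fun_sq_int[OF t])
  finally show "(LBINT x. u x * d x k) = - (LBINT x. (k \<bullet> g x) * \<psi> x)" by (simp add: inner sum_distrib_right mult.assoc)
qed

lemma AE_shift_diff_eq_segment_average:
  fixes u :: "real^'n \<Rightarrow> real"
  assumes u: "sq_int lborel u" and g: "weak_grad u g" and G: "sq_int lborel (\<lambda>x. k \<bullet> g x)"
  shows "AE x in lborel. u (x + k) - u x - segment_average k (\<lambda>x. k \<bullet> g x) x = 0"
proof (rule fundamental_lemma)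
  let ?G = "\<lambda>x. k \<bullet> g x" and ?w = "segment_average k (\<lambda>x. k \<bullet> g x)"
  note uk = sq_int_shift[OF u, of k] and w = sq_int_segment_average(1)[OF G]
  show "sq_int lborel (\<lambda>x. u (x + k) - u x - ?w x)" by (intro sq_int_diff u uk w)
  fix \<psi> :: "real^'n \<Rightarrow> real" and d assume t: "test_fun \<psi> d"
  note \<psi> = test_fun_sq_int(1)[OF t] and [measurable] = test_fun_measurable[OF t] sq_int_measurable[OF u, simplified] sq_int_measurable[OF G, simplified]
  have weak: "(LBINT x. u x * d (x + s *\<^sub>R - k) (- k)) = (LBINT x. \<psi> x * ?G (x + s *\<^sub>R k))" for s
    using weak_grad_directional(2)[OF u g test_fun_shift[OF t], of "- (s *\<^sub>R k)" "- k"]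
      integral_shift(1)[of "\<lambda>x. ?G x * \<psi> (x + - (s *\<^sub>R k))" "s *\<^sub>R k"] by (simp add: mult.commute)
  have "(LBINT x. (u (x + k) - u x) * \<psi> x) = (LBINT x. u (x + k) * \<psi> x) - (LBINT x. u x * \<psi> x)"
    using sq_int_mult[OF u \<psi>] sq_int_mult[OF uk \<psi>] by (simp add: left_diff_distrib)
  also have "(LBINT x. u (x + k) * \<psi> x) = (LBINT x. u x * \<psi> (x + - k))"
    using integral_shift(1)[of "\<lambda>x. u x * \<psi> (x + - k)" k] by simp
  also have "\<dots> - (LBINT x. u x * \<psi> x) = (LBINT x. u x * (\<psi> (x + - k) - \<psi> x))"
    using sq_int_mult[OF u \<psi>] sq_int_mult[OF u sq_int_shift[OF \<psi>, of "- k"]] by (simp add: right_diff_distrib)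
  also have "\<dots> = (LBINT t. indicator {0..1} t * (LBINT x. u x * d (x + t *\<^sub>R - k) (- k)))"
    by (simp only: test_fun_diff_eq_segment_average[OF t] integral_mult_segment_average[OF u test_fun_sq_int(2)[OF t]])
  also have "\<dots> = (LBINT t. indicator {0..1} t * (LBINT x. \<psi> x * ?G (x + t *\<^sub>R k)))" by (simp only: weak)
  also have "\<dots> = (LBINT x. ?w x * \<psi> x)" by (simp add: mult.commute flip: integral_mult_segment_average[OF \<psi> G])
  finally show "(LBINT x. (u (x + k) - u x - ?w x) * \<psi> x) = 0"
    using sq_int_mult[OF sq_int_diff[OF uk u] \<psi>] sq_int_mult[OF w \<psi>] by (simp add: left_diff_distrib[of "_ - _" "?w _"])
qed

theorem translation_estimate:
  fixes u :: "real^'n \<Rightarrow> real"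
  assumes u: "sq_int lborel u" and g: "weak_grad u g"
  shows "(LBINT x. (u (x + k) - u x)^2) \<le> (norm k)^2 * (LBINT x. (norm (g x))^2)"
proof -
  let ?w = "segment_average k (\<lambda>x. k \<bullet> g x)"
  have G: "sq_int lborel (\<lambda>x. k \<bullet> g x)" using weak_grad_directional(1)[OF u g] box_bump_test_fun by blast
  note [measurable] = sq_int_measurable[OF u, simplified] sq_int_measurable[OF sq_int_segment_average(1)[OF G], simplified]
  have "(LBINT x. (u (x + k) - u x)^2) = (LBINT x. (?w x)^2)"
    using AE_shift_diff_eq_segment_average[OF u g G] by (intro integral_cong_AE) (auto elim!: eventually_mono)
  also have "\<dots> \<le> (LBINT x. (k \<bullet> g x)^2)" by (rule sq_int_segment_average(2)[OF G])
  also have "\<dots> \<le> (LBINT x. (norm k)^2 * (norm (g x))^2)"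
  proof (rule integral_mono[OF sq_int_square_integrable[OF G]])
    have "(norm (g x))^2 = (\<Sum>i\<in>UNIV. (g x $ i)^2)" for x unfolding power2_norm_eq_inner inner_vec_def by (simp add: power2_eq_square)
    then show "integrable lborel (\<lambda>x. (norm k)^2 * (norm (g x))^2)" using sq_int_square_integrable[OF weak_gradD(1)[OF g]] by simp
    show "(k \<bullet> g x)^2 \<le> (norm k)^2 * (norm (g x))^2" for x
      using Cauchy_Schwarz_ineq[of k "g x"] by (simp add: power2_norm_eq_inner)
  qed
  finally show ?thesis by simp
qed

section \<open>The Sobolev space\<close>

definition H1_borel :: "(real^'n \<Rightarrow> real) set" where
  "H1_borel = {u. sq_int lborel u \<and> (\<exists>g. weak_grad u g)}"

lemma H1_borel_lincomb:
  assumes "u \<in> H1_borel" "v \<in> H1_borel"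
  shows "(\<lambda>x. a * u x + b * v x) \<in> H1_borel"
  using assms weak_grad_lincomb[of u _ v _ a b] sq_int_lincomb[of lborel u v a b] unfolding H1_borel_def by blast

lemma H1_borel_zero: "(\<lambda>x. 0) \<in> H1_borel"
proof -
  have "weak_grad (\<lambda>x. 0) (\<lambda>x. 0)" by (simp add: weak_grad_def sq_int_zero)
  then show ?thesis by (auto simp: H1_borel_def sq_int_zero)
qed

lemma H1_borel_add: "u \<in> H1_borel \<Longrightarrow> v \<in> H1_borel \<Longrightarrow> (\<lambda>x. u x + v x) \<in> H1_borel"
  using H1_borel_lincomb[of u v 1 1] by simp

lemma H1_borel_diff: "u \<in> H1_borel \<Longrightarrow> v \<in> H1_borel \<Longrightarrow> (\<lambda>x. u x - v x) \<in> H1_borel"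
  using H1_borel_lincomb[of u v 1 "-1"] by simp

lemma H1_borel_scale: "u \<in> H1_borel \<Longrightarrow> (\<lambda>x. a * u x) \<in> H1_borel"
  using H1_borel_lincomb[of u u a 0] by simp

definition h1_eq :: "(real^'n \<Rightarrow> real) \<Rightarrow> (real^'n \<Rightarrow> real) \<Rightarrow> bool" where
  "h1_eq u v \<longleftrightarrow> u \<in> H1_borel \<and> v \<in> H1_borel \<and> (AE x in lborel. u x = v x)"

quotient_type 'n h1 = "real^('n::finite) \<Rightarrow> real" / partial: h1_eq
proof (rule part_equivpI)
  show "\<exists>x. h1_eq x (x :: real^'n \<Rightarrow> real)" using H1_borel_zero by (auto simp: h1_eq_def)
  show "symp (h1_eq :: (real^'n \<Rightarrow> real) \<Rightarrow> _)" by (auto simp: symp_def h1_eq_def elim!: eventually_mono)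
  show "transp (h1_eq :: (real^'n \<Rightarrow> real) \<Rightarrow> _)"
    by (rule transpI) (auto simp: h1_eq_def elim: eventually_elim2)
qed

instantiation h1 :: (finite) real_vector
begin

lift_definition zero_h1 :: "'a h1" is "\<lambda>x. 0"
  by (simp add: h1_eq_def H1_borel_zero)

lift_definition plus_h1 :: "'a h1 \<Rightarrow> 'a h1 \<Rightarrow> 'a h1" is "\<lambda>u v x. u x + v x"
  by (auto simp: h1_eq_def intro: H1_borel_add elim!: eventually_elim2)

lift_definition minus_h1 :: "'a h1 \<Rightarrow> 'a h1 \<Rightarrow> 'a h1" is "\<lambda>u v x. u x - v x"
  by (auto simp: h1_eq_def intro: H1_borel_diff elim!: eventually_elim2)

lift_definition uminus_h1 :: "'a h1 \<Rightarrow> 'a h1" is "\<lambda>u x. - u x"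
  using H1_borel_scale[of _ "-1"] by (auto simp: h1_eq_def elim!: eventually_mono)

lift_definition scaleR_h1 :: "real \<Rightarrow> 'a h1 \<Rightarrow> 'a h1" is "\<lambda>r u x. r * u x"
  by (auto simp: h1_eq_def intro: H1_borel_scale elim!: eventually_mono)

instance
proof
  note closure = h1_eq_def H1_borel_add H1_borel_diff H1_borel_scale H1_borel_zero
  fix a b c :: "'a h1" and r t :: real
  show "a + b + c = a + (b + c)" "a + b = b + a" "0 + a = a" "- a + a = 0" by (transfer, simp add: closure algebra_simps)+
  show "a - b = a + - b" by transfer (insert H1_borel_diff, auto simp: h1_eq_def)
  show "r *\<^sub>R (a + b) = r *\<^sub>R a + r *\<^sub>R b" by transfer (simp add: closure distrib_left)
  show "(r + t) *\<^sub>R a = r *\<^sub>R a + t *\<^sub>R a"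
    by transfer (insert H1_borel_scale, auto simp: h1_eq_def distrib_right[symmetric])
  show "r *\<^sub>R t *\<^sub>R a = (r * t) *\<^sub>R a"
    by transfer (insert H1_borel_scale, auto simp: h1_eq_def mult.assoc[symmetric])
  show "1 *\<^sub>R a = a" by transfer (simp add: h1_eq_def)
qed

end

definition fn :: "'n::finite h1 \<Rightarrow> real^'n \<Rightarrow> real" where "fn = rep_h1"

definition grad :: "'n::finite h1 \<Rightarrow> real^'n \<Rightarrow> real^'n" where "grad u = (SOME g. weak_grad (fn u) g)"

lemma fn_in_H1_borel: "fn u \<in> H1_borel"
  using Quotient3_rep_reflp[OF Quotient3_h1, of u] by (simp add: h1_eq_def fn_def)

lemma fn_abs: "u \<in> H1_borel \<Longrightarrow> AE x in lborel. fn (abs_h1 u) x = u x"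
  using Quotient3_rel[OF Quotient3_h1, of "fn (abs_h1 u)" u] Quotient3_abs_rep[OF Quotient3_h1, of "abs_h1 u"]
    fn_in_H1_borel[of "abs_h1 u"]
  by (simp add: fn_def h1_eq_def)

lemma abs_fn: "abs_h1 (fn u) = u"
  unfolding fn_def by (rule Quotient3_abs_rep[OF Quotient3_h1])

lemma h1_eqI: "AE x in lborel. fn u x = fn v x \<Longrightarrow> u = v"
  using Quotient3_rel[OF Quotient3_h1, of "fn u" "fn v"] by (simp add: h1_eq_def fn_in_H1_borel abs_fn)

lemma sq_int_fn: "sq_int lborel (fn u)"
  using fn_in_H1_borel[of u] by (simp add: H1_borel_def)

lemma fn_measurable [measurable]: "fn u \<in> borel_measurable borel"
  using sq_int_fn[of u] by (simp add: sq_int_def)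

lemma weak_grad_fn: "weak_grad (fn u) (grad u)"
  using fn_in_H1_borel[of u] someI_ex[of "weak_grad (fn u)"] by (simp add: grad_def H1_borel_def)

lemma sq_int_grad: "sq_int lborel (\<lambda>x. grad u x $ i)"
  by (rule weak_gradD[OF weak_grad_fn])

lemma grad_measurable [measurable]: "(\<lambda>x. grad u x $ i) \<in> borel_measurable borel"
  using sq_int_grad[of u i] by (simp add: sq_int_def)

lemma h1_eq_fn: "h1_eq (fn u) (fn u)"
  by (simp add: h1_eq_def fn_in_H1_borel)

lemma fn_add: "AE x in lborel. fn (u + v) x = fn u x + fn v x"
  using fn_abs[OF H1_borel_add[OF fn_in_H1_borel fn_in_H1_borel], of u v] plus_h1.abs_eq[OF h1_eq_fn h1_eq_fn, of u v]
  by (simp add: abs_fn)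

lemma fn_diff: "AE x in lborel. fn (u - v) x = fn u x - fn v x"
  using fn_abs[OF H1_borel_diff[OF fn_in_H1_borel fn_in_H1_borel], of u v] minus_h1.abs_eq[OF h1_eq_fn h1_eq_fn, of u v]
  by (simp add: abs_fn)

lemma fn_scale: "AE x in lborel. fn (r *\<^sub>R u) x = r * fn u x"
  using fn_abs[OF H1_borel_scale[OF fn_in_H1_borel], of r u] scaleR_h1.abs_eq[OF h1_eq_fn, of r u] by (simp add: abs_fn)

lemma fn_zero: "AE x in lborel. fn 0 x = 0"
  using fn_abs[OF H1_borel_zero] by (simp add: zero_h1.abs_eq)

lemma fn_zero_iff: "u = 0 \<longleftrightarrow> (AE x in lborel. fn u x = 0)"
proof
  assume "AE x in lborel. fn u x = 0"
  with fn_zero have "AE x in lborel. fn u x = fn 0 x" by eventually_elim simp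
  then show "u = 0" by (rule h1_eqI)
qed (insert fn_zero, simp)

lemma grad_eqI:
  assumes "weak_grad v g" "AE x in lborel. fn u x = v x" "v \<in> borel_measurable borel"
  shows "AE x in lborel. grad u x = g x"
  by (rule weak_grad_unique[OF weak_grad_fn assms(1,2)]) (auto simp: assms(3))

lemma grad_lincomb: "AE x in lborel. grad (a *\<^sub>R u + b *\<^sub>R v) x = a *\<^sub>R grad u x + b *\<^sub>R grad v x"
proof (rule grad_eqI[OF weak_grad_lincomb[OF weak_grad_fn sq_int_fn weak_grad_fn sq_int_fn]])
  show "AE x in lborel. fn (a *\<^sub>R u + b *\<^sub>R v) x = a * fn u x + b * fn v x"
    using fn_add[of "a *\<^sub>R u" "b *\<^sub>R v"] fn_scale[of a u] fn_scale[of b v] by eventually_elim simp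
qed measurable

lemma grad_add: "AE x in lborel. grad (u + v) x = grad u x + grad v x"
  using grad_lincomb[of 1 u 1 v] by simp

lemma grad_diff: "AE x in lborel. grad (u - v) x = grad u x - grad v x"
  using grad_lincomb[of 1 u "-1" v] by simp

lemma grad_scale: "AE x in lborel. grad (r *\<^sub>R u) x = r *\<^sub>R grad u x"
  using grad_lincomb[of r u 0 u] by simp

lemma inner_grad_measurable [measurable]: "(\<lambda>x. grad u x \<bullet> grad v x) \<in> borel_measurable borel"
  unfolding inner_vec_def by measurable

lemma inner_grad_integrable: "integrable lborel (\<lambda>x. grad u x \<bullet> grad v x)"
  unfolding inner_vec_def by (auto intro!: sq_int_mult sq_int_grad)

lemma fn_mult_integrable: "integrable lborel (\<lambda>x. fn u x * fn v x)"
  by (rule sq_int_mult[OF sq_int_fn sq_int_fn])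

lemma weighted_fn_mult_integrable:
  assumes [measurable]: "w \<in> borel_measurable borel" and w: "\<And>x. abs (w x) \<le> M"
  shows "integrable lborel (\<lambda>x. w x * (fn u x * fn v x))"
  using sq_int_mult[OF sq_int_bounded_mult(1)[OF sq_int_fn[of u] _ w] sq_int_fn[of v]] by (simp add: mult.assoc)

definition weighted_l2 :: "(real^'n \<Rightarrow> real) \<Rightarrow> 'n::finite h1 \<Rightarrow> 'n h1 \<Rightarrow> real" where
  "weighted_l2 w u v = (LBINT x. w x * (fn u x * fn v x))"

lemma weighted_l2_sym: "weighted_l2 w u v = weighted_l2 w v u"
  by (simp add: weighted_l2_def mult.commute)

lemma weighted_l2_scale: "w \<in> borel_measurable borel \<Longrightarrow> weighted_l2 w (r *\<^sub>R u) v = r * weighted_l2 w u v"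
  unfolding weighted_l2_def integral_mult_right_zero[symmetric]
  by (intro integral_cong_AE) (insert fn_scale[of r u], auto elim!: eventually_mono)

lemma weighted_l2_add:
  assumes [measurable]: "w \<in> borel_measurable borel" and w: "\<And>x. abs (w x) \<le> M"
  shows "weighted_l2 w (u + u') v = weighted_l2 w u v + weighted_l2 w u' v"
  unfolding weighted_l2_def
  using fn_add[of u u'] by (subst Bochner_Integration.integral_add[symmetric])
    (auto simp: algebra_simps elim!: eventually_mono intro!: integral_cong_AE weighted_fn_mult_integrable[OF assms])

definition l2 :: "'n::finite h1 \<Rightarrow> 'n h1 \<Rightarrow> real" where "l2 u v = (LBINT x. fn u x * fn v x)"

definition dirichlet :: "'n::finite h1 \<Rightarrow> 'n h1 \<Rightarrow> real" where "dirichlet u v = (LBINT x. grad u x \<bullet> grad v x)"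

lemma l2_eq_weighted: "l2 = weighted_l2 (\<lambda>x. 1)"
  by (simp add: fun_eq_iff l2_def weighted_l2_def)

lemma l2_add: "l2 (u + v) w = l2 u w + l2 v w"
  unfolding l2_eq_weighted by (rule weighted_l2_add) auto

lemma l2_scale: "l2 (r *\<^sub>R u) w = r * l2 u w"
  unfolding l2_eq_weighted by (rule weighted_l2_scale) simp

lemma l2_self: "l2 u u = (LBINT x. (fn u x)^2)"
  by (simp add: l2_def power2_eq_square)

lemma l2_nonneg: "0 \<le> l2 u u"
  by (simp add: l2_self)

lemma l2_pos: "u \<noteq> 0 \<Longrightarrow> 0 < l2 u u"
  using integral_nonneg_eq_0_iff_AE[OF sq_int_square_integrable[OF sq_int_fn[of u]]] l2_nonneg[of u] fn_zero_iff[of u]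
  by (auto simp: l2_self less_le)

lemma dirichlet_add: "dirichlet (u + u') v = dirichlet u v + dirichlet u' v"
proof -
  have "dirichlet (u + u') v = (LBINT x. grad u x \<bullet> grad v x + grad u' x \<bullet> grad v x)" unfolding dirichlet_def
    by (intro integral_cong_AE) (insert grad_add[of u u'], auto simp: inner_add_left elim!: eventually_mono)
  then show ?thesis by (simp add: dirichlet_def inner_grad_integrable)
qed

lemma dirichlet_scale: "dirichlet (r *\<^sub>R u) v = r * dirichlet u v"
  unfolding dirichlet_def integral_mult_right_zero[symmetric]
  by (intro integral_cong_AE) (insert grad_scale[of r u], auto elim!: eventually_mono)

lemma dirichlet_nonneg: "0 \<le> dirichlet u u"
  by (simp add: dirichlet_def)

lemma dirichlet_eq_sum: "dirichlet u u = (\<Sum>i\<in>UNIV. (LBINT x. (grad u x $ i)^2))"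
  unfolding dirichlet_def inner_vec_def
  by (subst Bochner_Integration.integral_sum) (auto simp: power2_eq_square intro!: sq_int_mult sq_int_grad)

instantiation h1 :: (finite) real_inner
begin

definition inner_h1 :: "'a h1 \<Rightarrow> 'a h1 \<Rightarrow> real" where "inner_h1 u v = l2 u v + dirichlet u v"
definition norm_h1 :: "'a h1 \<Rightarrow> real" where "norm_h1 u = sqrt (u \<bullet> u)"
definition dist_h1 :: "'a h1 \<Rightarrow> 'a h1 \<Rightarrow> real" where "dist_h1 u v = norm (u - v)"
definition sgn_h1 :: "'a h1 \<Rightarrow> 'a h1" where "sgn_h1 u = u /\<^sub>R norm u"
definition uniformity_h1 :: "('a h1 \<times> 'a h1) filter" where
  "uniformity_h1 = (INF e\<in>{0<..}. principal {(u, v). dist u v < e})"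
definition open_h1 :: "'a h1 set \<Rightarrow> bool" where
  "open_h1 S \<longleftrightarrow> (\<forall>u\<in>S. \<forall>\<^sub>F (u', v) in uniformity. u' = u \<longrightarrow> v \<in> S)"

instance
proof
  fix u v w :: "'a h1" and r :: real
  show "u \<bullet> v = v \<bullet> u" by (simp add: inner_h1_def l2_def dirichlet_def mult.commute inner_commute)
  show "(u + v) \<bullet> w = u \<bullet> w + v \<bullet> w" by (simp add: inner_h1_def l2_add dirichlet_add)
  show "(r *\<^sub>R u) \<bullet> v = r * (u \<bullet> v)" by (simp add: inner_h1_def l2_scale dirichlet_scale distrib_left)
  show "0 \<le> u \<bullet> u" by (simp add: inner_h1_def l2_nonneg dirichlet_nonneg)
  have "l2 0 (0 :: 'a h1) = 0" "dirichlet 0 (0 :: 'a h1) = 0" using l2_scale[of 0 0 0] dirichlet_scale[of 0 0 0] by simp_all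
  then show "u \<bullet> u = 0 \<longleftrightarrow> u = 0" using l2_pos[of u] dirichlet_nonneg[of u] by (cases "u = 0") (auto simp: inner_h1_def)
qed (rule norm_h1_def dist_h1_def sgn_h1_def uniformity_h1_def open_h1_def)+

end

lemma norm_h1_square: "(norm u)^2 = l2 u u + dirichlet u u" for u :: "'n::finite h1"
  by (simp add: power2_norm_eq_inner inner_h1_def)

lemma l2_le: "l2 u u \<le> (norm u)^2"
  by (simp add: norm_h1_square dirichlet_nonneg)

lemma dirichlet_le: "dirichlet u u \<le> (norm u)^2"
  by (simp add: norm_h1_square l2_nonneg)

lemma bounded_bilinear_weighted_l2:
  assumes [measurable]: "w \<in> borel_measurable borel" and w: "\<And>x. abs (w x) \<le> M"
  shows "bounded_bilinear (weighted_l2 w)"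
proof
  fix a a' b b' :: "'a h1" and r :: real
  show "weighted_l2 w (a + a') b = weighted_l2 w a b + weighted_l2 w a' b"
    "weighted_l2 w a (b + b') = weighted_l2 w a b + weighted_l2 w a b'"
    using weighted_l2_add[OF assms] weighted_l2_sym by metis+
  show "weighted_l2 w (r *\<^sub>R a) b = r *\<^sub>R weighted_l2 w a b" "weighted_l2 w a (r *\<^sub>R b) = r *\<^sub>R weighted_l2 w a b"
    using weighted_l2_scale[OF assms(1)] weighted_l2_sym by (metis real_scaleR_def)+
next
  have M: "0 \<le> M" using w[of 0] by linarith
  have "norm (weighted_l2 w u v) \<le> norm u * norm v * M" for u v :: "'a h1"
  proof (rule power2_le_imp_le)
    have wu: "sq_int lborel (\<lambda>x. w x * fn u x)" "(LBINT x. (w x * fn u x)^2) \<le> M^2 * l2 u u"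
      using sq_int_bounded_mult[OF sq_int_fn[of u] _ w] by (simp_all add: l2_self)
    have "(norm (weighted_l2 w u v))^2 \<le> (LBINT x. (w x * fn u x)^2) * l2 v v"
      using sq_int_Cauchy_Schwarz[OF wu(1) sq_int_fn[of v]] by (simp add: weighted_l2_def l2_self mult.assoc)
    also have "\<dots> \<le> (M^2 * (norm u)^2) * (norm v)^2"
      by (intro mult_mono order_trans[OF wu(2)] mult_left_mono l2_le l2_nonneg) simp_all
    finally show "(norm (weighted_l2 w u v))^2 \<le> (norm u * norm v * M)^2" by (simp add: power_mult_distrib mult_ac)
  qed (insert M, simp)
  then show "\<exists>K. \<forall>u v. norm (weighted_l2 w u v) \<le> norm u * norm v * K" by blast
qed

lemma weak_grad_limit:
  fixes f :: "real^'n \<Rightarrow> real"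
  assumes F: "\<And>n. sq_int lborel (F n)" "\<And>n. weak_grad (F n) (G n)" and f: "sq_int lborel f"
    and F_lim: "(\<lambda>n. LBINT x. (F n x - f x)^2) \<longlonglongrightarrow> 0"
    and g: "\<And>i. sq_int lborel (\<lambda>x. g x $ i)" "\<And>i. (\<lambda>n. LBINT x. (G n x $ i - g x $ i)^2) \<longlonglongrightarrow> 0"
  shows "weak_grad f g"
  unfolding weak_grad_def
proof (intro conjI allI impI g)
  fix \<psi> :: "real^'n \<Rightarrow> real" and d i assume t: "test_fun \<psi> d"
  have "(\<lambda>n. LBINT x. F n x * d x (axis i 1)) \<longlonglongrightarrow> (LBINT x. f x * d x (axis i 1))"
    by (rule sq_int_tendsto_mult[OF F(1) f test_fun_sq_int(2)[OF t] F_lim])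
  moreover have "(\<lambda>n. - (LBINT x. G n x $ i * \<psi> x)) \<longlonglongrightarrow> - (LBINT x. g x $ i * \<psi> x)"
    by (intro tendsto_minus sq_int_tendsto_mult[OF weak_gradD(1)[OF F(2)] g(1) test_fun_sq_int(1)[OF t] g(2)])
  ultimately show "(LBINT x. f x * d x (axis i 1)) = - (LBINT x. g x $ i * \<psi> x)"
    unfolding weak_gradD(2)[OF F(2) t] by (rule LIMSEQ_unique)
qed

lemma norm_diff_h1_square:
  assumes f: "AE x in lborel. fn z x = f x" "f \<in> borel_measurable borel"
    and g: "AE x in lborel. grad z x = g x" "\<And>i. (\<lambda>x. g x $ i) \<in> borel_measurable borel"
  shows "(norm (u - z))^2 = (LBINT x. (fn u x - f x)^2) + (\<Sum>i\<in>UNIV. (LBINT x. (grad u x $ i - g x $ i)^2))"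
proof -
  note [measurable] = f(2) g(2)
  have "l2 (u - z) (u - z) = (LBINT x. (fn u x - f x)^2)"
    unfolding l2_self by (intro integral_cong_AE) (insert fn_diff[of u z] f(1), auto elim!: eventually_elim2)
  moreover have "(LBINT x. (grad (u - z) x $ i)^2) = (LBINT x. (grad u x $ i - g x $ i)^2)" for i
    by (intro integral_cong_AE) (insert grad_diff[of u z] g(1), auto elim!: eventually_elim2)
  ultimately show ?thesis by (simp add: norm_h1_square dirichlet_eq_sum)
qed

instance h1 :: (finite) banach
proof
  fix X :: "nat \<Rightarrow> 'a h1" assume X: "Cauchy X"
  have diff: "(norm (X m - X n))^2
    = (LBINT x. (fn (X m) x - fn (X n) x)^2) + (\<Sum>i\<in>UNIV. (LBINT x. (grad (X m) x $ i - grad (X n) x $ i)^2))" for m n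
    by (rule norm_diff_h1_square) auto
  have complete: "\<exists>f. sq_int lborel f \<and> (\<lambda>n. LBINT x. (F n x - f x)^2) \<longlonglongrightarrow> 0"
    if F: "\<And>n. sq_int lborel (F n)" and bound: "\<And>m n. (LBINT x. (F m x - F n x)^2) \<le> (norm (X m - X n))^2" for F :: "nat \<Rightarrow> real^'a \<Rightarrow> real"
  proof (rule sq_int_complete[OF F])
    fix e :: real assume e: "0 < e"
    then obtain N where N: "\<And>m n. N \<le> m \<Longrightarrow> N \<le> n \<Longrightarrow> norm (X m - X n) < sqrt e" using CauchyD[OF X, of "sqrt e"] by auto
    have "(LBINT x. (F m x - F n x)^2) < e" if "N \<le> m" "N \<le> n" for m n
      using bound[of m n] power_strict_mono[OF N[OF that], of 2] e by simp
    then show "\<exists>N. \<forall>m\<ge>N. \<forall>n\<ge>N. (LBINT x. (F m x - F n x)^2) < e" by blast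
  qed
  have "\<exists>f. sq_int lborel f \<and> (\<lambda>n. LBINT x. (fn (X n) x - f x)^2) \<longlonglongrightarrow> 0"
    by (rule complete[OF sq_int_fn]) (simp add: diff sum_nonneg)
  then obtain f where f: "sq_int lborel f" "(\<lambda>n. LBINT x. (fn (X n) x - f x)^2) \<longlonglongrightarrow> 0" by blast
  have "\<forall>i. \<exists>g. sq_int lborel g \<and> (\<lambda>n. LBINT x. (grad (X n) x $ i - g x)^2) \<longlonglongrightarrow> 0"
    by (intro allI complete[OF sq_int_grad]) (auto simp: diff intro!: add_increasing member_le_sum)
  from choice[OF this] obtain g
    where g: "\<And>i. sq_int lborel (g i)" "\<And>i. (\<lambda>n. LBINT x. (grad (X n) x $ i - g i x)^2) \<longlonglongrightarrow> 0" by blast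
  have weak: "weak_grad f (\<lambda>x. \<chi> i. g i x)"
    by (rule weak_grad_limit[where F="\<lambda>n. fn (X n)" and G="\<lambda>n. grad (X n)"])
      (insert f g, simp_all add: sq_int_fn weak_grad_fn)
  then have f_z: "AE x in lborel. fn (abs_h1 f) x = f x" using f by (intro fn_abs) (auto simp: H1_borel_def)
  have fm: "f \<in> borel_measurable borel" using f by (simp add: sq_int_def)
  have gm: "g i \<in> borel_measurable borel" for i using g(1)[of i] by (simp add: sq_int_def)
  have "(norm (X n - abs_h1 f))^2 = (LBINT x. (fn (X n) x - f x)^2) + (\<Sum>i\<in>UNIV. (LBINT x. (grad (X n) x $ i - g i x)^2))" for n
    using norm_diff_h1_square[OF f_z fm grad_eqI[OF weak f_z fm]] gm by simp
  moreover have "(\<lambda>n. (LBINT x. (fn (X n) x - f x)^2) + (\<Sum>i\<in>UNIV. (LBINT x. (grad (X n) x $ i - g i x)^2)))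
    \<longlonglongrightarrow> 0 + (\<Sum>i\<in>(UNIV::'a set). 0)" by (intro tendsto_intros f g)
  ultimately have "(\<lambda>n. (norm (X n - abs_h1 f))^2) \<longlonglongrightarrow> 0" by simp
  then have "(\<lambda>n. sqrt ((norm (X n - abs_h1 f))^2)) \<longlonglongrightarrow> sqrt 0" by (rule tendsto_real_sqrt)
  then have "X \<longlonglongrightarrow> abs_h1 f" by (simp add: tendsto_norm_zero_iff Lim_null[of X])
  then show "convergent X" by (rule convergentI)
qed

lemma weak_grad_shift:
  fixes u :: "real^'n \<Rightarrow> real"
  assumes g: "weak_grad u g" and [measurable]: "u \<in> borel_measurable borel"
  shows "weak_grad (\<lambda>x. u (x + k)) (\<lambda>x. g (x + k))"
  unfolding weak_grad_def
proof (intro conjI allI impI)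
  fix i
  note [measurable] = sq_int_measurable[OF weak_gradD(1)[OF g], simplified]
  show "sq_int lborel (\<lambda>x. g (x + k) $ i)" by (rule sq_int_shift[OF weak_gradD(1)[OF g]])
  fix \<psi> :: "real^'n \<Rightarrow> real" and d assume t: "test_fun \<psi> d"
  note [measurable] = test_fun_measurable[OF t]
  have "(LBINT x. u (x + k) * d x (axis i 1)) = (LBINT x. u x * d (x + - k) (axis i 1))"
    using integral_shift(1)[of "\<lambda>x. u x * d (x + - k) (axis i 1)" k] by simp
  also have "\<dots> = - (LBINT x. g x $ i * \<psi> (x + - k))" by (rule weak_gradD(2)[OF g test_fun_shift[OF t]])
  also have "(LBINT x. g x $ i * \<psi> (x + - k)) = (LBINT x. g (x + k) $ i * \<psi> x)"
    using integral_shift(1)[of "\<lambda>x. g x $ i * \<psi> (x + - k)" k] by simp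
  finally show "(LBINT x. u (x + k) * d x (axis i 1)) = - (LBINT x. g (x + k) $ i * \<psi> x)" .
qed

definition shift :: "real^'n \<Rightarrow> 'n::finite h1 \<Rightarrow> 'n h1" where "shift k u = abs_h1 (\<lambda>x. fn u (x + k))"

lemma fn_shift: "AE x in lborel. fn (shift k u) x = fn u (x + k)"
  unfolding shift_def using weak_grad_shift[OF weak_grad_fn[of u] fn_measurable, of k] sq_int_shift[OF sq_int_fn, of u k]
  by (intro fn_abs) (auto simp: H1_borel_def)

lemma grad_shift: "AE x in lborel. grad (shift k u) x = grad u (x + k)"
  by (rule grad_eqI[OF weak_grad_shift[OF weak_grad_fn fn_measurable] fn_shift]) measurable

lemma weighted_l2_shift:
  assumes [measurable]: "w \<in> borel_measurable borel"
  shows "weighted_l2 (\<lambda>x. w (x + k)) (shift k u) (shift k v) = weighted_l2 w u v"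
proof -
  have "weighted_l2 (\<lambda>x. w (x + k)) (shift k u) (shift k v) = (LBINT x. w (x + k) * (fn u (x + k) * fn v (x + k)))"
    unfolding weighted_l2_def
    by (intro integral_cong_AE) (insert fn_shift[of k u] fn_shift[of k v], auto elim!: eventually_elim2)
  then show ?thesis using integral_shift(1)[of "\<lambda>x. w x * (fn u x * fn v x)" k] by (simp add: weighted_l2_def)
qed

lemma dirichlet_shift: "dirichlet (shift k u) (shift k v) = dirichlet u v"
proof -
  have [measurable]: "(\<lambda>x. grad u (x + k) \<bullet> grad v (x + k)) \<in> borel_measurable borel"
    using measurable_compose[OF _ inner_grad_measurable[of u v], of "\<lambda>x. x + k" borel] by simp
  have "dirichlet (shift k u) (shift k v) = (LBINT x. grad u (x + k) \<bullet> grad v (x + k))" unfolding dirichlet_def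
    by (intro integral_cong_AE) (insert grad_shift[of k u] grad_shift[of k v], auto elim!: eventually_elim2)
  then show ?thesis using integral_shift(1)[of "\<lambda>x. grad u x \<bullet> grad v x" k] by (simp add: dirichlet_def)
qed

lemma norm_shift: "norm (shift k u) = norm u"
proof (rule power2_eq_imp_eq)
  show "(norm (shift k u))^2 = (norm u)^2"
    using weighted_l2_shift[of "\<lambda>x. 1" k u u] by (simp add: norm_h1_square l2_eq_weighted dirichlet_shift)
qed simp_all

lemma h1_translation_estimate: "(LBINT x. (fn u (x + k) - fn u x)^2) \<le> (norm k)^2 * dirichlet u u"
  using translation_estimate[OF sq_int_fn weak_grad_fn, of u k] by (simp add: dirichlet_def power2_norm_eq_inner)

section \<open>Averages, Sobolev embedding and compactness\<close>

definition cube :: "(real^'n) set" where "cube = cbox 0 1"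

definition cube_measure :: "(real^'n) measure" where "cube_measure = density lborel (indicator cube)"

definition avg :: "real \<Rightarrow> (real^'n \<Rightarrow> real) \<Rightarrow> real^'n \<Rightarrow> real" where
  "avg s u x = (\<integral>h. u (x + s *\<^sub>R h) \<partial>cube_measure)"

definition mass :: "(real^'n) set \<Rightarrow> (real^'n \<Rightarrow> real) \<Rightarrow> real" where
  "mass S u = (LBINT y. (u y)^2 * indicator S y)"

lemma cube_borel [measurable]: "cube \<in> sets borel"
  by (simp add: cube_def)

lemma sets_cube_measure [simp, measurable_cong]: "sets cube_measure = sets borel"
  by (simp add: cube_measure_def)

lemma space_cube_measure [simp]: "space cube_measure = UNIV"
  by (simp add: cube_measure_def)

lemma mem_cube: "h \<in> cube \<longleftrightarrow> (\<forall>i. 0 \<le> h $ i \<and> h $ i \<le> 1)"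
  by (simp add: cube_def mem_box_cart)

lemma translate_borel [measurable]: "S \<in> sets borel \<Longrightarrow> {y. y - k \<in> S} \<in> sets borel" for S :: "(real^'n) set"
  using measurable_sets[of "\<lambda>y. y - k" borel borel S] by (simp add: vimage_def)

lemma emeasure_cube: "emeasure lborel (cube :: (real^'n) set) = 1"
proof -
  have "0 \<in> cbox 0 (1::real^'n)" by (simp add: mem_box_cart)
  then have "measure lborel (cbox 0 (1::real^'n)) = 1" by (subst content_cbox_cart) auto
  moreover have "emeasure lborel (cbox 0 (1::real^'n)) \<noteq> \<infinity>" using emeasure_bounded_finite[OF bounded_cbox, of 0 "1::real^'n"] by simp
  ultimately show ?thesis unfolding cube_def by (subst emeasure_eq_ennreal_measure) auto
qed

lemma nn_integral_cube:
  "f \<in> borel_measurable borel \<Longrightarrow> (\<integral>\<^sup>+h. f h \<partial>cube_measure) = (NNBINT h. f h * indicator cube h)"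
  unfolding cube_measure_def by (subst nn_integral_density) (auto simp: mult.commute)

lemma emeasure_cube_measure: "emeasure (cube_measure :: (real^'n) measure) UNIV = 1"
  using nn_integral_cube[of "\<lambda>_::real^'n. 1"] emeasure_cube by (simp add: nn_integral_const[of cube_measure])

interpretation cube: finite_measure "cube_measure :: (real^'n) measure"
  by (rule finite_measureI) (simp add: emeasure_cube_measure)

lemma measure_cube_measure [simp]: "measure cube_measure UNIV = 1"
  by (simp add: measure_def emeasure_cube_measure)

interpretation lborel_cube: pair_sigma_finite "lborel :: (real^'n) measure" "cube_measure :: (real^'n) measure" ..

interpretation cube_cube: pair_sigma_finite "cube_measure :: (real^'n) measure" "cube_measure :: (real^'n) measure" ..

lemma norm_cube_le:
  assumes "h \<in> (cube :: (real^'n) set)"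
  shows "(norm h)^2 \<le> real CARD('n)"
proof -
  have "(norm h)^2 = (\<Sum>i\<in>UNIV. (h $ i)^2)" unfolding power2_norm_eq_inner inner_vec_def by (simp add: power2_eq_square)
  also have "\<dots> \<le> (\<Sum>i\<in>(UNIV::'n set). 1)" using assms by (intro sum_mono power_le_one) (auto simp: mem_cube)
  finally show ?thesis by simp
qed

lemma AE_cube: "AE h in cube_measure. h \<in> cube"
  unfolding cube_measure_def by (subst AE_density) (auto simp: indicator_def)

lemma nn_integral_scaled:
  fixes x :: "real^'n"
  assumes [measurable]: "f \<in> borel_measurable borel" and s: "0 < s"
  shows "(NNBINT h. f (x + s *\<^sub>R h)) = ennreal (1 / s ^ CARD('n)) * (NNBINT y. f y)"
proof -
  have "(NNBINT y. f y) = (\<integral>\<^sup>+y. f y \<partial>(density (distr lborel borel (\<lambda>h. x + s *\<^sub>R h)) (\<lambda>_. abs s ^ DIM(real^'n))))"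
    using lborel_affine[of s x] s by simp
  also have "\<dots> = ennreal (s ^ CARD('n)) * (NNBINT h. f (x + s *\<^sub>R h))"
    using s by (simp add: nn_integral_density nn_integral_distr nn_integral_cmult)
  finally have "ennreal (1 / s ^ CARD('n)) * (NNBINT y. f y)
    = (ennreal (1 / s ^ CARD('n)) * ennreal (s ^ CARD('n))) * (NNBINT h. f (x + s *\<^sub>R h))" by (simp add: mult.assoc)
  also have "ennreal (1 / s ^ CARD('n)) * ennreal (s ^ CARD('n)) = 1" using s by (simp flip: ennreal_mult')
  finally show ?thesis by simp
qed

lemma nn_integral_cube_le:
  fixes x :: "real^'n"
  assumes [measurable]: "f \<in> borel_measurable borel" "S \<in> sets borel"
    and s: "0 < s" and S: "\<And>h. h \<in> cube \<Longrightarrow> x + s *\<^sub>R h \<in> S"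
  shows "(\<integral>\<^sup>+h. f (x + s *\<^sub>R h) \<partial>cube_measure) \<le> ennreal (1 / s ^ CARD('n)) * (NNBINT y. f y * indicator S y)"
proof -
  have "(\<integral>\<^sup>+h. f (x + s *\<^sub>R h) \<partial>cube_measure) = (NNBINT h. f (x + s *\<^sub>R h) * indicator cube h)"
    by (rule nn_integral_cube) measurable
  also have "\<dots> \<le> (NNBINT h. f (x + s *\<^sub>R h) * indicator S (x + s *\<^sub>R h))"
    using S by (intro nn_integral_mono) (auto simp: indicator_def)
  also have "\<dots> = ennreal (1 / s ^ CARD('n)) * (NNBINT y. f y * indicator S y)"
    by (rule nn_integral_scaled[OF _ s]) measurable
  finally show ?thesis .
qed

lemma Jensen_cube:
  "u \<in> borel_measurable borel \<Longrightarrow> ennreal ((\<integral>h. u h \<partial>cube_measure)^2) \<le> (\<integral>\<^sup>+h. ennreal ((u h)^2) \<partial>cube_measure)"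
  by (rule Jensen_square) (auto intro: cube.finite_measure_axioms)

lemma avg_measurable [measurable]:
  assumes [measurable]: "u \<in> borel_measurable borel"
  shows "avg s u \<in> borel_measurable borel"
  unfolding avg_def[abs_def] by measurable

lemma square_avg_le_mass:
  fixes x :: "real^'n"
  assumes u: "sq_int lborel u" and [measurable]: "S \<in> sets borel"
    and s: "0 < s" and S: "\<And>h. h \<in> cube \<Longrightarrow> x + s *\<^sub>R h \<in> S"
  shows "(avg s u x)^2 \<le> (1 / s ^ CARD('n)) * mass S u" "integrable cube_measure (\<lambda>h. u (x + s *\<^sub>R h))"
proof -
  note [measurable] = sq_int_measurable[OF u, simplified]
  have int: "integrable lborel (\<lambda>y. (u y)^2 * indicator S y)"
    by (intro integrable_real_mult_indicator sq_int_square_integrable[OF u]) simp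
  have "(NNBINT y. ennreal ((u y)^2) * indicator S y) = ennreal (mass S u)"
    unfolding mass_def by (subst nn_integral_eq_integral[OF int, symmetric]) (auto intro!: nn_integral_cong simp: indicator_def)
  moreover have mass: "0 \<le> mass S u" by (simp add: mass_def)
  ultimately have bound: "(\<integral>\<^sup>+h. ennreal ((u (x + s *\<^sub>R h))^2) \<partial>cube_measure) \<le> ennreal ((1 / s ^ CARD('n)) * mass S u)"
    using nn_integral_cube_le[of "\<lambda>y. ennreal ((u y)^2)" S s x] s S by (simp add: ennreal_mult[symmetric])
  have "ennreal ((avg s u x)^2) \<le> (\<integral>\<^sup>+h. ennreal ((u (x + s *\<^sub>R h))^2) \<partial>cube_measure)" unfolding avg_def by (rule Jensen_cube) measurable
  then have "ennreal ((avg s u x)^2) \<le> ennreal ((1 / s ^ CARD('n)) * mass S u)" using bound by (rule order_trans)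
  then show "(avg s u x)^2 \<le> (1 / s ^ CARD('n)) * mass S u" using s mass by (subst (asm) ennreal_le_iff) auto
  have "sq_int cube_measure (\<lambda>h. u (x + s *\<^sub>R h))" by (rule sq_int_if_nn_integral_le(1)[OF _ bound]) (insert s mass, auto)
  moreover have "sq_int cube_measure (\<lambda>_. 1)" by (simp add: sq_int_def)
  ultimately show "integrable cube_measure (\<lambda>h. u (x + s *\<^sub>R h))" using sq_int_mult by fastforce
qed

lemma square_avg_le: "sq_int lborel u \<Longrightarrow> 0 < s \<Longrightarrow> (avg s u x)^2 \<le> (1 / s ^ CARD('n)) * (LBINT y. (u y)^2)" for x :: "real^'n"
  using square_avg_le_mass(1)[of u UNIV s x] by (simp add: mass_def)

lemma integrable_cube_scaled: "sq_int lborel u \<Longrightarrow> 0 < s \<Longrightarrow> integrable cube_measure (\<lambda>h. u (x + s *\<^sub>R h))"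
  using square_avg_le_mass(2)[of u UNIV s x] by simp

lemma avg_diff:
  assumes "sq_int lborel u" "sq_int lborel v" "0 < s"
  shows "avg s (\<lambda>x. u x - v x) x = avg s u x - avg s v x"
  unfolding avg_def using integrable_cube_scaled[OF assms(1,3)] integrable_cube_scaled[OF assms(2,3)] by simp

lemma sq_int_avg:
  assumes u: "sq_int lborel u"
  shows "sq_int lborel (avg s u)" "(LBINT x. (avg s u x)^2) \<le> (LBINT x. (u x)^2)"
proof -
  note [measurable] = sq_int_measurable[OF u, simplified]
  have "(NNBINT x. ennreal ((avg s u x)^2)) \<le> (NNBINT x. \<integral>\<^sup>+h. ennreal ((u (x + s *\<^sub>R h))^2) \<partial>cube_measure)"
    unfolding avg_def by (intro nn_integral_mono Jensen_cube) measurable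
  also have "\<dots> = (\<integral>\<^sup>+h. \<integral>\<^sup>+x. ennreal ((u (x + s *\<^sub>R h))^2) \<partial>lborel \<partial>cube_measure)"
    by (rule lborel_cube.Fubini'[symmetric]) measurable
  also have "\<dots> = ennreal (LBINT x. (u x)^2)"
    by (simp add: nn_integral_shift[of "\<lambda>x. ennreal ((u x)^2)"] emeasure_cube_measure sq_int_nn_integral[OF u])
  finally have bound: "(NNBINT x. ennreal ((avg s u x)^2)) \<le> ennreal (LBINT x. (u x)^2)" .
  show "sq_int lborel (avg s u)" "(LBINT x. (avg s u x)^2) \<le> (LBINT x. (u x)^2)"
    using sq_int_if_nn_integral_le[OF _ bound] by simp_all
qed

lemma avg_commute:
  fixes x :: "real^'n"
  assumes u: "sq_int lborel u" and s: "0 < s"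
  shows "avg s (avg r u) x = avg r (avg s u) x"
proof -
  note [measurable] = sq_int_measurable[OF u, simplified]
  let ?M = "cube_measure \<Otimes>\<^sub>M cube_measure :: ((real^'n) \<times> (real^'n)) measure"
  let ?f = "\<lambda>h k. u (x + s *\<^sub>R h + r *\<^sub>R k)" and ?c = "(1 / s ^ CARD('n)) * (LBINT y. (u y)^2)"
  have "(\<integral>\<^sup>+z. ennreal ((case_prod ?f z)^2) \<partial>?M) = (\<integral>\<^sup>+k. \<integral>\<^sup>+h. ennreal ((?f h k)^2) \<partial>cube_measure \<partial>cube_measure)"
    by (subst cube_cube.nn_integral_snd[symmetric]) (auto simp: split_beta')
  also have "\<dots> \<le> (\<integral>\<^sup>+k. ennreal ?c \<partial>(cube_measure :: (real^'n) measure))"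
  proof (rule nn_integral_mono)
    fix k
    show "(\<integral>\<^sup>+h. ennreal ((?f h k)^2) \<partial>cube_measure) \<le> ennreal ?c"
      using nn_integral_cube_le[of "\<lambda>y. ennreal ((u y)^2)" UNIV s "x + r *\<^sub>R k"] s
      by (simp add: sq_int_nn_integral[OF u] ennreal_mult[symmetric] ac_simps)
  qed
  finally have "(\<integral>\<^sup>+z. ennreal ((case_prod ?f z)^2) \<partial>?M) \<le> ennreal ?c" by (simp add: emeasure_cube_measure)
  then have "sq_int ?M (case_prod ?f)" using s by (intro sq_int_if_nn_integral_le(1)[of _ _ ?c]) (auto simp: split_beta')
  moreover have "sq_int ?M (\<lambda>_. 1)"
  proof -
    have "emeasure ?M (space ?M) = 1"
      using cube.emeasure_pair_measure_Times[of UNIV cube_measure UNIV] by (simp add: space_pair_measure emeasure_cube_measure)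
    then interpret finite_measure ?M by (intro finite_measureI) simp
    show ?thesis by (simp add: sq_int_def)
  qed
  ultimately have "integrable ?M (\<lambda>(h, k). ?f h k)" using sq_int_mult by fastforce
  from cube_cube.Fubini_integral[OF this] show ?thesis unfolding avg_def by (simp add: ac_simps)
qed

lemma avg_error:
  fixes u :: "real^'n \<Rightarrow> real"
  assumes u: "sq_int lborel u" and s: "0 < s"
    and translation: "\<And>k. (LBINT x. (u (x + k) - u x)^2) \<le> (norm k)^2 * G" and G: "0 \<le> G"
  shows "(LBINT x. (u x - avg s u x)^2) \<le> s^2 * real CARD('n) * G"
proof -
  note [measurable] = sq_int_measurable[OF u, simplified]
  have "(NNBINT x. ennreal ((u x - avg s u x)^2)) \<le> (NNBINT x. \<integral>\<^sup>+h. ennreal ((u (x + s *\<^sub>R h) - u x)^2) \<partial>cube_measure)"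
  proof (rule nn_integral_mono)
    fix x
    have "avg s u x - u x = (\<integral>h. u (x + s *\<^sub>R h) - u x \<partial>cube_measure)"
      unfolding avg_def using integrable_cube_scaled[OF u s] by simp
    then show "ennreal ((u x - avg s u x)^2) \<le> (\<integral>\<^sup>+h. ennreal ((u (x + s *\<^sub>R h) - u x)^2) \<partial>cube_measure)"
      using Jensen_cube[of "\<lambda>h. u (x + s *\<^sub>R h) - u x"] by (simp add: power2_commute[of "u x"])
  qed
  also have "\<dots> = (\<integral>\<^sup>+h. \<integral>\<^sup>+x. ennreal ((u (x + s *\<^sub>R h) - u x)^2) \<partial>lborel \<partial>cube_measure)"
    by (rule lborel_cube.Fubini'[symmetric]) measurable
  also have "\<dots> \<le> (\<integral>\<^sup>+h. ennreal (s^2 * real CARD('n) * G) \<partial>(cube_measure :: (real^'n) measure))"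
  proof (rule nn_integral_mono_AE)
    show "AE h in cube_measure. (NNBINT x. ennreal ((u (x + s *\<^sub>R h) - u x)^2)) \<le> ennreal (s^2 * real CARD('n) * G)"
      using AE_cube
    proof eventually_elim
      case (elim h)
      have "(norm (s *\<^sub>R h))^2 * G \<le> s^2 * real CARD('n) * G"
        using norm_cube_le[OF elim] G by (simp add: power_mult_distrib mult_mono)
      with translation[of "s *\<^sub>R h"] have "(LBINT x. (u (x + s *\<^sub>R h) - u x)^2) \<le> s^2 * real CARD('n) * G" by (rule order_trans)
      then show ?case using sq_int_nn_integral[OF sq_int_diff[OF sq_int_shift[OF u] u]] by (simp add: ennreal_leI)
    qed
  qed
  finally have "(NNBINT x. ennreal ((u x - avg s u x)^2)) \<le> ennreal (s^2 * real CARD('n) * G)" by (simp add: emeasure_cube_measure)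
  then show ?thesis by (rule sq_int_if_nn_integral_le(2)[rotated]) (insert G, auto)
qed

lemma square_add_le: "(a + b)^2 \<le> 2 * a^2 + 2 * b^2" for a b :: real
  using sum_squares_bound[of a b] by (simp add: power2_sum)

lemma powr_add_le:
  fixes a b :: real
  assumes "0 \<le> a" "0 \<le> b" "0 \<le> p"
  shows "(a + b) powr p \<le> 2 powr p * (a powr p + b powr p)"
proof -
  have "(a + b) powr p \<le> (2 * max a b) powr p" using assms by (intro powr_mono2) auto
  also have "\<dots> = 2 powr p * (max a b) powr p" using assms by (simp add: powr_mult)
  also have "\<dots> \<le> 2 powr p * (a powr p + b powr p)" by (intro mult_left_mono) (auto simp: max_def)
  finally show ?thesis .
qed

lemma abs_powr_le_split:
  fixes a b :: real
  assumes "0 \<le> p"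
  shows "abs a powr p \<le> 2 powr p * (abs (a - b) powr p + abs b powr p)"
proof -
  have "abs a powr p \<le> (abs (a - b) + abs b) powr p" using assms by (intro powr_mono2) auto
  also have "\<dots> \<le> 2 powr p * (abs (a - b) powr p + abs b powr p)" using assms by (intro powr_add_le) auto
  finally show ?thesis .
qed

lemma weighted_powr_le_split:
  fixes a b w :: real
  assumes p: "0 \<le> p" and w: "0 \<le> w" "w \<le> 1"
  shows "w * abs a powr p \<le> 2 powr p * abs (a - b) powr p + 2 powr p * (w * abs b powr p)"
proof -
  have "w * abs a powr p \<le> w * (2 powr p * (abs (a - b) powr p + abs b powr p))"
    using w p by (intro mult_left_mono abs_powr_le_split)
  also have "\<dots> = 2 powr p * (w * abs (a - b) powr p) + 2 powr p * (w * abs b powr p)" by (simp add: algebra_simps)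
  also have "\<dots> \<le> 2 powr p * abs (a - b) powr p + 2 powr p * (w * abs b powr p)"
    using w by (intro add_right_mono mult_left_mono mult_left_le_one_le) simp_all
  finally show ?thesis .
qed

lemma powr_half_mult: "0 \<le> x \<Longrightarrow> x powr ((p - 2) / 2) * x = x powr (p / 2)" for x :: real
  using powr_add[of x "(p - 2) / 2" 1] by (cases "x = 0") (simp_all add: diff_divide_distrib)

lemma square_powr_half: "(x^2) powr (p / 2) = abs x powr p" for x :: real
  using powr_powr[of "abs x" 2 "p / 2"] by (cases "x = 0") simp_all

lemma abs_powr_le_square:
  fixes a K p :: real
  assumes "a^2 \<le> K" "2 \<le> p"
  shows "abs a powr p \<le> K powr ((p - 2) / 2) * a^2"
proof -
  have "abs a powr p = (a^2) powr ((p - 2) / 2) * a^2" by (simp only: square_powr_half[of a p, symmetric] powr_half_mult[OF zero_le_power2])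
  also have "\<dots> \<le> K powr ((p - 2) / 2) * a^2" using assms by (intro mult_right_mono powr_mono2) auto
  finally show ?thesis .
qed

lemma powr_diff_limit_le:
  fixes a :: "nat \<Rightarrow> real"
  assumes lim: "a \<longlonglongrightarrow> l" and \<rho>: "0 < \<rho>" "\<rho> < 1" and p: "0 < p"
  shows "ennreal (abs (l - a 0) powr p)
    \<le> ennreal ((1 / (1 - \<rho>)) powr p) * (\<Sum>j. ennreal ((abs (a j - a (Suc j)) / \<rho> ^ j) powr p))"
proof (cases "(\<Sum>j. ennreal ((abs (a j - a (Suc j)) / \<rho> ^ j) powr p)) = \<infinity>")
  case True
  then show ?thesis using \<rho> by (simp add: ennreal_mult_top)
next
  case False
  define b where "b j = (abs (a j - a (Suc j)) / \<rho> ^ j) powr p" for j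
  define M where "M = suminf b"
  have b: "summable b" unfolding b_def using False by (intro summable_suminf_not_top) auto
  have "0 \<le> M" unfolding M_def by (intro suminf_nonneg b) (simp add: b_def)
  have "abs (a j - a (Suc j)) \<le> M powr (1 / p) * \<rho> ^ j" for j
  proof -
    have "b j \<le> M" unfolding M_def using sum_le_suminf[OF b, of "{j}"] by (simp add: b_def)
    then have "b j powr (1 / p) \<le> M powr (1 / p)" using p by (intro powr_mono2) (simp_all add: b_def)
    then show ?thesis using p \<rho> by (simp add: b_def powr_powr divide_le_eq)
  qed
  then have "abs (\<Sum>j<n. a j - a (Suc j)) \<le> M powr (1 / p) * (\<Sum>j<n. \<rho> ^ j)" for n
    unfolding sum_distrib_left by (intro order_trans[OF sum_abs] sum_mono)
  also have "M powr (1 / p) * (\<Sum>j<n. \<rho> ^ j) \<le> M powr (1 / p) * (1 / (1 - \<rho>))" for n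
    using \<rho> by (intro mult_left_mono) (simp_all add: sum_gp_strict divide_right_mono)
  finally have "abs (a n - a 0) \<le> M powr (1 / p) * (1 / (1 - \<rho>))" for n
    by (simp add: sum_lessThan_telescope' abs_minus_commute[of "a n"])
  then have "abs (l - a 0) \<le> M powr (1 / p) * (1 / (1 - \<rho>))"
    by (intro LIMSEQ_le_const2[OF tendsto_rabs[OF tendsto_diff[OF lim tendsto_const]]]) blast
  then have "abs (l - a 0) powr p \<le> (M powr (1 / p) * (1 / (1 - \<rho>))) powr p" using p by (intro powr_mono2) auto
  also have "\<dots> = (1 / (1 - \<rho>)) powr p * M" using p \<open>0 \<le> M\<close> \<rho> by (simp add: powr_mult powr_powr del: mult_1_right times_divide_eq_right)
  finally have "ennreal (abs (l - a 0) powr p) \<le> ennreal ((1 / (1 - \<rho>)) powr p) * ennreal M"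
    using \<open>0 \<le> M\<close> by (simp add: ennreal_leI flip: ennreal_mult)
  also have "ennreal M = (\<Sum>j. ennreal (b j))" unfolding M_def by (intro suminf_ennreal2[symmetric] b) (simp add: b_def)
  finally show ?thesis by (simp add: b_def)
qed

abbreviation dyad :: "nat \<Rightarrow> real" where "dyad k \<equiv> (1/2) ^ k"

abbreviation davg :: "'n::finite h1 \<Rightarrow> nat \<Rightarrow> real^'n \<Rightarrow> real" where
  "davg u k \<equiv> avg (dyad k) (fn u)"

lemma sq_int_davg: "sq_int lborel (davg u k)"
  by (rule sq_int_avg(1)[OF sq_int_fn])

lemma davg_error:
  fixes u :: "'n::finite h1"
  shows "(LBINT x. (fn u x - davg u k x)^2) \<le> (dyad k)^2 * real CARD('n) * dirichlet u u"
  by (rule avg_error[OF sq_int_fn _ h1_translation_estimate dirichlet_nonneg]) simp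

lemma davg_Suc_error:
  fixes u :: "'n::finite h1"
  shows "(LBINT x. (fn u x - davg u (Suc k) x)^2) \<le> (dyad k)^2 * real CARD('n) * dirichlet u u"
proof -
  have "(dyad (Suc k))^2 * real CARD('n) * dirichlet u u \<le> (dyad k)^2 * real CARD('n) * dirichlet u u"
    using dirichlet_nonneg[of u] by (intro mult_right_mono power_mono) (auto simp: divide_simps)
  then show ?thesis using davg_error[of u "Suc k"] by (rule order_trans[rotated])
qed

text \<open>The difference of two averages of \<open>u\<close> is itself a difference of averages of \<open>u - avg u\<close>, as averages commute.\<close>
lemma davg_step_sup:
  fixes u :: "'n::finite h1"
  shows "(davg u k x - davg u (Suc k) x)^2
    \<le> (2 * real CARD('n) * (1 + 2 ^ CARD('n))) * dirichlet u u * (dyad k)^2 / dyad k ^ CARD('n)"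
proof -
  let ?s = "dyad k" and ?r = "dyad (Suc k)" and ?N = "real CARD('n)" and ?G = "dirichlet u u"
  note F = sq_int_fn[of u]
  define A where "A = avg ?s (\<lambda>x. fn u x - davg u (Suc k) x) x"
  define B where "B = avg ?r (\<lambda>x. fn u x - davg u k x) x"
  have "A = davg u k x - avg ?s (davg u (Suc k)) x" unfolding A_def by (rule avg_diff[OF F sq_int_davg]) simp
  moreover have "B = davg u (Suc k) x - avg ?r (davg u k) x" unfolding B_def by (rule avg_diff[OF F sq_int_davg]) simp
  ultimately have AB: "davg u k x - davg u (Suc k) x = A + - B" using avg_commute[OF F, of ?s ?r x] by simp
  have "A^2 \<le> (1 / ?s ^ CARD('n)) * (?s^2 * ?N * ?G)"
    unfolding A_def by (intro order_trans[OF square_avg_le mult_left_mono[OF davg_Suc_error]] sq_int_diff F sq_int_davg) simp_all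
  then have A: "A^2 \<le> (?N * ?G * ?s^2 / ?s ^ CARD('n)) * 1" by (simp add: mult_ac)
  have "B^2 \<le> (1 / ?r ^ CARD('n)) * (?s^2 * ?N * ?G)"
    unfolding B_def by (intro order_trans[OF square_avg_le mult_left_mono[OF davg_error]] sq_int_diff F sq_int_davg) simp_all
  also have "1 / ?r ^ CARD('n) = 2 ^ CARD('n) / ?s ^ CARD('n)" by (simp add: power_mult_distrib power_divide divide_simps)
  finally have B: "B^2 \<le> (?N * ?G * ?s^2 / ?s ^ CARD('n)) * 2 ^ CARD('n)" by (simp add: mult_ac)
  have "(A + - B)^2 \<le> 2 * A^2 + 2 * B^2" using square_add_le[of A "- B"] by simp
  also have "\<dots> \<le> 2 * ((?N * ?G * ?s^2 / ?s ^ CARD('n)) * 1) + 2 * ((?N * ?G * ?s^2 / ?s ^ CARD('n)) * 2 ^ CARD('n))"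
    using A B by linarith
  also have "\<dots> = (2 * ?N * (1 + 2 ^ CARD('n))) * ?G * ?s^2 / ?s ^ CARD('n)" by (simp add: field_simps)
  finally show ?thesis unfolding AB .
qed

lemma davg_step_L2:
  fixes u :: "'n::finite h1"
  shows "(LBINT x. (davg u k x - davg u (Suc k) x)^2) \<le> 4 * real CARD('n) * dirichlet u u * (dyad k)^2"
proof -
  let ?a = "\<lambda>x. fn u x - davg u (Suc k) x" and ?b = "\<lambda>x. fn u x - davg u k x"
  have int: "integrable lborel (\<lambda>x. (?a x)^2)" "integrable lborel (\<lambda>x. (?b x)^2)"
    by (intro sq_int_square_integrable sq_int_diff sq_int_fn sq_int_davg)+
  have "(davg u k x - davg u (Suc k) x)^2 \<le> 2 * (?a x)^2 + 2 * (?b x)^2" for x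
    using square_add_le[of "?a x" "- ?b x"] by (simp add: power2_commute[of "fn u x" "davg u k x"])
  then have "(LBINT x. (davg u k x - davg u (Suc k) x)^2) \<le> (LBINT x. 2 * (?a x)^2 + 2 * (?b x)^2)"
    using int by (intro integral_mono sq_int_square_integrable sq_int_diff sq_int_davg) auto
  also have "\<dots> = 2 * (LBINT x. (?a x)^2) + 2 * (LBINT x. (?b x)^2)" using int by simp
  also have "\<dots> \<le> 4 * ((dyad k)^2 * real CARD('n) * dirichlet u u)" using davg_Suc_error[of u k] davg_error[of u k] by linarith
  finally show ?thesis by (simp add: mult_ac)
qed

lemma davg_converges_AE:
  fixes u :: "'n::finite h1"
  shows "AE x in lborel. (\<lambda>k. davg u k x) \<longlonglongrightarrow> fn u x"
proof -
  have "(LBINT x. (fn u x - davg u k x)^2) \<le> real CARD('n) * dirichlet u u * (1/4) ^ k" for k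
    using davg_error[of u k] by (simp add: mult_ac power2_eq_square flip: power_mult_distrib)
  then have "AE x in lborel. summable (\<lambda>k. fn u x - davg u k x)"
    by (intro sq_int_AE_summable[of lborel _ "1/4"] sq_int_diff sq_int_fn sq_int_davg) auto
  then show ?thesis
  proof eventually_elim
    case (elim x)
    from tendsto_diff[OF tendsto_const summable_LIMSEQ_zero[OF this], of "fn u x"] show ?case by simp
  qed
qed

definition Lp_power :: "real \<Rightarrow> (real^'n \<Rightarrow> real) \<Rightarrow> ennreal" where
  "Lp_power p v = (NNBINT x. ennreal (abs (v x) powr p))"

lemma Lp_power_le_square:
  assumes v: "sq_int lborel v" and K: "\<And>x. (v x)^2 \<le> K" and p: "2 \<le> p"
  shows "Lp_power p v \<le> ennreal (K powr ((p - 2) / 2) * (LBINT x. (v x)^2))"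
proof -
  note [measurable] = sq_int_measurable[OF v, simplified]
  have "Lp_power p v \<le> (NNBINT x. ennreal (K powr ((p - 2) / 2)) * ennreal ((v x)^2))"
    unfolding Lp_power_def using abs_powr_le_square[OF K p] by (intro nn_integral_mono) (simp add: ennreal_leI flip: ennreal_mult)
  also have "\<dots> = ennreal (K powr ((p - 2) / 2) * (LBINT x. (v x)^2))"
    by (subst nn_integral_cmult) (auto simp: sq_int_nn_integral[OF v] ennreal_mult)
  finally show ?thesis .
qed

lemma Lp_power_limit_le:
  fixes v :: "nat \<Rightarrow> real^'n \<Rightarrow> real"
  assumes [measurable]: "\<And>j. v j \<in> borel_measurable borel" and lim: "AE x in lborel. (\<lambda>j. v j x) \<longlonglongrightarrow> w x"
    and p: "0 < p" and b: "0 < b" "b < 1" and c: "0 \<le> c"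
    and step: "\<And>j. Lp_power p (\<lambda>x. v j x - v (Suc j) x) \<le> ennreal (c * b ^ j)"
  shows "Lp_power p (\<lambda>x. w x - v k x) \<le> ennreal ((1 / (1 - b powr (1 / (2 * p)))) powr p * (c * b ^ k / (1 - sqrt b)))"
proof -
  define \<rho> where "\<rho> = b powr (1 / (2 * p))"
  have \<rho>: "0 < \<rho>" "\<rho> < 1" using b p powr_less_mono2[of "1 / (2 * p)" b 1] by (auto simp: \<rho>_def)
  have \<rho>_power: "(\<rho> ^ j) powr p = sqrt b ^ j" for j
    using p b by (simp add: \<rho>_def powr_half_sqrt[symmetric] powr_power powr_realpow[symmetric] powr_powr mult.commute)
  define d where "d j x = v (j + k) x - v (Suc (j + k)) x" for j x
  have "AE x in lborel. ennreal (abs (w x - v k x) powr p)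
    \<le> ennreal ((1 / (1 - \<rho>)) powr p) * (\<Sum>j. ennreal (1 / sqrt b ^ j) * ennreal (abs (d j x) powr p))" using lim
  proof eventually_elim
    case (elim x)
    from powr_diff_limit_le[OF LIMSEQ_ignore_initial_segment[OF this, of k] \<rho> p] show ?case
      using \<rho> b by (simp add: d_def powr_divide \<rho>_power flip: ennreal_mult)
  qed
  then have "Lp_power p (\<lambda>x. w x - v k x)
    \<le> (NNBINT x. ennreal ((1 / (1 - \<rho>)) powr p) * (\<Sum>j. ennreal (1 / sqrt b ^ j) * ennreal (abs (d j x) powr p)))"
    unfolding Lp_power_def by (rule nn_integral_mono_AE)
  also have "\<dots> = ennreal ((1 / (1 - \<rho>)) powr p) * (\<Sum>j. ennreal (1 / sqrt b ^ j) * Lp_power p (d j))"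
    unfolding Lp_power_def d_def by (simp add: nn_integral_cmult nn_integral_suminf)
  also have "\<dots> \<le> ennreal ((1 / (1 - \<rho>)) powr p) * (\<Sum>j. ennreal (1 / sqrt b ^ j) * ennreal (c * b ^ (j + k)))"
    unfolding d_def by (intro mult_left_mono suminf_le step) auto
  also have "(\<Sum>j. ennreal (1 / sqrt b ^ j) * ennreal (c * b ^ (j + k))) = (\<Sum>j. ennreal (c * b ^ k * sqrt b ^ j))"
  proof (intro suminf_cong)
    fix j
    have "b ^ j = sqrt b ^ j * sqrt b ^ j" using b by (simp flip: power_mult_distrib)
    then show "ennreal (1 / sqrt b ^ j) * ennreal (c * b ^ (j + k)) = ennreal (c * b ^ k * sqrt b ^ j)"
      using b c by (simp add: power_add flip: ennreal_mult)
  qed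
  also have "\<dots> = ennreal (c * b ^ k / (1 - sqrt b))"
    using b c by (subst suminf_ennreal2) (auto intro!: summable_mult summable_geometric simp: suminf_mult suminf_geometric)
  finally show ?thesis using b c by (simp add: \<rho>_def flip: ennreal_mult)
qed

definition subcritical :: "'n::finite itself \<Rightarrow> real \<Rightarrow> bool" where
  "subcritical T p \<longleftrightarrow> 2 \<le> p \<and> real CARD('n) * (p - 2) < 2 * p"

lemma subcritical_two: "subcritical T 2"
  by (simp add: subcritical_def)

lemma davg_step_Lp:
  fixes u :: "'n::finite h1"
  assumes p: "2 \<le> p"
  defines "N \<equiv> real CARD('n)"
  shows "Lp_power p (\<lambda>x. davg u k x - davg u (Suc k) x)
    \<le> ennreal ((2 * N * (1 + 2 ^ CARD('n))) powr ((p - 2) / 2) * (4 * N) * dirichlet u u powr (p / 2) * dyad k powr (p - N * (p - 2) / 2))"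
proof -
  let ?s = "dyad k" and ?G = "dirichlet u u"
  define c e where "c = 2 * N * (1 + 2 ^ CARD('n))" and "e = (p - 2) / 2"
  define K where "K = c * ?G * ?s^2 / ?s ^ CARD('n)"
  have "Lp_power p (\<lambda>x. davg u k x - davg u (Suc k) x) \<le> ennreal (K powr e * (LBINT x. (davg u k x - davg u (Suc k) x)^2))"
    unfolding e_def by (rule Lp_power_le_square[OF sq_int_diff[OF sq_int_davg sq_int_davg] _ p])
      (insert davg_step_sup[of k u], simp add: K_def c_def N_def)
  also have "\<dots> \<le> ennreal (K powr e * (4 * N * ?G * ?s^2))"
    using davg_step_L2[of k u] by (intro ennreal_leI mult_left_mono) (auto simp: N_def)
  also have "K powr e * (4 * N * ?G * ?s^2) = c powr e * (4 * N) * ?G powr (p / 2) * ?s powr (p - N * (p - 2) / 2)"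
  proof -
    have "?s^2 / ?s ^ CARD('n) = ?s powr (2 - N)" by (simp add: powr_diff powr_realpow N_def)
    then have "K = c * ?G * ?s powr (2 - N)" by (simp add: K_def flip: times_divide_eq_right)
    then have "K powr e * (4 * N * ?G * ?s^2) = c powr e * (4 * N) * (?G powr e * ?G) * (?s powr ((2 - N) * e) * ?s powr 2)"
      by (simp add: powr_mult powr_powr mult_ac)
    also have "?G powr e * ?G = ?G powr (p / 2)" unfolding e_def by (rule powr_half_mult[OF dirichlet_nonneg])
    also have "?s powr ((2 - N) * e) * ?s powr 2 = ?s powr ((2 - N) * e + 2)" by (simp add: powr_add)
    also have "(2 - N) * e + 2 = p - N * (p - 2) / 2" by (simp add: e_def field_simps)
    finally show ?thesis .
  qed
  finally show ?thesis by (simp only: c_def e_def)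
qed

abbreviation weighted_powr :: "(real^'n \<Rightarrow> real) \<Rightarrow> real \<Rightarrow> (real^'n \<Rightarrow> real) \<Rightarrow> real" where
  "weighted_powr w p v \<equiv> LBINT y. w y * abs (v y) powr p"

definition unit_weight :: "(real^'n \<Rightarrow> real) \<Rightarrow> bool" where
  "unit_weight w \<longleftrightarrow> w \<in> borel_measurable borel \<and> (\<forall>y. w y \<in> {0..1})"

lemma unit_weightD:
  assumes "unit_weight w"
  shows "w \<in> borel_measurable borel" "0 \<le> w y" "w y \<le> 1"
  using assms by (auto simp: unit_weight_def)

lemma ex_power_less:
  fixes a c q :: real
  assumes "0 < a" "0 < q" "q < 1"
  shows "\<exists>k. c * q ^ k < a"
proof -
  have "(\<lambda>k. c * q ^ k) \<longlonglongrightarrow> c * 0" using assms(2,3) by (intro tendsto_intros LIMSEQ_power_zero) simp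
  then show ?thesis using order_tendstoD(2)[of "\<lambda>k. c * q ^ k" 0 sequentially a] assms(1) eventually_sequentially by auto
qed

theorem davg_Lp_approximation:
  assumes p: "subcritical TYPE('n::finite) p" and e: "0 < e"
  shows "\<exists>k. \<forall>u::'n h1. Lp_power p (\<lambda>x. fn u x - davg u k x) \<le> ennreal (e * norm u powr p)"
proof -
  define N where "N = real CARD('n)"
  define \<beta> where "\<beta> = p - N * (p - 2) / 2"
  define q where "q = (1/2::real) powr \<beta>"
  have p2: "2 \<le> p" "0 < p" and \<beta>: "0 < \<beta>" using p by (auto simp: subcritical_def \<beta>_def N_def)
  have q: "0 < q" "q < 1" using \<beta> powr_less_mono2[of \<beta> "1/2" 1] by (auto simp: q_def)
  have dyad: "dyad j powr \<beta> = q ^ j" for j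
    unfolding q_def by (simp add: powr_power powr_realpow[symmetric] powr_powr mult.commute)
  define c where "c = (2 * N * (1 + 2 ^ CARD('n))) powr ((p - 2) / 2) * (4 * N)"
  define C where "C = (1 / (1 - q powr (1 / (2 * p)))) powr p * (c / (1 - sqrt q))"
  have c: "0 \<le> c" "0 \<le> C" using q by (simp_all add: c_def C_def N_def)
  obtain k where k: "C * q ^ k < e" using ex_power_less[OF e q] by blast
  have "Lp_power p (\<lambda>x. fn u x - davg u k x) \<le> ennreal (e * norm u powr p)" for u :: "'n h1"
  proof -
    have "Lp_power p (\<lambda>x. davg u j x - davg u (Suc j) x) \<le> ennreal (c * dirichlet u u powr (p / 2) * q ^ j)" for j
      using davg_step_Lp[OF p2(1), of j u] dyad[of j] by (simp add: c_def N_def \<beta>_def)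
    from Lp_power_limit_le[OF _ davg_converges_AE p2(2) q _ this]
    have "Lp_power p (\<lambda>x. fn u x - davg u k x) \<le> ennreal (C * q ^ k * dirichlet u u powr (p / 2))"
      using c by (simp add: C_def mult_ac)
    also have "\<dots> \<le> ennreal (e * norm u powr p)"
    proof (intro ennreal_leI mult_mono)
      have "dirichlet u u powr (p / 2) \<le> ((norm u)^2) powr (p / 2)"
        using dirichlet_le[of u] dirichlet_nonneg[of u] p2 by (intro powr_mono2) auto
      then show "dirichlet u u powr (p / 2) \<le> norm u powr p" by (simp add: square_powr_half)
    qed (insert k e, auto)
    finally show ?thesis .
  qed
  then show ?thesis by blast
qed

lemma powr_integral_if_Lp_power_le:
  assumes [measurable]: "v \<in> borel_measurable borel" and bound: "Lp_power p v \<le> ennreal c" and c: "0 \<le> c"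
  shows "integrable lborel (\<lambda>x. abs (v x) powr p)" "(LBINT x. abs (v x) powr p) \<le> c"
proof -
  have "(NNBINT x. ennreal (abs (v x) powr p)) < \<infinity>" using bound by (simp add: Lp_power_def le_less_trans less_top)
  then show "integrable lborel (\<lambda>x. abs (v x) powr p)" by (intro integrableI_bounded) auto
  then have "ennreal (LBINT x. abs (v x) powr p) = Lp_power p v"
    unfolding Lp_power_def by (intro nn_integral_eq_integral[symmetric]) auto
  then show "(LBINT x. abs (v x) powr p) \<le> c" using bound c by (metis ennreal_le_iff)
qed

lemma davg_powr_integral:
  fixes u :: "'n::finite h1"
  assumes p: "2 \<le> p" and K: "\<And>x. (davg u k x)^2 \<le> K"
  shows "integrable lborel (\<lambda>x. abs (davg u k x) powr p)"
    "(LBINT x. abs (davg u k x) powr p) \<le> K powr ((p - 2) / 2) * (norm u)^2"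
proof -
  have "(LBINT x. (davg u k x)^2) \<le> (norm u)^2" using sq_int_avg(2)[OF sq_int_fn, of "dyad k" u] l2_le[of u] by (simp add: l2_self)
  then have "ennreal (K powr ((p - 2) / 2) * (LBINT x. (davg u k x)^2)) \<le> ennreal (K powr ((p - 2) / 2) * (norm u)^2)"
    by (intro ennreal_leI mult_left_mono) simp_all
  then have "Lp_power p (davg u k) \<le> ennreal (K powr ((p - 2) / 2) * (norm u)^2)"
    using Lp_power_le_square[OF sq_int_davg K p] by (rule order_trans[rotated])
  then show "integrable lborel (\<lambda>x. abs (davg u k x) powr p)"
    "(LBINT x. abs (davg u k x) powr p) \<le> K powr ((p - 2) / 2) * (norm u)^2"
    using powr_integral_if_Lp_power_le[of "davg u k"] by simp_all
qed

lemma davg_square_le: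
  fixes u :: "'n::finite h1"
  shows "(davg u k x)^2 \<le> (1 / dyad k ^ CARD('n)) * (norm u)^2"
  by (rule order_trans[OF square_avg_le[OF sq_int_fn] mult_left_mono]) (insert l2_le[of u], simp_all add: l2_self)

theorem weighted_powr_le_davg:
  assumes p: "subcritical TYPE('n::finite) p" and e: "0 < e"
  shows "\<exists>k. \<forall>(u::'n h1) w. unit_weight w \<longrightarrow> integrable lborel (\<lambda>y. w y * abs (fn u y) powr p)
    \<and> weighted_powr w p (fn u) \<le> e * norm u powr p + 2 powr p * weighted_powr w p (davg u k)"
proof -
  have p2: "2 \<le> p" using p by (simp add: subcritical_def)
  obtain k where k: "\<And>u::'n h1. Lp_power p (\<lambda>x. fn u x - davg u k x) \<le> ennreal (e / 2 powr p * norm u powr p)"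
    using davg_Lp_approximation[OF p, of "e / 2 powr p"] e by auto
  note error = powr_integral_if_Lp_power_le[OF _ k]
  have "integrable lborel (\<lambda>y. w y * abs (fn u y) powr p)
      \<and> weighted_powr w p (fn u) \<le> e * norm u powr p + 2 powr p * weighted_powr w p (davg u k)"
    if w: "unit_weight w" for u :: "'n h1" and w
  proof
    note [measurable] = unit_weightD(1)[OF w] and w_bounds = unit_weightD(2,3)[OF w]
    let ?d = "\<lambda>y. abs (fn u y - davg u k y) powr p" and ?a = "\<lambda>y. w y * abs (davg u k y) powr p"
    have a: "integrable lborel ?a"
      by (rule Bochner_Integration.integrable_bound[OF davg_powr_integral(1)[OF p2 davg_square_le[of k u]]])
        (insert w_bounds, auto simp: abs_mult intro!: mult_left_le_one_le)
    have sum: "integrable lborel (\<lambda>y. 2 powr p * ?d y + 2 powr p * ?a y)" using error(1)[of u] e a by simp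
    have pointwise: "w y * abs (fn u y) powr p \<le> 2 powr p * ?d y + 2 powr p * ?a y" for y
      by (rule weighted_powr_le_split) (insert p2 w_bounds, auto)
    show int: "integrable lborel (\<lambda>y. w y * abs (fn u y) powr p)" by (rule Bochner_Integration.integrable_bound[OF sum])
        (insert pointwise w_bounds, auto simp: abs_mult intro: order_trans[OF _ abs_ge_self])
    have "weighted_powr w p (fn u) \<le> 2 powr p * (LBINT y. ?d y) + 2 powr p * (LBINT y. ?a y)"
      using integral_mono[OF int sum pointwise] error(1)[of u] e a by simp
    moreover have "2 powr p * (LBINT y. ?d y) \<le> e * norm u powr p" using error(2)[of u] e by (simp add: field_simps)
    ultimately show "weighted_powr w p (fn u) \<le> e * norm u powr p + 2 powr p * (LBINT y. ?a y)" by linarith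
  qed
  then show ?thesis by blast
qed

lemma fn_powr_integrable:
  assumes "subcritical TYPE('n::finite) p"
  shows "integrable lborel (\<lambda>x. abs (fn (u::'n h1) x) powr p)"
proof -
  have "unit_weight (\<lambda>y::real^'n. 1)" by (simp add: unit_weight_def)
  then have "integrable lborel (\<lambda>y. 1 * abs (fn u y) powr p)" using weighted_powr_le_davg[OF assms zero_less_one] by blast
  then show ?thesis by simp
qed

theorem sobolev_embedding:
  assumes p: "subcritical TYPE('n::finite) p"
  shows "\<exists>C\<ge>0. \<forall>u::'n h1. (LBINT x. abs (fn u x) powr p) \<le> C * norm u powr p"
proof -
  have p2: "2 \<le> p" using p by (simp add: subcritical_def)
  obtain k where bound: "\<And>(u::'n h1) w. unit_weight w
      \<Longrightarrow> weighted_powr w p (fn u) \<le> 1 * norm u powr p + 2 powr p * weighted_powr w p (davg u k)"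
    using weighted_powr_le_davg[OF p zero_less_one] by blast
  define S where "S = (1 / dyad k ^ CARD('n)) powr ((p - 2) / 2)"
  have "(LBINT x. abs (fn u x) powr p) \<le> (1 + 2 powr p * S) * norm u powr p" for u :: "'n h1"
  proof -
    have "(LBINT x. abs (davg u k x) powr p) \<le> (1 / dyad k ^ CARD('n) * (norm u)^2) powr ((p - 2) / 2) * (norm u)^2"
      by (rule davg_powr_integral(2)[OF p2 davg_square_le])
    also have "\<dots> = S * norm u powr p"
      using powr_half_mult[of "(norm u)^2" p] square_powr_half[of "norm u" p] by (simp only: S_def powr_mult mult.assoc) simp
    finally have "2 powr p * (LBINT x. abs (davg u k x) powr p) \<le> 2 powr p * (S * norm u powr p)" by (intro mult_left_mono) simp_all
    moreover have "(LBINT x. abs (fn u x) powr p) \<le> norm u powr p + 2 powr p * (LBINT x. abs (davg u k x) powr p)"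
      using bound[of "\<lambda>_. 1" u] by (simp add: unit_weight_def)
    ultimately show ?thesis unfolding distrib_right mult_1 mult.assoc by linarith
  qed
  then show ?thesis by (intro exI[of _ "1 + 2 powr p * S"]) (simp add: S_def)
qed

lemma AE_scaled:
  fixes x :: "real^'n"
  assumes "AE y in lborel. P y" and s: "0 < s"
  shows "AE h in cube_measure. P (x + s *\<^sub>R h)"
proof -
  obtain N where N: "\<And>y. y \<in> space lborel - N \<Longrightarrow> P y" "N \<in> null_sets lborel" using AE_E3[OF assms(1)] by blast
  have [measurable]: "N \<in> sets borel" using null_setsD2[OF N(2)] by simp
  have "(\<integral>\<^sup>+h. indicator N (x + s *\<^sub>R h) \<partial>cube_measure) \<le> ennreal (1 / s ^ CARD('n)) * (NNBINT y. indicator N y * indicator UNIV y)"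
    by (rule nn_integral_cube_le) (insert s, auto)
  then have "(\<integral>\<^sup>+h. indicator N (x + s *\<^sub>R h) \<partial>cube_measure) = 0" using null_setsD1[OF N(2)] by simp
  then have "AE h in cube_measure. (indicator N (x + s *\<^sub>R h) :: ennreal) = 0" by (subst (asm) nn_integral_0_iff_AE) auto
  then show ?thesis
  proof eventually_elim
    case (elim h)
    then show ?case using N(1) by (auto simp: indicator_def split: if_splits)
  qed
qed

lemma avg_cong_AE:
  assumes "AE y in lborel. u y = v y" "0 < s" and [measurable]: "u \<in> borel_measurable borel" "v \<in> borel_measurable borel"
  shows "avg s u x = avg s v x"
  unfolding avg_def by (rule integral_cong_AE) (insert AE_scaled[OF assms(1,2), of x], auto)

lemma bounded_linear_davg: "bounded_linear (\<lambda>u::'n::finite h1. davg u k x)"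
proof (rule bounded_linear_intro)
  fix u v :: "'n h1" and r
  have int: "integrable cube_measure (\<lambda>h. fn w (x + dyad k *\<^sub>R h))" for w :: "'n h1" by (rule integrable_cube_scaled[OF sq_int_fn]) simp
  have "davg (u + v) k x = avg (dyad k) (\<lambda>y. fn u y + fn v y) x" by (rule avg_cong_AE[OF fn_add]) auto
  then show "davg (u + v) k x = davg u k x + davg v k x" using int by (simp add: avg_def)
  have "davg (r *\<^sub>R u) k x = avg (dyad k) (\<lambda>y. r * fn u y) x" by (rule avg_cong_AE[OF fn_scale]) auto
  then show "davg (r *\<^sub>R u) k x = r *\<^sub>R davg u k x" by (simp add: avg_def)
  have "abs (davg u k x) \<le> sqrt ((1 / dyad k ^ CARD('n)) * (norm u)^2)"
    using davg_square_le[of k u x] by (intro real_le_rsqrt) simp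
  then show "norm (davg u k x) \<le> norm u * sqrt (1 / dyad k ^ CARD('n))"
    by (simp only: real_sqrt_mult real_sqrt_abs abs_norm_cancel real_norm_def mult.commute)
qed

lemma ex_powr_less:
  fixes a c e :: real
  assumes "0 < a" "0 < e"
  shows "\<exists>\<rho>>0. c * \<rho> powr e < a"
proof -
  have "((\<lambda>\<rho>. c * \<rho> powr e) \<longlongrightarrow> c * 0 powr e) (at_right 0)"
    using assms(2) by (intro tendsto_mult tendsto_const tendsto_powr' tendsto_ident_at)
      (auto intro!: eventually_mono[OF eventually_at_right_less[of 0]])
  then have "\<forall>\<^sub>F \<rho> in at_right 0. c * \<rho> powr e < a" by (rule order_tendstoD(2)) (insert assms(1), simp)
  then have "\<forall>\<^sub>F \<rho> in at_right 0. 0 < \<rho> \<and> c * \<rho> powr e < a"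
    using eventually_at_right_less by (rule eventually_elim2) simp
  then show ?thesis using eventually_happens'[OF trivial_limit_at_right_real] by blast
qed

lemma weighted_davg_tendsto_0:
  fixes X :: "nat \<Rightarrow> 'n::finite h1"
  assumes p: "0 < p" and X: "X \<rightharpoonup> 0" "\<And>n. norm (X n) \<le> R"
    and w: "unit_weight w" "integrable lborel w"
  shows "(\<lambda>n. weighted_powr w p (davg (X n) k)) \<longlonglongrightarrow> 0"
proof -
  note [measurable] = unit_weightD(1)[OF w(1)]
  define K where "K = (1 / dyad k ^ CARD('n)) * R^2"
  have K: "(davg (X n) k y)^2 \<le> K" for n y
    using order_trans[OF davg_square_le mult_left_mono[OF power_mono[OF X(2)[of n] norm_ge_zero, of 2]]] by (simp add: K_def)
  have "(\<lambda>n. weighted_powr w p (davg (X n) k)) \<longlonglongrightarrow> (\<integral>y. 0 \<partial>(lborel :: (real^'n) measure))"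
  proof (rule integral_dominated_convergence[where w="\<lambda>y. w y * K powr (p / 2)"])
    show "integrable lborel (\<lambda>y. w y * K powr (p / 2))" using w(2) by simp
    have "(\<lambda>n. w y * abs (davg (X n) k y) powr p) \<longlonglongrightarrow> w y * abs (davg (0 :: 'n h1) k y) powr p" for y
      using weakly_convergesD[OF X(1) bounded_linear_davg[of k y]] p by (intro tendsto_mult tendsto_const tendsto_powr' tendsto_rabs) auto
    moreover have "davg (0 :: 'n h1) k y = 0" for y by (rule linear_0[OF bounded_linear.linear[OF bounded_linear_davg]])
    ultimately show "AE y in lborel. (\<lambda>n. w y * abs (davg (X n) k y) powr p) \<longlonglongrightarrow> 0" by simp
    have "abs (davg (X n) k y) powr p \<le> K powr (p / 2)" for n y
      using powr_mono2[OF _ _ K[of n y], of "p / 2"] p by (simp add: square_powr_half)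
    then show "AE y in lborel. norm (w y * abs (davg (X n) k y) powr p) \<le> w y * K powr (p / 2)" for n
      using unit_weightD[OF w(1)] by (auto simp: abs_mult intro!: mult_left_mono)
  qed measurable
  then show ?thesis by simp
qed

lemma weighted_powr_less_davg:
  assumes p: "subcritical TYPE('n::finite) p" and e: "0 < e"
  shows "\<exists>k. \<forall>(u::'n h1) w. norm u \<le> R \<longrightarrow> unit_weight w
    \<longrightarrow> weighted_powr w p (fn u) < e + 2 powr p * weighted_powr w p (davg u k)"
proof -
  define d where "d = e / (R powr p + 1)"
  have d: "0 < d" "d * R powr p < e" using e add_nonneg_pos[OF powr_ge_zero[of R p] zero_less_one] by (simp_all add: d_def divide_less_eq)
  obtain k where k: "\<And>(u::'n h1) w. unit_weight w
      \<Longrightarrow> weighted_powr w p (fn u) \<le> d * norm u powr p + 2 powr p * weighted_powr w p (davg u k)"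
    using weighted_powr_le_davg[OF p d(1)] by blast
  have "d * norm u powr p < e" if "norm u \<le> R" for u :: "'n h1"
    using that p d by (intro le_less_trans[OF mult_left_mono[OF powr_mono2] d(2)]) (auto simp: subcritical_def)
  then show ?thesis using k by (meson add_strict_right_mono le_less_trans)
qed

lemma rellich_null:
  fixes X :: "nat \<Rightarrow> 'n::finite h1"
  assumes p: "subcritical TYPE('n) p" and X: "X \<rightharpoonup> 0" "\<And>n. norm (X n) \<le> R"
    and w: "unit_weight w" "integrable lborel w"
  shows "integrable lborel (\<lambda>y. w y * abs (fn (X n) y) powr p)" "(\<lambda>n. weighted_powr w p (fn (X n))) \<longlonglongrightarrow> 0"
proof -
  show "integrable lborel (\<lambda>y. w y * abs (fn (X n) y) powr p)" for n
    using weighted_powr_le_davg[OF p zero_less_one] w(1) by blast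
  show "(\<lambda>n. weighted_powr w p (fn (X n))) \<longlonglongrightarrow> 0"
  proof (rule order_tendstoI)
    show "\<forall>\<^sub>F n in sequentially. e < weighted_powr w p (fn (X n))" if "e < 0" for e
      using less_le_trans[OF that] unit_weightD(2)[OF w(1)] by simp
    fix e :: real assume e: "0 < e"
    obtain k where k: "\<And>n. weighted_powr w p (fn (X n)) < e / 2 + 2 powr p * weighted_powr w p (davg (X n) k)"
      using weighted_powr_less_davg[OF p half_gt_zero[OF e], of R] X(2) w(1) by blast
    have "(\<lambda>n. 2 powr p * weighted_powr w p (davg (X n) k)) \<longlonglongrightarrow> 2 powr p * 0"
      using p by (intro tendsto_intros weighted_davg_tendsto_0[OF _ X w]) (simp add: subcritical_def)
    then have "\<forall>\<^sub>F n in sequentially. 2 powr p * weighted_powr w p (davg (X n) k) < e / 2"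
      by (rule order_tendstoD(2)) (insert e, simp)
    then show "\<forall>\<^sub>F n in sequentially. weighted_powr w p (fn (X n)) < e"
    proof eventually_elim
      case (elim n)
      then show ?case using k[of n] by linarith
    qed
  qed
qed

theorem rellich:
  fixes X :: "nat \<Rightarrow> 'n::finite h1"
  assumes p: "subcritical TYPE('n) p" and X: "X \<rightharpoonup> x" "\<And>n. norm (X n) \<le> R"
    and w: "unit_weight w" "integrable lborel w"
  shows "integrable lborel (\<lambda>y. w y * abs (fn (X n) y - fn x y) powr p)"
    "(\<lambda>n. weighted_powr w p (\<lambda>y. fn (X n) y - fn x y)) \<longlonglongrightarrow> 0"
proof -
  note [measurable] = unit_weightD(1)[OF w(1)]
  have weak: "(\<lambda>n. X n - x) \<rightharpoonup> 0"
    using weakly_converges_diff[OF X(1) tendsto_imp_weakly_converges[OF tendsto_const[of x]]] by simp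
  have bound: "norm (X n - x) \<le> R + norm x" for n using norm_triangle_ineq4[of "X n" x] X(2)[of n] by linarith
  have AE: "AE y in lborel. w y * abs (fn (X n) y - fn x y) powr p = w y * abs (fn (X n - x) y) powr p" for n
    using fn_diff[of "X n" x] by eventually_elim simp
  show "integrable lborel (\<lambda>y. w y * abs (fn (X n) y - fn x y) powr p)" for n
    using rellich_null(1)[OF p weak bound w] by (subst integrable_cong_AE[OF _ _ AE]) auto
  have "weighted_powr w p (\<lambda>y. fn (X n) y - fn x y) = weighted_powr w p (fn (X n - x))" for n
    by (rule integral_cong_AE[OF _ _ AE]) auto
  then show "(\<lambda>n. weighted_powr w p (\<lambda>y. fn (X n) y - fn x y)) \<longlonglongrightarrow> 0"
    using rellich_null(2)[OF p weak bound w] by simp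
qed

text \<open>Otherwise the averages at a fixed fine scale are uniformly small, and with them the \<open>L\<^sup>p\<close> norm.\<close>
theorem nonvanishing:
  assumes p: "subcritical TYPE('n::finite) p" and p2: "2 < p" and \<delta>: "0 < \<delta>"
  shows "\<exists>\<eta>>0. \<forall>u::'n h1. norm u \<le> R \<longrightarrow> \<delta> \<le> (LBINT x. abs (fn u x) powr p) \<longrightarrow> (\<exists>x. \<eta> \<le> mass {y. y - x \<in> cube} (fn u))"
proof -
  obtain k where k: "\<And>(u::'n h1) w. norm u \<le> R \<Longrightarrow> unit_weight w
      \<Longrightarrow> weighted_powr w p (fn u) < \<delta> / 2 + 2 powr p * weighted_powr w p (davg u k)"
    using weighted_powr_less_davg[OF p half_gt_zero[OF \<delta>]] by blast
  define S where "S = 1 / dyad k ^ CARD('n)"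
  have S: "0 < S" by (simp add: S_def)
  obtain \<rho> where \<rho>: "0 < \<rho>" "2 powr p * R^2 * \<rho> powr ((p - 2) / 2) < \<delta> / 2"
    using ex_powr_less[of "\<delta> / 2" "(p - 2) / 2"] \<delta> p2 by auto
  define \<eta> where "\<eta> = \<rho> / S"
  have \<eta>: "0 < \<eta>" "S * \<eta> = \<rho>" using \<rho>(1) S by (simp_all add: \<eta>_def)
  have "\<exists>x. \<eta> \<le> mass {y. y - x \<in> cube} (fn u)"
    if R: "norm u \<le> R" and u: "\<delta> \<le> (LBINT x. abs (fn u x) powr p)" for u :: "'n h1"
  proof (rule ccontr)
    assume "\<not> ?thesis"
    then have small: "mass {y. y - x \<in> cube} (fn u) < \<eta>" for x by (simp add: not_le)
    have "(davg u k x)^2 \<le> \<rho>" for x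
    proof -
      have "(davg u k x)^2 \<le> S * mass {y. y - x \<in> cube} (fn u)"
        unfolding S_def by (rule square_avg_le_mass(1)[OF sq_int_fn]) (auto simp: mem_cube intro!: mult_le_one power_le_one)
      also have "\<dots> \<le> \<rho>" using small[of x] S unfolding \<eta>(2)[symmetric] by (intro mult_left_mono) auto
      finally show ?thesis .
    qed
    then have "(LBINT x. abs (davg u k x) powr p) \<le> \<rho> powr ((p - 2) / 2) * (norm u)^2"
      using p2 by (intro davg_powr_integral(2)) auto
    also have "\<dots> \<le> \<rho> powr ((p - 2) / 2) * R^2" using R by (intro mult_left_mono power_mono) simp_all
    finally have "2 powr p * (LBINT x. abs (davg u k x) powr p) \<le> 2 powr p * R^2 * \<rho> powr ((p - 2) / 2)"
      by (simp add: mult_left_mono mult_ac)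
    moreover have "(LBINT x. abs (fn u x) powr p) < \<delta> / 2 + 2 powr p * (LBINT x. abs (davg u k x) powr p)"
      using k[OF R, of "\<lambda>_. 1"] by (simp add: unit_weight_def)
    ultimately show False using \<rho>(2) u by linarith
  qed
  then show ?thesis using \<eta>(1) by blast
qed

section \<open>The nonlinearity\<close>

lemma quadratic_comparison:
  fixes f F :: "real \<Rightarrow> real"
  assumes deriv: "\<And>t. (F has_real_derivative f t) (at t)" and mono: "strict_mono_on {0<..} (\<lambda>t. f t / t)"
    and s: "0 < s" and z: "0 < z"
  shows "F s + f s / s * (z^2 - s^2) / 2 \<le> F z" "z \<noteq> s \<Longrightarrow> F s + f s / s * (z^2 - s^2) / 2 < F z"
proof -
  define g where "g x = F x - f s / s * x^2 / 2" for x
  have dg: "(g has_real_derivative (f x - f s / s * x)) (at x)" for x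
    unfolding g_def by (rule derivative_eq_intros deriv | simp)+
  have cont: "continuous_on A g" for A using dg DERIV_isCont continuous_at_imp_continuous_on by blast
  have factor: "f x - f s / s * x = x * (f x / x - f s / s)" if "0 < x" for x using that by (simp add: field_simps)
  have less: "g s < g z" if "z \<noteq> s"
  proof (cases "s < z")
    case True
    then show ?thesis
    proof (rule DERIV_pos_imp_increasing_open)
      fix x assume x: "s < x" "x < z"
      have "0 < f x - f s / s * x" using strict_mono_onD[OF mono, of s x] factor[of x] s x by simp
      then show "\<exists>y. (g has_real_derivative y) (at x) \<and> 0 < y" using dg by blast
    qed (rule cont)
  next
    case False
    then have "z < s" using that by simp
    then show ?thesis
    proof (rule DERIV_neg_imp_decreasing_open)
      fix x assume x: "z < x" "x < s"
      have "f x - f s / s * x < 0" using strict_mono_onD[OF mono, of x s] factor[of x] s z x by (simp add: mult_pos_neg)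
      then show "\<exists>y. (g has_real_derivative y) (at x) \<and> y < 0" using dg by blast
    qed (rule cont)
  qed
  have iff: "F s + f s / s * (z^2 - s^2) / 2 \<le> F z \<longleftrightarrow> g s \<le> g z" "F s + f s / s * (z^2 - s^2) / 2 < F z \<longleftrightarrow> g s < g z"
    by (auto simp: g_def right_diff_distrib diff_divide_distrib)
  show "F s + f s / s * (z^2 - s^2) / 2 \<le> F z" unfolding iff using less by (cases "z = s") auto
  show "z \<noteq> s \<Longrightarrow> F s + f s / s * (z^2 - s^2) / 2 < F z" unfolding iff by (rule less)
qed

lemma primitive_lower_bound_pos:
  fixes f F :: "real \<Rightarrow> real"
  assumes deriv: "\<And>t. (F has_real_derivative f t) (at t)" and mono: "strict_mono_on {0<..} (\<lambda>t. f t / t)"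
    and F: "\<And>z. 0 \<le> F z" "\<And>s. 0 < s \<Longrightarrow> F s \<le> f s * s / 2" and f: "\<And>s. 0 < s \<Longrightarrow> 0 < f s"
    and s: "0 < s" and t: "0 \<le> t"
  shows "F s + f s * (t * z - (t^2 + 1) * s / 2) \<le> F z"
proof (cases "0 < z")
  case True
  have "2 * s * (t * z - (t^2 + 1) * s / 2) = z^2 - s^2 - (t * s - z)^2" by (simp add: power2_eq_square field_simps)
  then have "2 * s * (t * z - (t^2 + 1) * s / 2) \<le> z^2 - s^2" by simp
  then have "t * z - (t^2 + 1) * s / 2 \<le> (z^2 - s^2) / (2 * s)" using s by (simp add: field_simps)
  then have "f s * (t * z - (t^2 + 1) * s / 2) \<le> f s * ((z^2 - s^2) / (2 * s))" using f[OF s] by (intro mult_left_mono) auto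
  also have "\<dots> = f s / s * (z^2 - s^2) / 2" by simp
  finally show ?thesis using quadratic_comparison(1)[OF deriv mono s True] by linarith
next
  case False
  then have "t * z \<le> 0" "0 \<le> t^2 * s" using s t by (simp_all add: mult_nonneg_nonpos)
  then have "t * z - (t^2 + 1) * s / 2 \<le> - (s / 2)" by (simp add: field_simps)
  then have "f s * (t * z - (t^2 + 1) * s / 2) \<le> f s * (- (s / 2))" using f[OF s] by (intro mult_left_mono) auto
  then show ?thesis using F(2)[OF s] F(1)[of z] by simp
qed

lemma abs_powr_diff_1_mult: "abs t powr (p - 1) * abs t = abs t powr p" for t :: real
  using powr_add[of "abs t" "p - 1" 1] by (cases "t = 0") auto

locale nonlinearity =
  fixes f :: "real \<Rightarrow> real" and p \<theta> :: real
  assumes f_cont: "continuous_on UNIV f"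
    and f_at_0: "((\<lambda>t. f t / t) \<longlongrightarrow> 0) (at 0)"
    and p: "2 < p" and f_at_infinity: "\<exists>C R. \<forall>t. R \<le> abs t \<longrightarrow> abs (f t) \<le> C * abs t powr (p - 1)"
    and f_mono: "strict_mono_on {0<..} (\<lambda>t. f t / t)" "strict_antimono_on {..<0} (\<lambda>t. f t / t)"
    and theta: "2 < \<theta>" and f_superquadratic: "\<And>t. t \<noteq> 0 \<Longrightarrow> 0 < \<theta> * prim f t \<and> \<theta> * prim f t \<le> f t * t"
begin

abbreviation F where "F \<equiv> prim f"

lemma f_isCont: "isCont f t"
  using f_cont by (simp add: continuous_on_eq_continuous_at)

lemma f_measurable [measurable]: "f \<in> borel_measurable borel"
  by (rule borel_measurable_continuous_onI[OF f_cont])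

lemma F_deriv: "(F has_real_derivative f t) (at t)"
proof -
  define M where "M = abs t + 1"
  have M: "- M < t" "t < M" "0 < M" by (auto simp: M_def)
  have cont: "continuous_on S f" for S using f_cont continuous_on_subset by blast
  have int: "f integrable_on {a..b}" for a b by (intro integrable_continuous_real cont)
  have F_eq: "F s = integral {- M..s} f - integral {- M..0} f" if "s \<in> {- M<..<M}" for s
    using Henstock_Kurzweil_Integration.integral_combine[of "- M" 0 s f]
      Henstock_Kurzweil_Integration.integral_combine[of "- M" s 0 f] int that M by (cases "0 \<le> s") (simp_all add: prim_def)
  have "((\<lambda>x. integral {- M..x} f) has_real_derivative f t) (at t within {- M..M})"
    by (rule integral_has_real_derivative[OF cont]) (insert M, auto)
  then have "((\<lambda>x. integral {- M..x} f - integral {- M..0} f) has_real_derivative f t) (at t)"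
    using M by (auto simp: at_within_Icc_at intro!: derivative_eq_intros)
  then show ?thesis
    by (rule has_field_derivative_transform_within_open[where S="{- M<..<M}"]) (insert M F_eq, auto)
qed

lemma F_isCont: "isCont F t"
  using F_deriv DERIV_isCont by blast

lemma F_measurable [measurable]: "F \<in> borel_measurable borel"
  by (rule borel_measurable_continuous_onI) (simp add: F_isCont continuous_at_imp_continuous_on)

lemma F_0: "F 0 = 0"
  by (simp add: prim_def)

lemma F_pos: "t \<noteq> 0 \<Longrightarrow> 0 < F t"
  using theta f_superquadratic[of t] by (simp add: zero_less_mult_iff)

lemma F_nonneg: "0 \<le> F t"
  using F_pos[of t] F_0 by (cases "t = 0") auto

lemma f_0: "f 0 = 0"
proof -
  have "((\<lambda>t. f t / t * t) \<longlongrightarrow> 0 * 0) (at 0)" by (intro tendsto_mult f_at_0 tendsto_ident_at)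
  moreover have "\<forall>\<^sub>F t in at 0. f t / t * t = f t" by (auto simp: eventually_at_filter)
  ultimately have "(f \<longlongrightarrow> 0) (at 0)" using Lim_transform_eventually by fastforce
  moreover have "(f \<longlongrightarrow> f 0) (at 0)" using f_isCont[of 0] by (simp add: isCont_def)
  ultimately show ?thesis using tendsto_unique[of "at (0::real)" f] by fastforce
qed

lemma theta_F_le: "\<theta> * F t \<le> f t * t"
  using f_superquadratic[of t] F_0 by (cases "t = 0") auto

lemma f_mult_pos: "t \<noteq> 0 \<Longrightarrow> 0 < f t * t"
  using f_superquadratic[of t] by linarith

lemma f_mult_nonneg: "0 \<le> f t * t"
  using f_mult_pos[of t] by (cases "t = 0") auto

lemma f_mult_abs: "f t * t = abs (f t) * abs t"
  using f_mult_nonneg[of t] by (simp add: abs_mult[symmetric])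

lemma F_less_half: "t \<noteq> 0 \<Longrightarrow> F t < f t * t / 2"
proof -
  assume "t \<noteq> 0"
  then have "2 * F t < \<theta> * F t" using theta F_pos[of t] by simp
  then show ?thesis using theta_F_le[of t] by simp
qed

lemma F_le_half: "F t \<le> f t * t / 2"
  using F_less_half[of t] F_0 by (cases "t = 0") auto

lemma F_le: "F t \<le> f t * t"
  using F_le_half[of t] f_mult_nonneg[of t] by linarith

lemma reflected:
  "((\<lambda>t. F (- t)) has_real_derivative - f (- t)) (at t)" "strict_mono_on {0<..} (\<lambda>t. - f (- t) / t)"
proof -
  have "((\<lambda>t. F (- t)) has_real_derivative f (- t) * (- 1)) (at t)"
    by (rule DERIV_chain2[where f=F and g=uminus, OF F_deriv]) (auto intro!: derivative_eq_intros)
  then show "((\<lambda>t. F (- t)) has_real_derivative - f (- t)) (at t)" by simp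
  show "strict_mono_on {0<..} (\<lambda>t. - f (- t) / t)"
  proof (rule strict_mono_onI)
    fix r s :: real assume "r \<in> {0<..}" "s \<in> {0<..}" "r < s"
    then have "f (- r) / (- r) < f (- s) / (- s)" using monotone_onD[OF f_mono(2), of "- s" "- r"] by simp
    then show "- f (- r) / r < - f (- s) / s" by simp
  qed
qed

theorem F_lower_bound:
  assumes t: "0 \<le> t"
  shows "F s + f s * (t * z - (t^2 + 1) * s / 2) \<le> F z"
proof -
  consider "s = 0" | "0 < s" | "0 < - s" by linarith
  then show ?thesis
  proof cases
    assume "s = 0"
    then show ?thesis using F_nonneg[of z] by (simp add: F_0 f_0)
  next
    assume s: "0 < s"
    have "0 < f r" if "0 < r" for r using f_mult_pos[of r] that by (auto simp: zero_less_mult_iff)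
    then show ?thesis by (intro primitive_lower_bound_pos[OF F_deriv f_mono(1) F_nonneg F_le_half _ s t])
  next
    assume s: "0 < - s"
    have "0 < - f (- r)" if "0 < r" for r using f_mult_pos[of "- r"] that by (auto simp: mult_less_0_iff)
    then have "F (- (- s)) + - f (- (- s)) * (t * (- z) - (t^2 + 1) * (- s) / 2) \<le> F (- (- z))"
      using F_le_half[of "- _"] by (intro primitive_lower_bound_pos[OF reflected F_nonneg _ _ s t]) simp_all
    then show ?thesis by (simp add: algebra_simps)
  qed
qed

lemma F_scaling_less:
  assumes t: "0 \<le> t" "t \<noteq> 1" and s: "s \<noteq> 0"
  shows "F s + (t^2 - 1) / 2 * (f s * s) < F (t * s)"
proof (cases "t = 0")
  case True
  then show ?thesis using F_less_half[OF s] F_0 by simp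
next
  case False
  then have t0: "0 < t" using t by simp
  have quadratic: "c / s * ((t * s)^2 - s^2) / 2 = (t^2 - 1) / 2 * (c * s)" if "s \<noteq> 0" for c s :: real
    using that by (simp add: power2_eq_square field_simps)
  consider "0 < s" | "0 < - s" using s by linarith
  then show ?thesis
  proof cases
    assume s: "0 < s"
    then show ?thesis using quadratic_comparison(2)[OF F_deriv f_mono(1), of s "t * s"] t0 t quadratic[of s "f s"] by simp
  next
    assume s: "0 < - s"
    then show ?thesis
      using quadratic_comparison(2)[OF reflected s mult_pos_pos[OF t0 s]] t0 t quadratic[of "- s" "- f s"] by simp
  qed
qed

lemma F_superhomogeneous:
  assumes r: "1 \<le> r"
  shows "r powr \<theta> * F t \<le> F (r * t)"
proof -
  have "F (1 * t) * 1 powr (- \<theta>) \<le> F (r * t) * r powr (- \<theta>)"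
  proof (rule DERIV_nonneg_imp_nondecreasing[OF r])
    fix x :: real assume x: "1 \<le> x" "x \<le> r"
    have "((\<lambda>x. F (x * t)) has_real_derivative f (x * t) * t) (at x)"
      by (rule DERIV_chain2[OF F_deriv]) (auto intro!: derivative_eq_intros)
    moreover have "((\<lambda>x. x powr (- \<theta>)) has_real_derivative - \<theta> * x powr (- \<theta> - 1)) (at x)"
      using x by (intro DERIV_powr[OF DERIV_ident, of x "\<lambda>_. - \<theta>" 0, THEN DERIV_cong]) (auto simp: powr_diff)
    ultimately have "((\<lambda>x. F (x * t) * x powr (- \<theta>)) has_real_derivative
        f (x * t) * t * x powr (- \<theta>) + - \<theta> * x powr (- \<theta> - 1) * F (x * t)) (at x)" by (rule DERIV_mult)
    moreover have "0 \<le> f (x * t) * t * x powr (- \<theta>) + - \<theta> * x powr (- \<theta> - 1) * F (x * t)"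
    proof -
      have "x powr (- \<theta>) = x powr (- \<theta> - 1) * x" using x powr_add[of x "- \<theta> - 1" 1] by simp
      moreover have "0 \<le> x powr (- \<theta> - 1) * (f (x * t) * (x * t) - \<theta> * F (x * t))" using theta_F_le[of "x * t"] by simp
      ultimately show ?thesis by (simp add: algebra_simps)
    qed
    ultimately show "\<exists>y. ((\<lambda>x. F (x * t) * x powr (- \<theta>)) has_real_derivative y) (at x) \<and> 0 \<le> y" by blast
  qed
  then have "F t * r powr \<theta> \<le> F (r * t) * r powr (- \<theta>) * r powr \<theta>" by (intro mult_right_mono) auto
  also have "\<dots> = F (r * t)" using r by (simp add: powr_minus mult.assoc)
  finally show ?thesis by (simp add: mult.commute)
qed

lemma f_growth:
  assumes e: "0 < e"
  shows "\<exists>C\<ge>0. \<forall>t. abs (f t) \<le> e * abs t + C * abs t powr (p - 1)"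
proof -
  obtain \<delta> where \<delta>: "0 < \<delta>" "\<And>t. t \<noteq> 0 \<Longrightarrow> abs t < \<delta> \<Longrightarrow> abs (f t / t) < e" using LIM_D[OF f_at_0 e] by auto
  obtain C R where CR: "\<And>t. R \<le> abs t \<Longrightarrow> abs (f t) \<le> C * abs t powr (p - 1)" using f_at_infinity by blast
  have "compact (f ` {-abs R..(abs R)})" by (intro compact_continuous_image continuous_on_subset[OF f_cont]) auto
  then obtain M where M: "\<forall>t\<in>{-abs R..(abs R)}. abs (f t) \<le> M" by (auto dest!: compact_imp_bounded simp: bounded_iff)
  define D where "D = max (abs C) (abs M / \<delta> powr (p - 1))"
  have "abs (f t) \<le> e * abs t + D * abs t powr (p - 1)" for t
  proof -
    consider "t = 0" | "t \<noteq> 0" "abs t < \<delta>" | "R \<le> abs t" | "\<delta> \<le> abs t" "t \<in> {-abs R..(abs R)}" unfolding atLeastAtMost_iff by linarith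
    then show ?thesis
    proof cases
      assume "t \<noteq> 0" "abs t < \<delta>"
      then have "abs (f t) \<le> e * abs t" using \<delta>(2)[of t] by (simp add: field_simps)
      then show ?thesis by (simp add: D_def add_increasing2)
    next
      assume "R \<le> abs t"
      then have "abs (f t) \<le> C * abs t powr (p - 1)" by (rule CR)
      also have "\<dots> \<le> D * abs t powr (p - 1)" unfolding D_def by (intro mult_right_mono) auto
      finally show ?thesis using e by (simp add: add_increasing)
    next
      assume t: "\<delta> \<le> abs t" "t \<in> {-abs R..(abs R)}"
      have "abs (f t) \<le> abs M / \<delta> powr (p - 1) * \<delta> powr (p - 1)" using bspec[OF M t(2)] \<delta>(1) by simp
      also have "\<dots> \<le> D * abs t powr (p - 1)" unfolding D_def using t(1) \<delta>(1) p by (intro mult_mono powr_mono2) auto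
      finally show ?thesis using e by (simp add: add_increasing)
    qed (simp add: f_0)
  qed
  then show ?thesis by (intro exI[of _ D]) (auto simp: D_def)
qed

lemma f_mult_growth:
  assumes e: "0 < e"
  shows "\<exists>C\<ge>0. \<forall>t. f t * t \<le> e * t^2 + C * abs t powr p"
proof -
  obtain C where C: "0 \<le> C" "\<And>t. abs (f t) \<le> e * abs t + C * abs t powr (p - 1)" using f_growth[OF e] by blast
  have "f t * t \<le> (e * abs t + C * abs t powr (p - 1)) * abs t" for t unfolding f_mult_abs by (intro mult_right_mono C) auto
  also have "(e * abs t + C * abs t powr (p - 1)) * abs t = e * t^2 + C * abs t powr p" for t
    by (simp add: distrib_right mult.assoc abs_powr_diff_1_mult flip: power2_eq_square)
  finally show ?thesis using C(1) by blast
qed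

lemma f_mult_Young: "\<exists>C\<ge>0. \<forall>t h. abs (f t * h) \<le> f t * t + (h^2 + C * abs h powr p)"
proof -
  obtain C where C: "0 \<le> C" "\<And>t. abs (f t) \<le> 1 * abs t + C * abs t powr (p - 1)" using f_growth[of 1] by auto
  have "abs (f t * h) \<le> f t * t + (h^2 + C * abs h powr p)" for t h
  proof (cases "abs h \<le> abs t")
    case True
    then have "abs (f t * h) \<le> f t * t" unfolding f_mult_abs abs_mult by (intro mult_left_mono) auto
    moreover have "0 \<le> h^2 + C * abs h powr p" using C(1) by simp
    ultimately show ?thesis by linarith
  next
    case False
    then have "C * abs t powr (p - 1) \<le> C * abs h powr (p - 1)" using p C(1) by (intro mult_left_mono powr_mono2) auto
    then have "abs (f t) * abs h \<le> (abs h + C * abs h powr (p - 1)) * abs h" using C(2)[of t] False by (intro mult_right_mono) auto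
    also have "\<dots> = h^2 + C * abs h powr p" by (simp add: distrib_right mult.assoc abs_powr_diff_1_mult flip: power2_eq_square)
    finally show ?thesis using f_mult_nonneg[of t] by (simp add: abs_mult)
  qed
  then show ?thesis using C(1) by blast
qed

end

lemma tendsto_if_subseqs_have_tendsto_subseq:
  fixes X :: "nat \<Rightarrow> 'a::metric_space"
  assumes "\<And>r :: nat \<Rightarrow> nat. strict_mono r \<Longrightarrow> \<exists>s :: nat \<Rightarrow> nat. strict_mono s \<and> (\<lambda>n. X (r (s n))) \<longlonglongrightarrow> L"
  shows "X \<longlonglongrightarrow> L"
proof (rule tendstoI, rule ccontr)
  fix e :: real assume e: "0 < e" and "\<not> (\<forall>\<^sub>F n in sequentially. dist (X n) L < e)"
  then obtain r :: "nat \<Rightarrow> nat" where r: "strict_mono r" "\<And>n. \<not> dist (X (r n)) L < e" using not_eventually_sequentiallyD by blast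
  obtain s :: "nat \<Rightarrow> nat" where "(\<lambda>n. X (r (s n))) \<longlonglongrightarrow> L" using assms[OF r(1)] by blast
  from tendstoD[OF this e] show False using r(2) by simp
qed

lemma weak_limit_AE_subseq:
  fixes X :: "nat \<Rightarrow> 'n::finite h1"
  assumes X: "X \<rightharpoonup> x" "\<And>n. norm (X n) \<le> R"
  shows "\<exists>r. strict_mono r \<and> (AE y in lborel. (\<lambda>n. fn (X (r n)) y) \<longlonglongrightarrow> fn x y)"
proof -
  obtain w :: "real^'n \<Rightarrow> real" where w: "w \<in> borel_measurable lborel" "\<And>y. 0 < w y" "\<And>y. w y \<le> 1" "integrable lborel w"
    using sigma_finite_measure.obtain_positive_integrable_function[OF sigma_finite_lborel] by metis
  have "unit_weight w" using w by (simp add: unit_weight_def less_imp_le)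
  note rellich = rellich[OF _ X this w(4), of 2]
  have "\<exists>r. strict_mono r \<and> (AE y in lborel. (\<lambda>n. w y * abs (fn (X (r n)) y - fn x y) powr 2) \<longlonglongrightarrow> 0)"
    by (rule tendsto_L1_AE_subseq) (insert rellich w(2), simp_all add: subcritical_def abs_mult less_imp_le)
  then obtain r where r: "strict_mono r" and lim: "AE y in lborel. (\<lambda>n. w y * abs (fn (X (r n)) y - fn x y) powr 2) \<longlonglongrightarrow> 0" by blast
  from lim have "AE y in lborel. (\<lambda>n. fn (X (r n)) y) \<longlonglongrightarrow> fn x y"
  proof eventually_elim
    case (elim y)
    then have "(\<lambda>n. (1 / w y) * (w y * abs (fn (X (r n)) y - fn x y) powr 2)) \<longlonglongrightarrow> (1 / w y) * 0" by (intro tendsto_intros)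
    then have "(\<lambda>n. (fn (X (r n)) y - fn x y)^2) \<longlonglongrightarrow> 0" using w(2)[of y] by simp
    then have "(\<lambda>n. sqrt ((fn (X (r n)) y - fn x y)^2)) \<longlonglongrightarrow> sqrt 0" by (rule tendsto_real_sqrt)
    then show ?case by (simp add: tendsto_rabs_zero_iff Lim_null[of _ "fn x y"])
  qed
  then show ?thesis using r by blast
qed

lemma almost_dominated_convergence:
  fixes a g :: "nat \<Rightarrow> 'a \<Rightarrow> real"
  assumes a: "\<And>n. integrable M (a n)" "\<And>n x. 0 \<le> a n x"
    and g: "\<And>n. integrable M (g n)" "\<And>n x. 0 \<le> g n x" "\<And>n. (\<integral>x. g n x \<partial>M) \<le> D"
    and lim: "AE x in M. (\<lambda>n. a n x) \<longlonglongrightarrow> 0"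
    and dominated: "\<And>\<delta>. 0 < \<delta> \<Longrightarrow> \<exists>H. integrable M H \<and> (\<forall>n x. a n x \<le> \<delta> * g n x + H x)"
  shows "(\<lambda>n. \<integral>x. a n x \<partial>M) \<longlonglongrightarrow> 0"
proof (rule order_tendstoI)
  show "\<forall>\<^sub>F n in sequentially. e < (\<integral>x. a n x \<partial>M)" if "e < 0" for e
    using less_le_trans[OF that] a(2) by simp
  fix e :: real assume e: "0 < e"
  define \<delta> where "\<delta> = e / (2 * (abs D + 1))"
  have \<delta>: "0 < \<delta>" "\<delta> * (abs D + 1) = e / 2" using e by (simp_all add: \<delta>_def field_simps add_pos_nonneg)
  obtain H where H: "integrable M H" "\<And>n x. a n x \<le> \<delta> * g n x + H x" using dominated[OF \<delta>(1)] by blast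
  define r where "r n x = max 0 (a n x - \<delta> * g n x)" for n x
  have r: "integrable M (r n)" "0 \<le> r n x" "r n x \<le> a n x" "r n x \<le> abs (H x)" for n x
    using a g(1,2) H(2)[of n x] \<delta>(1) by (auto simp: r_def[abs_def] intro!: mult_nonneg_nonneg less_imp_le)
  have "(\<lambda>n. \<integral>x. r n x \<partial>M) \<longlonglongrightarrow> (\<integral>x. 0 \<partial>M)"
  proof (rule integral_dominated_convergence[where w="\<lambda>x. abs (H x)"])
    show "AE x in M. (\<lambda>n. r n x) \<longlonglongrightarrow> 0"
      using lim by eventually_elim (rule Lim_null_comparison[OF always_eventually], use r(2,3) in auto)
  qed (insert H(1) r, auto)
  then have "\<forall>\<^sub>F n in sequentially. (\<integral>x. r n x \<partial>M) < e / 2" by (rule order_tendstoD(2)) (insert e, simp)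
  then show "\<forall>\<^sub>F n in sequentially. (\<integral>x. a n x \<partial>M) < e"
  proof eventually_elim
    case (elim n)
    have "(\<integral>x. a n x \<partial>M) \<le> (\<integral>x. r n x + \<delta> * g n x \<partial>M)" by (rule integral_mono) (insert a r(1) g(1), auto simp: r_def)
    also have "\<dots> = (\<integral>x. r n x \<partial>M) + \<delta> * (\<integral>x. g n x \<partial>M)" using r(1) g(1) by simp
    also have "\<delta> * (\<integral>x. g n x \<partial>M) \<le> \<delta> * (abs D + 1)" using g(3)[of n] \<delta>(1) by (intro mult_left_mono) auto
    finally show ?case using elim \<delta>(2) by simp
  qed
qed

locale nonlinear_functional = nonlinearity f p \<theta> for f p \<theta> +
  fixes k0 k1 :: real and dim :: "'n::finite itself"
  assumes p_subcritical: "subcritical TYPE('n) p" and k0: "0 < k0"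
begin

definition coefficients :: "(real^'n \<Rightarrow> real) set" where
  "coefficients = {K \<in> borel_measurable borel. \<forall>x. k0 \<le> K x \<and> K x \<le> k1}"

lemma coefficientsD:
  assumes "K \<in> coefficients"
  shows "K \<in> borel_measurable borel" "k0 \<le> K x" "K x \<le> k1" "0 < K x" "0 \<le> K x" "0 < k1"
  using assms k0 unfolding coefficients_def by (auto intro: less_le_trans order_trans less_imp_le)

definition weighted_integral :: "(real^'n \<Rightarrow> real) \<Rightarrow> (real^'n \<Rightarrow> real) \<Rightarrow> real" where
  "weighted_integral K g = (LBINT x. K x * g x)"

definition Phi :: "(real^'n \<Rightarrow> real) \<Rightarrow> 'n h1 \<Rightarrow> real" where
  "Phi K u = weighted_integral K (\<lambda>x. F (fn u x))"

definition phi :: "(real^'n \<Rightarrow> real) \<Rightarrow> 'n h1 \<Rightarrow> 'n h1 \<Rightarrow> real" where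
  "phi K u h = weighted_integral K (\<lambda>x. f (fn u x) * fn h x)"

lemma fn_powr_integrable' [simp]: "integrable lborel (\<lambda>x. abs (fn (u :: 'n h1) x) powr p)"
  by (rule fn_powr_integrable[OF p_subcritical])

lemma fn_square_integrable [simp]: "integrable lborel (\<lambda>x. (fn (u :: 'n h1) x)^2)"
  by (rule sq_int_square_integrable[OF sq_int_fn])

lemma f_mult_fn_integrable [simp]: "integrable lborel (\<lambda>x. f (fn u x) * fn h x)" for u h :: "'n h1"
proof -
  obtain C where C: "\<And>t. f t * t \<le> 1 * t^2 + C * abs t powr p" using f_mult_growth[of 1] by auto
  obtain D where D: "\<And>t h. abs (f t * h) \<le> f t * t + (h^2 + D * abs h powr p)" using f_mult_Young by blast
  have "abs (f t * h) \<le> abs (1 * t^2 + C * abs t powr p + (h^2 + D * abs h powr p))" for t h using C[of t] D[of t h] by linarith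
  then show ?thesis
    by (intro Bochner_Integration.integrable_bound[where g="\<lambda>x. f (fn u x) * fn h x"
        and f="\<lambda>x. 1 * (fn u x)^2 + C * abs (fn u x) powr p + ((fn h x)^2 + D * abs (fn h x) powr p)"])
      auto
qed

lemma F_integrable [simp]: "integrable lborel (\<lambda>x. F (fn u x))" for u :: "'n h1"
  by (rule Bochner_Integration.integrable_bound[OF f_mult_fn_integrable[of u u]]) (insert F_le F_nonneg f_mult_nonneg, auto)

lemma weighted_integral_cmult: "weighted_integral K (\<lambda>x. c * g x) = c * weighted_integral K g"
  unfolding weighted_integral_def by (subst mult.left_commute) simp

definition sobolev_const :: real where
  "sobolev_const = (SOME S. 0 \<le> S \<and> (\<forall>u::'n h1. (LBINT x. abs (fn u x) powr p) \<le> S * norm u powr p))"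

lemma sobolev_const:
  "0 \<le> sobolev_const" "(LBINT x. abs (fn u x) powr p) \<le> sobolev_const * norm u powr p" for u :: "'n h1"
  using someI_ex[OF sobolev_embedding[OF p_subcritical]] by (auto simp: sobolev_const_def)

context
  fixes K assumes K: "K \<in> coefficients"
begin

lemma weighted_integrable:
  assumes g: "integrable lborel g"
  shows "integrable lborel (\<lambda>x. K x * g x)"
  by (rule Bochner_Integration.integrable_bound[OF integrable_mult_right[OF g, of k1]])
    (insert coefficientsD[OF K] g, auto simp: abs_mult less_imp_le intro!: mult_right_mono borel_measurable_integrable)

lemma weighted_integral_add:
  "integrable lborel g \<Longrightarrow> integrable lborel h
    \<Longrightarrow> weighted_integral K (\<lambda>x. g x + h x) = weighted_integral K g + weighted_integral K h"
  by (simp add: weighted_integral_def distrib_left weighted_integrable)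

lemma weighted_integral_mono:
  assumes "integrable lborel g" "integrable lborel h" and pointwise: "AE x in lborel. g x \<le> h x"
  shows "weighted_integral K g \<le> weighted_integral K h"
  unfolding weighted_integral_def
  by (intro integral_mono_AE weighted_integrable assms) (rule eventually_mono[OF pointwise], simp add: mult_left_mono coefficientsD(5)[OF K])

lemma weighted_integral_cong:
  assumes [measurable]: "g \<in> borel_measurable borel" "h \<in> borel_measurable borel"
    and eq: "AE x in lborel. g x = h x"
  shows "weighted_integral K g = weighted_integral K h"
  unfolding weighted_integral_def using coefficientsD(1)[OF K] eq by (intro integral_cong_AE) (auto elim: eventually_mono)

lemma weighted_integral_nonneg: "(\<And>x. 0 \<le> g x) \<Longrightarrow> 0 \<le> weighted_integral K g"
  by (simp add: weighted_integral_def coefficientsD(5)[OF K])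

lemma weighted_integral_pos:
  assumes g: "integrable lborel g" "\<And>x. 0 \<le> g x" and pos: "\<not> (AE x in lborel. g x = 0)"
  shows "0 < weighted_integral K g"
proof -
  have "(LBINT x. K x * g x) = 0 \<longleftrightarrow> (AE x in lborel. K x * g x = 0)"
    using g(2) coefficientsD(5)[OF K] by (intro integral_nonneg_eq_0_iff_AE weighted_integrable[OF g(1)]) simp
  moreover have "K x \<noteq> 0" for x using coefficientsD(4)[OF K, of x] by simp
  ultimately show ?thesis using weighted_integral_nonneg[OF g(2)] pos by (auto simp: weighted_integral_def less_le)
qed

lemma weighted_integral_le:
  assumes g: "integrable lborel g" "\<And>x. 0 \<le> g x"
  shows "weighted_integral K g \<le> k1 * (LBINT x. g x)"
  unfolding weighted_integral_def integral_mult_right_zero[symmetric]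
  by (intro integral_mono weighted_integrable integrable_mult_right g mult_right_mono coefficientsD(3)[OF K])

lemma phi_linear: "linear (phi K u)"
proof (rule linearI)
  show "phi K u (g + h) = phi K u g + phi K u h" for g h
    unfolding phi_def weighted_integral_add[OF f_mult_fn_integrable f_mult_fn_integrable, symmetric]
    by (rule weighted_integral_cong) (insert fn_add[of g h], auto simp: distrib_left elim!: eventually_mono)
  show "phi K u (r *\<^sub>R h) = r *\<^sub>R phi K u h" for r h
    unfolding phi_def real_scaleR_def weighted_integral_cmult[symmetric]
    by (rule weighted_integral_cong) (insert fn_scale[of r h], auto elim!: eventually_mono)
qed

lemma weighted_integral_power_le:
  assumes e: "0 \<le> e" and C: "0 \<le> C"
  shows "weighted_integral K (\<lambda>x. e * (fn u x)^2 + C * abs (fn u x) powr p)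
      \<le> k1 * (e * (norm u)^2 + C * (LBINT x. abs (fn u x) powr p))"
    "weighted_integral K (\<lambda>x. e * (fn u x)^2 + C * abs (fn u x) powr p)
      \<le> k1 * (e * (norm u)^2 + C * (sobolev_const * norm u powr p))"
proof -
  have k1: "0 \<le> k1" using coefficientsD(6)[OF K] by simp
  have "weighted_integral K (\<lambda>x. e * (fn u x)^2 + C * abs (fn u x) powr p) \<le> k1 * (LBINT x. e * (fn u x)^2 + C * abs (fn u x) powr p)"
    using e C by (intro weighted_integral_le) auto
  also have "\<dots> = k1 * (e * l2 u u + C * (LBINT x. abs (fn u x) powr p))" by (simp add: l2_self)
  also have "\<dots> \<le> k1 * (e * (norm u)^2 + C * (LBINT x. abs (fn u x) powr p))"
    using e k1 by (intro mult_left_mono add_right_mono l2_le)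
  finally show "weighted_integral K (\<lambda>x. e * (fn u x)^2 + C * abs (fn u x) powr p)
    \<le> k1 * (e * (norm u)^2 + C * (LBINT x. abs (fn u x) powr p))" .
  also have "\<dots> \<le> k1 * (e * (norm u)^2 + C * (sobolev_const * norm u powr p))"
    using C k1 by (intro mult_left_mono add_left_mono sobolev_const)
  finally show "weighted_integral K (\<lambda>x. e * (fn u x)^2 + C * abs (fn u x) powr p)
    \<le> k1 * (e * (norm u)^2 + C * (sobolev_const * norm u powr p))" .
qed

lemma Phi_lower_bound:
  assumes t: "0 \<le> t"
  shows "Phi K u + (t^2 - 1) / 2 * phi K u u + t * phi K u v \<le> Phi K (t *\<^sub>R u + v)"
proof -
  note int = F_integrable f_mult_fn_integrable
  have "Phi K u + (t^2 - 1) / 2 * phi K u u + t * phi K u v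
    = weighted_integral K (\<lambda>x. F (fn u x) + (t^2 - 1) / 2 * (f (fn u x) * fn u x) + t * (f (fn u x) * fn v x))"
    unfolding Phi_def phi_def
    by (simp only: weighted_integral_add weighted_integral_cmult int integrable_mult_right Bochner_Integration.integrable_add)
  also have "\<dots> \<le> Phi K (t *\<^sub>R u + v)" unfolding Phi_def
  proof (rule weighted_integral_mono)
    show "AE x in lborel. F (fn u x) + (t^2 - 1) / 2 * (f (fn u x) * fn u x) + t * (f (fn u x) * fn v x) \<le> F (fn (t *\<^sub>R u + v) x)"
      using fn_add[of "t *\<^sub>R u" v] fn_scale[of t u]
    proof eventually_elim
      case (elim x)
      then show ?case using F_lower_bound[OF t, of "fn u x" "fn (t *\<^sub>R u + v) x"] by (simp add: power2_eq_square field_simps)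
    qed
  qed simp_all
  finally show ?thesis .
qed

lemma Phi_scaling_less:
  assumes t: "0 \<le> t" "t \<noteq> 1" and u: "u \<noteq> 0"
  shows "Phi K u + (t^2 - 1) / 2 * phi K u u < Phi K (t *\<^sub>R u)"
proof -
  let ?g = "\<lambda>x. F (t * fn u x) + (- 1 * F (fn u x) + (- ((t^2 - 1) / 2)) * (f (fn u x) * fn u x))"
  have AE: "AE x in lborel. F (fn (t *\<^sub>R u) x) = F (t * fn u x)" using fn_scale[of t u] by eventually_elim simp
  have int: "integrable lborel (\<lambda>x. F (t * fn u x))" using F_integrable[of "t *\<^sub>R u"] by (subst integrable_cong_AE[OF _ _ AE, symmetric]) auto
  have pos: "0 < ?g x" if "fn u x \<noteq> 0" for x using F_scaling_less[OF t that] by simp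
  have "0 < weighted_integral K ?g"
  proof (rule weighted_integral_pos)
    show "integrable lborel ?g" using int F_integrable f_mult_fn_integrable by simp
    show "0 \<le> ?g x" for x using pos[of x] by (cases "fn u x = 0") (auto simp: F_0)
    show "\<not> (AE x in lborel. ?g x = 0)"
    proof
      assume "AE x in lborel. ?g x = 0"
      then have "AE x in lborel. fn u x = 0" by eventually_elim (insert pos, force)
      then show False using u by (simp add: fn_zero_iff)
    qed
  qed
  also have "weighted_integral K ?g = Phi K (t *\<^sub>R u) - (Phi K u + (t^2 - 1) / 2 * phi K u u)"
    unfolding Phi_def phi_def weighted_integral_cong[OF _ _ AE, simplified]
    using int F_integrable[of u] f_mult_fn_integrable[of u u]
    by (simp only: weighted_integral_add weighted_integral_cmult integrable_mult_right Bochner_Integration.integrable_add)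
  finally show ?thesis by simp
qed

lemma theta_Phi_le: "\<theta> * Phi K u \<le> phi K u u"
  unfolding Phi_def phi_def weighted_integral_cmult[symmetric]
  by (intro weighted_integral_mono integrable_mult_right F_integrable f_mult_fn_integrable AE_I2 theta_F_le)

lemma Phi_zero:
  shows "Phi K 0 = 0"
proof -
  have "Phi K 0 = weighted_integral K (\<lambda>x. 0)"
    unfolding Phi_def by (rule weighted_integral_cong) (insert fn_zero, auto simp: F_0 elim!: eventually_mono)
  then show ?thesis by (simp add: weighted_integral_def)
qed

lemma Phi_pos:
  assumes u: "u \<noteq> 0"
  shows "0 < Phi K u"
  unfolding Phi_def
proof (rule weighted_integral_pos[OF F_integrable F_nonneg])
  have "F t = 0 \<longleftrightarrow> t = 0" for t using F_pos[of t] F_0 by (cases "t = 0") auto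
  then show "\<not> (AE x in lborel. F (fn u x) = 0)" using u by (simp add: fn_zero_iff)
qed

lemma Phi_growth:
  assumes r: "1 \<le> r"
  shows "r powr \<theta> * Phi K u \<le> Phi K (r *\<^sub>R u)"
  unfolding Phi_def weighted_integral_cmult[symmetric]
proof (rule weighted_integral_mono)
  show "AE x in lborel. r powr \<theta> * F (fn u x) \<le> F (fn (r *\<^sub>R u) x)"
    using fn_scale[of r u] by eventually_elim (simp add: F_superhomogeneous[OF r])
qed (simp_all add: F_integrable)

end

lemma phi_self_bounded: "\<exists>D. \<forall>K\<in>coefficients. \<forall>u. norm u \<le> R \<longrightarrow> phi K u u \<le> D"
proof -
  obtain C where C: "0 \<le> C" "\<And>t. f t * t \<le> 1 * t^2 + C * abs t powr p" using f_mult_growth[of 1] by auto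
  have "phi K u u \<le> k1 * (1 * R^2 + C * (sobolev_const * R powr p))" if K: "K \<in> coefficients" and R: "norm u \<le> R" for K u
  proof -
    have "phi K u u \<le> weighted_integral K (\<lambda>x. 1 * (fn u x)^2 + C * abs (fn u x) powr p)"
      unfolding phi_def using C(2) by (intro weighted_integral_mono[OF K]) auto
    also have "\<dots> \<le> k1 * (1 * (norm u)^2 + C * (sobolev_const * norm u powr p))"
      by (rule weighted_integral_power_le(2)[OF K zero_le_one C(1)])
    also have "\<dots> \<le> k1 * (1 * R^2 + C * (sobolev_const * R powr p))"
      using R C(1) sobolev_const(1) p coefficientsD(6)[OF K] by (intro mult_left_mono add_mono power_mono powr_mono2) simp_all
    finally show ?thesis .
  qed
  then show ?thesis by blast
qed

lemma phi_coercive: "\<exists>C\<ge>0. \<forall>K\<in>coefficients. \<forall>u h. phi K u u \<le> D \<longrightarrow> abs (phi K u h) \<le> C * norm h"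
proof -
  obtain c where c: "0 \<le> c" "\<And>t h. abs (f t * h) \<le> f t * t + (1 * h^2 + c * abs h powr p)" using f_mult_Young by auto
  define C where "C = abs D + abs k1 * (1 + c * sobolev_const)"
  have unit: "phi K u h \<le> C" if K: "K \<in> coefficients" and D: "phi K u u \<le> D" and h: "norm h = 1" for K u h
  proof -
    have "phi K u h \<le> weighted_integral K (\<lambda>x. f (fn u x) * fn u x + (1 * (fn h x)^2 + c * abs (fn h x) powr p))"
      unfolding phi_def using c(2) by (intro weighted_integral_mono[OF K]) (auto simp: abs_le_iff)
    also have "\<dots> = phi K u u + weighted_integral K (\<lambda>x. 1 * (fn h x)^2 + c * abs (fn h x) powr p)"
      unfolding phi_def by (rule weighted_integral_add[OF K]) simp_all
    also have "\<dots> \<le> abs D + k1 * (1 + c * sobolev_const)"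
      using D weighted_integral_power_le(2)[OF K zero_le_one c(1), of h] h by (intro add_mono) auto
    also have "\<dots> \<le> C" using sobolev_const(1) c(1) by (simp add: C_def mult_right_mono)
    finally show ?thesis .
  qed
  have "abs (phi K u h) \<le> C * norm h" if K: "K \<in> coefficients" and D: "phi K u u \<le> D" for K u h
  proof (cases "h = 0")
    case False
    note lin = phi_linear[OF K, of u]
    have "phi K u (s *\<^sub>R sgn h) \<le> C" if "abs s = 1" for s by (rule unit[OF K D]) (simp add: norm_sgn False that)
    from this[of 1] this[of "-1"] have "abs (phi K u (sgn h)) \<le> C" by (simp add: linear_neg[OF lin])
    then show ?thesis using False by (simp add: sgn_div_norm linear_scale[OF lin] abs_mult field_simps)
  qed (simp add: linear_0[OF phi_linear[OF K]])
  moreover have "0 \<le> C" using c sobolev_const(1) by (simp add: C_def)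
  ultimately show ?thesis by blast
qed

lemma Phi_small:
  assumes e: "0 < e"
  shows "\<exists>\<rho>>0. \<forall>K\<in>coefficients. \<forall>u. norm u \<le> \<rho> \<longrightarrow> Phi K u \<le> e * (norm u)^2"
proof -
  define k where "k = abs k1 + 1"
  define d where "d = e / (2 * k)"
  have k: "0 < k" "k1 \<le> k" by (simp_all add: k_def)
  have d: "0 < d" "k * d = e / 2" using e k by (simp_all add: d_def)
  obtain C where C: "0 \<le> C" "\<And>t. f t * t \<le> d * t^2 + C * abs t powr p" using f_mult_growth[OF d(1)] by blast
  obtain \<rho> where \<rho>: "0 < \<rho>" "k * (C * sobolev_const) * \<rho> powr (p - 2) < e / 2" using ex_powr_less[of "e / 2" "p - 2"] e p by auto
  have "Phi K u \<le> e * (norm u)^2" if K: "K \<in> coefficients" and u: "norm u \<le> \<rho>" for K u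
  proof -
    have "norm u powr p \<le> \<rho> powr (p - 2) * (norm u)^2"
    proof (cases "u = 0")
      case False
      then have "norm u powr p = norm u powr (p - 2) * (norm u)^2" using powr_add[of "norm u" "p - 2" 2] by simp
      also have "\<dots> \<le> \<rho> powr (p - 2) * (norm u)^2" using u p by (intro mult_right_mono powr_mono2) auto
      finally show ?thesis .
    qed simp
    then have small: "k * (C * sobolev_const) * norm u powr p \<le> k * (C * sobolev_const) * (\<rho> powr (p - 2) * (norm u)^2)" using k C(1) sobolev_const(1) by (intro mult_left_mono) auto
    have "Phi K u \<le> weighted_integral K (\<lambda>x. d * (fn u x)^2 + C * abs (fn u x) powr p)"
      unfolding Phi_def using order_trans[OF F_le C(2)]
      by (intro weighted_integral_mono[OF K]) auto
    also have "\<dots> \<le> k1 * (d * (norm u)^2 + C * (sobolev_const * norm u powr p))" 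
      by (rule weighted_integral_power_le(2)[OF K less_imp_le[OF d(1)] C(1)])
    also have "\<dots> \<le> k * (d * (norm u)^2 + C * (sobolev_const * norm u powr p))" using k(2) d C(1) sobolev_const(1) by (intro mult_right_mono) auto
    also have "\<dots> = k * d * (norm u)^2 + k * (C * sobolev_const) * norm u powr p" by (simp add: algebra_simps)
    also have "\<dots> \<le> e / 2 * (norm u)^2 + k * (C * sobolev_const) * \<rho> powr (p - 2) * (norm u)^2" using small unfolding d(2) mult.assoc by (rule add_left_mono)
    also have "\<dots> \<le> e / 2 * (norm u)^2 + e / 2 * (norm u)^2" using \<rho>(2) by (intro add_left_mono mult_right_mono) auto
    finally show ?thesis by simp
  qed
  then show ?thesis using \<rho>(1) by blast
qed

lemma f_mult_almost_dominated:
  fixes h :: "'n h1"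
  assumes \<delta>: "0 < \<delta>"
  shows "\<exists>H. integrable lborel H \<and> (\<forall>k t y. 0 \<le> k \<longrightarrow> k \<le> k1 \<longrightarrow> abs (k * (f t * fn h y)) \<le> \<delta> * (k * (f t * t)) + H y)"
proof -
  obtain C where C: "\<And>t h. abs (f t * h) \<le> f t * t + (h^2 + C * abs h powr p)" using f_mult_Young by blast
  let ?b = "\<lambda>y. abs ((fn h y / \<delta>)^2 + C * abs (fn h y / \<delta>) powr p)"
  have "abs (k * (f t * fn h y)) \<le> \<delta> * (k * (f t * t)) + k1 * (\<delta> * ?b y)" if k: "0 \<le> k" "k \<le> k1" for k t y
  proof -
    have "abs (f t * fn h y) = \<delta> * abs (f t * (fn h y / \<delta>))" using \<delta> by (simp add: abs_mult)
    also have "\<dots> \<le> \<delta> * (f t * t + ?b y)" using \<delta> by (intro mult_left_mono order_trans[OF C add_left_mono]) auto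
    finally have "k * abs (f t * fn h y) \<le> k * (\<delta> * (f t * t + ?b y))" using k(1) by (rule mult_left_mono)
    also have "\<dots> = \<delta> * (k * (f t * t)) + k * (\<delta> * ?b y)" by (simp only: distrib_left mult.left_commute)
    also have "\<dots> \<le> \<delta> * (k * (f t * t)) + k1 * (\<delta> * ?b y)" using k \<delta> by (intro add_left_mono mult_right_mono) auto
    finally show ?thesis using k(1) by (simp add: abs_mult)
  qed
  moreover have "integrable lborel (\<lambda>y. k1 * (\<delta> * ?b y))"
    using \<delta> fn_powr_integrable'[of h] fn_square_integrable[of h] by (simp add: power_divide powr_divide)
  ultimately show ?thesis by (intro exI[of _ "\<lambda>y. k1 * (\<delta> * ?b y)"]) blast
qed

lemma phi_tendsto_AE:
  fixes Ks :: "nat \<Rightarrow> real^'n \<Rightarrow> real"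
  assumes X: "AE y in lborel. (\<lambda>n. fn (X n) y) \<longlonglongrightarrow> fn x y" "\<And>n. norm (X n) \<le> R"
    and Ks: "\<And>n. Ks n \<in> coefficients" and K: "K \<in> coefficients" and lim: "\<And>y. (\<lambda>n. Ks n y) \<longlonglongrightarrow> K y"
  shows "(\<lambda>n. phi (Ks n) (X n) h) \<longlonglongrightarrow> phi K x h"
proof -
  let ?a = "\<lambda>n y. abs (Ks n y * (f (fn (X n) y) * fn h y) - K y * (f (fn x y) * fn h y))"
  let ?g = "\<lambda>n y. Ks n y * (f (fn (X n) y) * fn (X n) y)"
  note int = weighted_integrable[OF Ks f_mult_fn_integrable] weighted_integrable[OF K f_mult_fn_integrable]
  note [measurable] = coefficientsD(1)[OF Ks] coefficientsD(1)[OF K]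
  obtain D where D: "\<And>n. phi (Ks n) (X n) (X n) \<le> D" using phi_self_bounded[of R] Ks X(2) by metis
  have "(\<lambda>n. LBINT y. ?a n y) \<longlonglongrightarrow> 0"
  proof (rule almost_dominated_convergence[where g="?g" and D=D])
    show "AE y in lborel. (\<lambda>n. ?a n y) \<longlonglongrightarrow> 0" using X(1)
    proof eventually_elim
      case (elim y)
      have "(\<lambda>n. ?a n y) \<longlonglongrightarrow> abs (K y * (f (fn x y) * fn h y) - K y * (f (fn x y) * fn h y))"
        by (intro tendsto_intros lim isCont_tendsto_compose[OF f_isCont elim])
      then show ?case by simp
    qed
    fix \<delta> :: real assume \<delta>: "0 < \<delta>"
    obtain H where H: "integrable lborel H" "\<And>k t y. 0 \<le> k \<Longrightarrow> k \<le> k1 \<Longrightarrow> abs (k * (f t * fn h y)) \<le> \<delta> * (k * (f t * t)) + H y"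
      using f_mult_almost_dominated[OF \<delta>, of h] by blast
    have "?a n y \<le> \<delta> * ?g n y + (H y + abs (K y * (f (fn x y) * fn h y)))" for n y
      using H(2)[OF coefficientsD(5,3)[OF Ks], of n y "fn (X n) y" y] by linarith
    moreover have "integrable lborel (\<lambda>y. H y + abs (K y * (f (fn x y) * fn h y)))" using H(1) int(2)[of x h] by simp
    ultimately show "\<exists>H. integrable lborel H \<and> (\<forall>n y. ?a n y \<le> \<delta> * ?g n y + H y)"
      by (intro exI[of _ "\<lambda>y. H y + abs (K y * (f (fn x y) * fn h y))"]) blast
  qed (insert int D coefficientsD(5)[OF Ks] f_mult_nonneg, auto simp: phi_def weighted_integral_def)
  then have "(\<lambda>n. phi (Ks n) (X n) h - phi K x h) \<longlonglongrightarrow> 0"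
  proof (rule Lim_null_comparison[rotated], intro always_eventually allI)
    fix n
    have "phi (Ks n) (X n) h - phi K x h = (LBINT y. Ks n y * (f (fn (X n) y) * fn h y) - K y * (f (fn x y) * fn h y))"
      unfolding phi_def weighted_integral_def using int by simp
    then show "norm (phi (Ks n) (X n) h - phi K x h) \<le> (LBINT y. ?a n y)" by (simp only: real_norm_def integral_abs_bound)
  qed
  then show ?thesis using Lim_null by blast
qed

theorem phi_weakly_continuous:
  fixes Ks :: "nat \<Rightarrow> real^'n \<Rightarrow> real"
  assumes X: "X \<rightharpoonup> x" "\<And>n. norm (X n) \<le> R"
    and Ks: "\<And>n. Ks n \<in> coefficients" and K: "K \<in> coefficients" and lim: "\<And>y. (\<lambda>n. Ks n y) \<longlonglongrightarrow> K y"
  shows "(\<lambda>n. phi (Ks n) (X n) h) \<longlonglongrightarrow> phi K x h"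
proof (rule tendsto_if_subseqs_have_tendsto_subseq)
  fix r :: "nat \<Rightarrow> nat" assume r: "strict_mono r"
  obtain s where s: "strict_mono s" and AE: "AE y in lborel. (\<lambda>n. fn ((X \<circ> r) (s n)) y) \<longlonglongrightarrow> fn x y"
    using weak_limit_AE_subseq[OF weakly_converges_subseq[OF X(1) r], of R] X(2) by auto
  have "(\<lambda>n. phi (Ks (r (s n))) ((X \<circ> r) (s n)) h) \<longlonglongrightarrow> phi K x h"
    by (rule phi_tendsto_AE[OF AE _ Ks K])
      (insert X(2) LIMSEQ_subseq_LIMSEQ[OF lim strict_mono_o[OF r s]], simp_all add: o_def)
  then show "\<exists>s. strict_mono s \<and> (\<lambda>n. phi (Ks (r (s n))) (X (r (s n))) h) \<longlonglongrightarrow> phi K x h" using s by auto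
qed

lemma weighted_integral_Fatou:
  fixes Ks :: "nat \<Rightarrow> real^'n \<Rightarrow> real" and G :: "real \<Rightarrow> real"
  assumes X: "X \<rightharpoonup> x" "\<And>n. norm (X n) \<le> R"
    and Ks: "\<And>n. Ks n \<in> coefficients" and K: "K \<in> coefficients" and lim: "\<And>y. (\<lambda>n. Ks n y) \<longlonglongrightarrow> K y"
    and G: "\<And>t. 0 \<le> G t" "\<And>t. isCont G t" "\<And>u :: 'n h1. integrable lborel (\<lambda>y. G (fn u y))"
    and bound: "\<And>n. weighted_integral (Ks n) (\<lambda>y. G (fn (X n) y)) \<le> c n" and c: "c \<longlonglongrightarrow> c0"
  shows "weighted_integral K (\<lambda>y. G (fn x y)) \<le> c0"
proof -
  obtain s where s: "strict_mono s" and AE: "AE y in lborel. (\<lambda>n. fn (X (s n)) y) \<longlonglongrightarrow> fn x y" using weak_limit_AE_subseq[OF X] by blast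
  note [measurable] = coefficientsD(1)[OF Ks] coefficientsD(1)[OF K]
  have [measurable]: "G \<in> borel_measurable borel" using G(2) by (intro borel_measurable_continuous_onI) (simp add: continuous_at_imp_continuous_on)
  have nn: "(NNBINT y. ennreal (L y * G (fn u y))) = ennreal (weighted_integral L (\<lambda>y. G (fn u y)))"
    if L: "L \<in> coefficients" for L and u :: "'n h1"
    unfolding weighted_integral_def by (rule nn_integral_eq_integral[OF weighted_integrable[OF L G(3)]]) (insert G(1) coefficientsD(5)[OF L], auto)
  have "ennreal (weighted_integral K (\<lambda>y. G (fn x y))) \<le> ennreal c0" unfolding nn[OF K, symmetric]
  proof (rule nn_integral_Fatou[where F="\<lambda>n y. Ks (s n) y * G (fn (X (s n)) y)"])
    show "AE y in lborel. (\<lambda>n. Ks (s n) y * G (fn (X (s n)) y)) \<longlonglongrightarrow> K y * G (fn x y)" using AE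
    proof eventually_elim
      case (elim y)
      show ?case using LIMSEQ_subseq_LIMSEQ[OF lim[of y] s]
        by (intro tendsto_mult isCont_tendsto_compose[OF G(2) elim]) (simp add: o_def)
    qed
    show "\<forall>\<^sub>F n in sequentially. (NNBINT y. ennreal (Ks (s n) y * G (fn (X (s n)) y))) \<le> ennreal (c (s n))"
      unfolding nn[OF Ks] by (intro always_eventually allI ennreal_leI bound)
    show "(\<lambda>n. c (s n)) \<longlonglongrightarrow> c0" using LIMSEQ_subseq_LIMSEQ[OF c s] by (simp add: o_def)
  qed measurable
  moreover have "0 \<le> c0"
    by (rule LIMSEQ_le_const[OF c]) (insert order_trans[OF weighted_integral_nonneg[OF Ks G(1)] bound], blast)
  ultimately show ?thesis by (simp add: ennreal_le_iff)
qed

lemmas Phi_Fatou = weighted_integral_Fatou[where G=F, OF _ _ _ _ _ F_nonneg F_isCont F_integrable, folded Phi_def]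

theorem excess_Fatou:
  fixes Ks :: "nat \<Rightarrow> real^'n \<Rightarrow> real"
  assumes X: "X \<rightharpoonup> x" "\<And>n. norm (X n) \<le> R"
    and Ks: "\<And>n. Ks n \<in> coefficients" and K: "K \<in> coefficients" and lim: "\<And>y. (\<lambda>n. Ks n y) \<longlonglongrightarrow> K y"
    and bound: "\<And>n. phi (Ks n) (X n) (X n) / 2 - Phi (Ks n) (X n) \<le> c n" and c: "c \<longlonglongrightarrow> c0"
  shows "phi K x x / 2 - Phi K x \<le> c0"
proof -
  let ?G = "\<lambda>t. f t * t / 2 - F t"
  have excess: "weighted_integral L (\<lambda>y. ?G (fn u y)) = phi L u u / 2 - Phi L u" if L: "L \<in> coefficients" for L u
    using weighted_integrable[OF L f_mult_fn_integrable, of u u] weighted_integrable[OF L F_integrable, of u]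
    by (simp add: weighted_integral_def phi_def Phi_def right_diff_distrib)
  have "weighted_integral K (\<lambda>y. ?G (fn x y)) \<le> c0"
  proof (rule weighted_integral_Fatou[OF X Ks K lim _ _ _ _ c, where G="?G"])
    show "0 \<le> ?G t" for t using F_le_half[of t] by simp
    show "isCont ?G t" for t by (intro continuous_intros f_isCont F_isCont) auto
    show "integrable lborel (\<lambda>y. ?G (fn u y))" for u :: "'n h1" using f_mult_fn_integrable F_integrable by simp
  qed (simp add: excess[OF Ks] bound)
  then show ?thesis by (simp add: excess[OF K])
qed

end

section \<open>The Schroedinger form and its spectral projection\<close>

lemma test_fun_mult:
  assumes t: "test_fun \<psi> d" and s: "test_fun \<eta> e"
  shows "test_fun (\<lambda>x. \<psi> x * \<eta> x) (\<lambda>x h. \<psi> x * e x h + d x h * \<eta> x)"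
  unfolding test_fun_def
proof (intro conjI allI)
  show "((\<lambda>x. \<psi> x * \<eta> x) has_derivative (\<lambda>h. \<psi> x * e x h + d x h * \<eta> x)) (at x)" for x
    using t s by (intro has_derivative_mult) (auto simp: test_fun_def)
  show "continuous_on UNIV (\<lambda>x. \<psi> x * e x (axis i 1) + d x (axis i 1) * \<eta> x)" for i
    by (intro continuous_intros test_fun_continuous[OF t] test_fun_continuous[OF s] test_fun_deriv_continuous[OF t] test_fun_deriv_continuous[OF s])
  show "bounded {x. \<psi> x * \<eta> x \<noteq> 0}"
    by (rule bounded_subset[of "{x. \<psi> x \<noteq> 0}"]) (insert t, auto simp: test_fun_def)
qed

lemma integrable_bounded_support:
  fixes h :: "'a::euclidean_space \<Rightarrow> real"
  assumes h: "sq_int lborel h" and S: "bounded {x. h x \<noteq> 0}"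
  shows "integrable lborel h"
proof -
  obtain a b where ab: "{x. h x \<noteq> 0} \<subseteq> cbox a b" using bounded_subset_cbox_symmetric[OF S] by blast
  have "sq_int lborel (indicator (cbox a b))" by (rule sq_int_bounded_support[of _ 1 "cbox a b"]) (auto simp: indicator_def)
  moreover have "(\<lambda>x. h x * indicator (cbox a b) x) = h" using ab by (auto simp: fun_eq_iff indicator_def)
  ultimately show ?thesis using sq_int_mult[OF h, of "indicator (cbox a b)"] by simp
qed

lemma test_fun_integrable:
  assumes t: "test_fun \<psi> d"
  shows "integrable lborel \<psi>" "integrable lborel (\<lambda>x. d x k)"
  using integrable_bounded_support[OF test_fun_sq_int(1)[OF t]] t
    integrable_bounded_support[OF test_fun_sq_int(2)[OF t] test_fun_deriv_bounded_support[OF t]]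
  by (auto simp: test_fun_def)

lemma test_fun_integral_deriv:
  assumes t: "test_fun \<psi> d"
  shows "(LBINT x. d x k) = 0"
proof -
  note [measurable] = test_fun_measurable[OF t]
  have C: "(NNBINT x. ennreal (abs (d x k))) = ennreal (LBINT x. abs (d x k))"
    by (rule nn_integral_eq_integral) (insert test_fun_integrable(2)[OF t, of k], auto)
  have "0 = (LBINT x. \<psi> (x + k) - \<psi> x)" using test_fun_integrable(1)[OF t] integral_shift[of \<psi> k] by simp
  also have "\<dots> = (LBINT x. (LBINT s. indicator {0..1} s * d (x + s *\<^sub>R k) k))"
    by (simp only: test_fun_diff_eq_segment_average[OF t] segment_average_def)
  also have "\<dots> = (LBINT s. (LBINT x. indicator {0..1} s * d (x + s *\<^sub>R k) k))"
  proof (rule Fubini_unit_interval[where C="LBINT x. abs (d x k)"])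
    fix s :: real
    show "(NNBINT x. ennreal (abs (indicator {0..1} s * d (x + s *\<^sub>R k) k))) \<le> ennreal (LBINT x. abs (d x k)) * indicator {0..1} s"
      using nn_integral_shift[of "\<lambda>x. ennreal (abs (d x k))" "s *\<^sub>R k"] C by (cases "s \<in> {0..1}") auto
  qed measurable
  also have "\<dots> = (LBINT x. d x k)" using integral_shift(1)[of "\<lambda>x. d x k"] by simp
  finally show ?thesis by simp
qed

lemma test_fun_weak_grad:
  assumes t: "test_fun \<psi> d"
  shows "weak_grad \<psi> (\<lambda>x. \<chi> i. d x (axis i 1))"
  unfolding weak_grad_def
proof (intro conjI allI impI)
  show "sq_int lborel (\<lambda>x. (\<chi> i. d x (axis i 1)) $ i)" for i by (simp add: test_fun_sq_int(2)[OF t])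
  fix \<phi> :: "real^'a \<Rightarrow> real" and e i assume s: "test_fun \<phi> e"
  show "(LBINT x. \<psi> x * e x (axis i 1)) = - (LBINT x. (\<chi> i. d x (axis i 1)) $ i * \<phi> x)"
    using test_fun_integral_deriv[OF test_fun_mult[OF t s], of "axis i 1"]
      sq_int_mult[OF test_fun_sq_int(1)[OF t] test_fun_sq_int(2)[OF s]] sq_int_mult[OF test_fun_sq_int(2)[OF t] test_fun_sq_int(1)[OF s]]
    by simp
qed

lemma test_fun_H1:
  assumes t: "test_fun \<psi> d"
  shows "\<psi> \<in> H1_borel" "AE x in lborel. grad (abs_h1 \<psi>) x = (\<chi> i. d x (axis i 1))"
proof -
  show H1: "\<psi> \<in> H1_borel" unfolding H1_borel_def using test_fun_sq_int(1)[OF t] test_fun_weak_grad[OF t] by blast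
  show "AE x in lborel. grad (abs_h1 \<psi>) x = (\<chi> i. d x (axis i 1))"
    by (rule grad_eqI[OF test_fun_weak_grad[OF t] fn_abs[OF H1] test_fun_measurable(1)[OF t]])
qed

lemma bounded_bilinear_add_scaled:
  fixes a b :: "'a::real_normed_vector \<Rightarrow> 'b::real_normed_vector \<Rightarrow> real"
  assumes "bounded_bilinear a" "bounded_bilinear b"
  shows "bounded_bilinear (\<lambda>x y. a x y + c * b x y)"
proof -
  interpret a: bounded_bilinear a + b: bounded_bilinear b by fact+
  obtain A B where A: "\<And>x y. norm (a x y) \<le> norm x * norm y * A" and B: "\<And>x y. norm (b x y) \<le> norm x * norm y * B"
    using a.bounded b.bounded by blast
  show ?thesis
  proof
    have "norm (a x y + c * b x y) \<le> norm x * norm y * A + abs c * (norm x * norm y * B)" for x y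
      using norm_triangle_ineq[of "a x y" "c * b x y"] A[of x y] mult_left_mono[OF B[of x y], of "abs c"] by (simp add: abs_mult)
    then have "norm (a x y + c * b x y) \<le> norm x * norm y * (A + abs c * B)" for x y by (simp add: algebra_simps)
    then show "\<exists>K. \<forall>x y. norm (a x y + c * b x y) \<le> norm x * norm y * K" by blast
  qed (simp_all add: a.add_left a.add_right b.add_left b.add_right a.scaleR_left a.scaleR_right b.scaleR_left b.scaleR_right algebra_simps)
qed

lemma borel_imp_lebesgue: "v \<in> borel_measurable borel \<Longrightarrow> v \<in> borel_measurable lebesgue"
  for v :: "'a::euclidean_space \<Rightarrow> 'b::topological_space" by (rule measurable_completion) simp

lemma lebesgue_borel_version:
  fixes u :: "'a::euclidean_space \<Rightarrow> real"
  assumes "u \<in> borel_measurable lebesgue"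
  shows "\<exists>v. v \<in> borel_measurable borel \<and> (AE x in lborel. u x = v x)"
  using completion_ex_borel_measurable_real[OF assms] by auto

lemma integral_lebesgue_eq:
  fixes u v :: "'a::euclidean_space \<Rightarrow> real"
  assumes u: "u \<in> borel_measurable lebesgue" and v: "v \<in> borel_measurable borel" and ae: "AE x in lborel. u x = v x"
  shows "integral\<^sup>L lebesgue u = integral\<^sup>L lborel v" "integrable lebesgue u \<longleftrightarrow> integrable lborel v"
  using integral_cong_AE[OF u borel_imp_lebesgue[OF v] AE_completion[OF ae]]
    integrable_cong_AE[OF u borel_imp_lebesgue[OF v] AE_completion[OF ae]] v
  by (simp_all add: integral_completion integrable_completion)

lemma L2_iff_sq_int:
  assumes "u \<in> borel_measurable lebesgue" "v \<in> borel_measurable borel" "AE x in lborel. u x = v x"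
  shows "L2 u \<longleftrightarrow> sq_int lborel v"
proof -
  have "integrable lebesgue (\<lambda>x. (u x)^2) \<longleftrightarrow> integrable lborel (\<lambda>x. (v x)^2)"
    by (rule integral_lebesgue_eq(2)) (insert assms, auto elim!: eventually_mono)
  then show ?thesis using assms by (simp add: L2_def sq_int_def)
qed

lemma is_weak_grad_iff:
  fixes u v :: "real^'n \<Rightarrow> real"
  assumes u: "u \<in> borel_measurable lebesgue" "v \<in> borel_measurable borel" "AE x in lborel. u x = v x"
    and g: "\<And>i. (\<lambda>x. g x $ i) \<in> borel_measurable lebesgue" "\<And>i. (\<lambda>x. G x $ i) \<in> borel_measurable borel" "AE x in lborel. g x = G x"
  shows "is_weak_grad u g \<longleftrightarrow> weak_grad v G"
proof -
  have L2: "L2 (\<lambda>x. g x $ i) \<longleftrightarrow> sq_int lborel (\<lambda>x. G x $ i)" for i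
    by (rule L2_iff_sq_int[OF g(1,2)]) (insert g(3), auto elim!: eventually_mono)
  have "(\<integral>x. u x * d x (axis i 1) \<partial>lebesgue) = (LBINT x. v x * d x (axis i 1))"
    "(\<integral>x. g x $ i * \<psi> x \<partial>lebesgue) = (LBINT x. G x $ i * \<psi> x)" if t: "test_fun \<psi> d" for \<psi> d i
  proof -
    note [measurable] = test_fun_measurable[OF t] test_fun_measurable[OF t, THEN borel_imp_lebesgue] u(1,2) g(1,2)
    show "(\<integral>x. u x * d x (axis i 1) \<partial>lebesgue) = (LBINT x. v x * d x (axis i 1))"
      by (rule integral_lebesgue_eq(1)) (insert u(3), auto elim!: eventually_mono)
    show "(\<integral>x. g x $ i * \<psi> x \<partial>lebesgue) = (LBINT x. G x $ i * \<psi> x)"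
      by (rule integral_lebesgue_eq(1)) (insert g(3), auto elim!: eventually_mono)
  qed
  then show ?thesis unfolding is_weak_grad_def weak_grad_def L2 by simp
qed

lemma is_weak_grad_imp_weak_grad:
  fixes u v :: "real^'n \<Rightarrow> real"
  assumes u: "u \<in> borel_measurable lebesgue" "v \<in> borel_measurable borel" "AE x in lborel. u x = v x" and g: "is_weak_grad u g"
  shows "\<exists>G. weak_grad v G \<and> (AE x in lborel. g x = G x)"
proof -
  have g_measurable: "(\<lambda>x. g x $ i) \<in> borel_measurable lebesgue" for i using g by (auto simp: is_weak_grad_def L2_def)
  obtain h where h: "\<And>i. h i \<in> borel_measurable borel" "\<And>i. AE x in lborel. g x $ i = h i x"
    using lebesgue_borel_version[OF g_measurable] by metis
  have "AE x in lborel. \<forall>i. g x $ i = h i x" using h(2) by (simp add: AE_all_countable)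
  then have "AE x in lborel. g x = (\<chi> i. h i x)" by eventually_elim (simp add: vec_eq_iff)
  then show ?thesis using is_weak_grad_iff[OF u g_measurable, of "\<lambda>x. \<chi> i. h i x"] h(1) g by auto
qed

definition represents :: "(real^'n \<Rightarrow> real) \<Rightarrow> 'n::finite h1 \<Rightarrow> bool" where
  "represents u U \<longleftrightarrow> u \<in> borel_measurable lebesgue \<and> (AE x in lborel. u x = fn U x)"

lemma represents_fn: "represents (fn U) U"
  by (simp add: represents_def borel_imp_lebesgue)

lemma represents_unique:
  assumes "represents u U" "represents u W"
  shows "U = W"
  by (rule h1_eqI) (insert assms, auto simp: represents_def elim: eventually_elim2)

lemma represents_AE: "represents u U \<Longrightarrow> w \<in> borel_measurable lebesgue \<Longrightarrow> AE x in lborel. w x = u x \<Longrightarrow> represents w U"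
  unfolding represents_def by (auto elim: eventually_elim2)

lemma represents_lincomb:
  assumes u: "represents u U" and w: "represents w W"
  shows "represents (\<lambda>x. s * u x + t * w x) (s *\<^sub>R U + t *\<^sub>R W)"
proof -
  have "AE x in lborel. u x = fn U x" "AE x in lborel. w x = fn W x" using u w by (auto simp: represents_def)
  with fn_add[of "s *\<^sub>R U" "t *\<^sub>R W"] fn_scale[of s U] fn_scale[of t W]
  have "AE x in lborel. s * u x + t * w x = fn (s *\<^sub>R U + t *\<^sub>R W) x" by eventually_elim simp
  then show ?thesis using u w by (auto simp: represents_def)
qed

lemma represents_zero_iff: "represents u U \<Longrightarrow> U = 0 \<longleftrightarrow> (AE x in lebesgue. u x = 0)"
  by (auto simp: represents_def fn_zero_iff AE_completion_iff elim: eventually_elim2)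

lemma represents_L2: "represents u U \<Longrightarrow> L2 u"
  using L2_iff_sq_int[OF _ fn_measurable, of u U] sq_int_fn[of U] by (auto simp: represents_def)

lemma represents_weak_grad: "represents u U \<Longrightarrow> is_weak_grad u (grad U)"
  unfolding represents_def using is_weak_grad_iff[OF _ fn_measurable _ borel_imp_lebesgue[OF grad_measurable] grad_measurable, of u U U] weak_grad_fn
  by auto

lemma H1_iff_represents: "u \<in> H1 \<longleftrightarrow> (\<exists>U. represents u U)"
proof
  show "\<exists>U. represents u U \<Longrightarrow> u \<in> H1" unfolding H1_def using represents_L2 represents_weak_grad by blast
  assume "u \<in> H1"
  then obtain g where g: "is_weak_grad u g" and L2: "L2 u" by (auto simp: H1_def)
  have m: "u \<in> borel_measurable lebesgue" using L2 by (simp add: L2_def)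
  obtain v where v: "v \<in> borel_measurable borel" "AE x in lborel. u x = v x" using lebesgue_borel_version[OF m] by blast
  have "v \<in> H1_borel" unfolding H1_borel_def using L2_iff_sq_int[OF m v] L2 is_weak_grad_imp_weak_grad[OF m v g] by blast
  from fn_abs[OF this] v(2) have "AE x in lborel. u x = fn (abs_h1 v) x" by eventually_elim simp
  then show "\<exists>U. represents u U" using m by (auto simp: represents_def)
qed

lemma represents_H1: "represents u U \<Longrightarrow> u \<in> H1"
  using H1_iff_represents by blast

lemma wgrad_represents:
  assumes u: "represents u U"
  shows "(\<lambda>x. wgrad u x $ i) \<in> borel_measurable lebesgue" "AE x in lborel. wgrad u x = grad U x"
proof -
  have w: "is_weak_grad u (wgrad u)" unfolding wgrad_def by (rule someI[of "is_weak_grad u", OF represents_weak_grad[OF u]])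
  then show "(\<lambda>x. wgrad u x $ i) \<in> borel_measurable lebesgue" by (simp add: is_weak_grad_def L2_def)
  obtain G where G: "weak_grad (fn U) G" "AE x in lborel. wgrad u x = G x"
    using is_weak_grad_imp_weak_grad[OF _ fn_measurable _ w, of U] u by (auto simp: represents_def)
  have "AE x in lborel. grad U x = G x" by (rule grad_eqI[OF G(1) _ fn_measurable]) simp
  with G(2) show "AE x in lborel. wgrad u x = grad U x" by eventually_elim simp
qed

lemma integral_represents:
  assumes u: "represents u U" and w: "represents w W"
  shows "(\<integral>x. u x * w x \<partial>lebesgue) = l2 U W"
  unfolding l2_def using u w
  by (intro integral_lebesgue_eq(1) borel_measurable_times) (auto simp: represents_def elim: eventually_elim2)

lemma AE_zero_continuous:
  fixes g :: "'a::euclidean_space \<Rightarrow> real"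
  assumes g: "continuous_on UNIV g" and ae: "AE x in lborel. g x = 0"
  shows "g x = 0"
proof -
  have "open {x. g x \<noteq> 0}" by (rule open_Collect_neq[OF g continuous_on_const])
  moreover have "{x. g x \<noteq> 0} \<in> null_sets lborel" using AE_iff_null_sets[of "{x. g x \<noteq> 0}" lborel] ae calculation by auto
  then have "negligible {x. g x \<noteq> 0}" by (simp add: negligible_iff_null_sets null_sets_completionI)
  ultimately have "{x. g x \<noteq> 0} = {}" using open_not_negligible by blast
  then show ?thesis by blast
qed

lemma box_bump_h1:
  fixes a b :: "real^'n"
  assumes "box a b \<noteq> {}"
  shows "AE x in lborel. fn (abs_h1 (box_bump a b)) x = box_bump a b x" "abs_h1 (box_bump a b) \<noteq> 0"
proof -
  obtain d where d: "test_fun (box_bump a b) d" using box_bump_test_fun by blast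
  show eq: "AE x in lborel. fn (abs_h1 (box_bump a b)) x = box_bump a b x" by (rule fn_abs[OF test_fun_H1(1)[OF d]])
  show "abs_h1 (box_bump a b) \<noteq> 0"
  proof
    assume "abs_h1 (box_bump a b) = 0"
    with eq fn_zero have "AE x in lborel. box_bump a b x = 0" by (auto elim: eventually_elim2)
    then have "box_bump a b x = 0" for x by (rule AE_zero_continuous[OF test_fun_continuous[OF d]])
    then show False using assms by (auto simp: box_bump_eq_0_iff)
  qed
qed

locale periodic_potential =
  fixes V :: "real^'n \<Rightarrow> real"
  assumes V_cont: "continuous_on UNIV V" and V_periodic: "\<And>x k. (\<forall>i. k $ i \<in> \<int>) \<Longrightarrow> V (x + k) = V x"
begin

lemma V_borel [measurable]: "V \<in> borel_measurable borel"
  using V_cont by (rule borel_measurable_continuous_onI)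

definition V_sup :: real where "V_sup = (SUP x. abs (V x))"

lemma V_le_sup: "abs (V x) \<le> V_sup"
proof -
  have "bounded (V ` cube)" unfolding cube_def
    by (intro compact_imp_bounded compact_continuous_image continuous_on_subset[OF V_cont]) auto
  then obtain b where b: "\<And>x. x \<in> cube \<Longrightarrow> abs (V x) \<le> b" by (auto simp: bounded_iff)
  have "abs (V x) \<le> b" for x
  proof -
    define k :: "real^'n" where "k = (\<chi> i. - real_of_int \<lfloor>x $ i\<rfloor>)"
    have "x + k \<in> cube" unfolding mem_cube k_def by (auto simp: algebra_simps) linarith
    moreover have "V (x + k) = V x" by (rule V_periodic) (simp add: k_def)
    ultimately show ?thesis using b[of "x + k"] by simp
  qed
  then show ?thesis unfolding V_sup_def by (intro cSUP_upper bdd_aboveI2) auto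
qed

lemma V_sup_nonneg: "0 \<le> V_sup"
  using V_le_sup[of 0] by linarith

definition BV :: "'n h1 \<Rightarrow> 'n h1 \<Rightarrow> real" where "BV U W = dirichlet U W + weighted_l2 V U W"

lemma bounded_bilinear_BV: "bounded_bilinear BV"
proof -
  have "BV = (\<lambda>U W. U \<bullet> W + weighted_l2 (\<lambda>x. V x - 1) U W)"
  proof (intro ext)
    fix U W
    have "weighted_l2 V U W - l2 U W = weighted_l2 (\<lambda>x. V x - 1) U W"
      using Bochner_Integration.integral_diff[OF weighted_fn_mult_integrable[OF V_borel V_le_sup, of U W] fn_mult_integrable[of U W]]
      by (simp add: weighted_l2_def l2_def left_diff_distrib)
    then show "BV U W = U \<bullet> W + weighted_l2 (\<lambda>x. V x - 1) U W" by (simp add: BV_def inner_h1_def)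
  qed
  moreover have "abs (V x - 1) \<le> V_sup + 1" for x using V_le_sup[of x] by linarith
  then have "bounded_bilinear (\<lambda>U W. U \<bullet> W + weighted_l2 (\<lambda>x. V x - 1) U W)"
    using bounded_bilinear_add_scaled[OF bounded_bilinear_inner bounded_bilinear_weighted_l2, of "\<lambda>x. V x - 1" "V_sup + 1" 1] by simp
  ultimately show ?thesis by simp
qed

sublocale BV: bounded_bilinear BV
  by (rule bounded_bilinear_BV)

lemmas BV_simps = BV.add_left BV.add_right BV.diff_left BV.diff_right BV.scaleR_left BV.scaleR_right BV.zero_left BV.zero_right

lemma BV_sym: "BV U W = BV W U"
  by (simp add: BV_def dirichlet_def inner_commute weighted_l2_sym[of V])

lemma weighted_l2_V_le: "abs (weighted_l2 V U U) \<le> V_sup * l2 U U"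
proof -
  have "abs (weighted_l2 V U U) \<le> (LBINT x. abs (V x * (fn U x * fn U x)))" unfolding weighted_l2_def by (rule integral_abs_bound)
  also have "\<dots> \<le> (LBINT x. V_sup * (fn U x * fn U x))"
    using V_le_sup integrable_abs[OF weighted_fn_mult_integrable[OF V_borel V_le_sup, of U U]] fn_mult_integrable[of U U]
    by (intro integral_mono) (auto simp: abs_mult mult_right_mono)
  finally show ?thesis by (simp add: l2_def)
qed

lemma BV_shift:
  assumes k: "\<forall>i. k $ i \<in> \<int>"
  shows "BV (shift k U) (shift k W) = BV U W"
  using weighted_l2_shift[OF V_borel, of k U W] by (simp add: BV_def dirichlet_shift V_periodic[OF k])

lemma Bform_represents:
  assumes u: "represents u U" and w: "represents w W"
  shows "Bform V u w = BV U W"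
proof -
  note [measurable] = wgrad_represents(1)[OF u] wgrad_represents(1)[OF w] borel_imp_lebesgue[OF V_borel]
  have [measurable]: "u \<in> borel_measurable lebesgue" "w \<in> borel_measurable lebesgue"
    and ae: "AE x in lborel. u x = fn U x" "AE x in lborel. w x = fn W x" using u w by (auto simp: represents_def)
  have "Bform V u w = (LBINT x. grad U x \<bullet> grad W x + V x * (fn U x * fn W x))" unfolding Bform_def
  proof (rule integral_lebesgue_eq(1))
    show "(\<lambda>x. wgrad u x \<bullet> wgrad w x + V x * u x * w x) \<in> borel_measurable lebesgue" unfolding inner_vec_def by measurable
    show "AE x in lborel. wgrad u x \<bullet> wgrad w x + V x * u x * w x = grad U x \<bullet> grad W x + V x * (fn U x * fn W x)"
      using ae wgrad_represents(2)[OF u] wgrad_represents(2)[OF w] by eventually_elim (simp add: mult.assoc)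
  qed measurable
  then show ?thesis
    using inner_grad_integrable[of U W] weighted_fn_mult_integrable[OF V_borel V_le_sup, of U W] by (simp add: BV_def dirichlet_def weighted_l2_def)
qed

text \<open>A bump supported in a cube of side \<open>s\<close> is disjoint from its translate by \<open>s\<close>, so by the translation
  estimate its Dirichlet energy is at least \<open>2 / s\<^sup>2\<close> times its mass.\<close>
lemma BV_positive_direction: "\<exists>U. 0 < BV U U"
proof -
  define s where "s = 1 / (V_sup + 1)"
  have s: "0 < s" "s \<le> 1" "s * (V_sup + 1) = 1" using V_sup_nonneg by (auto simp: s_def)
  define b :: "real^'n" where "b = (\<chi> i. s)"
  define k :: "real^'n" where "k = axis undefined s"
  define U where "U = abs_h1 (box_bump 0 b)"
  have "(\<chi> i. s / 2) \<in> box 0 b" using s(1) by (simp add: mem_box_cart b_def)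
  then have ae: "AE x in lborel. fn U x = box_bump 0 b x" and "U \<noteq> 0" unfolding U_def using box_bump_h1[of 0 b] by auto
  then have pos: "0 < l2 U U" by (intro l2_pos)
  have "box_bump 0 b (x + k) * box_bump 0 b x = 0" for x
  proof -
    have "x \<notin> box 0 b \<or> x + k \<notin> box 0 b" by (force simp: mem_box_cart b_def k_def dest: spec[of _ undefined])
    then show ?thesis by (auto simp: box_bump_eq_0_iff)
  qed
  then have disjoint: "AE x in lborel. (fn U (x + k))^2 + (fn U x)^2 = (fn U (x + k) - fn U x)^2"
    using ae AE_shift[OF ae, of k] by (auto simp: power2_diff elim!: eventually_elim2)
  have int: "integrable lborel (\<lambda>x. (fn U x)^2)" by (rule sq_int_square_integrable[OF sq_int_fn])
  have "2 * l2 U U = (LBINT x. (fn U (x + k))^2) + (LBINT x. (fn U x)^2)"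
    using integral_shift(1)[of "\<lambda>x. (fn U x)^2" k] by (simp add: l2_self)
  also have "\<dots> = (LBINT x. (fn U (x + k))^2 + (fn U x)^2)" using int integral_shift(2)[of "\<lambda>x. (fn U x)^2" k] by simp
  also have "\<dots> = (LBINT x. (fn U (x + k) - fn U x)^2)" by (rule integral_cong_AE[OF _ _ disjoint]) measurable
  also have "\<dots> \<le> (norm k)^2 * dirichlet U U" by (rule h1_translation_estimate)
  also have "norm k = s"
    using s by (simp add: k_def axis_def norm_vec_def L2_set_def if_distrib[of "\<lambda>x. x^2"] cong: if_cong)
  finally have upper: "2 * l2 U U \<le> s^2 * dirichlet U U" .
  have "s^2 * V_sup = s * (s * (V_sup + 1)) - s^2" by (simp add: power2_eq_square algebra_simps)
  also have "\<dots> \<le> 1" using s zero_le_power2[of s] unfolding s(3) by linarith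
  finally have "s^2 * V_sup * l2 U U \<le> 1 * l2 U U" using pos by (intro mult_right_mono) auto
  moreover have "s^2 * (dirichlet U U - V_sup * l2 U U) = s^2 * dirichlet U U - s^2 * V_sup * l2 U U" by (simp add: algebra_simps)
  ultimately have "0 < s^2 * (dirichlet U U - V_sup * l2 U U)" using upper pos by linarith
  then have "0 < dirichlet U U - V_sup * l2 U U" using s(1) by (simp add: zero_less_mult_iff)
  then show ?thesis using weighted_l2_V_le[of U] by (intro exI[of _ U]) (simp add: BV_def)
qed

definition shifted_form :: "'n h1 \<Rightarrow> 'n h1 \<Rightarrow> real" where "shifted_form U W = BV U W + (V_sup + 1) * l2 U W"

lemma norm_square_le_shifted_form: "(norm U)^2 \<le> shifted_form U U"
  using weighted_l2_V_le[of U] by (simp add: shifted_form_def BV_def norm_h1_square algebra_simps)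

sublocale shifted: coercive_form shifted_form 1
proof (rule coercive_form.intro)
  have l2: "bounded_bilinear (l2 :: 'n h1 \<Rightarrow> _)" unfolding l2_eq_weighted by (rule bounded_bilinear_weighted_l2) auto
  show "bounded_bilinear shifted_form"
    unfolding shifted_form_def[abs_def] by (rule bounded_bilinear_add_scaled[OF bounded_bilinear_BV l2])
  show "shifted_form U W = shifted_form W U" for U W by (simp add: shifted_form_def BV_sym l2_def mult.commute)
qed (simp_all add: norm_square_le_shifted_form)

definition splitting :: "'n h1 set \<Rightarrow> 'n h1 set \<Rightarrow> bool" where
  "splitting Wp Wm \<longleftrightarrow> subspace Wp \<and> subspace Wm \<and> (\<forall>U. \<exists>A\<in>Wp. U - A \<in> Wm) \<and> (\<forall>A\<in>Wp. \<forall>B\<in>Wm. l2 A B = 0 \<and> BV A B = 0)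
    \<and> (\<forall>A\<in>Wp. A \<noteq> 0 \<longrightarrow> 0 < BV A A) \<and> (\<forall>B\<in>Wm. B \<noteq> 0 \<longrightarrow> BV B B < 0)"

lemma splittingD:
  assumes "splitting Wp Wm"
  shows "subspace Wp" "subspace Wm" "\<exists>A\<in>Wp. U - A \<in> Wm" "A \<in> Wp \<Longrightarrow> B \<in> Wm \<Longrightarrow> l2 A B = 0" "A \<in> Wp \<Longrightarrow> B \<in> Wm \<Longrightarrow> BV A B = 0"
    "A \<in> Wp \<Longrightarrow> A \<noteq> 0 \<Longrightarrow> 0 < BV A A" "B \<in> Wm \<Longrightarrow> B \<noteq> 0 \<Longrightarrow> BV B B < 0"
  using assms by (simp_all add: splitting_def)

definition represented :: "'n h1 set \<Rightarrow> (real^'n \<Rightarrow> real) set" where "represented W = {u. \<exists>U\<in>W. represents u U}"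

lemma represented_subspace:
  assumes W: "subspace W"
  shows "represented W \<subseteq> H1 \<and> (\<lambda>x. 0) \<in> represented W
    \<and> (\<forall>a\<in>represented W. \<forall>b\<in>represented W. \<forall>s t. (\<lambda>x. s * a x + t * b x) \<in> represented W)
    \<and> (\<forall>a\<in>represented W. \<forall>b. b \<in> borel_measurable lebesgue \<longrightarrow> (AE x in lebesgue. a x = b x) \<longrightarrow> b \<in> represented W)"
proof (intro conjI ballI allI impI)
  show "represented W \<subseteq> H1" unfolding represented_def using represents_H1 by blast
  show "(\<lambda>x. 0) \<in> represented W"
    unfolding represented_def using represents_lincomb[OF represents_fn represents_fn, of 0 0 0 0] subspace_0[OF W] by force
  fix a b assume a: "a \<in> represented W"
  show "(\<lambda>x. s * a x + t * b x) \<in> represented W" if "b \<in> represented W" for s t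
    using a that unfolding represented_def
    using represents_lincomb subspace_add[OF W subspace_scale[OF W] subspace_scale[OF W]] by blast
  assume b: "b \<in> borel_measurable lebesgue" "AE x in lebesgue. a x = b x"
  obtain U where "U \<in> W" "represents a U" using a by (auto simp: represented_def)
  moreover have "AE x in lborel. b x = a x" using b(2) by (simp add: AE_completion_iff eq_commute)
  ultimately show "b \<in> represented W" using represents_AE[OF _ b(1)] by (auto simp: represented_def)
qed

lemma spectral_decomp_represented:
  assumes split: "splitting Wp Wm"
  shows "spectral_decomp V (represented Wp) (represented Wm)"
proof -
  note split = splittingD[OF split]
  have "\<exists>a\<in>represented Wp. \<exists>b\<in>represented Wm. u = (\<lambda>x. a x + b x)" if u: "u \<in> H1" for u
  proof -
    obtain U where U: "represents u U" using u by (auto simp: H1_iff_represents)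
    obtain A where A: "A \<in> Wp" "U - A \<in> Wm" using split(3) by blast
    have "represents (\<lambda>x. u x - fn A x) (U - A)" using represents_lincomb[OF U represents_fn[of A], of 1 "-1"] by simp
    then show ?thesis using A represents_fn[of A] unfolding represented_def
      by (intro bexI[of _ "fn A"] bexI[of _ "\<lambda>x. u x - fn A x"]) auto
  qed
  moreover have "(\<integral>x. a x * b x \<partial>lebesgue) = 0 \<and> Bform V a b = 0" if "a \<in> represented Wp" "b \<in> represented Wm" for a b
    using that split(4,5) by (auto simp: represented_def integral_represents Bform_represents)
  moreover have "0 < Bform V a a" if "a \<in> represented Wp" "\<not> (AE x in lebesgue. a x = 0)" for a
    using that split(6) by (auto simp: represented_def represents_zero_iff Bform_represents)
  moreover have "Bform V b b < 0" if "b \<in> represented Wm" "\<not> (AE x in lebesgue. b x = 0)" for b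
    using that split(7) by (auto simp: represented_def represents_zero_iff Bform_represents)
  ultimately show ?thesis
    unfolding spectral_decomp_def using represented_subspace[OF split(1)] represented_subspace[OF split(2)]
    by simp
qed

lemma spectral_decomp_splitting:
  assumes decomp: "spectral_decomp V Ep Em"
  shows "splitting {U. fn U \<in> Ep} {U. fn U \<in> Em}" "represents u U \<Longrightarrow> u \<in> Em \<longleftrightarrow> fn U \<in> Em"
proof -
  note decomp = decomp[unfolded spectral_decomp_def]
  note space = bspec[OF conjunct1[OF decomp]]
  note sum = conjunct2[OF decomp, THEN conjunct1, THEN bspec]
  note orth = conjunct2[OF decomp, THEN conjunct2, THEN conjunct1, THEN bspec, THEN bspec]
  note sign = conjunct2[OF decomp, THEN conjunct2, THEN conjunct2]
  have mem: "u \<in> E \<longleftrightarrow> fn U \<in> E" if u: "represents u U" and E: "E \<in> {Ep, Em}" for u U E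
  proof -
    have closed: "a \<in> E \<Longrightarrow> b \<in> borel_measurable lebesgue \<Longrightarrow> AE x in lebesgue. a x = b x \<Longrightarrow> b \<in> E" for a b using space[OF E] by blast
    have "u \<in> borel_measurable lebesgue" "AE x in lebesgue. u x = fn U x" "AE x in lebesgue. fn U x = u x"
      using u by (auto simp: represents_def AE_completion_iff elim: eventually_mono)
    then show ?thesis using closed[of u "fn U"] closed[of "fn U" u] borel_imp_lebesgue[OF fn_measurable] by blast
  qed
  then show "represents u U \<Longrightarrow> u \<in> Em \<longleftrightarrow> fn U \<in> Em" by blast
  have sub: "subspace {U. fn U \<in> E}" if E: "E \<in> {Ep, Em}" for E
  proof -
    have zero: "fn 0 \<in> E" using space[OF E] mem[OF _ E, of "\<lambda>x. 0" 0] represents_lincomb[OF represents_fn represents_fn, of 0 0 0 0] by simp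
    have "fn (s *\<^sub>R A + t *\<^sub>R B) \<in> E" if "fn A \<in> E" "fn B \<in> E" for A B s t
      using space[OF E] that mem[OF represents_lincomb[OF represents_fn represents_fn] E] by blast
    from this[of _ _ 1 1] this[of _ 0 _ 0] show ?thesis using zero by (simp add: subspace_def)
  qed
  have "\<exists>A. fn A \<in> Ep \<and> fn (U - A) \<in> Em" for U
  proof -
    obtain a b where ab: "a \<in> Ep" "b \<in> Em" "fn U = (\<lambda>x. a x + b x)" using sum[OF represents_H1[OF represents_fn[of U]]] by blast
    then obtain A B where AB: "represents a A" "represents b B" using space H1_iff_represents by (metis insertCI subsetD)
    have "U = A + B" using represents_unique[OF represents_fn[of U], of "1 *\<^sub>R A + 1 *\<^sub>R B"] represents_lincomb[OF AB, of 1 1] ab(3) by simp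
    then show ?thesis using mem[OF AB(1)] mem[OF AB(2)] ab by (intro exI[of _ A]) simp
  qed
  moreover have "\<not> (AE x in lebesgue. fn A x = 0)" if "A \<noteq> 0" for A :: "'n h1" using represents_zero_iff[OF represents_fn, of A] that by simp
  moreover have "l2 A B = 0 \<and> BV A B = 0" if "fn A \<in> Ep" "fn B \<in> Em" for A B
    using orth[OF that] by (simp add: integral_represents[OF represents_fn represents_fn] Bform_represents[OF represents_fn represents_fn])
  ultimately show "splitting {U. fn U \<in> Ep} {U. fn U \<in> Em}"
    unfolding splitting_def using sub[of Ep] sub[of Em] sign Bform_represents[OF represents_fn represents_fn] by (auto; metis)
qed

end

locale schroedinger = periodic_potential V for V :: "real^'n \<Rightarrow> real" +
  assumes zero_not_in_spectrum: "0 \<notin> schroedinger_spectrum V"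
begin

lemma resolvent_estimate: "\<exists>C\<ge>0. \<forall>U W. (\<forall>Z. BV U Z = l2 W Z) \<longrightarrow> l2 U U \<le> C * l2 W W"
proof -
  obtain C where C: "\<And>u g. u \<in> H1 \<Longrightarrow> L2 g
      \<Longrightarrow> \<forall>v\<in>H1. Bform V u v - 0 * (\<integral>x. u x * v x \<partial>lebesgue) = (\<integral>x. g x * v x \<partial>lebesgue) \<Longrightarrow> L2_norm u \<le> C * L2_norm g"
    using zero_not_in_spectrum unfolding schroedinger_spectrum_def by blast
  have L2_norm: "L2_norm (fn U) = sqrt (l2 U U)" for U :: "'n h1"
    unfolding L2_norm_def using integral_represents[OF represents_fn represents_fn, of U U] by (simp add: power2_eq_square)
  have "l2 U U \<le> C^2 * l2 W W" if UW: "\<forall>Z. BV U Z = l2 W Z" for U W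
  proof -
    have "Bform V (fn U) v = (\<integral>x. fn W x * v x \<partial>lebesgue)" if "v \<in> H1" for v
    proof -
      obtain Z where "represents v Z" using \<open>v \<in> H1\<close> by (auto simp: H1_iff_represents)
      then show ?thesis
        using Bform_represents[OF represents_fn[of U]] integral_represents[OF represents_fn[of W]] UW by simp
    qed
    then have "L2_norm (fn U) \<le> C * L2_norm (fn W)"
      by (intro C represents_H1[OF represents_fn] represents_L2[OF represents_fn]) simp
    then have "(sqrt (l2 U U))^2 \<le> (C * sqrt (l2 W W))^2" unfolding L2_norm by (rule power_mono) (simp add: l2_nonneg)
    then show ?thesis by (simp add: power_mult_distrib l2_nonneg)
  qed
  then show ?thesis by (intro exI[of _ "C^2"]) simp
qed

lemma shifted_operator_exists:
  "\<exists>L c. bounded_linear L \<and> (\<forall>U W. BV U W = shifted_form (L U) W) \<and> 0 < c \<and> (\<forall>U. c * norm U \<le> norm (L U))"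
proof -
  obtain L where L: "bounded_linear L" "\<And>U W. BV U W = shifted_form (L U) W"
    using shifted.form_operator_exists[OF bounded_bilinear_BV] by blast
  define \<kappa> where "\<kappa> = V_sup + 1"
  have \<kappa>: "0 < \<kappa>" using V_sup_nonneg by (simp add: \<kappa>_def)
  obtain C where C: "0 \<le> C" "\<And>U W. \<forall>Z. BV U Z = l2 W Z \<Longrightarrow> l2 U U \<le> C * l2 W W" using resolvent_estimate by blast
  interpret l2: bounded_bilinear "l2 :: 'n h1 \<Rightarrow> _" unfolding l2_eq_weighted by (rule bounded_bilinear_weighted_l2) auto
  note l2_simps = l2.add_left l2.add_right l2.diff_left l2.diff_right l2.scaleR_left l2.scaleR_right
  define D where "D = 2 * (C * \<kappa>^2) + 2"
  have D: "0 \<le> D" using C(1) by (simp add: D_def)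
  obtain K where K: "0 < K" "\<And>U W. norm (shifted_form U W) \<le> norm U * norm W * K" using shifted.form.pos_bounded by blast
  define c where "c = sqrt (1 / ((1 + 2 * \<kappa> * D) * K))"
  have pos: "0 < 1 + 2 * \<kappa> * D" using \<kappa> D by (simp add: add_pos_nonneg)
  have "c * norm U \<le> norm (L U)" for U
  proof -
    define h where "h = L U"
    have "BV (U - h) Z = l2 (\<kappa> *\<^sub>R h) Z" for Z using L(2)[of U Z] by (simp add: h_def shifted_form_def \<kappa>_def BV.diff_left l2_simps)
    then have "l2 (U - h) (U - h) \<le> C * l2 (\<kappa> *\<^sub>R h) (\<kappa> *\<^sub>R h)" by (intro C(2)) simp
    then have "l2 (U - h) (U - h) \<le> C * \<kappa>^2 * l2 h h" by (simp add: l2_simps power2_eq_square mult.assoc)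
    moreover have "l2 U U \<le> 2 * l2 (U - h) (U - h) + 2 * l2 h h" using l2_nonneg[of "U - h - h"] by (simp add: l2_simps)
    ultimately have "l2 U U \<le> D * l2 h h" by (simp add: D_def algebra_simps)
    also have "\<dots> \<le> D * shifted_form h h" using D order_trans[OF l2_le norm_square_le_shifted_form] by (intro mult_left_mono)
    finally have "\<kappa> * l2 U U \<le> \<kappa> * (D * shifted_form h h)" using \<kappa> by simp
    moreover have "shifted_form U U = shifted_form h U + \<kappa> * l2 U U" using L(2)[of U U] by (simp add: shifted_form_def[of U] \<kappa>_def h_def)
    moreover have "2 * shifted_form h U \<le> shifted_form h h + shifted_form U U"
      using shifted.nonneg[of "U - h"] by (simp add: shifted.form_simps shifted.sym[of U h])
    ultimately have "shifted_form U U \<le> (1 + 2 * \<kappa> * D) * shifted_form h h" by (simp add: algebra_simps)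
    also have "\<dots> \<le> (1 + 2 * \<kappa> * D) * ((norm h)^2 * K)"
      using K(2)[of h h] pos by (intro mult_left_mono) (simp_all add: power2_eq_square)
    finally have "(norm U)^2 \<le> (1 + 2 * \<kappa> * D) * ((norm h)^2 * K)" using norm_square_le_shifted_form[of U] by linarith
    moreover have "c^2 = 1 / ((1 + 2 * \<kappa> * D) * K)" using pos K(1) by (simp add: c_def)
    ultimately have "(c * norm U)^2 \<le> (norm h)^2" using pos K(1) by (simp add: power_mult_distrib divide_le_eq mult_ac)
    then show ?thesis unfolding h_def by (rule power2_le_imp_le) simp
  qed
  moreover have "0 < c" using pos K(1) by (simp add: c_def)
  ultimately show ?thesis using L by blast
qed

lemma splitting_exists: "\<exists>Wp Wm. splitting Wp Wm"
proof -
  obtain L c where L: "bounded_linear L" "\<And>U W. BV U W = shifted_form (L U) W" and c: "0 < c" "\<And>U. c * norm U \<le> norm (L U)"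
    using shifted_operator_exists by blast
  interpret L: bounded_linear L by (rule L(1))
  have L_sym: "shifted_form (L U) W = shifted_form U (L W)" for U W using L(2)[of U W] L(2)[of W U] by (simp add: BV_sym shifted.sym[of U])
  obtain S where S: "linear S" "\<And>u v. shifted_form (S u) v = shifted_form u (S v)" "\<And>u. S (S u) = u" "\<And>u. S (L u) = L (S u)"
    "\<And>u. 0 \<le> shifted_form (L (S u)) u" using shifted.sign_operator_exists[OF L(1) L_sym c] by blast
  note S_simps = linear_add[OF S(1)] linear_scale[OF S(1)] linear_diff[OF S(1)] linear_0[OF S(1)]
  have pos: "0 < shifted_form (L (S A)) A" if A: "A \<noteq> 0" for A
  proof -
    define q where "q x y = shifted_form (L (S x)) y" for x y
    have "(q A (L (S A)))^2 \<le> q A A * q (L (S A)) (L (S A))"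
    proof (rule semidefinite_form_Cauchy_Schwarz[of q UNIV])
      show "linear (q x)" for x unfolding q_def by (rule linearI) (simp_all add: shifted.form_simps)
      show "q x y = q y x" for x y unfolding q_def by (metis L_sym S(2,4) shifted.sym)
    qed (simp_all add: q_def S(5))
    moreover have "S A \<noteq> 0" using S(3)[of A] S_simps(4) A by metis
    then have "L (S A) \<noteq> 0" using c(2)[of "S A"] c(1) by (auto simp: mult_le_0_iff)
    ultimately have "q A A \<noteq> 0" using shifted.pos[of "L (S A)"] by (auto simp: q_def)
    then show ?thesis using S(5)[of A] by (simp add: q_def)
  qed
  have orth: "shifted_form A B = 0" if "S A = A" "S B = - B" for A B using S(2)[of A B] that by (simp add: shifted.form.minus_right)
  have "splitting {U. S U = U} {U. S U = - U}" unfolding splitting_def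
  proof (intro conjI allI ballI impI)
    show "subspace {U. S U = U}" "subspace {U. S U = - U}" by (auto simp: subspace_def S_simps)
    show "\<exists>A\<in>{U. S U = U}. U - A \<in> {U. S U = - U}" for U
    proof (rule bexI[of _ "(1/2) *\<^sub>R (U + S U)"])
      have "U = (1/2) *\<^sub>R (U + U)" by (rule scaleR_half_double[symmetric])
      then have "U - (1/2) *\<^sub>R (U + S U) = (1/2) *\<^sub>R (U - S U)" by (metis add_diff_cancel_left scaleR_right_diff_distrib)
      then show "U - (1/2) *\<^sub>R (U + S U) \<in> {U. S U = - U}" by (simp add: S_simps S(3) flip: scaleR_minus_right)
    qed (simp add: S_simps S(3) add.commute)
    fix A B assume A: "A \<in> {U. S U = U}" and B: "B \<in> {U. S U = - U}"
    show "BV A B = 0" using orth[of "L A" B] S(4)[of A] A B by (simp add: L(2))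
    then show "l2 A B = 0" using orth[of A B] A B V_sup_nonneg by (simp add: shifted_form_def)
  next
    show "0 < BV A A" if "A \<in> {U. S U = U}" "A \<noteq> 0" for A using pos[OF that(2)] that(1) by (simp add: L(2))
    show "BV A A < 0" if "A \<in> {U. S U = - U}" "A \<noteq> 0" for A
      using pos[OF that(2)] that(1) by (simp add: L(2) L.neg shifted.form.minus_left)
  qed
  then show ?thesis by blast
qed

definition W_minus :: "'n h1 set" where "W_minus = {U. fn U \<in> Eminus V}"

definition W_plus :: "'n h1 set" where "W_plus = (SOME W. splitting W W_minus)"

definition P_plus :: "'n h1 \<Rightarrow> 'n h1" where "P_plus U = (SOME A. A \<in> W_plus \<and> U - A \<in> W_minus)"

lemma spectral_decomp_Eminus: "\<exists>Ep. spectral_decomp V Ep (Eminus V)"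
  unfolding Eminus_def by (rule someI_ex) (insert splitting_exists spectral_decomp_represented, blast)

lemma splitting_W: "splitting W_plus W_minus"
  unfolding W_plus_def using spectral_decomp_Eminus
  by (intro someI_ex[of "\<lambda>W. splitting W W_minus"]) (auto simp: W_minus_def dest: spectral_decomp_splitting)

lemma represents_Eminus_iff: "represents u U \<Longrightarrow> u \<in> Eminus V \<longleftrightarrow> U \<in> W_minus"
  using spectral_decomp_Eminus spectral_decomp_splitting(2) by (auto simp: W_minus_def)

lemma Eminus_subset_H1: "Eminus V \<subseteq> H1"
proof -
  obtain Ep where "spectral_decomp V Ep (Eminus V)" using spectral_decomp_Eminus by blast
  then show ?thesis by (simp add: spectral_decomp_def)
qed

lemmas W = splittingD[OF splitting_W]

lemma P_plus_in: "P_plus U \<in> W_plus" "U - P_plus U \<in> W_minus"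
  using someI_ex[of "\<lambda>A. A \<in> W_plus \<and> U - A \<in> W_minus"] W(3) by (fastforce simp: P_plus_def)+

lemma P_plus_unique:
  assumes A: "A \<in> W_plus" "U - A \<in> W_minus"
  shows "P_plus U = A"
proof (rule ccontr)
  assume "P_plus U \<noteq> A"
  moreover have "P_plus U - A \<in> W_plus" by (intro subspace_diff W P_plus_in A)
  moreover have "P_plus U - A \<in> W_minus" using subspace_diff[OF W(2) A(2) P_plus_in(2)[of U]] by simp
  ultimately show False using W(5)[of "P_plus U - A" "P_plus U - A"] W(6)[of "P_plus U - A"] by simp
qed

lemma P_plus_zero_iff: "P_plus U = 0 \<longleftrightarrow> U \<in> W_minus"
  using P_plus_unique[of 0 U] P_plus_in(2)[of U] subspace_0[OF W(1)] by auto

lemma P_plus_idem: "P_plus (P_plus U) = P_plus U"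
  by (rule P_plus_unique) (simp_all add: P_plus_in subspace_0[OF W(2)])

lemma shifted_form_orth: "A \<in> W_plus \<Longrightarrow> B \<in> W_minus \<Longrightarrow> shifted_form A B = 0"
  by (simp add: shifted_form_def W(4,5))

lemma shifted_form_P_plus: "shifted_form U U = shifted_form (P_plus U) (P_plus U) + shifted_form (U - P_plus U) (U - P_plus U)"
  using shifted_form_orth[OF P_plus_in, of U U] by (simp add: shifted.form_simps shifted.sym[of U "P_plus U"])

lemma P_plus_bounded: "\<exists>K>0. \<forall>U. norm (P_plus U) \<le> K * norm U \<and> norm (U - P_plus U) \<le> K * norm U"
proof -
  obtain m where m: "0 < m" "\<And>x y. shifted_form x x \<le> shifted_form y y \<Longrightarrow> m * norm x \<le> norm y" using shifted.form_le_imp_norm_le by blast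
  have "m * norm (P_plus U) \<le> norm U" "m * norm (U - P_plus U) \<le> norm U" for U
    by (intro m(2); use shifted_form_P_plus[of U] in simp)+
  then show ?thesis using m(1) by (intro exI[of _ "1 / m"]) (simp add: field_simps)
qed

lemma bounded_linear_P_plus: "bounded_linear P_plus"
proof -
  obtain K where K: "\<And>U. norm (P_plus U) \<le> K * norm U" using P_plus_bounded by blast
  show ?thesis
  proof (rule bounded_linear_intro)
    show "P_plus (x + y) = P_plus x + P_plus y" for x y
    proof (rule P_plus_unique)
      show "x + y - (P_plus x + P_plus y) \<in> W_minus" using subspace_add[OF W(2) P_plus_in(2)[of x] P_plus_in(2)[of y]] by (simp add: algebra_simps)
    qed (intro subspace_add W P_plus_in)
    show "P_plus (r *\<^sub>R x) = r *\<^sub>R P_plus x" for r x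
    proof (rule P_plus_unique)
      show "r *\<^sub>R x - r *\<^sub>R P_plus x \<in> W_minus" using subspace_scale[OF W(2) P_plus_in(2)[of x], of r] by (simp add: algebra_simps)
    qed (intro subspace_scale W P_plus_in)
    show "norm (P_plus x) \<le> norm x * K" for x using K[of x] by (simp add: mult.commute)
  qed
qed

text \<open>Cauchy-Schwarz for the semidefinite form \<open>\<sigma> BV\<close> on \<open>W\<close>, tested with the projection of \<open>L A\<close>, where \<open>BV A A' = shifted_form (L A) A'\<close>.\<close>
lemma definite_part_coercive:
  fixes Q :: "'n h1 \<Rightarrow> 'n h1"
  assumes W: "subspace W" and Q: "\<And>U. Q U \<in> W" "\<And>A U. A \<in> W \<Longrightarrow> BV A (U - Q U) = 0" "\<exists>K>0. \<forall>U. norm (Q U) \<le> K * norm U"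
    and sgn: "\<sigma>^2 = 1" "\<And>A. A \<in> W \<Longrightarrow> 0 \<le> \<sigma> * BV A A"
  shows "\<exists>c>0. \<forall>A\<in>W. c * (norm A)^2 \<le> \<sigma> * BV A A"
proof -
  obtain L c where L: "bounded_linear L" "\<And>U W. BV U W = shifted_form (L U) W" and c: "0 < c" "\<And>U. c * norm U \<le> norm (L U)"
    using shifted_operator_exists by blast
  obtain K where K: "0 < K" "\<And>U. norm (Q U) \<le> K * norm U" using Q(3) by blast
  obtain M where M: "0 < M" "\<And>U W. norm (BV U W) \<le> norm U * norm W * M" using BV.pos_bounded by blast
  have "c^2 / (K^2 * M) * (norm A)^2 \<le> \<sigma> * BV A A" if A: "A \<in> W" for A
  proof (cases "A = 0")
    case False
    define X where "X = Q (L A)"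
    have LA: "0 < norm (L A)" using c(2)[of A] c(1) False by (meson less_le_trans mult_pos_pos zero_less_norm_iff)
    have "BV A X = shifted_form (L A) (L A)" using Q(2)[OF A, of "L A"] L(2)[of A "L A"] by (simp add: X_def BV_simps)
    then have "(norm (L A))^2 * (norm (L A))^2 \<le> BV A X * BV A X"
      using norm_square_le_shifted_form[of "L A"] by (intro mult_mono) auto
    also have "\<dots> = (\<sigma> * BV A X)^2" using sgn(1) by (simp add: power_mult_distrib power2_eq_square)
    also have "\<dots> \<le> (\<sigma> * BV A A) * (\<sigma> * BV X X)"
      by (rule semidefinite_form_Cauchy_Schwarz[of "\<lambda>x y. \<sigma> * BV x y" W])
        (insert W sgn A Q(1) BV_sym, auto simp: X_def BV_simps algebra_simps intro!: linearI)
    also have "\<dots> \<le> (\<sigma> * BV A A) * ((K^2 * M) * (norm (L A))^2)"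
    proof (rule mult_left_mono[OF _ sgn(2)[OF A]])
      have "abs \<sigma> = 1" using sgn(1) by (auto simp: power2_eq_1_iff)
      then have "\<sigma> * BV X X \<le> norm (BV X X)" by (metis abs_ge_self abs_mult mult_1 real_norm_def)
      also have "\<dots> \<le> (norm X)^2 * M" using M(2)[of X X] by (simp add: power2_eq_square)
      also have "\<dots> \<le> (K * norm (L A))^2 * M" using K(2)[of "L A"] M(1) by (intro mult_right_mono power_mono) (auto simp: X_def)
      finally show "\<sigma> * BV X X \<le> (K^2 * M) * (norm (L A))^2" by (simp add: power_mult_distrib mult_ac)
    qed
    finally have "(norm (L A))^2 * (norm (L A))^2 \<le> (\<sigma> * BV A A) * (K^2 * M) * (norm (L A))^2" by (simp only: mult.assoc)
    then have "(norm (L A))^2 \<le> (\<sigma> * BV A A) * (K^2 * M)" by (rule mult_right_le_imp_le) (insert LA, simp)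
    moreover have "(c * norm A)^2 \<le> (norm (L A))^2" by (rule power_mono[OF c(2)]) (insert c(1), simp)
    ultimately have "(c * norm A)^2 \<le> (\<sigma> * BV A A) * (K^2 * M)" by linarith
    then show ?thesis using K(1) M(1) by (simp add: power_mult_distrib field_simps)
  qed (simp add: BV_simps)
  moreover have "0 < c^2 / (K^2 * M)" using c(1) K(1) M(1) by simp
  ultimately show ?thesis by blast
qed

lemma BV_coercive:
  "\<exists>c>0. \<forall>U. c * (norm (P_plus U))^2 \<le> BV (P_plus U) (P_plus U) \<and> c * (norm (U - P_plus U))^2 \<le> - BV (U - P_plus U) (U - P_plus U)"
proof -
  have nonneg: "0 \<le> 1 * BV A A" if "A \<in> W_plus" for A using W(6)[OF that] by (cases "A = 0") (auto simp: BV_simps)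
  have "\<exists>c>0. \<forall>A\<in>W_plus. c * (norm A)^2 \<le> 1 * BV A A"
    by (rule definite_part_coercive[OF W(1) P_plus_in(1) W(5)[OF _ P_plus_in(2)] _ _ nonneg]) (insert P_plus_bounded, auto)
  then obtain a where a: "0 < a" "\<And>A. A \<in> W_plus \<Longrightarrow> a * (norm A)^2 \<le> BV A A" by auto
  have nonpos: "0 \<le> - 1 * BV A A" if "A \<in> W_minus" for A using W(7)[OF that] by (cases "A = 0") (auto simp: BV_simps)
  have "BV A (U - (U - P_plus U)) = 0" if "A \<in> W_minus" for A U using W(5)[OF P_plus_in(1) that] by (simp add: BV_sym)
  then have "\<exists>c>0. \<forall>A\<in>W_minus. c * (norm A)^2 \<le> - 1 * BV A A"
    by (rule definite_part_coercive[OF W(2) P_plus_in(2) _ _ _ nonpos]) (insert P_plus_bounded, auto)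
  then obtain b where b: "0 < b" "\<And>A. A \<in> W_minus \<Longrightarrow> b * (norm A)^2 \<le> - BV A A" by auto
  have "min a b * (norm A)^2 \<le> a * (norm A)^2" "min a b * (norm A)^2 \<le> b * (norm A)^2" for A :: "'n h1" by (intro mult_right_mono; simp)+
  then have "min a b * (norm (P_plus U))^2 \<le> BV (P_plus U) (P_plus U)"
    "min a b * (norm (U - P_plus U))^2 \<le> - BV (U - P_plus U) (U - P_plus U)" for U
    using a(2) b(2) P_plus_in order_trans by meson+
  then show ?thesis using a(1) b(1) by (intro exI[of _ "min a b"]) simp
qed

lemma P_plus_nontrivial: "\<exists>w. P_plus w = w \<and> w \<noteq> 0"
proof -
  obtain U where U: "0 < BV U U" using BV_positive_direction by blast
  then have "U \<noteq> 0" by (auto simp: BV_simps)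
  then have "P_plus U \<noteq> 0" using U W(7)[of U] by (auto simp: P_plus_zero_iff)
  then show ?thesis using P_plus_idem by blast
qed

end

section \<open>Compactness and the comparison of levels\<close>

lemma bounded_subseq_if_not_at_infinity:
  fixes z :: "nat \<Rightarrow> 'a::real_normed_vector"
  assumes "\<not> filterlim z at_infinity sequentially"
  shows "\<exists>(r :: nat \<Rightarrow> nat) Z. strict_mono r \<and> (\<forall>n. norm (z (r n)) \<le> Z)"
proof -
  obtain Z where "\<not> (\<forall>\<^sub>F n in sequentially. Z \<le> norm (z n))"
    using assms by (auto simp: filterlim_at_infinity_conv_norm_at_top filterlim_at_top)
  then show ?thesis by (blast dest: not_eventually_sequentiallyD intro: less_imp_le[OF not_le[THEN iffD1]])
qed

lemma ex_integer_vector_cube: "\<exists>k. (\<forall>i. k $ i \<in> \<int>) \<and> x - k \<in> cube" for x :: "real^'n"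
proof (intro exI[of _ "\<chi> i. real_of_int \<lfloor>x $ i\<rfloor>"] conjI allI)
  show "x - (\<chi> i. real_of_int \<lfloor>x $ i\<rfloor>) \<in> cube" unfolding mem_cube by (auto simp: algebra_simps) linarith
qed simp

lemma norm_cube_le_card:
  assumes "h \<in> (cube :: (real^'n) set)"
  shows "norm h \<le> real CARD('n)"
proof (rule power2_le_imp_le)
  show "(norm h)^2 \<le> (real CARD('n))^2" by (rule order_trans[OF norm_cube_le[OF assms] self_le_power]) (simp_all add: Suc_leI)
qed simp

definition powr_mass :: "real \<Rightarrow> (real^'n) set \<Rightarrow> 'n::finite h1 \<Rightarrow> real" where
  "powr_mass q S U = weighted_powr (indicator S) q (fn U)"

lemma powr_mass_two: "powr_mass 2 S U = mass S (fn U)"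
  by (simp add: powr_mass_def mass_def mult.commute)

lemma powr_mass_mono:
  fixes U :: "'n::finite h1"
  assumes q: "subcritical TYPE('n) q" and ST: "S \<subseteq> T" and S: "S \<in> sets borel" and T: "T \<in> sets borel"
  shows "powr_mass q S U \<le> powr_mass q T U"
  unfolding powr_mass_def
proof (rule integral_mono)
  show "integrable lborel (\<lambda>y. indicator S y * abs (fn U y) powr q)" "integrable lborel (\<lambda>y. indicator T y * abs (fn U y) powr q)"
    using integrable_real_mult_indicator[OF _ fn_powr_integrable[OF q, of U]] S T by (simp_all add: mult.commute)
  show "indicator S y * abs (fn U y) powr q \<le> indicator T y * abs (fn U y) powr q" for y using ST by (auto simp: indicator_def)
qed

lemma powr_mass_at_integer_vector:
  fixes U :: "'n::finite h1"
  assumes q: "subcritical TYPE('n) q" and S: "S \<in> sets borel" and b: "\<And>y. y \<in> S \<Longrightarrow> norm y \<le> b"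
  shows "\<exists>k. (\<forall>i. k $ i \<in> \<int>) \<and> norm (x - k) \<le> real CARD('n)
    \<and> powr_mass q {y. y - x \<in> S} U \<le> powr_mass q {y. y - k \<in> cball 0 (b + real CARD('n))} U"
proof -
  obtain k :: "real^'n" where k: "\<forall>i. k $ i \<in> \<int>" "x - k \<in> cube" using ex_integer_vector_cube by blast
  note norm = norm_cube_le_card[OF k(2)]
  have "norm (y - k) \<le> b + real CARD('n)" if "y - x \<in> S" for y
    using b[OF that] norm norm_triangle_ineq[of "y - x" "x - k"] by simp
  then show ?thesis using k(1) norm S by (auto intro!: powr_mass_mono[OF q])
qed

lemma powr_mass_shift:
  fixes U :: "'n::finite h1"
  assumes [measurable]: "S \<in> sets borel"
  shows "powr_mass q S (shift k U) = powr_mass q {y. y - k \<in> S} U"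
proof -
  have "powr_mass q S (shift k U) = (LBINT y. indicator {y. y - k \<in> S} (y + k) * abs (fn U (y + k)) powr q)"
    unfolding powr_mass_def by (rule integral_cong_AE) (insert fn_shift[of k U], auto simp: indicator_def elim!: eventually_mono)
  also have "\<dots> = powr_mass q {y. y - k \<in> S} U"
    unfolding powr_mass_def by (rule integral_shift(1)[of "\<lambda>y. indicator {y. y - k \<in> S} y * abs (fn U y) powr q"]) measurable
  finally show ?thesis .
qed

lemma weak_limit_nonzero:
  fixes X :: "nat \<Rightarrow> 'n::finite h1"
  assumes q: "subcritical TYPE('n) q" and X: "X \<rightharpoonup> w" "\<And>n. norm (X n) \<le> R" and S: "S \<in> sets borel" "bounded S"
    and mass: "0 < \<eta>" "\<And>n. \<eta> \<le> powr_mass q S (X n)"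
  shows "w \<noteq> 0"
proof
  assume zero: "w = 0"
  have "unit_weight (indicator S)" using S(1) by (auto simp: unit_weight_def indicator_def)
  moreover have "integrable lborel (indicator S :: real^'n \<Rightarrow> real)"
    using S emeasure_bounded_finite[of S] by (intro integrable_real_indicator) auto
  ultimately have "(\<lambda>n. powr_mass q S (X n)) \<longlonglongrightarrow> 0" using X unfolding zero powr_mass_def by (intro rellich_null(2)[OF q])
  then have "\<eta> \<le> 0" using mass(2) by (intro LIMSEQ_le_const) auto
  then show False using mass(1) by simp
qed

lemma shift_inverse: "shift k (shift (- k) U) = U"
proof (rule h1_eqI)
  show "AE x in lborel. fn (shift k (shift (- k) U)) x = fn U x"
    using fn_shift[of k "shift (- k) U"] AE_shift[OF fn_shift[of "- k" U], of k] by eventually_elim simp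
qed

context nonlinear_functional
begin

lemma coefficients_const: "k0 \<le> c \<Longrightarrow> c \<le> k1 \<Longrightarrow> (\<lambda>_. c) \<in> coefficients"
  by (simp add: coefficients_def)

lemma coefficients_shift: "K \<in> coefficients \<Longrightarrow> (\<lambda>x. K (x + k)) \<in> coefficients"
  by (simp add: coefficients_def measurable_compose[of "\<lambda>x. x + k" borel borel K])

lemma weighted_integral_shift:
  assumes K: "K \<in> coefficients" and [measurable]: "g \<in> borel_measurable borel" "h \<in> borel_measurable borel"
    and h: "AE x in lborel. h x = g (x + k)"
  shows "weighted_integral (\<lambda>x. K (x + k)) h = weighted_integral K g"
proof -
  note [measurable] = coefficientsD(1)[OF K]
  have "weighted_integral (\<lambda>x. K (x + k)) h = weighted_integral (\<lambda>x. K (x + k)) (\<lambda>x. g (x + k))"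
    by (rule weighted_integral_cong[OF coefficients_shift[OF K] _ _ h]) measurable
  also have "\<dots> = weighted_integral K g"
    unfolding weighted_integral_def by (rule integral_shift(1)[of "\<lambda>x. K x * g x"]) measurable
  finally show ?thesis .
qed

lemma phi_shift:
  assumes K: "K \<in> coefficients"
  shows "phi (\<lambda>x. K (x + k)) (shift k u) (shift k h) = phi K u h"
proof -
  have "AE x in lborel. f (fn (shift k u) x) * fn (shift k h) x = f (fn u (x + k)) * fn h (x + k)"
    using fn_shift[of k u] fn_shift[of k h] by eventually_elim simp
  then show ?thesis unfolding phi_def by (intro weighted_integral_shift[OF K]) measurable
qed

lemma Phi_shift:
  assumes K: "K \<in> coefficients"
  shows "Phi (\<lambda>x. K (x + k)) (shift k u) = Phi K u"
  unfolding Phi_def by (rule weighted_integral_shift[OF K]) (insert fn_shift[of k u], auto elim: eventually_mono)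

lemma Phi_mono:
  assumes K: "K \<in> coefficients" "K' \<in> coefficients" and pointwise: "\<And>x. K x \<le> K' x"
  shows "Phi K u \<le> Phi K' u"
  unfolding Phi_def weighted_integral_def
  by (intro integral_mono weighted_integrable[OF K(1) F_integrable] weighted_integrable[OF K(2) F_integrable] mult_right_mono pointwise F_nonneg)

lemma Phi_const_less:
  assumes c: "k0 \<le> c" "c < c'" "c' \<le> k1" and z: "z \<noteq> 0"
  shows "Phi (\<lambda>_. c) z < Phi (\<lambda>_. c') z"
proof -
  have "0 < Phi (\<lambda>_. c) z" using c by (intro Phi_pos[OF coefficients_const z]) auto
  then have "0 < (LBINT x. F (fn z x))" using c k0 by (simp add: Phi_def weighted_integral_def zero_less_mult_iff)
  then show ?thesis using c(2) by (simp add: Phi_def weighted_integral_def mult_strict_right_mono)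
qed

lemma powr_integral_lower_bound:
  assumes \<alpha>: "0 < \<alpha>"
  shows "\<exists>d>0. \<forall>K\<in>coefficients. \<forall>u. norm u \<le> R \<longrightarrow> 2 * \<alpha> \<le> phi K u u \<longrightarrow> d \<le> (LBINT x. abs (fn u x) powr p)"
proof (cases "coefficients = {}")
  case False
  then have k1: "0 < k1" using coefficientsD(6) by blast
  define e where "e = \<alpha> / (k1 * (R^2 + 1))"
  have "0 < R^2 + 1" by (simp add: add_nonneg_pos)
  then have e: "0 < e" "k1 * (e * (R^2 + 1)) = \<alpha>" using \<alpha> k1 by (simp_all add: e_def)
  obtain C where C: "0 \<le> C" "\<And>t. f t * t \<le> e * t^2 + C * abs t powr p" using f_mult_growth[OF e(1)] by blast
  have "\<alpha> / (k1 * (C + 1)) \<le> (LBINT x. abs (fn u x) powr p)"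
    if K: "K \<in> coefficients" and u: "norm u \<le> R" "2 * \<alpha> \<le> phi K u u" for K u
  proof -
    let ?I = "LBINT x. abs (fn u x) powr p"
    have "2 * \<alpha> \<le> weighted_integral K (\<lambda>x. e * (fn u x)^2 + C * abs (fn u x) powr p)"
      using u(2) C unfolding phi_def by (elim order_trans) (auto intro!: weighted_integral_mono[OF K])
    also have "\<dots> \<le> k1 * (e * (norm u)^2 + C * ?I)" using e(1) C(1) by (intro weighted_integral_power_le(1)[OF K]) auto
    also have "\<dots> \<le> k1 * (e * (R^2 + 1) + (C + 1) * ?I)"
    proof -
      have "(norm u)^2 \<le> R^2 + 1" using power_mono[OF u(1), of 2] by simp
      moreover have "0 \<le> ?I" by simp
      ultimately show ?thesis using k1 e(1) C(1) by (intro mult_left_mono add_mono) (auto intro: mult_right_mono)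
    qed
    also have "\<dots> = \<alpha> + k1 * (C + 1) * ?I" using e(2) by (simp add: distrib_left mult.assoc)
    finally have "\<alpha> \<le> k1 * (C + 1) * ?I" by simp
    then show ?thesis using k1 C(1) by (simp add: divide_le_eq mult_ac add_nonneg_pos)
  qed
  moreover have "0 < \<alpha> / (k1 * (C + 1))" using \<alpha> k1 C(1) by simp
  ultimately show ?thesis by blast
qed (auto intro: exI[of _ 1])

end

locale variational = schroedinger V + nonlinear_functional f p \<theta> k0 k1 "TYPE('n)"
  for V :: "real^'n \<Rightarrow> real" and f p \<theta> k0 k1
begin

sublocale pankov?: nehari_pankov BV P_plus coefficients Phi phi \<theta>
proof (rule nehari_pankov.intro)
  show "BV (P_plus u) (v - P_plus v) = 0" for u v by (rule W(5)[OF P_plus_in])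
  show "(\<lambda>n. phi K (Y n) h) \<longlonglongrightarrow> phi K y h" if "K \<in> coefficients" "Y \<rightharpoonup> y" "\<And>n. norm (Y n) \<le> R" for K Y y R h
    by (rule phi_weakly_continuous[OF that(2,3,1,1)]) simp
qed (fact bounded_bilinear_BV BV_sym bounded_linear_P_plus P_plus_idem BV_coercive P_plus_nontrivial phi_linear phi_self_bounded
    phi_coercive Phi_lower_bound Phi_scaling_less theta theta_Phi_le Phi_zero Phi_pos Phi_growth Phi_small)+

lemma denergy_shift:
  assumes K: "K \<in> coefficients" and k: "\<forall>i. k $ i \<in> \<int>"
  shows "denergy (\<lambda>x. K (x + k)) (shift k u) h = denergy K u (shift (- k) h)"
  using BV_shift[OF k, of u "shift (- k) h"] phi_shift[OF K, of k u "shift (- k) h"] by (simp add: denergy_def shift_inverse)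

lemma energy_shift:
  assumes K: "K \<in> coefficients" and k: "\<forall>i. k $ i \<in> \<int>"
  shows "energy (\<lambda>x. K (x + k)) (shift k u) = energy K u"
  by (simp add: energy_def BV_shift[OF k] Phi_shift[OF K])

lemma weak_limit_critical:
  fixes Ks :: "nat \<Rightarrow> real^'n \<Rightarrow> real"
  assumes X: "X \<rightharpoonup> w" "\<And>n. norm (X n) \<le> R"
    and Ks: "\<And>n. Ks n \<in> coefficients" and K: "K \<in> coefficients" and lim: "\<And>x. (\<lambda>n. Ks n x) \<longlonglongrightarrow> K x"
    and d: "\<And>n h. abs (denergy (Ks n) (X n) h) \<le> \<delta> n * norm h" "\<delta> \<longlonglongrightarrow> 0"
    and e: "\<And>n. energy (Ks n) (X n) \<le> e n" "e \<longlonglongrightarrow> e0"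
  shows "critical K w \<and> energy K w \<le> e0"
proof
  have denergy: "denergy K w h = 0" for h
  proof (rule LIMSEQ_unique)
    show "(\<lambda>n. denergy (Ks n) (X n) h) \<longlonglongrightarrow> denergy K w h" unfolding denergy_def
      by (intro tendsto_diff phi_weakly_continuous[OF X Ks K lim] weakly_convergesD[OF X(1) BV.bounded_linear_left])
    show "(\<lambda>n. denergy (Ks n) (X n) h) \<longlonglongrightarrow> 0"
      by (rule Lim_null_comparison[OF always_eventually tendsto_mult_left_zero[OF d(2), of "norm h"]]) (simp add: d(1))
  qed
  then show "critical K w" by (simp add: critical_def)
  have "phi K w w / 2 - Phi K w \<le> e0"
  proof (rule excess_Fatou[OF X Ks K lim])
    show "(\<lambda>n. e n + abs (\<delta> n) * R / 2) \<longlonglongrightarrow> e0" by (rule tendsto_eq_intros e(2) d(2) | simp)+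
    fix n
    have "- denergy (Ks n) (X n) (X n) \<le> \<delta> n * norm (X n)" using d(1)[of n "X n"] by linarith
    also have "\<dots> \<le> abs (\<delta> n) * R" using X(2)[of n] by (intro mult_mono) auto
    finally show "phi (Ks n) (X n) (X n) / 2 - Phi (Ks n) (X n) \<le> e n + abs (\<delta> n) * R / 2"
      using e(1)[of n] by (simp add: energy_def denergy_def field_simps)
  qed
  then show "energy K w \<le> e0" using denergy[of w] by (simp add: denergy_def energy_def)
qed

lemma translated_limit:
  fixes Ks :: "nat \<Rightarrow> real^'n \<Rightarrow> real" and k :: "nat \<Rightarrow> real^'n"
  assumes q: "subcritical TYPE('n) q" and Ks: "\<And>n. Ks n \<in> coefficients" and K: "K \<in> coefficients" and R: "\<And>n. norm (X n) \<le> R"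
    and d: "\<And>n h. abs (denergy (Ks n) (X n) h) \<le> \<delta> n * norm h" "\<delta> \<longlonglongrightarrow> 0"
    and e: "\<And>n. energy (Ks n) (X n) \<le> e n" "e \<longlonglongrightarrow> e0"
    and k: "\<And>n i. k n $ i \<in> \<int>" and lim: "\<And>x. (\<lambda>n. Ks n (x + k n)) \<longlonglongrightarrow> K x"
    and S: "S \<in> sets borel" "bounded S" and mass: "0 < \<eta>" "\<And>n. \<eta> \<le> powr_mass q {y. y - k n \<in> S} (X n)"
  shows "\<exists>w. w \<noteq> 0 \<and> critical K w \<and> energy K w \<le> e0"
proof -
  define Y where "Y n = shift (k n) (X n)" for n
  have Y: "norm (Y n) \<le> R" for n using R by (simp add: Y_def norm_shift)
  obtain r w where r: "strict_mono r" and w: "(Y \<circ> r) \<rightharpoonup> w" using bounded_imp_weakly_convergent_subseq[of Y R, OF Y] by blast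
  let ?Z = "\<lambda>n. Y (r n)" and ?Ls = "\<lambda>n x. Ks (r n) (x + k (r n))"
  have Z: "?Z \<rightharpoonup> w" "norm (?Z n) \<le> R" for n using w Y by (simp_all add: o_def)
  have "critical K w \<and> energy K w \<le> e0"
  proof (rule weak_limit_critical[of ?Z w R ?Ls K "\<lambda>n. \<delta> (r n)" "\<lambda>n. e (r n)" e0, OF Z])
    show "?Ls n \<in> coefficients" for n by (rule coefficients_shift[OF Ks])
    show "(\<lambda>n. ?Ls n x) \<longlonglongrightarrow> K x" for x using LIMSEQ_subseq_LIMSEQ[OF lim r] by (simp add: o_def)
    show "abs (denergy (?Ls n) (?Z n) h) \<le> \<delta> (r n) * norm h" for n h
      using d(1)[of "r n" "shift (- k (r n)) h"] by (simp add: Y_def denergy_shift[OF Ks] k norm_shift)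
    show "energy (?Ls n) (?Z n) \<le> e (r n)" for n using e(1) by (simp add: Y_def energy_shift[OF Ks] k)
  qed (insert K LIMSEQ_subseq_LIMSEQ[OF d(2) r] LIMSEQ_subseq_LIMSEQ[OF e(2) r], simp_all add: o_def)
  moreover have "w \<noteq> 0" using mass by (intro weak_limit_nonzero[OF q Z S mass(1)]) (simp add: Y_def powr_mass_shift[OF S(1)])
  ultimately show ?thesis by blast
qed

lemma nonvanishing_nehari:
  assumes \<alpha>: "0 < \<alpha>"
  shows "\<exists>\<eta>>0. \<forall>K\<in>coefficients. \<forall>u\<in>nehari K. norm u \<le> R \<longrightarrow> \<alpha> \<le> energy K u \<longrightarrow> (\<exists>x. \<eta> \<le> mass {y. y - x \<in> cube} (fn u))"
proof -
  obtain d where d: "0 < d" "\<And>K u. K \<in> coefficients \<Longrightarrow> norm u \<le> R \<Longrightarrow> 2 * \<alpha> \<le> phi K u u \<Longrightarrow> d \<le> (LBINT x. abs (fn u x) powr p)"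
    using powr_integral_lower_bound[OF \<alpha>, of R] by blast
  have "2 * \<alpha> \<le> phi K u u" if "K \<in> coefficients" "u \<in> nehari K" "\<alpha> \<le> energy K u" for K u
    using that nehariD(2)[of u K] Phi_nonneg[of K u] by (simp add: energy_def)
  then show ?thesis using nonvanishing[OF p_subcritical p d(1), of R] d(2) by meson
qed

lemma palais_smale_with_mass:
  assumes K: "K \<in> coefficients"
  shows "\<exists>X k R \<eta> b. 0 < \<eta> \<and> (\<forall>n. norm (X n) \<le> R \<and> energy K (X n) \<le> level K + 1 / real (Suc n)
    \<and> (\<forall>h. abs (denergy K (X n) h) \<le> 1 / real (Suc n) * norm h)
    \<and> (\<forall>i. k n $ i \<in> \<int>) \<and> \<eta> \<le> powr_mass 2 {y. y - k n \<in> cball 0 b} (X n))"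
proof -
  have "\<exists>u. u \<in> nehari K \<and> energy K u \<le> level K + 1 / real (Suc n) \<and> (\<forall>h. abs (denergy K u h) \<le> 1 / real (Suc n) * norm h)" for n
    using palais_smale_sequence[OF K, of "1 / real (Suc n)"] by auto
  then obtain X where X: "\<And>n. X n \<in> nehari K" "\<And>n. energy K (X n) \<le> level K + 1 / real (Suc n)"
    "\<And>n h. abs (denergy K (X n) h) \<le> 1 / real (Suc n) * norm h" by metis
  obtain R where R: "\<And>u. u \<in> nehari K \<Longrightarrow> energy K u \<le> level K + 1 \<Longrightarrow> norm u \<le> R" using nehari_bounded K by meson
  have "norm (X n) \<le> R" for n
  proof (rule R[OF X(1)])
    have "1 / real (Suc n) \<le> 1" by simp
    then show "energy K (X n) \<le> level K + 1" using X(2)[of n] by linarith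
  qed
  moreover obtain \<eta> where \<eta>: "0 < \<eta>"
    "\<And>u. u \<in> nehari K \<Longrightarrow> norm u \<le> R \<Longrightarrow> level K \<le> energy K u \<Longrightarrow> \<exists>x. \<eta> \<le> mass {y. y - x \<in> cube} (fn u)"
    using nonvanishing_nehari[OF level_pos[OF K], of R] K by meson
  ultimately have "\<exists>x. \<eta> \<le> mass {y. y - x \<in> cube} (fn (X n))" for n using X(1) level_le[OF K X(1)] by blast
  then obtain x where x: "\<And>n. \<eta> \<le> powr_mass 2 {y. y - x n \<in> cube} (X n)" unfolding powr_mass_two by metis
  define b where "b = real CARD('n) + real CARD('n)"
  have "\<forall>n. \<exists>k. (\<forall>i. k $ i \<in> \<int>) \<and> \<eta> \<le> powr_mass 2 {y. y - k \<in> cball 0 b} (X n)"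
    unfolding b_def using powr_mass_at_integer_vector[OF subcritical_two cube_borel norm_cube_le_card] x order_trans by blast
  then have "\<exists>k. \<forall>n. (\<forall>i. k n $ i \<in> \<int>) \<and> \<eta> \<le> powr_mass 2 {y. y - k n \<in> cball 0 b} (X n)" by (rule choice)
  then show ?thesis using \<eta>(1) X(2,3) \<open>\<And>n. norm (X n) \<le> R\<close> by blast
qed

theorem compactness_alternative:
  assumes K: "K \<in> coefficients" and K_lim: "(K \<longlongrightarrow> K_inf) at_infinity" "k0 \<le> K_inf" "K_inf \<le> k1"
  shows "\<exists>K'\<in>{K, \<lambda>_. K_inf}. \<exists>w. w \<noteq> 0 \<and> critical K' w \<and> energy K' w \<le> level K"
proof -
  obtain X k R \<eta> b where X: "0 < \<eta>" "\<And>n. norm (X n) \<le> R" "\<And>n. energy K (X n) \<le> level K + 1 / real (Suc n)"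
    "\<And>n h. abs (denergy K (X n) h) \<le> 1 / real (Suc n) * norm h" and k: "\<And>n i. k n $ i \<in> \<int>"
    and mass: "\<And>n. \<eta> \<le> powr_mass 2 {y. y - k n \<in> cball 0 b} (X n)"
    using palais_smale_with_mass[OF K] by blast
  have d0: "(\<lambda>n. 1 / real (Suc n)) \<longlonglongrightarrow> 0" using LIMSEQ_inverse_real_of_nat by (simp add: inverse_eq_divide)
  then have e0: "(\<lambda>n. level K + 1 / real (Suc n)) \<longlonglongrightarrow> level K" using tendsto_add[OF tendsto_const] by fastforce
  show ?thesis
  proof (cases "filterlim k at_infinity sequentially")
    case True
    have "\<exists>w. w \<noteq> 0 \<and> critical (\<lambda>_. K_inf) w \<and> energy (\<lambda>_. K_inf) w \<le> level K"
    proof (rule translated_limit[where Ks="\<lambda>_. K", OF subcritical_two K coefficients_const[OF K_lim(2,3)] X(2,4) d0 X(3) e0 k _ _ _ X(1) mass])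
      show "(\<lambda>n. K (y + k n)) \<longlonglongrightarrow> K_inf" for y
        using filterlim_compose[OF K_lim(1) tendsto_add_filterlim_at_infinity[OF tendsto_const True]] .
    qed simp_all
    then show ?thesis by blast
  next
    case False
    then obtain r :: "nat \<Rightarrow> nat" and Z where r: "strict_mono r" "\<And>n. norm (k (r n)) \<le> Z"
      using bounded_subseq_if_not_at_infinity[of k] by blast
    have "norm y \<le> b + Z" if "norm (y - k (r n)) \<le> b" for y n
      using that r(2)[of n] norm_triangle_sub[of y "k (r n)"] by linarith
    then have "\<eta> \<le> powr_mass 2 {y. y - 0 \<in> cball 0 (b + Z)} (X (r n))" for n
      by (intro order_trans[OF mass[of "r n"] powr_mass_mono[OF subcritical_two]]) auto
    then have "\<exists>w. w \<noteq> 0 \<and> critical K w \<and> energy K w \<le> level K"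
      using LIMSEQ_subseq_LIMSEQ[OF d0 r(1)] LIMSEQ_subseq_LIMSEQ[OF e0 r(1)]
      by (intro translated_limit[where Ks="\<lambda>_. K" and k="\<lambda>_. 0" and S="cball 0 (b + Z)", OF subcritical_two K K X(2,4) _ X(3) _ _ _ _ _ X(1)])
        (auto simp: o_def)
    then show ?thesis by blast
  qed
qed

lemma constant_ground_state:
  assumes c: "k0 \<le> c" "c \<le> k1"
  shows "\<exists>w\<in>nehari (\<lambda>_. c). energy (\<lambda>_. c) w = level (\<lambda>_. c)"
proof -
  note K = coefficients_const[OF c]
  obtain w where w: "w \<noteq> 0" "critical (\<lambda>_. c) w" "energy (\<lambda>_. c) w \<le> level (\<lambda>_. c)"
    using compactness_alternative[OF K tendsto_const c] by auto
  then show ?thesis using critical_imp_nehari[OF K w(2,1)] level_le_critical[OF K w(2,1)] by (intro bexI[of _ w]) auto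
qed

lemma level_const_strict_antimono:
  assumes c: "k0 \<le> c" "c < c'" "c' \<le> k1"
  shows "level (\<lambda>_. c') < level (\<lambda>_. c)"
proof -
  obtain w where w: "w \<in> nehari (\<lambda>_. c)" "energy (\<lambda>_. c) w = level (\<lambda>_. c)" using constant_ground_state[of c] c by auto
  show ?thesis
    using level_less_energy[OF coefficients_const coefficients_const w(1) Phi_const_less[OF c]] c w(2) by simp
qed

lemma le_energy_of_le_levels_coefficients:
  assumes Ks: "\<And>n. Ks n \<in> coefficients" and K: "K \<in> coefficients" and lim: "\<And>x. (\<lambda>n. Ks n x) \<longlonglongrightarrow> K x"
    and u: "u \<in> nehari K" and m: "\<And>n. m \<le> level (Ks n)"
  shows "m \<le> energy K u"
proof (rule le_energy_of_le_levels[OF Ks K u m])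
  show k0: "(\<lambda>_. k0) \<in> coefficients" using coefficientsD(2,3)[OF K] by (intro coefficients_const) (auto intro: order_trans)
  show "Phi (\<lambda>_. k0) z \<le> Phi (Ks n) z" for n z by (rule Phi_mono[OF k0 Ks coefficientsD(2)[OF Ks]])
  show "Phi K z \<le> p0" if "strict_mono r" "Z \<rightharpoonup> z" "\<And>n. norm (Z n) \<le> R" "\<And>n. Phi (Ks (r n)) (Z n) \<le> q n" "q \<longlonglongrightarrow> p0" for r Z z R q p0
    by (rule Phi_Fatou[OF that(2,3) Ks K _ that(4,5)]) (insert LIMSEQ_subseq_LIMSEQ[OF lim that(1)], simp add: o_def)
qed

end

section \<open>The mean value estimate\<close>

definition bump :: "real^'n \<Rightarrow> real \<Rightarrow> real^'n \<Rightarrow> real" where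
  "bump x0 s x = max 0 (1 - (x - x0) \<bullet> (x - x0) / s^2)"

text \<open>The derivative of \<open>bump\<^sup>4\<close>, that of its \<open>i\<close>-th partial derivative, and the trace of the latter.\<close>
definition bump_grad :: "real^'n \<Rightarrow> real \<Rightarrow> real^'n \<Rightarrow> real^'n \<Rightarrow> real" where
  "bump_grad x0 s x h = (- 8 / s^2 * (bump x0 s x)^3) * ((x - x0) \<bullet> h)"

definition bump_hessian :: "real^'n \<Rightarrow> real \<Rightarrow> 'n \<Rightarrow> real^'n \<Rightarrow> real^'n \<Rightarrow> real" where
  "bump_hessian x0 s i x h
    = - 8 / s^2 * (h $ i * (bump x0 s x)^3 - 6 / s^2 * ((x - x0) $ i) * ((x - x0) \<bullet> h) * (bump x0 s x)^2)"

definition bump_laplacian :: "real^'n \<Rightarrow> real \<Rightarrow> real^'n \<Rightarrow> real" where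
  "bump_laplacian x0 s x = (\<Sum>i\<in>UNIV. bump_hessian x0 s i x (axis i 1))"

definition mollifier :: "real^'n \<Rightarrow> real \<Rightarrow> real^'n \<Rightarrow> real" where
  "mollifier x0 s x = (bump x0 s x)^3 / s ^ CARD('n)"

lemma bump_bounds: "0 \<le> bump x0 s x" "bump x0 s x \<le> 1"
  by (auto simp: bump_def)

lemma bump_support:
  assumes "0 < s" "bump x0 s x \<noteq> 0"
  shows "norm (x - x0) < s"
proof (rule power2_less_imp_less)
  show "(norm (x - x0))^2 < s^2" using assms by (simp add: bump_def max_def power2_norm_eq_inner field_simps split: if_splits)
qed (insert assms, simp)

lemma support_subset_cball:
  assumes "0 < s" "\<And>x. bump x0 s x = 0 \<Longrightarrow> h x = 0"
  shows "{x. h x \<noteq> 0} \<subseteq> cball x0 s"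
proof
  fix x assume "x \<in> {x. h x \<noteq> 0}"
  then have "bump x0 s x \<noteq> 0" using assms(2) by blast
  then show "x \<in> cball x0 s" using bump_support[OF assms(1), of x0 x] by (simp add: dist_norm norm_minus_commute less_imp_le)
qed

lemma bump_power_le_indicator:
  assumes s: "0 < s" and n: "0 < n"
  shows "(bump x0 s x)^n \<le> indicator (cball x0 s) x"
  using bump_support[OF s, of x0 x] bump_bounds[of x0 s x] power_le_one[of "bump x0 s x" n] n
  by (cases "bump x0 s x = 0") (auto simp: zero_power dist_norm norm_minus_commute)

lemmas bounded_bump_support = bounded_subset[OF bounded_cball support_subset_cball]

lemma continuous_on_bump [continuous_intros]:
  "continuous_on S s \<Longrightarrow> continuous_on S g \<Longrightarrow> (\<And>z. z \<in> S \<Longrightarrow> s z \<noteq> 0) \<Longrightarrow> continuous_on S (\<lambda>z. bump x0 (s z) (g z))"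
  unfolding bump_def by (intro continuous_intros continuous_on_max) auto

lemma pos_part_power_deriv:
  "((\<lambda>s::real. (max 0 s)^3) has_real_derivative 3 * (max 0 s)^2) (at s)"
  "((\<lambda>s::real. (max 0 s)^4) has_real_derivative 4 * (max 0 s)^3) (at s)"
proof -
  have eq: "(\<lambda>s::real. (max 0 s)^3) = (\<lambda>s. s * (max 0 s)^2)" "(\<lambda>s::real. (max 0 s)^4) = (\<lambda>s. ((max 0 s)^2)^2)"
    by (auto simp: fun_eq_iff max_def power3_eq_cube power2_eq_square power4_eq_xxxx)
  show "((\<lambda>s::real. (max 0 s)^3) has_real_derivative 3 * (max 0 s)^2) (at s)"
    unfolding eq by (rule derivative_eq_intros pos_part_square_deriv refl)+ (auto simp: max_def power2_eq_square)
  show "((\<lambda>s::real. (max 0 s)^4) has_real_derivative 4 * (max 0 s)^3) (at s)"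
    unfolding eq by (rule derivative_eq_intros pos_part_square_deriv refl)+ (auto simp: max_def power2_eq_square power3_eq_cube)
qed

lemma paraboloid_deriv: "((\<lambda>x. 1 - (x - x0) \<bullet> (x - x0) / s^2) has_derivative (\<lambda>h. - 2 * ((x - x0) \<bullet> h) / s^2)) (at x)"
  for x0 :: "real^'n" unfolding divide_inverse by (auto intro!: derivative_eq_intros simp: fun_eq_iff inner_commute algebra_simps)

lemma bump_test_fun:
  fixes x0 :: "real^'n"
  assumes s: "0 < s"
  shows "test_fun (\<lambda>x. (bump x0 s x)^4) (bump_grad x0 s)"
  unfolding test_fun_def
proof (intro conjI allI)
  show "((\<lambda>x. (bump x0 s x)^4) has_derivative bump_grad x0 s x) (at x)" for x
    using DERIV_compose_FDERIV[OF pos_part_power_deriv(2) paraboloid_deriv[of x0 s x]]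
    by (simp add: bump_grad_def[abs_def] bump_def mult_ac)
  show "continuous_on UNIV (\<lambda>x. bump_grad x0 s x (axis i 1))" for i
    unfolding bump_grad_def using s by (intro continuous_intros) auto
  show "bounded {x. (bump x0 s x)^4 \<noteq> 0}" by (rule bounded_bump_support[OF s, of x0]) simp
qed

lemma bump_deriv_test_fun:
  fixes x0 :: "real^'n"
  assumes s: "0 < s"
  shows "test_fun (\<lambda>x. bump_grad x0 s x (axis i 1)) (bump_hessian x0 s i)"
  unfolding test_fun_def
proof (intro conjI allI)
  fix x
  have cube: "((\<lambda>x. (bump x0 s x)^3) has_derivative (\<lambda>h. (- 2 * ((x - x0) \<bullet> h) / s^2) * (3 * (bump x0 s x)^2))) (at x)"
    using DERIV_compose_FDERIV[OF pos_part_power_deriv(1) paraboloid_deriv[of x0 s x]] by (simp add: bump_def)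
  have "((\<lambda>x. bump_grad x0 s x (axis i 1)) has_derivative
      (\<lambda>h. (- 8 / s^2 * (bump x0 s x)^3) * (h \<bullet> axis i 1)
        + (- 8 / s^2 * ((- 2 * ((x - x0) \<bullet> h) / s^2) * (3 * (bump x0 s x)^2))) * ((x - x0) \<bullet> axis i 1))) (at x)"
    unfolding bump_grad_def by (intro has_derivative_mult has_derivative_mult_right cube) (auto intro!: derivative_eq_intros)
  moreover have "(- 8 / s^2 * m^3) * (h \<bullet> axis i 1) + (- 8 / s^2 * ((- 2 * (y \<bullet> h) / s^2) * (3 * m^2))) * (y \<bullet> axis i 1)
      = - 8 / s^2 * (h $ i * m^3 - 6 / s^2 * (y $ i) * (y \<bullet> h) * m^2)" for m :: real and h y :: "real^'n"
    using s by (simp add: inner_axis field_simps)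
  ultimately show "((\<lambda>x. bump_grad x0 s x (axis i 1)) has_derivative bump_hessian x0 s i x) (at x)"
    unfolding bump_hessian_def[abs_def] by (simp only:)
next
  show "continuous_on UNIV (\<lambda>x. bump_hessian x0 s i x (axis j 1))" for j
    unfolding bump_hessian_def using s by (intro continuous_intros) auto
  show "bounded {x. bump_grad x0 s x (axis i 1) \<noteq> 0}" by (rule bounded_bump_support[OF s, of x0]) (simp add: bump_grad_def)
qed

lemma bump_laplacian_eq:
  fixes x0 :: "real^'n"
  shows "bump_laplacian x0 s x
    = - 8 / s^2 * (real CARD('n) * (bump x0 s x)^3 - 6 * ((x - x0) \<bullet> (x - x0) / s^2) * (bump x0 s x)^2)"
proof -
  have "(\<Sum>i\<in>UNIV. - 8 / s^2 * (axis i 1 $ i * m^3 - 6 / s^2 * (y $ i) * (y \<bullet> axis i 1) * m^2))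
      = - 8 / s^2 * (real CARD('n) * m^3 - 6 * (y \<bullet> y / s^2) * m^2)" for m :: real and y :: "real^'n"
  proof -
    have "(\<Sum>i\<in>UNIV. - 8 / s^2 * (axis i 1 $ i * m^3 - 6 / s^2 * (y $ i) * (y \<bullet> axis i 1) * m^2))
        = (\<Sum>i\<in>UNIV. - 8 / s^2 * m^3 + (48 / s^2 / s^2 * m^2) * (y $ i * y $ i))"
      by (rule sum.cong) (simp_all add: inner_axis right_diff_distrib mult_ac)
    also have "\<dots> = real CARD('n) * (- 8 / s^2 * m^3) + (48 / s^2 / s^2 * m^2) * (y \<bullet> y)"
      by (simp only: sum.distrib sum_constant sum_distrib_left inner_vec_def inner_real_def)
    finally show ?thesis by (simp add: right_diff_distrib mult_ac)
  qed
  then show ?thesis unfolding bump_laplacian_def bump_hessian_def .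
qed

lemma bump_laplacian_integral: "0 < s \<Longrightarrow> (LBINT x. bump_laplacian x0 s x) = 0"
  unfolding bump_laplacian_def
  by (subst Bochner_Integration.integral_sum)
    (auto intro!: sum.neutral test_fun_integral_deriv test_fun_integrable(2) bump_deriv_test_fun)

lemma dirichlet_bump:
  fixes U :: "'n::finite h1"
  assumes s: "0 < s"
  shows "dirichlet U (abs_h1 (\<lambda>x. (bump x0 s x)^4)) = - (LBINT x. fn U x * bump_laplacian x0 s x)"
proof -
  let ?d = "\<lambda>i x. bump_grad x0 s x (axis i 1)"
  note test = bump_deriv_test_fun[OF s, of x0]
  note [measurable] = test_fun_measurable(1)[OF test]
  have "dirichlet U (abs_h1 (\<lambda>x. (bump x0 s x)^4)) = (LBINT x. (\<Sum>i\<in>UNIV. grad U x $ i * ?d i x))"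
    unfolding dirichlet_def
  proof (rule integral_cong_AE)
    show "AE x in lborel. grad U x \<bullet> grad (abs_h1 (\<lambda>x. (bump x0 s x)^4)) x = (\<Sum>i\<in>UNIV. grad U x $ i * ?d i x)"
      using test_fun_H1(2)[OF bump_test_fun[OF s, of x0]] by eventually_elim (simp add: inner_vec_def)
  qed measurable
  also have "\<dots> = (\<Sum>i\<in>UNIV. (LBINT x. grad U x $ i * ?d i x))"
    by (rule Bochner_Integration.integral_sum) (rule sq_int_mult[OF sq_int_grad test_fun_sq_int(1)[OF test]])
  also have "\<dots> = - (\<Sum>i\<in>UNIV. (LBINT x. fn U x * bump_hessian x0 s i x (axis i 1)))"
    unfolding sum_negf[symmetric] using weak_gradD(2)[OF weak_grad_fn[of U] test] by (intro sum.cong) auto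
  also have "\<dots> = - (LBINT x. fn U x * bump_laplacian x0 s x)" unfolding bump_laplacian_def sum_distrib_left
    by (subst Bochner_Integration.integral_sum) (auto intro!: sq_int_mult[OF sq_int_fn test_fun_sq_int(2)[OF test]])
  finally show ?thesis .
qed

lemma mollifier_bounds:
  fixes x0 :: "real^'n"
  assumes s: "0 < s"
  shows "0 \<le> mollifier x0 s x" "mollifier x0 s x \<le> indicator (cball x0 s) x / s ^ CARD('n)"
proof -
  show "0 \<le> mollifier x0 s x" using s bump_bounds(1)[of x0 s x] by (simp add: mollifier_def)
  show "mollifier x0 s x \<le> indicator (cball x0 s) x / s ^ CARD('n)"
    unfolding mollifier_def using s by (intro divide_right_mono bump_power_le_indicator) auto
qed

lemma continuous_mollifier:
  assumes "0 < s"
  shows "continuous_on UNIV (mollifier x0 s)"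
  unfolding mollifier_def[abs_def] using assms by (intro continuous_intros) auto

text \<open>The normalization of \<open>mollifier\<close> is chosen so that its derivative in the scale is a multiple of the Laplacian of
  \<open>bump\<^sup>4\<close>; a bound for the weak Laplacian of a function thus controls its averages over all scales.\<close>
lemma mollifier_deriv:
  fixes x0 :: "real^'n"
  assumes s: "0 < s"
  shows "((\<lambda>s. mollifier x0 s x) has_real_derivative s / (8 * s ^ CARD('n)) * bump_laplacian x0 s x) (at s)"
proof -
  define w where "w = (x - x0) \<bullet> (x - x0)"
  define N where "N = CARD('n)"
  have base: "((\<lambda>s. 1 - w / s^2) has_real_derivative 2 * w / s^3) (at s)"
    using s by (auto intro!: derivative_eq_intros simp: power2_eq_square power3_eq_cube field_simps)
  have "((\<lambda>s. (max 0 (1 - w / s^2))^3 / s ^ N) has_real_derivative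
      (3 * (max 0 (1 - w / s^2))^2 * (2 * w / s^3) * s ^ N - (max 0 (1 - w / s^2))^3 * (real N * s ^ (N - 1))) / (s ^ N * s ^ N)) (at s)"
    by (rule DERIV_divide[OF DERIV_chain2[OF pos_part_power_deriv(1) base]]) (insert s, auto intro!: derivative_eq_intros)
  moreover have "(3 * m^2 * (2 * w / s^3) * s ^ N - m^3 * (real N * s ^ (N - 1))) / (s ^ N * s ^ N)
      = s / (8 * s ^ N) * (- 8 / s^2 * (real N * m^3 - 6 * (w / s^2) * m^2))" for m :: real
  proof -
    have "s ^ N = s * s ^ (N - 1)" using power_eq_if[of s N] by (simp add: N_def)
    moreover have "s ^ (N - 1) \<noteq> 0" using s by simp
    ultimately show ?thesis using s by (simp add: field_simps power2_eq_square power3_eq_cube)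
  qed
  ultimately show ?thesis unfolding mollifier_def bump_laplacian_eq bump_def w_def[symmetric] N_def[symmetric] by metis
qed

lemma integral_eq_on_cbox:
  fixes h :: "'a::euclidean_space \<Rightarrow> real"
  assumes h: "continuous_on UNIV h" and S: "{x. h x \<noteq> 0} \<subseteq> cbox a b"
  shows "(LBINT x. h x) = integral (cbox a b) h"
proof -
  have "bounded {x. h x \<noteq> 0}" using S by (rule bounded_subset[OF bounded_cbox])
  then have "(h has_integral (LBINT x. h x)) UNIV"
    using h by (intro has_integral_integral_lborel integrable_bounded_support sq_int_continuous_bounded_support)
  moreover have "(\<lambda>x. if x \<in> cbox a b then h x else 0) = h" using S by (auto simp: fun_eq_iff)
  ultimately show ?thesis using has_integral_restrict_UNIV[of "cbox a b" h] by (simp add: integral_unique)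
qed

definition mollified :: "(real^'n \<Rightarrow> real) \<Rightarrow> real^'n \<Rightarrow> real \<Rightarrow> real" where
  "mollified u x0 s = (LBINT x. u x * mollifier x0 s x)"

lemma mollified_deriv:
  fixes x0 :: "real^'n"
  assumes u: "continuous_on UNIV u" and s: "s \<in> {0<..r}"
  shows "(mollified u x0 has_real_derivative s / (8 * s ^ CARD('n)) * (LBINT x. u x * bump_laplacian x0 s x)) (at s within {0<..r})"
proof -
  obtain a b where ab: "cball x0 r \<subseteq> cbox a b" using bounded_subset_cbox_symmetric[OF bounded_cball] by blast
  have sub: "{x. u x * h x \<noteq> 0} \<subseteq> cbox a b" if t: "t \<in> {0<..r}" and h: "\<And>x. bump x0 t x = 0 \<Longrightarrow> h x = 0" for t h
  proof -
    have "{x. u x * h x \<noteq> 0} \<subseteq> cball x0 t" using t h by (intro support_subset_cball) auto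
    also have "\<dots> \<subseteq> cball x0 r" using t by (intro subset_cball) auto
    finally show ?thesis using ab by (rule order_trans)
  qed
  have average: "mollified u x0 t = integral (cbox a b) (\<lambda>x. u x * mollifier x0 t x)" if t: "t \<in> {0<..r}" for t
    unfolding mollified_def using t
    by (intro integral_eq_on_cbox sub[OF t] continuous_on_mult u continuous_mollifier) (auto simp: mollifier_def)
  have laplacian: "integral (cbox a b) (\<lambda>x. u x * (s / (8 * s ^ CARD('n)) * bump_laplacian x0 s x))
      = s / (8 * s ^ CARD('n)) * (LBINT x. u x * bump_laplacian x0 s x)"
  proof -
    have "(LBINT x. u x * bump_laplacian x0 s x) = integral (cbox a b) (\<lambda>x. u x * bump_laplacian x0 s x)"
      using s by (intro integral_eq_on_cbox sub[OF s]) (auto simp: bump_laplacian_eq intro!: continuous_intros u)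
    then show ?thesis by (simp only: mult.left_commute[of "u _"] integral_mult_right)
  qed
  have "((\<lambda>t. integral (cbox a b) (\<lambda>x. u x * mollifier x0 t x)) has_field_derivative
      integral (cbox a b) (\<lambda>x. u x * (s / (8 * s ^ CARD('n)) * bump_laplacian x0 s x))) (at s within {0<..r})"
  proof (rule leibniz_rule_field_derivative[OF _ _ _ s])
    show "((\<lambda>t. u x * mollifier x0 t x) has_field_derivative u x * (t / (8 * t ^ CARD('n)) * bump_laplacian x0 t x)) (at t within {0<..r})"
      if "t \<in> {0<..r}" for t x using that by (intro DERIV_cmult[OF has_field_derivative_at_within[OF mollifier_deriv]]) simp
    show "(\<lambda>x. u x * mollifier x0 t x) integrable_on cbox a b" if "t \<in> {0<..r}" for t
      using that by (intro integrable_continuous continuous_on_subset[OF continuous_on_mult[OF u continuous_mollifier]]) auto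
    show "continuous_on ({0<..r} \<times> cbox a b) (\<lambda>(t, x). u x * (t / (8 * t ^ CARD('n)) * bump_laplacian x0 t x))"
      unfolding bump_laplacian_eq case_prod_unfold
      by (intro continuous_intros continuous_on_compose2[OF u]) auto
  qed simp
  then show ?thesis
    unfolding laplacian by (rule has_field_derivative_transform_within[OF _ zero_less_one s]) (simp add: average)
qed

lemma mollified_diff_le:
  fixes x0 :: "real^'n"
  assumes u: "continuous_on UNIV u" and s: "0 < s" "s \<le> r"
    and B: "0 \<le> B" "\<And>t. 0 < t \<Longrightarrow> t \<le> r \<Longrightarrow> abs (LBINT x. u x * bump_laplacian x0 t x) \<le> B * t ^ CARD('n)"
  shows "abs (mollified u x0 r - mollified u x0 s) \<le> B * r^2 / 8"
proof -
  have "norm (mollified u x0 r - mollified u x0 s) \<le> (B * r / 8) * norm (r - s)"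
  proof (rule field_differentiable_bound[OF _ mollified_deriv[OF u]])
    fix t assume t: "t \<in> {0<..r}"
    then have "abs (t / (8 * t ^ CARD('n)) * (LBINT x. u x * bump_laplacian x0 t x)) \<le> t / (8 * t ^ CARD('n)) * (B * t ^ CARD('n))"
      unfolding abs_mult using B(2)[of t] by (intro mult_mono) auto
    also have "\<dots> \<le> B * r / 8" using t B(1) by (simp add: mult.commute mult_left_mono)
    finally show "norm (t / (8 * t ^ CARD('n)) * (LBINT x. u x * bump_laplacian x0 t x)) \<le> B * r / 8" by simp
  qed (insert s, auto)
  also have "\<dots> \<le> (B * r / 8) * r" using s B(1) by (intro mult_left_mono) auto
  finally show ?thesis by (simp add: power2_eq_square)
qed

definition mollifier_mass :: "'n::finite itself \<Rightarrow> real" where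
  "mollifier_mass _ = (LBINT x. mollifier (0 :: real^'n) 1 x)"

lemma mollifier_integrable:
  fixes x0 :: "real^'n"
  assumes u: "continuous_on UNIV u" and s: "0 < s"
  shows "integrable lborel (\<lambda>x. u x * mollifier x0 s x)"
  by (intro integrable_bounded_support sq_int_continuous_bounded_support continuous_on_mult u continuous_mollifier[OF s]
      bounded_bump_support[OF s, of x0]) (simp_all add: mollifier_def)

lemma integral_mollifier:
  fixes x0 :: "real^'n"
  assumes s: "0 < s" "s \<le> 1"
  shows "(LBINT x. mollifier x0 s x) = mollifier_mass TYPE('n)"
proof -
  have "abs (mollified (\<lambda>_. 1) x0 1 - mollified (\<lambda>_. 1) x0 s) \<le> 0 * 1^2 / 8"
    by (rule mollified_diff_le) (insert s bump_laplacian_integral, auto)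
  then have "(LBINT x. mollifier x0 s x) = (LBINT x. mollifier x0 1 x)" by (simp add: mollified_def)
  also have "\<dots> = (LBINT x. mollifier x0 1 (x + x0))"
    by (rule integral_shift(1)[symmetric]) (simp add: borel_measurable_continuous_onI continuous_mollifier)
  finally show ?thesis by (simp add: mollifier_mass_def mollifier_def bump_def)
qed

lemma mollifier_mass_pos: "0 < mollifier_mass TYPE('n::finite)"
proof -
  let ?m = "mollifier (0::real^'n) 1"
  have nonneg: "0 \<le> ?m x" for x by (rule mollifier_bounds(1)) simp
  have "mollifier_mass TYPE('n) \<noteq> 0"
  proof
    assume "mollifier_mass TYPE('n) = 0"
    moreover have "integrable lborel ?m" using mollifier_integrable[OF continuous_on_const, of 1 1] by simp
    ultimately have "AE x in lborel. ?m x = 0" using nonneg by (simp add: mollifier_mass_def integral_nonneg_eq_0_iff_AE)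
    then have "?m 0 = 0" by (rule AE_zero_continuous[OF continuous_mollifier[OF zero_less_one]])
    then show False by (simp add: mollifier_def bump_def)
  qed
  moreover have "0 \<le> mollifier_mass TYPE('n)" using nonneg by (simp add: mollifier_mass_def)
  ultimately show ?thesis by simp
qed

lemma mollified_near:
  fixes x0 :: "real^'n"
  assumes u: "continuous_on UNIV u" and e: "0 < e"
  shows "\<exists>d>0. \<forall>s. 0 < s \<longrightarrow> s < d \<longrightarrow> s \<le> 1 \<longrightarrow> abs (mollified u x0 s - u x0 * mollifier_mass TYPE('n)) \<le> e * mollifier_mass TYPE('n)"
proof -
  obtain d where d: "0 < d" "\<And>x. dist x x0 < d \<Longrightarrow> abs (u x - u x0) < e"
    using u[unfolded continuous_on_iff, rule_format, of x0 e] e by (auto simp: dist_real_def)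
  have "abs (mollified u x0 s - u x0 * mollifier_mass TYPE('n)) \<le> e * mollifier_mass TYPE('n)" if s: "0 < s" "s < d" "s \<le> 1" for s
  proof -
    let ?k = "mollifier x0 s"
    have int: "integrable lborel ?k" using mollifier_integrable[OF continuous_on_const s(1), of 1 x0] by simp
    have "mollified u x0 s - u x0 * mollifier_mass TYPE('n) = (LBINT x. (u x - u x0) * ?k x)"
      using mollifier_integrable[OF u s(1), of x0] int
      by (simp add: mollified_def left_diff_distrib integral_mollifier[OF s(1,3), of x0, symmetric])
    also have "abs \<dots> \<le> (LBINT x. e * ?k x)"
    proof (rule order_trans[OF integral_abs_bound], rule integral_mono')
      fix x
      have k: "0 \<le> ?k x" by (rule mollifier_bounds(1)[OF s(1)])
      show "abs ((u x - u x0) * ?k x) \<le> e * ?k x"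
      proof (cases "bump x0 s x = 0")
        case False
        then have "dist x x0 < d" using bump_support[OF s(1) False] s(2) by (simp add: dist_norm)
        then show ?thesis using d(2)[of x] k by (simp add: abs_mult mult_right_mono)
      qed (simp add: mollifier_def)
      show "0 \<le> e * ?k x" using e k by simp
    qed (insert int, simp)
    finally show ?thesis by (simp add: integral_mollifier[OF s(1,3)])
  qed
  then show ?thesis using d(1) by blast
qed

theorem mean_value_estimate:
  fixes x0 :: "real^'n"
  assumes u: "continuous_on UNIV u" and r: "0 < r" "r \<le> 1"
    and B: "0 \<le> B" "\<And>t. 0 < t \<Longrightarrow> t \<le> r \<Longrightarrow> abs (LBINT x. u x * bump_laplacian x0 t x) \<le> B * t ^ CARD('n)"
  shows "abs (mollified u x0 r - u x0 * mollifier_mass TYPE('n)) \<le> B * r^2 / 8"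
proof (rule field_le_epsilon)
  let ?c = "mollifier_mass TYPE('n)"
  fix e :: real assume e: "0 < e"
  obtain d where d: "0 < d" "\<And>s. 0 < s \<Longrightarrow> s < d \<Longrightarrow> s \<le> 1 \<Longrightarrow> abs (mollified u x0 s - u x0 * ?c) \<le> e / ?c * ?c"
    using mollified_near[OF u, of "e / ?c" x0] e mollifier_mass_pos[where 'n='n] by auto
  define s where "s = min (d / 2) r"
  have s: "0 < s" "s < d" "s \<le> r" using d(1) r by (auto simp: s_def)
  have "abs (mollified u x0 s - u x0 * ?c) \<le> e" using d(2)[OF s(1,2)] s(3) r(2) mollifier_mass_pos[where 'n='n] by simp
  moreover have "abs (mollified u x0 r - mollified u x0 s) \<le> B * r^2 / 8" by (rule mollified_diff_le[OF u s(1,3) B])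
  ultimately show "abs (mollified u x0 r - u x0 * ?c) \<le> B * r^2 / 8 + e" by linarith
qed

lemma powr_tangent_le:
  fixes a t q :: real
  assumes a: "0 < a" and t: "0 \<le> t" and q: "1 \<le> q"
  shows "a powr (q - 1) * (t - a) \<le> t powr q"
proof (cases "t \<le> a")
  case True
  then have "a powr (q - 1) * (t - a) \<le> 0" by (intro mult_nonneg_nonpos) auto
  then show ?thesis using powr_ge_zero[of t q] by linarith
next
  case False
  have "a powr (q - 1) * (t - a) \<le> t powr (q - 1) * t" using False a q by (intro mult_mono powr_mono2) auto
  also have "\<dots> = t powr q" using False a by (simp add: powr_diff)
  finally show ?thesis .
qed

lemma mollified_powr_le:
  fixes x0 :: "real^'n"
  assumes u: "continuous_on UNIV u" and r: "0 < r" "r \<le> 1" and a: "0 < a" and q: "1 \<le> q"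
  shows "r ^ CARD('n) * (a powr (q - 1) * (mollified (\<lambda>x. abs (u x)) x0 r - a * mollifier_mass TYPE('n)))
    \<le> (LBINT x. abs (u x) powr q * indicator (cball x0 r) x)"
proof -
  let ?k = "mollifier x0 r" and ?c = "mollifier_mass TYPE('n)"
  have abs: "continuous_on UNIV (\<lambda>x. abs (u x))" using u by (intro continuous_intros)
  have int: "integrable lborel (\<lambda>x. abs (u x) * ?k x)" "integrable lborel ?k"
    using mollifier_integrable[OF abs r(1)] mollifier_integrable[OF continuous_on_const r(1), of 1 x0] by auto
  have "a powr (q - 1) * (mollified (\<lambda>x. abs (u x)) x0 r - a * ?c) = (LBINT x. a powr (q - 1) * (abs (u x) - a) * ?k x)"
    using int by (simp add: mollified_def integral_mollifier[OF r, of x0, symmetric] left_diff_distrib right_diff_distrib mult.assoc)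
  also have "\<dots> \<le> (LBINT x. abs (u x) powr q * indicator (cball x0 r) x / r ^ CARD('n))"
  proof (rule integral_mono)
    show "integrable lborel (\<lambda>x. a powr (q - 1) * (abs (u x) - a) * ?k x)"
      using int by (simp add: left_diff_distrib right_diff_distrib mult.assoc)
    have "continuous_on (cball x0 r) (\<lambda>x. abs (u x) powr q)"
      using q by (intro continuous_on_powr' continuous_intros continuous_on_subset[OF u]) auto
    then have "integrable lborel (\<lambda>x. indicator (cball x0 r) x *\<^sub>R (abs (u x)) powr q)"
      by (rule borel_integrable_compact[OF compact_cball])
    then show "integrable lborel (\<lambda>x. abs (u x) powr q * indicator (cball x0 r) x / r ^ CARD('n))" by (simp add: mult.commute)
    fix x
    have "a powr (q - 1) * (abs (u x) - a) * ?k x \<le> abs (u x) powr q * ?k x"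
      using mollifier_bounds(1)[OF r(1)] by (intro mult_right_mono powr_tangent_le a q) auto
    also have "\<dots> \<le> abs (u x) powr q * (indicator (cball x0 r) x / r ^ CARD('n))"
      by (intro mult_left_mono mollifier_bounds(2)[OF r(1)]) auto
    finally show "a powr (q - 1) * (abs (u x) - a) * ?k x \<le> abs (u x) powr q * indicator (cball x0 r) x / r ^ CARD('n)" by simp
  qed
  finally show ?thesis using r(1) by (simp add: field_simps)
qed

lemma local_mass_lower_bound:
  fixes x0 :: "real^'n"
  assumes u: "continuous_on UNIV u" and M: "abs (u x0) = M" "0 < M" and r: "0 < r" "r \<le> 1"
    and B: "0 \<le> B" "\<And>t. 0 < t \<Longrightarrow> t \<le> r \<Longrightarrow> abs (LBINT x. u x * bump_laplacian x0 t x) \<le> B * t ^ CARD('n)"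
    and small: "B * r^2 \<le> 4 * M * mollifier_mass TYPE('n)" and q: "1 \<le> q"
  shows "r ^ CARD('n) * ((M / 4) powr q * mollifier_mass TYPE('n)) \<le> (LBINT x. abs (u x) powr q * indicator (cball x0 r) x)"
proof -
  let ?c = "mollifier_mass TYPE('n)" and ?avg = "mollified (\<lambda>x. abs (u x)) x0 r"
  have "M * ?c = abs (u x0 * ?c)" using M(1) mollifier_mass_pos[where 'n='n] by (simp add: abs_mult)
  also have "\<dots> \<le> abs (mollified u x0 r) + B * r^2 / 8" using mean_value_estimate[OF u r B] by linarith
  also have "abs (mollified u x0 r) \<le> ?avg"
    unfolding mollified_def using integral_abs_bound[of lborel "\<lambda>x. u x * mollifier x0 r x"] mollifier_bounds(1)[OF r(1), of x0]
    by (simp add: abs_mult)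
  finally have "M / 4 * ?c \<le> ?avg - M / 4 * ?c" using small by linarith
  then have "(M / 4) powr (q - 1) * (M / 4 * ?c) \<le> (M / 4) powr (q - 1) * (?avg - M / 4 * ?c)" by (intro mult_left_mono) auto
  moreover have "(M / 4) powr q = (M / 4) powr (q - 1) * (M / 4)" using M(2) by (simp add: powr_diff)
  ultimately have "r ^ CARD('n) * ((M / 4) powr q * ?c) \<le> r ^ CARD('n) * ((M / 4) powr (q - 1) * (?avg - M / 4 * ?c))"
    using r(1) by (intro mult_left_mono) (simp_all only: mult.assoc zero_le_power less_imp_le)
  also have "\<dots> \<le> (LBINT x. abs (u x) powr q * indicator (cball x0 r) x)"
    using M(2) by (intro mollified_powr_le[OF u r _ q]) simp
  finally show ?thesis .
qed

context variational
begin

lemma nonlinear_term_bound: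
  "\<exists>D>0. \<forall>K\<in>coefficients. \<forall>M t x. abs t \<le> M \<longrightarrow> abs (V x * t - K x * f t) \<le> D * M * max 1 M powr (p - 2)"
proof -
  obtain C where C: "0 \<le> C" "\<And>t. abs (f t) \<le> 1 * abs t + C * abs t powr (p - 1)" using f_growth[of 1] by auto
  have "abs (V x * t - K x * f t) \<le> (V_sup + abs k1 * (1 + C) + 1) * M * max 1 M powr (p - 2)"
    if K: "K \<in> coefficients" and t: "abs t \<le> M" for K M t x
  proof -
    define Y where "Y = max 1 M powr (p - 2)"
    have Y: "1 \<le> Y" "abs t powr (p - 2) \<le> Y" using t p by (auto simp: Y_def ge_one_powr_ge_zero intro: powr_mono2)
    have M: "0 \<le> M" "M \<le> M * Y" using t Y(1) by (auto simp: mult_le_cancel_left1)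
    have "abs t powr (p - 1) = abs t * abs t powr (p - 2)" by (simp add: powr_mult_base)
    also have "\<dots> \<le> M * Y" using t Y(2) M(1) by (intro mult_mono) auto
    finally have "abs (f t) \<le> M * Y + C * (M * Y)" using C(2)[of t] t M(2) mult_left_mono[OF _ C(1)] by (smt (verit))
    then have "abs (K x) * abs (f t) \<le> abs k1 * (M * Y + C * (M * Y))"
      using coefficientsD(3,5)[OF K, of x] by (intro mult_mono) auto
    moreover have "abs (V x) * abs t \<le> V_sup * (M * Y)" using V_le_sup[of x] t M V_sup_nonneg by (intro mult_mono) auto
    ultimately have "abs (V x * t - K x * f t) \<le> V_sup * (M * Y) + abs k1 * (M * Y + C * (M * Y))"
      using abs_triangle_ineq4[of "V x * t" "K x * f t"] by (simp add: abs_mult)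
    also have "\<dots> \<le> (V_sup + abs k1 * (1 + C) + 1) * M * Y" using M Y(1) by (simp add: algebra_simps)
    finally show ?thesis by (simp add: Y_def)
  qed
  moreover have "0 < V_sup + abs k1 * (1 + C) + 1" using V_sup_nonneg C(1) by (simp add: add_nonneg_pos)
  ultimately show ?thesis by blast
qed

definition critical_maximum :: "real \<Rightarrow> (real^'n \<Rightarrow> real) \<Rightarrow> 'n h1 \<Rightarrow> (real^'n \<Rightarrow> real) \<Rightarrow> real^'n \<Rightarrow> bool" where
  "critical_maximum R K U u x0 \<longleftrightarrow> K \<in> coefficients \<and> U \<noteq> 0 \<and> critical K U \<and> norm U \<le> R
    \<and> represents u U \<and> continuous_on UNIV u \<and> (\<forall>y. abs (u y) \<le> abs (u x0))"

lemma critical_maximumD: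
  assumes "critical_maximum R K U u x0"
  shows "K \<in> coefficients" "U \<noteq> 0" "critical K U" "norm U \<le> R" "continuous_on UNIV u"
    "AE x in lborel. fn U x = u x" "AE x in lborel. abs (fn U x) \<le> abs (u x0)" "u \<in> borel_measurable borel"
  using assms unfolding critical_maximum_def represents_def
  by (auto simp: borel_measurable_continuous_onI elim!: eventually_mono) (metis)

lemma critical_maximum_lower_bound: "\<exists>\<delta>>0. \<forall>K U u x0. critical_maximum R K U u x0 \<longrightarrow> \<delta> \<le> abs (u x0)"
proof (cases "coefficients = {}")
  case False
  then have k1: "(\<lambda>_. k1) \<in> coefficients" using coefficientsD(2,3) by (fastforce intro: coefficients_const order_trans)
  obtain d where d: "0 < d" "\<And>K U. K \<in> coefficients \<Longrightarrow> norm U \<le> R \<Longrightarrow> 2 * level (\<lambda>_. k1) \<le> phi K U U \<Longrightarrow> d \<le> (LBINT x. abs (fn U x) powr p)"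
    using powr_integral_lower_bound[OF level_pos[OF k1], of R] by blast
  define \<delta> where "\<delta> = (d / (R^2 + 1)) powr (1 / (p - 2))"
  have R: "0 < R^2 + 1" by (simp add: add_nonneg_pos)
  have "\<delta> \<le> abs (u x0)" if max: "critical_maximum R K U u x0" for K U u x0
  proof -
    note K = critical_maximumD(1)[OF max] and U = critical_maximumD(2-4)[OF max]
    have "level (\<lambda>_. k1) \<le> energy K U"
      using level_antimono[OF K k1 Phi_mono[OF K k1 coefficientsD(3)[OF K]]] level_le_critical[OF K U(2,1)] by linarith
    then have "2 * level (\<lambda>_. k1) \<le> phi K U U" using U(2) Phi_nonneg[OF K, of U] by (simp add: energy_def critical_def denergy_def)
    then have "d \<le> (LBINT x. abs (fn U x) powr p)" by (rule d(2)[OF K U(3)])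
    also have "\<dots> \<le> (LBINT x. (abs (u x0)^2) powr ((p - 2) / 2) * (fn U x)^2)" using critical_maximumD(7)[OF max] p
      by (intro integral_mono_AE) (auto elim!: eventually_mono intro!: abs_powr_le_square simp: abs_le_square_iff)
    also have "\<dots> \<le> abs (u x0) powr (p - 2) * (R^2 + 1)"
      using l2_le[of U] power_mono[OF U(3), of 2] by (simp add: l2_self square_powr_half mult_left_mono)
    finally have "d / (R^2 + 1) \<le> abs (u x0) powr (p - 2)" using R by (simp add: divide_le_eq)
    then have "\<delta> \<le> (abs (u x0) powr (p - 2)) powr (1 / (p - 2))" unfolding \<delta>_def using d(1) R p by (intro powr_mono2) auto
    then show ?thesis using p by (simp add: powr_powr)
  qed
  moreover have "0 < \<delta>" using d(1) R by (simp add: \<delta>_def)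
  ultimately show ?thesis by blast
qed (auto simp: critical_maximum_def intro: exI[of _ 1])

lemma critical_maximum_laplacian_eq:
  assumes max: "critical_maximum R K U u x0" and s: "0 < s"
  shows "(LBINT x. u x * bump_laplacian x0 s x) = (LBINT x. (V x * u x - K x * f (u x)) * (bump x0 s x)^4)"
proof -
  note K = critical_maximumD(1)[OF max] and u = critical_maximumD(6)[OF max]
  define W where "W = abs_h1 (\<lambda>x. (bump x0 s x)^4)"
  have W: "AE x in lborel. fn W x = (bump x0 s x)^4" unfolding W_def by (rule fn_abs[OF test_fun_H1(1)[OF bump_test_fun[OF s]]])
  have [measurable]: "bump_laplacian x0 s \<in> borel_measurable borel"
    unfolding bump_laplacian_def[abs_def] by (intro borel_measurable_sum test_fun_measurable(2)[OF bump_deriv_test_fun[OF s]])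
  note [measurable] = critical_maximumD(8)[OF max] coefficientsD(1)[OF K] test_fun_measurable(1)[OF bump_test_fun[OF s, of x0]]
  have "(LBINT x. u x * bump_laplacian x0 s x) = (LBINT x. fn U x * bump_laplacian x0 s x)"
    by (rule integral_cong_AE) (insert u, auto elim!: eventually_mono)
  also have "\<dots> = weighted_l2 V U W - phi K U W"
    using critical_maximumD(3)[OF max, unfolded critical_def, rule_format, of W] dirichlet_bump[OF s, of U x0, folded W_def]
    by (simp add: denergy_def BV_def)
  also have "\<dots> = (LBINT x. V x * (fn U x * fn W x) - K x * (f (fn U x) * fn W x))"
    unfolding weighted_l2_def phi_def weighted_integral_def
    using weighted_fn_mult_integrable[OF V_borel V_le_sup, of U W] weighted_integrable[OF K f_mult_fn_integrable[of U W]] by simp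
  also have "\<dots> = (LBINT x. (V x * u x - K x * f (u x)) * (bump x0 s x)^4)"
    by (rule integral_cong_AE) (insert W u, auto simp: algebra_simps elim!: eventually_elim2)
  finally show ?thesis .
qed

lemma critical_maximum_laplacian_bound:
  "\<exists>D>0. \<forall>R K U u x0 s. critical_maximum R K U u x0 \<longrightarrow> 0 < s
    \<longrightarrow> abs (LBINT x. u x * bump_laplacian x0 s x) \<le> D * abs (u x0) * max 1 (abs (u x0)) powr (p - 2) * s ^ CARD('n)"
proof -
  obtain D where D: "0 < D" "\<And>K M t x. K \<in> coefficients \<Longrightarrow> abs t \<le> M \<Longrightarrow> abs (V x * t - K x * f t) \<le> D * M * max 1 M powr (p - 2)"
    using nonlinear_term_bound by blast
  define \<omega> where "\<omega> = unit_ball_vol (real CARD('n))"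
  have \<omega>: "0 < \<omega>" by (simp add: \<omega>_def)
  have "abs (LBINT x. u x * bump_laplacian x0 s x) \<le> (D * \<omega>) * abs (u x0) * max 1 (abs (u x0)) powr (p - 2) * s ^ CARD('n)"
    if max: "critical_maximum R K U u x0" and s: "0 < s" for R K U u x0 s
  proof -
    define G where "G = D * abs (u x0) * max 1 (abs (u x0)) powr (p - 2)"
    have G: "abs (V x * u x - K x * f (u x)) \<le> G" for x
      using max D(2)[of K "u x" "abs (u x0)" x] by (simp add: critical_maximum_def G_def)
    have "abs (LBINT x. u x * bump_laplacian x0 s x) \<le> (LBINT x. abs ((V x * u x - K x * f (u x)) * (bump x0 s x)^4))"
      unfolding critical_maximum_laplacian_eq[OF max s] by (rule integral_abs_bound)
    also have "\<dots> \<le> (LBINT x. G * indicator (cball x0 s) x)"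
    proof (rule integral_mono')
      show "integrable lborel (\<lambda>x. G * indicator (cball x0 s) x)"
        using emeasure_bounded_finite[OF bounded_cball, of x0 s] by (intro integrable_mult_right integrable_real_indicator) auto
      fix x
      show "abs ((V x * u x - K x * f (u x)) * (bump x0 s x)^4) \<le> G * indicator (cball x0 s) x"
        unfolding abs_mult using order_trans[OF abs_ge_zero G] bump_power_le_indicator[OF s, of 4 x0 x]
        by (intro mult_mono G) auto
      show "0 \<le> G * indicator (cball x0 s) x" using order_trans[OF abs_ge_zero G] by simp
    qed
    also have "\<dots> = G * (\<omega> * s ^ CARD('n))" using s by (simp add: content_cball \<omega>_def)
    finally show ?thesis by (simp add: G_def mult_ac)
  qed
  then show ?thesis using D(1) \<omega> by (intro exI[of _ "D * \<omega>"]) simp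
qed

text \<open>On the scale \<open>natural_radius b M\<close> the right-hand side of the equation is too small to make a solution with maximum \<open>M\<close>
  drop below half of its maximum.\<close>
definition natural_radius :: "real \<Rightarrow> real \<Rightarrow> real" where
  "natural_radius b M = sqrt (b / max 1 M powr (p - 2))"

lemma natural_radius:
  assumes b: "0 < b" "b \<le> 1"
  shows "0 < natural_radius b M" "natural_radius b M \<le> 1" "(natural_radius b M)^2 * max 1 M powr (p - 2) = b"
proof -
  have "1 \<le> max 1 M powr (p - 2)" using p by (simp add: ge_one_powr_ge_zero)
  then show "0 < natural_radius b M" "natural_radius b M \<le> 1" "(natural_radius b M)^2 * max 1 M powr (p - 2) = b"
    using b by (auto simp: natural_radius_def)
qed

lemma critical_maximum_local_mass:
  "\<exists>b>0. b \<le> 1 \<and> (\<forall>R K U u x0. critical_maximum R K U u x0 \<longrightarrow>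
    natural_radius b (abs (u x0)) ^ CARD('n) * ((abs (u x0) / 4) powr p * mollifier_mass TYPE('n))
      \<le> powr_mass p {y. y - x0 \<in> cball 0 (natural_radius b (abs (u x0)))} U)"
proof -
  let ?c = "mollifier_mass TYPE('n)"
  obtain D where D: "0 < D" "\<And>R K U u x0 s. critical_maximum R K U u x0 \<Longrightarrow> 0 < s
      \<Longrightarrow> abs (LBINT x. u x * bump_laplacian x0 s x) \<le> D * abs (u x0) * max 1 (abs (u x0)) powr (p - 2) * s ^ CARD('n)"
    using critical_maximum_laplacian_bound by blast
  define b where "b = min 1 (4 * ?c / D)"
  have b: "0 < b" "b \<le> 1" "D * b \<le> 4 * ?c" using D(1) mollifier_mass_pos[where 'n='n] by (auto simp: b_def min_def field_simps)
  have "natural_radius b (abs (u x0)) ^ CARD('n) * ((abs (u x0) / 4) powr p * ?c)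
      \<le> powr_mass p {y. y - x0 \<in> cball 0 (natural_radius b (abs (u x0)))} U"
    if max: "critical_maximum R K U u x0" for R K U u x0
  proof -
    define M where "M = abs (u x0)"
    define r where "r = natural_radius b M"
    note D = D(1) D(2)[OF max, folded M_def] and max = critical_maximumD[OF max, folded M_def]
      and r = natural_radius[OF b(1,2), of M, folded r_def]
    note [measurable] = max(8)
    have "M \<noteq> 0" using max(2,7) by (auto simp: fn_zero_iff)
    then have M: "0 < M" by (simp add: M_def)
    have "r ^ CARD('n) * ((M / 4) powr p * ?c) \<le> (LBINT x. abs (u x) powr p * indicator (cball x0 r) x)"
    proof (rule local_mass_lower_bound[OF max(5) M_def[symmetric] M r(1,2)])
      show "abs (LBINT x. u x * bump_laplacian x0 t x) \<le> (D * M * max 1 M powr (p - 2)) * t ^ CARD('n)" if "0 < t" for t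
        using that by (rule D(2))
      have "(D * M * max 1 M powr (p - 2)) * r^2 = (D * b) * M" using r(3) by (simp add: mult_ac)
      also have "\<dots> \<le> (4 * ?c) * M" using b(3) M by (intro mult_right_mono) auto
      finally show "(D * M * max 1 M powr (p - 2)) * r^2 \<le> 4 * M * ?c" by (simp add: mult_ac)
    qed (insert D(1) M p, simp_all)
    also have "\<dots> = powr_mass p {y. y - x0 \<in> cball 0 r} U" unfolding powr_mass_def
    proof (rule integral_cong_AE)
      show "AE x in lborel. abs (u x) powr p * indicator (cball x0 r) x = indicator {y. y - x0 \<in> cball 0 r} x * abs (fn U x) powr p"
        using max(6) by eventually_elim (simp add: indicator_def dist_norm norm_minus_commute)
    qed (intro borel_measurable_times borel_measurable_indicator; measurable)+
    finally show ?thesis by (simp add: M_def r_def)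
  qed
  then show ?thesis using b(1,2) by blast
qed

text \<open>Subcriticality makes the exponent \<open>p - (p - 2) N / 2\<close> of the maximum in the local \<open>L\<^sup>p\<close> mass positive,
  so that large maxima carry more mass.\<close>
lemma natural_radius_mass_bound:
  assumes b: "0 < b" "b \<le> 1" and M: "0 < \<delta>" "\<delta> \<le> M"
  shows "b powr (real CARD('n) / 2) * min 1 (\<delta> powr p) \<le> natural_radius b M ^ CARD('n) * M powr p"
proof -
  define N where "N = real CARD('n)"
  define Y where "Y = max 1 M"
  have Y: "1 \<le> Y" by (simp add: Y_def)
  have "natural_radius b M = (b / Y powr (p - 2)) powr (1/2)" using b(1) Y by (simp add: natural_radius_def Y_def powr_half_sqrt)
  then have "natural_radius b M ^ CARD('n) = b powr (N / 2) * Y powr (- ((p - 2) * N / 2))"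
    unfolding powr_realpow[OF natural_radius(1)[OF b], symmetric] N_def using b(1) Y by (simp add: powr_powr powr_divide powr_minus_divide)
  then have eq: "natural_radius b M ^ CARD('n) * M powr p = b powr (N / 2) * (Y powr (- ((p - 2) * N / 2)) * M powr p)" by simp
  have "min 1 (\<delta> powr p) \<le> Y powr (- ((p - 2) * N / 2)) * M powr p"
  proof (cases "M \<le> 1")
    case True
    then show ?thesis using M p by (simp add: Y_def powr_mono2 min.coboundedI2)
  next
    case False
    have "0 \<le> p - (p - 2) * N / 2" using p_subcritical by (simp add: N_def subcritical_def mult.commute)
    then have "1 \<le> M powr (p - (p - 2) * N / 2)" using False by (intro ge_one_powr_ge_zero) auto
    also have "\<dots> = Y powr (- ((p - 2) * N / 2)) * M powr p" using False by (simp add: Y_def flip: powr_add)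
    finally show ?thesis by simp
  qed
  then show ?thesis unfolding eq N_def[symmetric] by (intro mult_left_mono) auto
qed

theorem mass_at_maximum:
  "\<exists>\<eta>>0. \<forall>K U u x0. critical_maximum R K U u x0 \<longrightarrow> \<eta> \<le> powr_mass p {y. y - x0 \<in> cball 0 1} U"
proof -
  let ?c = "mollifier_mass TYPE('n)"
  obtain \<delta> where \<delta>: "0 < \<delta>" "\<And>K U u x0. critical_maximum R K U u x0 \<Longrightarrow> \<delta> \<le> abs (u x0)" using critical_maximum_lower_bound by blast
  obtain b where b: "0 < b" "b \<le> 1" and mass: "\<And>K U u x0. critical_maximum R K U u x0 \<Longrightarrow>
      natural_radius b (abs (u x0)) ^ CARD('n) * ((abs (u x0) / 4) powr p * ?c) \<le> powr_mass p {y. y - x0 \<in> cball 0 (natural_radius b (abs (u x0)))} U"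
    using critical_maximum_local_mass by blast
  define \<eta> where "\<eta> = b powr (real CARD('n) / 2) * min 1 (\<delta> powr p) * (1 / 4 powr p * ?c)"
  have "\<eta> \<le> powr_mass p {y. y - x0 \<in> cball 0 1} U" if max: "critical_maximum R K U u x0" for K U u x0
  proof -
    have "\<eta> \<le> natural_radius b (abs (u x0)) ^ CARD('n) * abs (u x0) powr p * (1 / 4 powr p * ?c)"
      unfolding \<eta>_def using natural_radius_mass_bound[OF b \<delta>(1) \<delta>(2)[OF max]] mollifier_mass_pos[where 'n='n] by (intro mult_right_mono) auto
    also have "\<dots> = natural_radius b (abs (u x0)) ^ CARD('n) * ((abs (u x0) / 4) powr p * ?c)" by (simp add: powr_divide)
    also have "\<dots> \<le> powr_mass p {y. y - x0 \<in> cball 0 1} U"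
      using natural_radius(2)[OF b, of "abs (u x0)"] by (intro order_trans[OF mass[OF max] powr_mass_mono[OF p_subcritical]]) auto
    finally show ?thesis .
  qed
  moreover have "0 < \<eta>" using b(1) \<delta>(1) mollifier_mass_pos[where 'n='n] by (simp add: \<eta>_def)
  ultimately show ?thesis by blast
qed

end

section \<open>Ground states and their concentration\<close>

locale semiclassical = variational V f p \<theta> k0 "A 0"
  for V :: "real^'n \<Rightarrow> real" and f p \<theta> k0 and A :: "real^'n \<Rightarrow> real" +
  fixes A_inf :: real
  assumes A_cont: "continuous_on UNIV A" and A_max: "A x \<le> A 0" and A_min: "k0 \<le> A x"
    and A_lim: "(A \<longlongrightarrow> A_inf) at_infinity" and A_inf: "k0 \<le> A_inf" "A_inf < A 0"
begin

definition rescaled :: "real \<Rightarrow> real^'n \<Rightarrow> real" where "rescaled \<epsilon> x = A (\<epsilon> *\<^sub>R x)"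

lemma A_isCont: "isCont A x"
  using A_cont by (simp add: continuous_on_eq_continuous_at)

lemma A_borel [measurable]: "A \<in> borel_measurable borel"
  using A_cont by (rule borel_measurable_continuous_onI)

lemma rescaled_coefficients: "rescaled \<epsilon> \<in> coefficients"
  using A_min A_max by (simp add: coefficients_def rescaled_def[abs_def])

lemma constant_coefficients: "(\<lambda>_. k0) \<in> coefficients" "(\<lambda>_. A_inf) \<in> coefficients" "(\<lambda>_. A 0) \<in> coefficients"
  using A_min A_inf by (auto intro!: coefficients_const)

lemma weighted_integral_rescaled:
  assumes "g \<in> borel_measurable lebesgue" "h \<in> borel_measurable borel" "AE x in lborel. g x = h x"
  shows "(\<integral>x. A (\<epsilon> *\<^sub>R x) * g x \<partial>lebesgue) = weighted_integral (rescaled \<epsilon>) h"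
  unfolding weighted_integral_def
proof (rule integral_lebesgue_eq(1))
  note [measurable] = assms(1,2) borel_imp_lebesgue[OF coefficientsD(1)[OF rescaled_coefficients]]
  show "(\<lambda>x. A (\<epsilon> *\<^sub>R x) * g x) \<in> borel_measurable lebesgue" unfolding rescaled_def[symmetric] by measurable
  show "(\<lambda>x. rescaled \<epsilon> x * h x) \<in> borel_measurable borel" using coefficientsD(1)[OF rescaled_coefficients] by simp
  show "AE x in lborel. A (\<epsilon> *\<^sub>R x) * g x = rescaled \<epsilon> x * h x" using assms(3) by (auto simp: rescaled_def)
qed

lemma Ifun_represents:
  assumes u: "represents u U"
  shows "Ifun V A f \<epsilon> u = energy (rescaled \<epsilon>) U"
proof -
  have [measurable]: "u \<in> borel_measurable lebesgue" using u by (simp add: represents_def)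
  have "(\<integral>x. A (\<epsilon> *\<^sub>R x) * F (u x) \<partial>lebesgue) = Phi (rescaled \<epsilon>) U"
    unfolding Phi_def by (rule weighted_integral_rescaled) (insert u, auto simp: represents_def elim!: eventually_mono)
  then show ?thesis by (simp add: Ifun_def energy_def Bform_represents[OF u u])
qed

lemma dIfun_represents:
  assumes u: "represents u U" and w: "represents w W"
  shows "dIfun V A f \<epsilon> u w = denergy (rescaled \<epsilon>) U W"
proof -
  have [measurable]: "u \<in> borel_measurable lebesgue" "w \<in> borel_measurable lebesgue"
    and ae: "AE x in lborel. u x = fn U x" "AE x in lborel. w x = fn W x" using u w by (auto simp: represents_def)
  have "(\<integral>x. A (\<epsilon> *\<^sub>R x) * (f (u x) * w x) \<partial>lebesgue) = phi (rescaled \<epsilon>) U W"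
    unfolding phi_def by (rule weighted_integral_rescaled) (insert ae, auto elim!: eventually_elim2)
  then show ?thesis by (simp add: dIfun_def denergy_def Bform_represents[OF u w] mult.assoc)
qed

lemma all_dIfun_iff:
  assumes u: "represents u U" and E: "E \<subseteq> H1" "\<And>w W. represents w W \<Longrightarrow> w \<in> E \<longleftrightarrow> W \<in> S"
  shows "(\<forall>v\<in>E. dIfun V A f \<epsilon> u v = 0) \<longleftrightarrow> (\<forall>W\<in>S. denergy (rescaled \<epsilon>) U W = 0)"
proof (intro iffI ballI)
  fix W assume "\<forall>v\<in>E. dIfun V A f \<epsilon> u v = 0" "W \<in> S"
  then show "denergy (rescaled \<epsilon>) U W = 0" using E(2)[OF represents_fn] dIfun_represents[OF u represents_fn] by metis
next
  fix v assume "\<forall>W\<in>S. denergy (rescaled \<epsilon>) U W = 0" "v \<in> E"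
  moreover obtain W where "represents v W" using \<open>v \<in> E\<close> E(1) H1_iff_represents by blast
  ultimately show "dIfun V A f \<epsilon> u v = 0" using E(2) dIfun_represents[OF u] by auto
qed

lemma Nehari_Pankov_represents: "u \<in> Nehari_Pankov V A f \<epsilon> \<longleftrightarrow> (\<exists>U\<in>nehari (rescaled \<epsilon>). represents u U)"
proof -
  have "u \<in> Nehari_Pankov V A f \<epsilon> \<longleftrightarrow> U \<in> nehari (rescaled \<epsilon>)" if u: "represents u U" for U
    using represents_H1[OF u] represents_Eminus_iff[OF u] dIfun_represents[OF u u]
      all_dIfun_iff[OF u Eminus_subset_H1 represents_Eminus_iff]
    by (simp add: Nehari_Pankov_def nehari_def P_plus_zero_iff Ball_def)
  moreover have "\<exists>U. represents u U" if "u \<in> Nehari_Pankov V A f \<epsilon>"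
    using that by (simp add: Nehari_Pankov_def H1_iff_represents)
  ultimately show ?thesis by blast
qed

lemma ground_level_eq_level: "ground_level V A f \<epsilon> = level (rescaled \<epsilon>)"
proof -
  have "Ifun V A f \<epsilon> ` Nehari_Pankov V A f \<epsilon> = energy (rescaled \<epsilon>) ` nehari (rescaled \<epsilon>)"
  proof (intro equalityI image_subsetI)
    show "Ifun V A f \<epsilon> u \<in> energy (rescaled \<epsilon>) ` nehari (rescaled \<epsilon>)" if "u \<in> Nehari_Pankov V A f \<epsilon>" for u
      using that by (auto simp: Nehari_Pankov_represents Ifun_represents)
    show "energy (rescaled \<epsilon>) U \<in> Ifun V A f \<epsilon> ` Nehari_Pankov V A f \<epsilon>" if "U \<in> nehari (rescaled \<epsilon>)" for U
      using that represents_fn[of U] Ifun_represents[OF represents_fn[of U]] by (metis Nehari_Pankov_represents imageI)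
  qed
  then show ?thesis by (simp add: ground_level_def level_def)
qed

lemma ground_state_iff:
  assumes u: "represents u U"
  shows "ground_state V A f \<epsilon> u \<longleftrightarrow> critical (rescaled \<epsilon>) U \<and> energy (rescaled \<epsilon>) U = level (rescaled \<epsilon>)"
proof -
  have "(\<forall>v\<in>H1. dIfun V A f \<epsilon> u v = 0) \<longleftrightarrow> critical (rescaled \<epsilon>) U"
    using all_dIfun_iff[OF u order_refl, of UNIV] by (simp add: represents_H1 critical_def)
  then show ?thesis by (simp add: ground_state_def represents_H1[OF u] Ifun_represents[OF u] ground_level_eq_level)
qed

lemma level_rescaled_less:
  assumes m: "level (\<lambda>_. A 0) < m"
  shows "\<forall>\<^sub>F \<epsilon> in at_right 0. level (rescaled \<epsilon>) < m"
proof (rule sequentially_imp_eventually_at_right[OF zero_less_one])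
  fix e :: "nat \<Rightarrow> real" assume e: "e \<longlonglongrightarrow> 0"
  show "\<forall>\<^sub>F n in sequentially. level (rescaled (e n)) < m"
  proof (rule ccontr)
    assume "\<not> ?thesis"
    then obtain r :: "nat \<Rightarrow> nat" where r: "strict_mono r" "\<And>n. m \<le> level (rescaled (e (r n)))"
      using not_eventually_sequentiallyD[of "\<lambda>n. level (rescaled (e n)) < m"] by (auto simp: not_less)
    obtain w where w: "w \<in> nehari (\<lambda>_. A 0)" "energy (\<lambda>_. A 0) w = level (\<lambda>_. A 0)"
      using constant_ground_state[OF A_min[of 0] order_refl] by blast
    have "(\<lambda>n. rescaled (e (r n)) x) \<longlonglongrightarrow> A 0" for x
      using isCont_tendsto_compose[OF A_isCont tendsto_scaleR[OF LIMSEQ_subseq_LIMSEQ[OF e r(1)] tendsto_const[of x]]]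
      by (simp add: rescaled_def o_def)
    then have "m \<le> energy (\<lambda>_. A 0) w"
      by (rule le_energy_of_le_levels_coefficients[OF rescaled_coefficients constant_coefficients(3) _ w(1) r(2)])
    then show False using w(2) m by simp
  qed
qed

lemma ground_state_if_level_less:
  assumes \<epsilon>: "0 < \<epsilon>" and less: "level (rescaled \<epsilon>) < level (\<lambda>_. A_inf)"
  shows "\<exists>u. ground_state V A f \<epsilon> u"
proof -
  have "filterlim (\<lambda>x :: real^'n. \<epsilon> *\<^sub>R x) at_infinity at_infinity"
    unfolding filterlim_at_infinity_conv_norm_at_top using \<epsilon>
    by (auto intro!: filterlim_tendsto_pos_mult_at_top[OF tendsto_const] filterlim_norm_at_top simp: filterlim_at_infinity_conv_norm_at_top[symmetric])
  then have "(rescaled \<epsilon> \<longlongrightarrow> A_inf) at_infinity" unfolding rescaled_def[abs_def] by (rule filterlim_compose[OF A_lim])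
  then obtain K w where w: "K = rescaled \<epsilon> \<or> K = (\<lambda>_. A_inf)" "w \<noteq> 0" "critical K w" "energy K w \<le> level (rescaled \<epsilon>)"
    using compactness_alternative[OF rescaled_coefficients _ A_inf(1), of \<epsilon>] A_inf(2) by auto
  then have "level K \<le> energy K w" using rescaled_coefficients constant_coefficients(2) by (auto intro: level_le_critical)
  then have "K = rescaled \<epsilon>" "energy (rescaled \<epsilon>) w = level (rescaled \<epsilon>)" using w(1,4) less by auto
  then show ?thesis using ground_state_iff[OF represents_fn[of w]] w(3) by blast
qed

theorem ground_states_exist: "\<exists>\<epsilon>0>0. \<forall>\<epsilon>\<in>{0<..<\<epsilon>0}. \<exists>u. ground_state V A f \<epsilon> u"
proof -
  have "level (\<lambda>_. A 0) < level (\<lambda>_. A_inf)" using A_inf by (intro level_const_strict_antimono) auto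
  from level_rescaled_less[OF this] obtain \<epsilon>0 where "0 < \<epsilon>0" "\<forall>\<epsilon>>0. \<epsilon> < \<epsilon>0 \<longrightarrow> level (rescaled \<epsilon>) < level (\<lambda>_. A_inf)"
    by (auto simp: eventually_at_right[OF zero_less_one])
  then show ?thesis using ground_state_if_level_less by (intro exI[of _ \<epsilon>0]) auto
qed

definition continuous_ground_state :: "real \<Rightarrow> (real^'n \<Rightarrow> real) \<Rightarrow> real^'n \<Rightarrow> bool" where
  "continuous_ground_state \<epsilon> u x0 \<longleftrightarrow> ground_state V A f \<epsilon> u \<and> continuous_on UNIV u \<and> (\<forall>y. abs (u y) \<le> abs (u x0))"

lemma ground_states_critical_maximum:
  "\<exists>R. \<forall>\<epsilon> u x0. continuous_ground_state \<epsilon> u x0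
    \<longrightarrow> (\<exists>U. critical_maximum R (rescaled \<epsilon>) U u x0 \<and> energy (rescaled \<epsilon>) U = level (rescaled \<epsilon>))"
proof -
  obtain R where R: "\<And>K U. K \<in> coefficients \<Longrightarrow> U \<in> nehari K \<Longrightarrow> energy K U \<le> level (\<lambda>_. k0) \<Longrightarrow> norm U \<le> R"
    using nehari_bounded by blast
  have "\<exists>U. critical_maximum R (rescaled \<epsilon>) U u x0 \<and> energy (rescaled \<epsilon>) U = level (rescaled \<epsilon>)"
    if u: "continuous_ground_state \<epsilon> u x0" for \<epsilon> u x0
  proof -
    note K = rescaled_coefficients[of \<epsilon>]
    obtain U where U: "represents u U" using u by (auto simp: continuous_ground_state_def ground_state_def H1_iff_represents)
    then have crit: "critical (rescaled \<epsilon>) U" "energy (rescaled \<epsilon>) U = level (rescaled \<epsilon>)"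
      using u ground_state_iff by (auto simp: continuous_ground_state_def)
    have "U \<noteq> 0" using crit(2) level_pos[OF K] by (auto simp: energy_def BV_simps Phi_zero[OF K])
    moreover have "level (rescaled \<epsilon>) \<le> level (\<lambda>_. k0)"
      by (intro level_antimono K constant_coefficients Phi_mono) (simp add: rescaled_def A_min)
    ultimately have "norm U \<le> R" using R[OF K critical_imp_nehari[OF K crit(1)]] crit(2) by simp
    then show ?thesis using u U crit K \<open>U \<noteq> 0\<close> by (auto simp: critical_maximum_def continuous_ground_state_def)
  qed
  then show ?thesis by blast
qed

lemma level_rescaled_tendsto:
  fixes e :: "nat \<Rightarrow> real"
  assumes e: "\<And>n. 0 < e n" "e \<longlonglongrightarrow> 0"
  shows "(\<lambda>n. max (level (rescaled (e n))) (level (\<lambda>_. A 0))) \<longlonglongrightarrow> level (\<lambda>_. A 0)"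
proof (rule order_tendstoI)
  fix m assume m: "level (\<lambda>_. A 0) < m"
  have "filterlim e (at_right 0) sequentially" using e by (simp add: filterlim_at order_less_imp_not_eq2)
  then have "\<forall>\<^sub>F n in sequentially. level (rescaled (e n)) < m" by (rule eventually_compose_filterlim[OF level_rescaled_less[OF m]])
  then show "\<forall>\<^sub>F n in sequentially. max (level (rescaled (e n))) (level (\<lambda>_. A 0)) < m" using m by simp
qed (simp add: less_max_iff_disj)

lemma concentration_limit:
  fixes e :: "nat \<Rightarrow> real" and x :: "nat \<Rightarrow> real^'n"
  assumes e: "\<And>n. 0 < e n" "e \<longlonglongrightarrow> 0" and u: "\<And>n. continuous_ground_state (e n) (u n) (x n)"
    and lim: "\<And>v. v \<longlonglongrightarrow> 0 \<Longrightarrow> (\<lambda>n. A (e n *\<^sub>R x n + v n)) \<longlonglongrightarrow> a" and a: "k0 \<le> a" "a \<le> A 0"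
  shows "a = A 0"
proof (rule ccontr)
  assume "a \<noteq> A 0"
  then have less: "level (\<lambda>_. A 0) < level (\<lambda>_. a)" using a by (intro level_const_strict_antimono) auto
  obtain R where "\<forall>n. \<exists>U. critical_maximum R (rescaled (e n)) U (u n) (x n) \<and> energy (rescaled (e n)) U = level (rescaled (e n))"
    using ground_states_critical_maximum u by blast
  then obtain U where U: "\<And>n. critical_maximum R (rescaled (e n)) (U n) (u n) (x n)" "\<And>n. energy (rescaled (e n)) (U n) = level (rescaled (e n))"
    by metis
  obtain \<eta> where \<eta>: "0 < \<eta>" "\<And>n. \<eta> \<le> powr_mass p {y. y - x n \<in> cball 0 1} (U n)" using mass_at_maximum[of R] U(1) by blast
  define b where "b = real CARD('n)"
  have "\<forall>n. \<exists>k. (\<forall>i. k $ i \<in> \<int>) \<and> norm (x n - k) \<le> b \<and> \<eta> \<le> powr_mass p {y. y - k \<in> cball 0 (1 + b)} (U n)"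
    unfolding b_def using powr_mass_at_integer_vector[OF p_subcritical, of "cball 0 1" 1] \<eta>(2) order_trans by fastforce
  then obtain k where k: "\<And>n i. k n $ i \<in> \<int>" "\<And>n. norm (x n - k n) \<le> b" "\<And>n. \<eta> \<le> powr_mass p {y. y - k n \<in> cball 0 (1 + b)} (U n)"
    by metis
  have K_lim: "(\<lambda>n. rescaled (e n) (y + k n)) \<longlonglongrightarrow> a" for y
  proof -
    have "(\<lambda>n. e n *\<^sub>R (y + k n - x n)) \<longlonglongrightarrow> 0"
    proof (rule Lim_null_comparison[OF always_eventually tendsto_mult_left_zero[OF e(2), of "norm y + b"]], intro allI)
      have "norm (y + k n - x n) \<le> norm y + b" for n using k(2)[of n] norm_triangle_ineq4[of y "x n - k n"] by (simp add: algebra_simps)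
      then show "norm (e n *\<^sub>R (y + k n - x n)) \<le> e n * (norm y + b)" for n using e(1)[of n] by (simp add: mult_left_mono)
    qed
    from lim[OF this] show ?thesis by (simp add: rescaled_def algebra_simps)
  qed
  have "\<exists>w. w \<noteq> 0 \<and> critical (\<lambda>_. a) w \<and> energy (\<lambda>_. a) w \<le> level (\<lambda>_. A 0)"
    by (rule translated_limit[OF p_subcritical rescaled_coefficients coefficients_const[OF a] _ _ tendsto_const _ level_rescaled_tendsto[OF e]
          k(1) K_lim _ _ \<eta>(1) k(3)])
      (insert U, auto simp: critical_maximum_def critical_def)
  then show False using level_le_critical[OF coefficients_const[OF a]] less by (meson leD order_trans)
qed

lemma concentration_subsequence:
  fixes e :: "nat \<Rightarrow> real" and x :: "nat \<Rightarrow> real^'n"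
  assumes e: "\<And>n. 0 < e n" "e \<longlonglongrightarrow> 0" and u: "\<And>n. continuous_ground_state (e n) (u n) (x n)"
  shows "\<exists>s :: nat \<Rightarrow> nat. strict_mono s \<and> (\<lambda>n. A (e (s n) *\<^sub>R x (s n))) \<longlonglongrightarrow> A 0"
proof -
  let ?z = "\<lambda>n. e n *\<^sub>R x n"
  have "\<not> filterlim ?z at_infinity sequentially"
  proof
    assume z: "filterlim ?z at_infinity sequentially"
    have "(\<lambda>n. A (?z n + v n)) \<longlonglongrightarrow> A_inf" if "v \<longlonglongrightarrow> 0" for v
      using filterlim_compose[OF A_lim tendsto_add_filterlim_at_infinity[OF that z]] by (simp add: add.commute)
    then have "A_inf = A 0" using A_inf by (intro concentration_limit[OF e u]) auto
    then show False using A_inf(2) by simp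
  qed
  then obtain r :: "nat \<Rightarrow> nat" and Z where r: "strict_mono r" "\<And>n. ?z (r n) \<in> cball 0 Z"
    using bounded_subseq_if_not_at_infinity[of ?z] by auto
  then obtain \<xi> r' where r': "strict_mono r'" "((\<lambda>n. ?z (r n)) \<circ> r') \<longlonglongrightarrow> \<xi>"
    using compact_cball[of 0 Z, unfolded compact_def, rule_format, of "\<lambda>n. ?z (r n)"] by blast
  define s where "s = r \<circ> r'"
  have s: "strict_mono s" "(\<lambda>n. ?z (s n)) \<longlonglongrightarrow> \<xi>" using strict_mono_o[OF r(1) r'(1)] r'(2) by (simp_all add: s_def o_def)
  have A_tendsto: "(\<lambda>n. A (?z (s n) + v n)) \<longlonglongrightarrow> A \<xi>" if "v \<longlonglongrightarrow> 0" for v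
    using isCont_tendsto_compose[OF A_isCont tendsto_add[OF s(2) that]] by simp
  have "A \<xi> = A 0" by (rule concentration_limit[of "\<lambda>n. e (s n)" "\<lambda>n. u (s n)" "\<lambda>n. x (s n)"])
      (insert e(1) LIMSEQ_subseq_LIMSEQ[OF e(2) s(1)] u A_tendsto A_min A_max, auto simp: o_def)
  then show ?thesis using s(1) A_tendsto[OF tendsto_const] by auto
qed

theorem ground_states_concentrate:
  assumes "0 < \<epsilon>0" and u: "\<And>\<epsilon>. \<epsilon> \<in> {0<..<\<epsilon>0} \<Longrightarrow> continuous_ground_state \<epsilon> (u \<epsilon>) (x \<epsilon>)"
  shows "((\<lambda>\<epsilon>. A (\<epsilon> *\<^sub>R x \<epsilon>)) \<longlongrightarrow> A 0) (at_right 0)"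
proof (rule tendsto_at_right_sequentially[OF \<open>0 < \<epsilon>0\<close>])
  fix e :: "nat \<Rightarrow> real" assume e: "\<And>n. 0 < e n" "\<And>n. e n < \<epsilon>0" "e \<longlonglongrightarrow> 0"
  show "(\<lambda>n. A (e n *\<^sub>R x (e n))) \<longlonglongrightarrow> A 0"
  proof (rule tendsto_if_subseqs_have_tendsto_subseq)
    fix r :: "nat \<Rightarrow> nat" assume "strict_mono r"
    then show "\<exists>s :: nat \<Rightarrow> nat. strict_mono s \<and> (\<lambda>n. A (e (r (s n)) *\<^sub>R x (e (r (s n))))) \<longlonglongrightarrow> A 0"
      using e u LIMSEQ_subseq_LIMSEQ[OF e(3)]
      by (intro concentration_subsequence[of "\<lambda>n. e (r n)" "\<lambda>n. u (e (r n))"]) (auto simp: o_def)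
  qed
qed

end

lemma subcritical_Suc_exponent:
  assumes q: "1 < q" "3 \<le> CARD('n::finite) \<longrightarrow> q < 2 * real CARD('n) / (real CARD('n) - 2) - 1"
  shows "subcritical TYPE('n) (q + 1)"
proof (cases "3 \<le> CARD('n)")
  case True
  then have "(q + 1) * (real CARD('n) - 2) < 2 * real CARD('n)" using q(2) by (simp add: pos_less_divide_eq less_diff_eq)
  then show ?thesis using q(1) by (simp add: subcritical_def algebra_simps)
next
  case False
  then have "real CARD('n) * (q - 1) \<le> 2 * (q - 1)" using q(1) by (intro mult_right_mono) auto
  then show ?thesis using q(1) by (simp add: subcritical_def)
qed

lemma bdd_below_if_limit_at_infinity:
  fixes A :: "'a::euclidean_space \<Rightarrow> real"
  assumes A: "continuous_on UNIV A" and lim: "(A \<longlongrightarrow> l) at_infinity"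
  shows "bdd_below (range A)"
proof -
  obtain b where b: "\<And>x. b \<le> norm x \<Longrightarrow> l - 1 < A x"
    using order_tendstoD(1)[OF lim, of "l - 1"] by (auto simp: eventually_at_infinity)
  have "bdd_below (A ` cball 0 b)"
    by (intro bounded_imp_bdd_below compact_imp_bounded compact_continuous_image continuous_on_subset[OF A]) auto
  then obtain B where B: "\<And>x. norm x \<le> b \<Longrightarrow> B \<le> A x" unfolding bdd_below_def by fastforce
  have "min B (l - 1) \<le> A x" for x using b[of x] B[of x] by (cases "b \<le> norm x") auto
  then show ?thesis by (rule bdd_belowI2)
qed

theorem theorem1p1:
  fixes V A :: "real^'n \<Rightarrow> real" and f :: "real \<Rightarrow> real"
  assumes V_cont: "continuous_on UNIV V"
    and V_per: "\<And>x k. (\<forall>i. k $ i \<in> \<int>) \<Longrightarrow> V (x + k) = V x"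
    and V_spec: "0 \<notin> schroedinger_spectrum V"
    and A_cont: "continuous_on UNIV A"
    and A_max: "\<And>x. A x \<le> A 0"
    and A_pos: "0 < (INF x. A x)"
    and A_lim: "(A \<longlongrightarrow> Ainf) at_infinity"
    and A_inf_le: "(INF x. A x) \<le> Ainf"
    and A_inf_lt: "Ainf < (SUP x. A x)"
    and f_cont: "continuous_on UNIV f"
    and f1: "((\<lambda>t. f t / t) \<longlongrightarrow> 0) (at 0)"
    and f2: "\<exists>q C R. 1 < q \<and> (CARD('n) \<ge> 3 \<longrightarrow> q < 2 * real CARD('n) / (real CARD('n) - 2) - 1)
               \<and> (\<forall>t. R \<le> \<bar>t\<bar> \<longrightarrow> \<bar>f t\<bar> \<le> C * \<bar>t\<bar> powr q)"
    and f3: "strict_mono_on {0<..} (\<lambda>t. f t / t)" "strict_antimono_on {..<0} (\<lambda>t. f t / t)"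
    and f4: "\<exists>\<theta>>2. \<forall>t. t \<noteq> 0 \<longrightarrow> 0 < \<theta> * prim f t \<and> \<theta> * prim f t \<le> f t * t"
  shows "\<exists>\<epsilon>0>0. (\<forall>\<epsilon>\<in>{0<..<\<epsilon>0}. \<exists>u. ground_state V A f \<epsilon> u)
     \<and> (\<forall>u x. (\<forall>\<epsilon>\<in>{0<..<\<epsilon>0}. ground_state V A f \<epsilon> (u \<epsilon>) \<and> continuous_on UNIV (u \<epsilon>)
                  \<and> (\<forall>y. \<bar>u \<epsilon> y\<bar> \<le> \<bar>u \<epsilon> (x \<epsilon>)\<bar>))
           \<longrightarrow> ((\<lambda>\<epsilon>. A (\<epsilon> *\<^sub>R x \<epsilon>)) \<longlongrightarrow> (SUP x. A x)) (at_right 0))"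
proof -
  obtain q where q: "1 < q" "subcritical TYPE('n) (q + 1)" "\<exists>C R. \<forall>t. R \<le> abs t \<longrightarrow> abs (f t) \<le> C * abs t powr (q + 1 - 1)"
    using f2 subcritical_Suc_exponent[where 'n='n] by auto
  obtain \<theta> where \<theta>: "2 < \<theta>" "\<And>t. t \<noteq> 0 \<Longrightarrow> 0 < \<theta> * prim f t \<and> \<theta> * prim f t \<le> f t * t" using f4 by blast
  have SUP_A: "(SUP x. A x) = A 0" using A_max by (intro cSup_eq_maximum) auto
  have A_min: "(INF x. A x) \<le> A x" for x
    by (rule cINF_lower[OF bdd_below_if_limit_at_infinity[OF A_cont A_lim] UNIV_I])
  interpret semiclassical V f "q + 1" \<theta> "INF x. A x" A Ainf
    by unfold_locales (insert assms q \<theta> A_min SUP_A, auto)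
  obtain \<epsilon>0 where "0 < \<epsilon>0" "\<forall>\<epsilon>\<in>{0<..<\<epsilon>0}. \<exists>u. ground_state V A f \<epsilon> u" using ground_states_exist by blast
  then show ?thesis
    using ground_states_concentrate[of \<epsilon>0] unfolding SUP_A continuous_ground_state_def by (intro exI[of _ \<epsilon>0]) blast
qed

end
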